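(* Let $\Omega\subset\mathbb{R}^d$ be a bounded Lipschitz domain and assume the standing assumptions (ellipticity, boundedness, periodicity) below with $\Omega_0=\Omega$. Let $f\in H^{-1}(\Omega)$, $g\in H^{1/2}(\partial\Omega)$, and let $u_\varepsilon\in H^1(\Omega)$ be the weak solution of $-\mathrm{div}(A^\varepsilon\nabla u_\varepsilon)=f$ in $\Omega$, $u_\varepsilon=g$ on $\partial\Omega$. Then, as $\varepsilon\rightrightarrows 0$, $u_\varepsilon\to u_0$ weakly in $H^1(\Omega)$, where $u_0$ is the weak solution of $-\mathrm{div}(\widehat{A}\nabla u_0)=f$ in $\Omega$, $u_0=g$ on $\partial\Omega$, and $\widehat A$ is the homogenized matrix defined below. Moreover, as $\varepsilon\rightrightarrows0$, $A^\varepsilon$ $H$-converges to $\widehat A$ in $\mathcal M(\mu,\mu^{-3};\Omega)$.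
   Context: Setting. Let $\Omega_0\subseteq\mathbb{R}^d$ be open. For each integer $\ell\ge0$ let $B_\ell=B_\ell(y_0,y_1,\dots,y_\ell)$ be a continuous real $d\times d$ matrix-valued function on $\Omega_0\times(\mathbb{R}^d)^\ell$, and set $A_n=\sum_{\ell=0}^nB_\ell$. Standing assumptions: (ellipticity) there is $\mu>0$ such that $\xi\cdot A_n\xi\ge\mu|\xi|^2$ for all $n$, all arguments and all $\xi\in\mathbb{R}^d$; (boundedness) $\sum_{\ell=0}^\infty\|B_\ell\|_{L^\infty}\le\mu^{-1}$; (periodicity) for every $n\ge1$, $A_n(y_0,y_1+z_1,\dots,y_n+z_n)=A_n(y_0,\dots,y_n)$ for all $z_1,\dots,z_n\in\mathbb{Z}^d$. Scales: $\varepsilon=(\varepsilon_1,\varepsilon_2,\dots)$ with $1=\varepsilon_0>\varepsilon_1>\varepsilon_2>\cdots>0$ and $\varepsilon_n\to0$. Put $A_n^\varepsilon(x)=A_n(x,x/\varepsilon_1,\dots,x/\varepsilon_n)$ and $A^\varepsilon(x)=\lim_{n\to\infty}A_n^\varepsilon(x)$ (uniform limit). "$\varepsilon\rightrightarrows0$" means along a sequence of scale vectors with $\varepsilon_1\to0$ and $\varepsilon_{k+1}/\varepsilon_k\to0$ for every $k\ge1$. Reiterated homogenized matrices. Fix $n$. Set $A_n^n=A_n$. For $k=n-1,\dots,0$, given $A_n^{k+1}(y_0,\dots,y_{k+1})$ and fixed $(y_0,\dots,y_k)$, let $\chi^j=\chi^j_{A_n^{k+1}}$ ($1\le j\le d$)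 be the $1$-periodic in $y_{k+1}$, mean-zero solution of $-\mathrm{div}_{y_{k+1}}(A_n^{k+1}\nabla_{y_{k+1}}\chi^j)=\mathrm{div}_{y_{k+1}}(A_n^{k+1}e^j)$ on $\mathbb{T}^d$, and set $A_n^k(y_0,\dots,y_k)=\int_{\mathbb{T}^d}\big(A_n^{k+1}+A_n^{k+1}\nabla_{y_{k+1}}\chi_{A_n^{k+1}}\big)dy_{k+1}$, where $(A\nabla\chi)_{ij}=\sum_l A_{il}\partial_l\chi^j$. Set $B^n_k=A^k_n-\sum_{\ell=0}^{k-1}B_\ell$ (so $B^n_n=B_n$) and $\widehat A_n(y_0)=A^0_n(y_0)$. The homogenized matrix is $\widehat A=\lim_{n\to\infty}\widehat A_n$ (uniform limit on $\Omega_0$). $H$-convergence. For $0<\alpha\le\beta$, $\mathcal M(\alpha,\beta;\Omega)$ is the set of $A\in L^\infty(\Omega;\mathbb{R}^{d\times d})$ with $A\xi\cdot\xi\ge\alpha|\xi|^2$ and $A^{-1}\xi\cdot\xi\ge\beta^{-1}|\xi|^2$ a.e. A family $A_k\in\mathcal M(\alpha,\beta;\Omega)$ $H$-converges to $\bar A$ if for every $f\in H^{-1}(\Omega)$ the solutions $u_k\in H^1_0(\Omega)$ of $-\mathrm{div}(A_k\nabla u_k)=f$ converge weakly in $H^1_0(\Omega)$ to the solution $\bar u$ of $-\mathrm{div}(\bar A\nabla\bar u)=f$, and $A_k\nabla u_k\to\bar A\nabla\bar u$ weakly in $L^2(\Omega;\mathbb{R}^d)$. *)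

theory Defs
  imports "HOL-Analysis.Analysis"
begin

definition grad :: "(real^'n \<Rightarrow> real) \<Rightarrow> real^'n \<Rightarrow> real^'n" where
  "grad \<phi> x = (\<chi> i. frechet_derivative \<phi> (at x) (axis i 1))"

fun Ck :: "nat \<Rightarrow> (real^'n \<Rightarrow> real) \<Rightarrow> bool" where
  "Ck 0 \<phi> = continuous_on UNIV \<phi>"
| "Ck (Suc k) \<phi> = ((\<forall>x. \<phi> differentiable (at x)) \<and>
      (\<forall>i. Ck k (\<lambda>x. frechet_derivative \<phi> (at x) (axis i 1))))"

definition smooth :: "(real^'n \<Rightarrow> real) \<Rightarrow> bool" where
  "smooth \<phi> \<longleftrightarrow> (\<forall>k. Ck k \<phi>)"

definition test_fun :: "(real^'n) set \<Rightarrow> (real^'n \<Rightarrow> real) \<Rightarrow> bool" where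
  "test_fun \<Omega> \<phi> \<longleftrightarrow> smooth \<phi> \<and> compact (closure {x. \<phi> x \<noteq> 0})
      \<and> closure {x. \<phi> x \<noteq> 0} \<subseteq> \<Omega>"

definition L2 :: "(real^'n) set \<Rightarrow> (real^'n \<Rightarrow> real) \<Rightarrow> bool" where
  "L2 \<Omega> u \<longleftrightarrow> set_borel_measurable lebesgue \<Omega> u \<and>
      set_integrable lebesgue \<Omega> (\<lambda>x. (u x)^2)"

definition L2v :: "(real^'n) set \<Rightarrow> (real^'n \<Rightarrow> real^'n) \<Rightarrow> bool" where
  "L2v \<Omega> F \<longleftrightarrow> set_borel_measurable lebesgue \<Omega> F \<and>
      set_integrable lebesgue \<Omega> (\<lambda>x. (norm (F x))^2)"

definition is_weak_grad :: "(real^'n) set \<Rightarrow> (real^'n \<Rightarrow> real) \<Rightarrow> (real^'n \<Rightarrow> real^'n) \<Rightarrow> bool" where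
  "is_weak_grad \<Omega> u G \<longleftrightarrow> (\<forall>\<phi>. test_fun \<Omega> \<phi> \<longrightarrow> (\<forall>i.
      (LINT x:\<Omega>|lebesgue. u x * grad \<phi> x $ i) = - (LINT x:\<Omega>|lebesgue. G x $ i * \<phi> x)))"

definition H1 :: "(real^'n) set \<Rightarrow> (real^'n \<Rightarrow> real) set" where
  "H1 \<Omega> = {u. L2 \<Omega> u \<and> (\<exists>G. L2v \<Omega> G \<and> is_weak_grad \<Omega> u G)}"

definition wgrad :: "(real^'n) set \<Rightarrow> (real^'n \<Rightarrow> real) \<Rightarrow> real^'n \<Rightarrow> real^'n" where
  "wgrad \<Omega> u = (SOME G. L2v \<Omega> G \<and> is_weak_grad \<Omega> u G)"

definition h1_inner :: "(real^'n) set \<Rightarrow> (real^'n \<Rightarrow> real) \<Rightarrow> (real^'n \<Rightarrow> real) \<Rightarrow> real" where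
  "h1_inner \<Omega> u v = (LINT x:\<Omega>|lebesgue. u x * v x)
      + (LINT x:\<Omega>|lebesgue. wgrad \<Omega> u x \<bullet> wgrad \<Omega> v x)"

definition h1_norm :: "(real^'n) set \<Rightarrow> (real^'n \<Rightarrow> real) \<Rightarrow> real" where
  "h1_norm \<Omega> u = sqrt (h1_inner \<Omega> u u)"

definition H10 :: "(real^'n) set \<Rightarrow> (real^'n \<Rightarrow> real) set" where
  "H10 \<Omega> = {u \<in> H1 \<Omega>. \<exists>\<phi>s. (\<forall>k. test_fun \<Omega> (\<phi>s k)) \<and>
      (\<lambda>k. h1_norm \<Omega> (\<lambda>x. u x - \<phi>s k x)) \<longlonglongrightarrow> 0}"

definition Hminus1 :: "(real^'n) set \<Rightarrow> ((real^'n \<Rightarrow> real) \<Rightarrow> real) \<Rightarrow> bool" where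
  "Hminus1 \<Omega> f \<longleftrightarrow>
     (\<forall>u\<in>H10 \<Omega>. \<forall>v\<in>H10 \<Omega>. \<forall>a b. f (\<lambda>x. a * u x + b * v x) = a * f u + b * f v) \<and>
     (\<exists>C. \<forall>u\<in>H10 \<Omega>. \<bar>f u\<bar> \<le> C * h1_norm \<Omega> u)"

text \<open>Weak solution of -div(A grad u) = f in Omega, u = g on the boundary, where the
  boundary datum g in H^{1/2} is given as the trace of G in H^1(Omega):
  u = g on the boundary means u - G in H^1_0(Omega).\<close>
definition weak_sol :: "(real^'n) set \<Rightarrow> (real^'n \<Rightarrow> real^'n^'n) \<Rightarrow> ((real^'n \<Rightarrow> real) \<Rightarrow> real)
    \<Rightarrow> (real^'n \<Rightarrow> real) \<Rightarrow> (real^'n \<Rightarrow> real) \<Rightarrow> bool" where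
  "weak_sol \<Omega> A f G u \<longleftrightarrow> u \<in> H1 \<Omega> \<and> (\<lambda>x. u x - G x) \<in> H10 \<Omega> \<and>
     (\<forall>\<phi>\<in>H10 \<Omega>. (LINT x:\<Omega>|lebesgue. (A x *v wgrad \<Omega> u x) \<bullet> wgrad \<Omega> \<phi> x) = f \<phi>)"

definition weak_conv :: "(real^'n \<Rightarrow> real) set \<Rightarrow> (real^'n) set \<Rightarrow> (nat \<Rightarrow> real^'n \<Rightarrow> real)
    \<Rightarrow> (real^'n \<Rightarrow> real) \<Rightarrow> bool" where
  "weak_conv V \<Omega> us u \<longleftrightarrow> (\<forall>v\<in>V. (\<lambda>k. h1_inner \<Omega> (us k) v) \<longlonglongrightarrow> h1_inner \<Omega> u v)"

definition weak_conv_L2v :: "(real^'n) set \<Rightarrow> (nat \<Rightarrow> real^'n \<Rightarrow> real^'n) \<Rightarrow> (real^'n \<Rightarrow> real^'n) \<Rightarrow> bool" where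
  "weak_conv_L2v \<Omega> Fs F \<longleftrightarrow> (\<forall>w. L2v \<Omega> w \<longrightarrow>
     (\<lambda>k. LINT x:\<Omega>|lebesgue. Fs k x \<bullet> w x) \<longlonglongrightarrow> (LINT x:\<Omega>|lebesgue. F x \<bullet> w x))"

definition Mclass :: "real \<Rightarrow> real \<Rightarrow> (real^'n) set \<Rightarrow> (real^'n \<Rightarrow> real^'n^'n) \<Rightarrow> bool" where
  "Mclass \<alpha> \<beta> \<Omega> A \<longleftrightarrow> set_borel_measurable lebesgue \<Omega> A \<and>
     (\<exists>C. AE x in lebesgue. x \<in> \<Omega> \<longrightarrow> norm (A x) \<le> C) \<and>
     (AE x in lebesgue. x \<in> \<Omega> \<longrightarrow> (\<forall>\<xi>. (A x *v \<xi>) \<bullet> \<xi> \<ge> \<alpha> * (norm \<xi>)^2 \<and>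
        (matrix_inv (A x) *v \<xi>) \<bullet> \<xi> \<ge> (1/\<beta>) * (norm \<xi>)^2))"

definition H_conv :: "(real^'n) set \<Rightarrow> (nat \<Rightarrow> real^'n \<Rightarrow> real^'n^'n) \<Rightarrow> (real^'n \<Rightarrow> real^'n^'n) \<Rightarrow> bool" where
  "H_conv \<Omega> As Abar \<longleftrightarrow> (\<forall>f us ubar. Hminus1 \<Omega> f \<longrightarrow>
     (\<forall>k. weak_sol \<Omega> (As k) f (\<lambda>x. 0) (us k)) \<longrightarrow> weak_sol \<Omega> Abar f (\<lambda>x. 0) ubar \<longrightarrow>
     weak_conv (H10 \<Omega>) \<Omega> us ubar \<and>
     weak_conv_L2v \<Omega> (\<lambda>k x. As k x *v wgrad \<Omega> (us k) x) (\<lambda>x. Abar x *v wgrad \<Omega> ubar x))"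

definition lipschitz_domain :: "(real^'n) set \<Rightarrow> bool" where
  "lipschitz_domain \<Omega> \<longleftrightarrow> open \<Omega> \<and> connected \<Omega> \<and> \<Omega> \<noteq> {} \<and>
     (\<forall>x\<in>frontier \<Omega>. \<exists>r>0. \<exists>\<nu> \<gamma> L. norm \<nu> = 1 \<and> L-lipschitz_on UNIV \<gamma> \<and>
        \<Omega> \<inter> ball x r = {y \<in> ball x r. (y - x) \<bullet> \<nu> < \<gamma> ((y - x) - ((y - x) \<bullet> \<nu>) *\<^sub>R \<nu>)})"

definition int_vec :: "real^'n \<Rightarrow> bool" where
  "int_vec z \<longleftrightarrow> (\<forall>i. z $ i \<in> \<int>)"

definition periodic :: "(real^'n \<Rightarrow> 'b) \<Rightarrow> bool" where
  "periodic f \<longleftrightarrow> (\<forall>x z. int_vec z \<longrightarrow> f (x + z) = f x)"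

definition unit_cell :: "(real^'n) set" where
  "unit_cell = cbox 0 One"

text \<open>chi is the 1-periodic, mean-zero H^1_loc weak solution (with weak gradient G) of
  -div(M grad chi) = div(M e_j) on the torus.\<close>
definition cell_sol :: "(real^'n \<Rightarrow> real^'n^'n) \<Rightarrow> 'n \<Rightarrow> (real^'n \<Rightarrow> real) \<Rightarrow> (real^'n \<Rightarrow> real^'n) \<Rightarrow> bool" where
  "cell_sol M j w G \<longleftrightarrow> periodic w \<and> (\<forall>r. L2 (ball 0 r) w \<and> L2v (ball 0 r) G) \<and>
     is_weak_grad UNIV w G \<and> (LINT y:unit_cell|lebesgue. w y) = 0 \<and>
     (\<forall>\<phi>. smooth \<phi> \<and> periodic \<phi> \<longrightarrow>
        (LINT y:unit_cell|lebesgue. (M y *v (G y + axis j 1)) \<bullet> grad \<phi> y) = 0)"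

definition effective :: "(real^'n \<Rightarrow> real^'n^'n) \<Rightarrow> real^'n^'n" where
  "effective M = (\<chi> i j. (LINT y:unit_cell|lebesgue.
      M y *v (axis j 1 + snd (SOME p. cell_sol M j (fst p) (snd p)) y)) $ i)"

text \<open>Arguments (y_0, y_1, ...) are encoded as a function nat => R^d.\<close>
definition Asum :: "(nat \<Rightarrow> (nat \<Rightarrow> real^'n) \<Rightarrow> real^'n^'n) \<Rightarrow> nat \<Rightarrow> (nat \<Rightarrow> real^'n) \<Rightarrow> real^'n^'n" where
  "Asum B n y = (\<Sum>l\<le>n. B l y)"

text \<open>hom_level B n m = A_n^{n-m} (homogenize successively in y_n, y_{n-1}, ...)\<close>
fun hom_level :: "(nat \<Rightarrow> (nat \<Rightarrow> real^'n) \<Rightarrow> real^'n^'n) \<Rightarrow> nat \<Rightarrow> nat \<Rightarrow> (nat \<Rightarrow> real^'n) \<Rightarrow> real^'n^'n" where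
  "hom_level B n 0 = Asum B n"
| "hom_level B n (Suc m) = (\<lambda>y. effective (\<lambda>z. hom_level B n m (y(n - m := z))))"

definition hatA_n :: "(nat \<Rightarrow> (nat \<Rightarrow> real^'n) \<Rightarrow> real^'n^'n) \<Rightarrow> nat \<Rightarrow> real^'n \<Rightarrow> real^'n^'n" where
  "hatA_n B n x = hom_level B n n (\<lambda>i. x)"

definition hatA :: "(nat \<Rightarrow> (nat \<Rightarrow> real^'n) \<Rightarrow> real^'n^'n) \<Rightarrow> real^'n \<Rightarrow> real^'n^'n" where
  "hatA B x = lim (\<lambda>n. hatA_n B n x)"

text \<open>A^eps(x) = lim_n A_n(x, x/eps_1, ..., x/eps_n); note eps_0 = 1.\<close>
definition Aeps :: "(nat \<Rightarrow> (nat \<Rightarrow> real^'n) \<Rightarrow> real^'n^'n) \<Rightarrow> (nat \<Rightarrow> real) \<Rightarrow> real^'n \<Rightarrow> real^'n^'n" where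
  "Aeps B \<epsilon> x = lim (\<lambda>n. Asum B n (\<lambda>i. (1 / \<epsilon> i) *\<^sub>R x))"

definition scale_vec :: "(nat \<Rightarrow> real) \<Rightarrow> bool" where
  "scale_vec \<epsilon> \<longleftrightarrow> \<epsilon> 0 = 1 \<and> (\<forall>k. 0 < \<epsilon> (Suc k) \<and> \<epsilon> (Suc k) < \<epsilon> k) \<and> \<epsilon> \<longlonglongrightarrow> 0"

definition sep_scales :: "(nat \<Rightarrow> nat \<Rightarrow> real) \<Rightarrow> bool" where
  "sep_scales E \<longleftrightarrow> (\<forall>m. scale_vec (E m)) \<and> (\<lambda>m. E m 1) \<longlonglongrightarrow> 0 \<and>
     (\<forall>k\<ge>1. (\<lambda>m. E m (Suc k) / E m k) \<longlonglongrightarrow> 0)"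

definition standing_assms :: "(real^'n) set \<Rightarrow> real \<Rightarrow> (nat \<Rightarrow> (nat \<Rightarrow> real^'n) \<Rightarrow> real^'n^'n) \<Rightarrow> bool" where
  "standing_assms \<Omega>0 \<mu> B \<longleftrightarrow> open \<Omega>0 \<and> \<mu> > 0 \<and>
     (\<forall>l y y'. (\<forall>i\<le>l. y i = y' i) \<longrightarrow> B l y = B l y') \<and>
     (\<forall>l. continuous_on {y. y 0 \<in> \<Omega>0} (B l)) \<and>
     (\<forall>n y \<xi>. y 0 \<in> \<Omega>0 \<longrightarrow> \<xi> \<bullet> (Asum B n y *v \<xi>) \<ge> \<mu> * (norm \<xi>)^2) \<and>
     (\<exists>c. (\<forall>l y \<xi>. y 0 \<in> \<Omega>0 \<longrightarrow> norm (B l y *v \<xi>) \<le> c l * norm \<xi>) \<and>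
          summable c \<and> suminf c \<le> 1 / \<mu>) \<and>
     (\<forall>n\<ge>1. \<forall>y z. z 0 = 0 \<longrightarrow> (\<forall>i. int_vec (z i)) \<longrightarrow> Asum B n (\<lambda>i. y i + z i) = Asum B n y)"

end

(* H-convergence is proved by oscillating test functions, one scale at a time.  Let u be a solution
   for the coefficient truncated after n scales.  If V is a field oscillating on the scales up to k,
   the adjoint corrector on the scale k + 1 yields V + grad_{y_{k+1}} zeta, whose adjoint flux is
   that of V for the k-th homogenized matrix plus a periodic solenoidal field of mean zero.  Written
   at x / eps_{k+1}, the added gradient is up to a small error the gradient of eps_{k+1} zeta, which
   tends weakly to zero and so does not see the equation, and the solenoidal field tends to zero
   against gradients because it is the divergence of a small skew matrix.  Hence A_n^{k+1} grad u and
   A_n^k grad u agree asymptotically when tested with V.  Correctors and fluxes are only continuous in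
   the slow variables with values in L^2 of the cell, so they are first approximated uniformly by
   trigonometric polynomials (Stone-Weierstrass and the Helmholtz decomposition of the cell).
   The passage n to infinity rests on the stability of homogenization: the estimate
   |(M - M') xi . eta| <= d (M xi . xi + M' eta . eta) passes to the effective matrices with the same
   d, so truncation errors do not accumulate over the levels. *)
theory Submission
  imports Defs "HOL-Analysis.Analysis" "HOL-Computational_Algebra.Polynomial"
begin

text \<open>Pairings with the gradients of the solutions use only their bound in L^2, so it is
  enough that test fields solve the cell problem up to an error small in mean square, uniformly in
  the scales. A corrector on the scale k + 1 also depends on the slower variables; differentiating
  it there costs 1 / eps_k, to be paid for by the factor eps_{k+1}. A corrected field of level k
  oscillates on the scale k + 1 and is fed back into the comparison at level k + 1, so the statement
  carried down the levels must admit test fields oscillating on all scales up to its own. The limit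
  is identified by duality: as soon as the oscillating and the homogenized flux, taken on the same
  gradients, agree weakly, solving the adjoint homogenized problem determines the weak limit of the
  solutions. The bound mu^{-3} comes from |A xi| <= |xi| / mu: mu^3 |A xi|^2 <= mu |xi|^2 <= A xi .
  xi. In this form, which is the lower bound on the inverse written with A xi, it passes to
  effective matrices with the same constant.\<close>

abbreviation cell :: "(real^'n) set" where "cell \<equiv> unit_cell"
abbreviation ind :: "'a set => 'a => real" where "ind A \<equiv> indicat_real A"
abbreviation scR :: "real => 'a => 'a::scaleR" (infixr "*R" 75) where "c *R x \<equiv> c *\<^sub>R x"
abbreviation seq_tends :: "(nat => 'a::topological_space) => 'a => bool" (infix "--->" 60) where "X ---> L \<equiv> X \<longlonglongrightarrow> L"

section \<open>Projections and the Lax-Milgram lemma\<close>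

lemma subspace_closure:
 fixes S :: "'a::real_normed_vector set"
 assumes "subspace S"
 shows "subspace (closure S)"
 unfolding subspace_def
proof (intro conjI ballI allI)
 show "0 : closure S" using subspace_0[OF assms] closure_subset by blast
next
 fix x y assume "x : closure S" "y : closure S"
 then obtain f g where "!!n. f n : S" "f ---> x" "!!n. g n : S" "g ---> y"
  by (auto simp: closure_sequential)
 then show "x + y : closure S" unfolding closure_sequential
  using assms by (intro exI[of _ "%n. f n + g n"]) (auto simp: subspace_add intro: tendsto_add)
next
 fix c :: real and x assume "x : closure S"
 then obtain f where "!!n. f n : S" "f ---> x" by (auto simp: closure_sequential)
 then show "c *R x : closure S" unfolding closure_sequential
  using assms by (intro exI[of _ "%n. c *R f n"]) (auto simp: subspace_scale intro: tendsto_scaleR)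
qed

text \<open>The parallelogram identity makes a minimizing sequence for the distance Cauchy, since
  midpoints stay in \<open>S\<close>; its limit is the nearest point, and minimality gives
  orthogonality.\<close>

lemma closed_subspace_projection_exists:
 fixes S :: "'a::{real_inner,complete_space} set"
 assumes "subspace S" "closed S"
 shows "EX p : S. ALL s : S. inner (x - p) s = 0"
proof -
 define D where "D = (%s. norm (x - s)) ` S"
 define d where "d = Inf D"
 have S0: "0 : S" using assms(1) by (rule subspace_0)
 have Dne: "D ~= {}" using S0 by (auto simp: D_def)
 have bdd: "bdd_below D" by (rule bdd_belowI[of _ 0]) (auto simp: D_def)
 have dle: "d <= norm (x - s)" if "s : S" for s
  unfolding d_def by (rule cInf_lower[OF _ bdd]) (use that in "auto simp: D_def")
 have d0: "0 <= d" unfolding d_def by (rule cInf_greatest[OF Dne]) (auto simp: D_def)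
 have "EX s : S. norm (x - s) < d + 1 / real (Suc n)" for n
 proof -
  have "Inf D < d + 1 / real (Suc n)" by (simp add: d_def)
  from cInf_lessD[OF Dne this] show ?thesis by (auto simp: D_def)
 qed
 then obtain s where s: "!!n. s n : S" "!!n. norm (x - s n) < d + 1 / real (Suc n)" by metis
 have par: "(norm (s m - s n))^2 <= 2 * (norm (x - s m))^2 + 2 * (norm (x - s n))^2 - 4 * d^2" for m n
 proof -
  have "(1/2) *R (s m + s n) : S" using s(1) assms(1) by (intro subspace_scale subspace_add) auto
  from dle[OF this] have "d^2 <= (norm (x - (1/2) *R (s m + s n)))^2" using d0 by (rule power_mono)
  moreover have "(norm (s m - s n))^2 + 4 * (norm (x - (1/2) *R (s m + s n)))^2
    = 2 * (norm (x - s m))^2 + 2 * (norm (x - s n))^2"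
   unfolding power2_norm_eq_inner
   by (simp add: inner_diff_left inner_diff_right inner_add_left inner_add_right inner_commute algebra_simps)
  ultimately show ?thesis by linarith
 qed
 have lim: "(%n. norm (x - s n)) ---> d"
 proof (rule tendsto_sandwich[of "%_. d" _ _ "%n. d + 1 / real (Suc n)"])
  show "(%n. d + 1 / real (Suc n)) ---> d"
   using tendsto_add[OF tendsto_const[of d] LIMSEQ_inverse_real_of_nat] by (simp add: inverse_eq_divide)
  show "\<forall>\<^sub>F n in sequentially. norm (x - s n) <= d + 1 / real (Suc n)"
   using s(2) by (intro always_eventually allI less_imp_le)
 qed (use dle s(1) in auto)
 have "Cauchy s"
 proof (rule metric_CauchyI)
  fix e :: real assume e: "e > 0"
  have "(%n. 2 * (norm (x - s n))^2 - 2 * d^2) ---> 2 * d^2 - 2 * d^2"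
   by (intro tendsto_intros lim)
  then have "\<forall>\<^sub>F n in sequentially. 2 * (norm (x - s n))^2 - 2 * d^2 < e^2 / 2"
   using e by (intro order_tendstoD(2)) auto
  then obtain N where N: "!!n. n >= N ==> 2 * (norm (x - s n))^2 - 2 * d^2 < e^2 / 2"
   by (auto simp: eventually_sequentially)
  show "EX N. ALL m>=N. ALL n>=N. dist (s m) (s n) < e"
  proof (intro exI allI impI)
   fix m n assume "m >= N" "n >= N"
   then have "(norm (s m - s n))^2 < e^2" using par[of m n] N[of m] N[of n] by simp
   then show "dist (s m) (s n) < e" using e by (simp add: dist_norm power_less_imp_less_base)
  qed
 qed
 then obtain p where p: "s ---> p" using Cauchy_convergent convergent_def by blast
 have pS: "p : S" using closed_sequentially[OF assms(2) s(1) p] .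
 have npd: "norm (x - p) = d"
  by (rule LIMSEQ_unique[OF tendsto_norm[OF tendsto_diff[OF tendsto_const p]] lim])
 have "inner (x - p) v = 0" if v: "v : S" for v
 proof (cases "v = 0")
  case False
  \<comment> \<open>The minimizer of t -> |x - p - t v|^2; comparing with it forces the inner
    product to vanish.\<close>
  define t where "t = inner (x - p) v / (norm v)^2"
  have nv: "(norm v)^2 > 0" using False by simp
  have "p + t *R v : S" using pS v assms(1) by (intro subspace_add subspace_scale)
  from dle[OF this] have "d^2 <= (norm (x - (p + t *R v)))^2" using d0 by (rule power_mono)
  also have "... = (norm (x - p))^2 - 2 * t * inner (x - p) v + t^2 * (norm v)^2"
   unfolding power2_norm_eq_inner
   by (simp add: inner_diff_left inner_diff_right inner_add_left inner_add_right inner_commute algebra_simps power2_eq_square)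
  also have "... = d^2 - (inner (x - p) v)^2 / (norm v)^2"
   using nv by (simp add: npd t_def field_simps power2_eq_square)
  finally have "(inner (x - p) v)^2 / (norm v)^2 <= 0" by simp
  with nv have "(inner (x - p) v)^2 <= 0" by (simp add: field_simps)
  then show ?thesis by simp
 qed simp
 with pS show ?thesis by blast
qed

definition proj :: "'a::{real_inner,complete_space} set => 'a => 'a" where
 "proj S x = (SOME p. p : S & (ALL s : S. inner (x - p) s = 0))"

lemma
 fixes S :: "'a::{real_inner,complete_space} set"
 assumes "subspace S" "closed S"
 shows proj_in: "proj S x : S"
  and proj_orthogonal: "s : S ==> inner (x - proj S x) s = 0"
proof -
 have *: "proj S x : S & (ALL s : S. inner (x - proj S x) s = 0)"
  unfolding proj_def
  by (rule someI_ex) (use closed_subspace_projection_exists[OF assms, of x] in blast)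
 show "proj S x : S" "s : S ==> inner (x - proj S x) s = 0" using * by auto
qed

lemma proj_unique:
 fixes S :: "'a::{real_inner,complete_space} set"
 assumes "subspace S" "closed S" "p : S" "!!s. s : S ==> inner (x - p) s = 0"
 shows "proj S x = p"
proof -
 have "p - proj S x : S" using assms proj_in[OF assms(1,2)] by (intro subspace_diff)
 then have "inner (x - proj S x) (p - proj S x) - inner (x - p) (p - proj S x) = 0"
  using assms(4) proj_orthogonal[OF assms(1,2)] by simp
 then have "inner (p - proj S x) (p - proj S x) = 0"
  unfolding inner_diff_left[symmetric] by simp
 then show ?thesis by simp
qed

lemma proj_diff:
 fixes S :: "'a::{real_inner,complete_space} set"
 assumes "subspace S" "closed S"
 shows "proj S (x - y) = proj S x - proj S y"
proof (rule proj_unique[OF assms])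
 show "proj S x - proj S y : S" using proj_in[OF assms] assms(1) by (intro subspace_diff)
 fix s assume "s : S"
 then show "inner (x - y - (proj S x - proj S y)) s = 0"
  using proj_orthogonal[OF assms, of s x] proj_orthogonal[OF assms, of s y]
  by (simp add: inner_diff_left)
qed

lemma norm_proj_le:
 fixes S :: "'a::{real_inner,complete_space} set"
 assumes "subspace S" "closed S"
 shows "norm (proj S x) <= norm x"
proof -
 have "inner x (proj S x) = (norm (proj S x))^2"
  using proj_orthogonal[OF assms proj_in[OF assms], of x x] by (simp add: inner_diff_left power2_norm_eq_inner)
 with norm_cauchy_schwarz[of x "proj S x"]
 have "norm (proj S x) * norm (proj S x) <= norm x * norm (proj S x)" by (simp add: power2_eq_square)
 then show ?thesis by (cases "norm (proj S x) = 0") (auto dest: mult_right_le_imp_le)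
qed

text \<open>The map g -> g - rh P (T g - h), with P the projection onto \<open>S\<close>, contracts
  \<open>S\<close> for rh = mu / L^2, with squared factor 1 - mu^2 / L^2; at its fixed point the
  projection of T g - h vanishes. \<open>T\<close> acts on the whole space and need not preserve
  \<open>S\<close>, which is why P appears.\<close>

lemma lax_milgram:
 fixes S :: "'a::{real_inner,complete_space} set"
 assumes S: "subspace S" "closed S" and T: "bounded_linear T" and mu: "mu > 0"
  and co: "!!s. s : S ==> mu * (norm s)^2 <= inner (T s) s"
 shows "EX g : S. ALL s : S. inner (T g) s = inner h s"
proof -
 interpret T: bounded_linear T by fact
 obtain K where K: "K > 0" "!!x. norm (T x) <= norm x * K" using T.pos_bounded by blast
 \<comment> \<open>The maximum with \<open>mu\<close> ensures mu <= L, so the squared contraction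
   factor is nonnegative.\<close>
 define L where "L = max K mu"
 have L: "L > 0" "mu <= L" "norm (T x) <= norm x * L" for x
  using K(1) K(2)[of x] mu by (auto simp: L_def intro: order_trans[OF _ mult_left_mono[of K "max K mu"]])
 define rh where "rh = mu / L^2"
 have rh: "rh > 0" using mu L by (simp add: rh_def)
 define c where "c = sqrt (1 - mu^2 / L^2)"
 have ml: "mu^2 / L^2 <= 1" "0 < mu^2 / L^2" using mu L by (auto simp: power_mono)
 define Ph where "Ph g = g - rh *R proj S (T g - h)" for g
 have "EX! g : S. Ph g = g"
 proof (rule Banach_fix[of S c])
  show "complete S" using S(2) complete_eq_closed by blast
  show "S ~= {}" using subspace_0[OF S(1)] by blast
  show "0 <= c" "c < 1" using ml by (auto simp: c_def)
  show "Ph ` S <= S"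
   using proj_in[OF S] S(1) by (auto simp: Ph_def intro!: subspace_diff subspace_scale)
  fix x y assume xy: "x : S" "y : S"
  define z where "z = x - y"
  have z: "z : S" using xy S(1) by (auto simp: z_def intro: subspace_diff)
  have eq: "Ph x - Ph y = z - rh *R proj S (T z)"
  proof -
   have "proj S (T z) = proj S (T x - h) - proj S (T y - h)"
    unfolding proj_diff[OF S, symmetric] by (simp add: z_def T.diff)
   then show ?thesis by (simp only: Ph_def z_def scaleR_diff_right) (simp add: algebra_simps)
  qed
  have ip: "inner z (proj S (T z)) = inner (T z) z"
   using proj_orthogonal[OF S z, of "T z"] by (simp add: inner_diff_left inner_diff_right inner_commute)
  have "(norm (Ph x - Ph y))^2 = (norm z)^2 - 2 * rh * inner (T z) z + rh^2 * (norm (proj S (T z)))^2"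
   unfolding eq power2_norm_eq_inner
   by (simp add: inner_diff_left inner_diff_right inner_commute[of "proj S (T z)" z] ip algebra_simps power2_eq_square)
  also have "... <= (norm z)^2 - 2 * rh * (mu * (norm z)^2) + rh^2 * (norm z * L)^2"
  proof -
   have "norm (proj S (T z)) <= norm z * L" using norm_proj_le[OF S, of "T z"] L(3)[of z] by linarith
   then have "(norm (proj S (T z)))^2 <= (norm z * L)^2" by (rule power_mono) simp
   then have "rh^2 * (norm (proj S (T z)))^2 <= rh^2 * (norm z * L)^2" by (rule mult_left_mono) simp
   moreover have "rh * (mu * (norm z)^2) <= rh * inner (T z) z" using co[OF z] rh by simp
   ultimately show ?thesis by linarith
  qed
  also have "... = (1 - mu^2 / L^2) * (norm z)^2"
   using L(1) by (simp add: rh_def field_simps power2_eq_square)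
  also have "... = (c * norm z)^2" using ml by (simp add: c_def power_mult_distrib)
  finally have "norm (Ph x - Ph y) <= c * norm z"
   by (rule power2_le_imp_le) (use ml in "simp add: c_def")
  then show "dist (Ph x) (Ph y) <= c * dist x y" by (simp add: dist_norm z_def)
 qed
 then obtain g where g: "g : S" "Ph g = g" by blast
 then have pz: "proj S (T g - h) = 0" using rh by (simp add: Ph_def)
 have "inner (T g) s = inner h s" if "s : S" for s
  using proj_orthogonal[OF S that, of "T g - h"] pz by (simp add: inner_diff_left)
 with g show ?thesis by blast
qed

text \<open>Linearity and bound are asked for on \<open>S\<close> only, as functionals here are
  total functions that mean something only there. The representing vector is a multiple of
  \<open>w\<close>, the component of some \<open>z\<close> with f z ~= 0 orthogonal to the
  kernel.\<close>

lemma riesz_representation: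
 fixes S :: "'a::{real_inner,complete_space} set"
 assumes S: "subspace S" "closed S"
  and lin: "!!x y a b. x : S ==> y : S ==> f (a *R x + b *R y) = a * f x + b * f y"
  and bd: "!!x. x : S ==> \<bar>f x\<bar> <= C * norm x"
 shows "EX h : S. ALL s : S. f s = inner h s"
proof -
 define N where "N = {s : S. f s = 0}"
 have f0: "f 0 = 0" using lin[of 0 0 0 0] subspace_0[OF S(1)] by simp
 have subN: "subspace N" unfolding subspace_def N_def
  using S(1) lin[of _ _ 1 1] lin[of _ 0 _ 0] f0 subspace_0[OF S(1)]
  by (auto simp: subspace_add subspace_scale)
 have fd: "f (x - y) = f x - f y" if "x : S" "y : S" for x y
  using lin[OF that, of 1 "-1"] by simp
 have clN: "closed N"
 proof (unfold closed_sequential_limits, intro allI impI, elim conjE)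
  fix x l assume x: "ALL n. x n : N" and l: "x ---> l"
  have lS: "l : S" using x l S(2) by (auto simp: N_def intro: closed_sequentially)
  have "\<bar>f l\<bar> <= C * norm (l - x n)" for n
   using bd[of "l - x n"] fd[of l "x n"] x lS S(1) by (auto simp: N_def subspace_diff)
  moreover have "(%n. C * norm (l - x n)) ---> C * norm (l - l)" by (intro tendsto_intros l)
  ultimately have "\<bar>f l\<bar> <= C * norm (l - l)"
   by (intro LIMSEQ_le_const) auto
  then show "l : N" using lS by (simp add: N_def)
 qed
 show ?thesis
 proof (cases "N = S")
  case True
  then show ?thesis using subspace_0[OF S(1)] by (intro bexI[of _ 0]) (auto simp: N_def)
 next
  case False
  then obtain z where z: "z : S" "f z ~= 0" by (auto simp: N_def)
  define w where "w = z - proj N z"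
  have pN: "proj N z : N" by (rule proj_in[OF subN clN])
  have wS: "w : S" using z pN S(1) by (auto simp: w_def N_def subspace_diff)
  have fw: "f w = f z" using fd[of z "proj N z"] z pN by (auto simp: w_def N_def)
  have wne: "w ~= 0" using fw z f0 by auto
  have orth: "inner w s = 0" if "s : N" for s
   unfolding w_def by (rule proj_orthogonal[OF subN clN that])
  define c where "c = f w / (norm w)^2"
  have "f s = inner (c *R w) s" if s: "s : S" for s
  proof -
   have "s - (f s / f w) *R w : N"
    unfolding N_def using s wS S(1) lin[OF s wS, of 1 "- (f s / f w)"] fw z
    by (auto simp: subspace_diff subspace_scale)
   from orth[OF this] have "inner w s = f s / f w * (norm w)^2"
    by (simp add: inner_diff_right power2_norm_eq_inner)
   then show ?thesis using wne fw z by (simp add: c_def)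
  qed
  moreover have "c *R w : S" using wS S(1) by (rule subspace_scale[rotated])
  ultimately show ?thesis by blast
 qed
qed

text \<open>The density criterion by annihilators: the projection remainder of \<open>x\<close> is
  orthogonal to \<open>S\<close>, hence to \<open>x\<close> and to itself.\<close>

lemma in_closure_if_orthogonal:
 fixes S :: "'a::{real_inner,complete_space} set"
 assumes "subspace S" "!!z. (!!s. s : S ==> inner z s = 0) ==> inner z x = 0"
 shows "x : closure S"
proof -
 have cs: "subspace (closure S)" "closed (closure S)" using assms(1) by (auto intro: subspace_closure)
 define z where "z = x - proj (closure S) x"
 have zo: "inner z s = 0" if "s : closure S" for s
  unfolding z_def by (rule proj_orthogonal[OF cs that])
 then have "inner z x = 0" using closure_subset by (intro assms(2)) blast
 moreover have "inner z (proj (closure S) x) = 0" by (rule zo[OF proj_in[OF cs]])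
 ultimately have "inner z z = 0" by (simp add: z_def inner_diff_right)
 then have "x = proj (closure S) x" by (simp add: z_def)
 then show ?thesis using proj_in[OF cs, of x] by simp
qed

lemma inner_zero_on_closure:
 fixes S :: "'a::real_inner set"
 assumes "!!s. s : S ==> inner z s = 0" "x : closure S"
 shows "inner z x = 0"
proof -
 have "closed {s. inner z s = 0}" by (intro closed_Collect_eq continuous_intros)
 then have "closure S <= {s. inner z s = 0}" using assms(1) by (intro closure_minimal) auto
 then show ?thesis using assms(2) by auto
qed

section \<open>The Hilbert space of square integrable functions\<close>

definition sqint :: "'a measure => ('a => 'b::euclidean_space) => bool" where
 "sqint M f \<longleftrightarrow> f : borel_measurable M & integrable M (%x. (norm (f x))^2)"

lemma sqint_measurable: "sqint M f ==> f : borel_measurable M"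
 by (simp add: sqint_def)

lemma sqint_bound:
 assumes "sqint M f" "g : borel_measurable M" "AE x in M. norm (g x) <= C * norm (f x)"
 shows "sqint M g"
 unfolding sqint_def
proof (intro conjI assms(2))
 show "integrable M (%x. (norm (g x))^2)"
 proof (rule Bochner_Integration.integrable_bound)
  show "integrable M (%x. C^2 * (norm (f x))^2)"
   using assms(1) by (simp add: sqint_def)
  show "(%x. (norm (g x))^2) : borel_measurable M" using assms(2) by measurable
  show "AE x in M. norm ((norm (g x))^2) <= norm (C^2 * (norm (f x))^2)"
   using assms(3)
  proof eventually_elim
   case (elim x)
   from power_mono[OF this, of 2] show ?case by (simp add: power_mult_distrib)
  qed
 qed
qed

lemma sqint_add:
 assumes "sqint M f" "sqint M g"
 shows "sqint M (%x. f x + g x)"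
 unfolding sqint_def
proof (intro conjI)
 have [measurable]: "f : borel_measurable M" "g : borel_measurable M"
  using assms by (auto simp: sqint_def)
 show "(%x. f x + g x) : borel_measurable M" by measurable
 show "integrable M (%x. (norm (f x + g x))^2)"
 proof (rule Bochner_Integration.integrable_bound)
  show "integrable M (%x. 2 * (norm (f x))^2 + 2 * (norm (g x))^2)"
   using assms by (auto simp: sqint_def)
  show "(%x. (norm (f x + g x))^2) : borel_measurable M" by measurable
  have "(norm (f x + g x))^2 <= 2 * (norm (f x))^2 + 2 * (norm (g x))^2" for x
  proof -
   have "(norm (f x + g x))^2 <= (norm (f x) + norm (g x))^2"
    by (rule power_mono[OF norm_triangle_ineq]) simp
   moreover have "0 <= (norm (f x) - norm (g x))^2" by simp
   ultimately show ?thesis by (simp add: power2_eq_square algebra_simps)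
  qed
  then show "AE x in M. norm ((norm (f x + g x))^2) <= norm (2 * (norm (f x))^2 + 2 * (norm (g x))^2)"
   by (auto simp: abs_of_nonneg)
 qed
qed

lemma sqint_scaleR:
 assumes "sqint M f" shows "sqint M (%x. c *R f x)"
 by (rule sqint_bound[OF assms, of _ "\<bar>c\<bar>"])
  (use sqint_measurable[OF assms] in auto)

lemma sqint_minus:
 assumes "sqint M f" shows "sqint M (%x. - f x)"
 using sqint_scaleR[OF assms, of "-1"] by simp

lemma sqint_diff:
 assumes "sqint M f" "sqint M g"
 shows "sqint M (%x. f x - g x)"
 using sqint_add[OF assms(1) sqint_minus[OF assms(2)]] by simp

lemma sqint_zero: "sqint M (%x. 0)"
 by (simp add: sqint_def)

lemma integrable_inner:
 assumes "sqint M f" "sqint M g"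
 shows "integrable M (%x. inner (f x) (g x))"
proof (rule Bochner_Integration.integrable_bound)
 have [measurable]: "f : borel_measurable M" "g : borel_measurable M"
  using assms by (auto simp: sqint_def)
 show "integrable M (%x. (norm (f x))^2 + (norm (g x))^2)"
  using assms by (auto simp: sqint_def)
 show "(%x. inner (f x) (g x)) : borel_measurable M" by measurable
 have "\<bar>inner (f x) (g x)\<bar> <= (norm (f x))^2 + (norm (g x))^2" for x
 proof -
  have "\<bar>inner (f x) (g x)\<bar> <= norm (f x) * norm (g x)" by (rule Cauchy_Schwarz_ineq2)
  moreover have "0 <= (norm (f x) - norm (g x))^2" by simp
  moreover have "0 <= norm (f x) * norm (g x)" by simp
  ultimately show ?thesis by (simp add: power2_eq_square algebra_simps)
 qed
 then show "AE x in M. norm (inner (f x) (g x)) <= norm ((norm (f x))^2 + (norm (g x))^2)"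
  by (auto simp: abs_of_nonneg)
qed

definition l2_rel :: "('a::euclidean_space => 'b::euclidean_space) => ('a => 'b) => bool" where
 "l2_rel f g \<longleftrightarrow> sqint lebesgue f & sqint lebesgue g & (AE x in lebesgue. f x = g x)"

lemma l2_rel_refl: "l2_rel f f \<longleftrightarrow> sqint lebesgue f"
 by (simp add: l2_rel_def)

\<comment> \<open>A partial quotient turns equality almost everywhere of square integrable functions
  into equality, so that \<open>real_inner\<close> and \<open>complete_space\<close> can be
  instantiated and the projection results above apply.\<close>
quotient_type (overloaded) ('a, 'b) l2 = "'a::euclidean_space => 'b::euclidean_space" / partial: l2_rel
proof (rule part_equivpI)
 show "EX x. l2_rel x (x::'a => 'b)"
  using sqint_zero by (auto simp: l2_rel_refl)
 show "symp (l2_rel :: ('a => 'b) => _)"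
  by (auto simp: l2_rel_def intro!: sympI elim: eventually_mono)
 show "transp (l2_rel :: ('a => 'b) => _)"
  by (auto simp: l2_rel_def intro!: transpI elim: eventually_elim2)
qed

instantiation l2 :: (euclidean_space, euclidean_space) real_inner
begin

lift_definition zero_l2 :: "('a,'b) l2" is "%x. 0" by (simp add: l2_rel_refl sqint_zero)
lift_definition plus_l2 :: "('a,'b) l2 => ('a,'b) l2 => ('a,'b) l2" is "%f g x. f x + g x"
 by (auto simp: l2_rel_def intro!: sqint_add elim: eventually_elim2)
lift_definition minus_l2 :: "('a,'b) l2 => ('a,'b) l2 => ('a,'b) l2" is "%f g x. f x - g x"
 by (auto simp: l2_rel_def intro!: sqint_diff elim: eventually_elim2)
lift_definition uminus_l2 :: "('a,'b) l2 => ('a,'b) l2" is "%f x. - f x"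
 by (auto simp: l2_rel_def intro!: sqint_minus elim: eventually_mono)
lift_definition scaleR_l2 :: "real => ('a,'b) l2 => ('a,'b) l2" is "%c f x. c *\<^sub>R f x"
 by (auto simp: l2_rel_def intro!: sqint_scaleR elim: eventually_mono)
lift_definition inner_l2 :: "('a,'b) l2 => ('a,'b) l2 => real" is "%f g. \<integral>x. inner (f x) (g x) \<partial>lebesgue"
proof -
 fix f1 f2 g1 g2 :: "'a => 'b"
 assume "l2_rel f1 f2" "l2_rel g1 g2"
 then have sq: "sqint lebesgue f1" "sqint lebesgue f2" "sqint lebesgue g1" "sqint lebesgue g2"
  and ae: "AE x in lebesgue. f1 x = f2 x" "AE x in lebesgue. g1 x = g2 x" by (auto simp: l2_rel_def)
 show "(\<integral>x. inner (f1 x) (g1 x) \<partial>lebesgue) = (\<integral>x. inner (f2 x) (g2 x) \<partial>lebesgue)"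
 proof (rule integral_cong_AE)
  show "AE x in lebesgue. inner (f1 x) (g1 x) = inner (f2 x) (g2 x)" using ae by eventually_elim simp
 qed (use integrable_inner[OF sq(1,3)] integrable_inner[OF sq(2,4)] in auto)
qed

definition norm_l2 :: "('a,'b) l2 => real" where "norm_l2 x = sqrt (inner x x)"
definition dist_l2 :: "('a,'b) l2 => ('a,'b) l2 => real" where "dist_l2 x y = norm (x - y)"
definition sgn_l2 :: "('a,'b) l2 => ('a,'b) l2" where "sgn_l2 x = inverse (norm x) *\<^sub>R x"
definition uniformity_l2 :: "(('a,'b) l2 \<times> ('a,'b) l2) filter" where
 "uniformity_l2 = (INF e\<in>{0<..}. principal {(x, y). dist x y < e})"
definition open_l2 :: "('a,'b) l2 set => bool" where
 "open_l2 U \<longleftrightarrow> (ALL x : U. \<forall>\<^sub>F (x', y) in uniformity. x' = x --> y : U)"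

instance
proof
 fix x y z :: "('a,'b) l2" and r s :: real
 show "x + y + z = x + (y + z)"
  by transfer (auto simp: l2_rel_def intro!: sqint_add simp: algebra_simps)
 show "x + y = y + x"
  by transfer (auto simp: l2_rel_def intro!: sqint_add simp: algebra_simps)
 show "0 + x = x" by transfer (auto simp: l2_rel_def)
 show "- x + x = 0" by transfer (auto simp: l2_rel_def sqint_zero)
 show "x - y = x + - y"
  by transfer (auto simp: l2_rel_def intro!: sqint_diff)
 show "r *\<^sub>R (x + y) = r *\<^sub>R x + r *\<^sub>R y"
  by transfer (auto simp: l2_rel_def intro!: sqint_add sqint_scaleR simp: scaleR_add_right)
 show "(r + s) *\<^sub>R x = r *\<^sub>R x + s *\<^sub>R x"
  by transfer (auto simp: l2_rel_def intro!: sqint_add sqint_scaleR simp: scaleR_add_left)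
 show "r *\<^sub>R s *\<^sub>R x = (r * s) *\<^sub>R x"
  by transfer (auto simp: l2_rel_def intro!: sqint_scaleR)
 show "1 *\<^sub>R x = x" by transfer (auto simp: l2_rel_def)
 show "inner x y = inner y x" by transfer (simp add: inner_commute)
 show "inner (x + y) z = inner x z + inner y z"
  by transfer (simp add: l2_rel_def inner_add_left integrable_inner)
 show "inner (r *\<^sub>R x) y = r * inner x y"
  by transfer simp
 show "0 <= inner x x" by transfer simp
 show "inner x x = 0 \<longleftrightarrow> x = 0"
 proof transfer
  fix f :: "'a => 'b" assume "l2_rel f f"
  then have f: "sqint lebesgue f" by (simp add: l2_rel_refl)
  have "(\<integral>x. inner (f x) (f x) \<partial>lebesgue) = 0 \<longleftrightarrow> (AE x in lebesgue. inner (f x) (f x) = 0)"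
   by (rule integral_nonneg_eq_0_iff_AE[OF integrable_inner[OF f f]]) simp
  then show "(\<integral>x. inner (f x) (f x) \<partial>lebesgue) = 0 \<longleftrightarrow> l2_rel f (%x. 0)"
   using f by (simp add: l2_rel_def sqint_zero)
 qed
qed (simp_all add: norm_l2_def dist_l2_def sgn_l2_def uniformity_l2_def open_l2_def)

end

lemma abs_l2_add: "sqint lebesgue f ==> sqint lebesgue g ==>
  abs_l2 (%x. f x + g x) = abs_l2 f + abs_l2 g"
 by (simp add: plus_l2.abs_eq l2_rel_refl)

lemma abs_l2_diff: "sqint lebesgue f ==> sqint lebesgue g ==>
  abs_l2 (%x. f x - g x) = abs_l2 f - abs_l2 g"
 by (simp add: minus_l2.abs_eq l2_rel_refl)

lemma abs_l2_scaleR: "sqint lebesgue f ==> abs_l2 (%x. c *R f x) = c *R abs_l2 f"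
 by (simp add: scaleR_l2.abs_eq l2_rel_refl)

lemma inner_abs_l2: "sqint lebesgue f ==> sqint lebesgue g ==>
  inner (abs_l2 f) (abs_l2 g) = (\<integral>x. inner (f x) (g x) \<partial>lebesgue)"
 by (simp add: inner_l2.abs_eq l2_rel_refl)

lemma norm_abs_l2: "sqint lebesgue f ==>
  (norm (abs_l2 f))^2 = (\<integral>x. (norm (f x))^2 \<partial>lebesgue)"
 by (simp add: power2_norm_eq_inner inner_abs_l2)

lemma abs_l2_eq_iff: "sqint lebesgue f ==> sqint lebesgue g ==>
  abs_l2 f = abs_l2 g \<longleftrightarrow> (AE x in lebesgue. f x = g x)"
 using Quotient_rel[OF Quotient_l2, of f g] by (auto simp: l2_rel_def)

lemma l2_cases:
 obtains f where "sqint lebesgue f" "X = abs_l2 f"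
 using Quotient_abs_rep[OF Quotient_l2, of X] Quotient_rep_reflp[OF Quotient_l2, of X] by (metis l2_rel_refl)

lemma sqint_nn:
 "sqint M f \<longleftrightarrow> f : borel_measurable M & (\<integral>\<^sup>+x. ennreal ((norm (f x))^2) \<partial>M) < \<infinity>"
 unfolding sqint_def integrable_iff_bounded by auto

text \<open>The pointwise half of the Riesz-Fischer theorem. With squared increments of integral at
  most 16^{-k}, the sum of 4^k |u_{k+1} - u_k|^2 is finite almost everywhere; there the increments
  are at most a constant times 2^{-k} and can be summed.\<close>

lemma sqint_AE_limit:
 fixes u :: "nat => 'a => 'b::euclidean_space"
 assumes sq: "!!k. sqint M (u k)"
  and le: "!!k. (\<integral>\<^sup>+x. ennreal ((norm (u (Suc k) x - u k x))^2) \<partial>M) <= ennreal ((1/16)^k)"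
 shows "EX F. F : borel_measurable M & (AE x in M. (%k. u k x) ---> F x)"
proof -
 have [measurable]: "u k : borel_measurable M" for k using sq by (simp add: sqint_def)
 have "(\<integral>\<^sup>+x. (\<Sum>k. ennreal (4^k * (norm (u (Suc k) x - u k x))^2)) \<partial>M)
   = (\<Sum>k. \<integral>\<^sup>+x. ennreal (4^k * (norm (u (Suc k) x - u k x))^2) \<partial>M)"
  by (rule nn_integral_suminf) measurable
 also have "... <= (\<Sum>k. ennreal ((1/4)^k))"
 proof (rule suminf_le)
  fix k
  have "(\<integral>\<^sup>+x. ennreal (4^k * (norm (u (Suc k) x - u k x))^2) \<partial>M)
    = ennreal (4^k) * (\<integral>\<^sup>+x. ennreal ((norm (u (Suc k) x - u k x))^2) \<partial>M)"
   by (subst nn_integral_cmult[symmetric]) (auto simp: ennreal_mult)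
  also have "... <= ennreal (4^k) * ennreal ((1/16)^k)" by (rule mult_left_mono[OF le]) simp
  also have "... = ennreal ((1/4)^k)" by (simp add: ennreal_mult[symmetric] power_mult_distrib[symmetric])
  finally show "(\<integral>\<^sup>+x. ennreal (4^k * (norm (u (Suc k) x - u k x))^2) \<partial>M) <= ennreal ((1/4)^k)" .
 qed auto
 also have "... = ennreal (\<Sum>k. (1/4)^k)" by (rule suminf_ennreal2) (auto intro: summable_geometric)
 also have "... < \<infinity>" by simp
 finally have "(\<integral>\<^sup>+x. (\<Sum>k. ennreal (4^k * (norm (u (Suc k) x - u k x))^2)) \<partial>M) ~= \<infinity>" by simp
 then have "AE x in M. (\<Sum>k. ennreal (4^k * (norm (u (Suc k) x - u k x))^2)) ~= \<infinity>"
  by (intro nn_integral_PInf_AE) auto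
 then have ae: "AE x in M. convergent (%k. u k x)"
 proof eventually_elim
  case (elim x)
  then have sm: "summable (%k. 4^k * (norm (u (Suc k) x - u k x))^2)"
   by (intro summable_suminf_not_top) auto
  from summable_LIMSEQ_zero[OF this] have "Bseq (%k. 4^k * (norm (u (Suc k) x - u k x))^2)"
   by (intro convergent_imp_Bseq) (auto simp: convergent_def)
  then obtain K where K: "K > 0" "!!k. norm (4^k * (norm (u (Suc k) x - u k x))^2) <= K" by (auto simp: Bseq_def)
  have b: "norm (u (Suc k) x - u k x) <= sqrt K * (1/2)^k" for k
  proof (rule power2_le_imp_le)
   have "((1/2)^k)^2 = (1/4::real)^k" by (simp add: power2_eq_square power_mult_distrib[symmetric])
   then have "(sqrt K * (1/2)^k)^2 = K * (1/4)^k" using K(1) by (simp only: power_mult_distrib real_sqrt_pow2 less_imp_le)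
   then have "(sqrt K * (1/2)^k)^2 = K / 4^k" by (simp add: power_one_over)
   moreover have "4^k * (norm (u (Suc k) x - u k x))^2 <= K" using K(2)[of k] by (simp add: abs_mult)
   then have "(norm (u (Suc k) x - u k x))^2 <= K / 4^k" by (simp add: field_simps)
   ultimately show "(norm (u (Suc k) x - u k x))^2 <= (sqrt K * (1/2)^k)^2" by linarith
  qed (use K in auto)
  have "summable (%k. sqrt K * (1/2)^k)" by (intro summable_mult summable_geometric) auto
  then have "summable (%k. u (Suc k) x - u k x)" by (rule summable_comparison_test'[of _ 0]) (use b in auto)
  then have "convergent (%n. \<Sum>k<n. (u (Suc k) x - u k x))" by (simp add: summable_iff_convergent)
  then have "convergent (%n. u n x - u 0 x)" using sum_lessThan_telescope[of "%n. u n x"] by simp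
  then obtain l where "(%n. u n x - u 0 x) ---> l" by (auto simp: convergent_def)
  from tendsto_add[OF this tendsto_const[of "u 0 x"]] show ?case by (auto simp: convergent_def)
 qed
 define F where "F x = lim (%k. u k x)" for x
 have "F : borel_measurable M" unfolding F_def by (rule borel_measurable_lim_metric) measurable
 moreover have "AE x in M. (%k. u k x) ---> F x"
  using ae by eventually_elim (simp add: F_def convergent_LIMSEQ_iff)
 ultimately show ?thesis by blast
qed

text \<open>Fatou's lemma: an L^2 distance estimate along the sequence passes to its pointwise
  limit.\<close>

lemma nn_integral_norm_square_diff_limit:
 fixes u :: "nat => 'a => 'b::euclidean_space"
 assumes [measurable]: "!!k. u k : borel_measurable M" "v : borel_measurable M" "F : borel_measurable M"
  and ae: "AE x in M. (%k. u k x) ---> F x"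
  and le: "!!k. k >= N ==> (\<integral>\<^sup>+x. ennreal ((norm (v x - u k x))^2) \<partial>M) <= C"
 shows "(\<integral>\<^sup>+x. ennreal ((norm (v x - F x))^2) \<partial>M) <= C"
proof -
 have "(\<integral>\<^sup>+x. ennreal ((norm (v x - F x))^2) \<partial>M) = (\<integral>\<^sup>+x. liminf (%k. ennreal ((norm (v x - u k x))^2)) \<partial>M)"
 proof (rule nn_integral_cong_AE)
  show "AE x in M. ennreal ((norm (v x - F x))^2) = liminf (%k. ennreal ((norm (v x - u k x))^2))"
   using ae
  proof eventually_elim
   case (elim x)
   have "(%k. ennreal ((norm (v x - u k x))^2)) ---> ennreal ((norm (v x - F x))^2)"
    by (intro tendsto_ennrealI tendsto_intros elim)
   then show ?case using lim_imp_Liminf[OF sequentially_bot] by metis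
  qed
 qed
 also have "... <= liminf (%k. \<integral>\<^sup>+x. ennreal ((norm (v x - u k x))^2) \<partial>M)"
  by (rule nn_integral_liminf) measurable
 also have "... <= C"
 proof -
  have "\<forall>\<^sub>F k in sequentially. (\<integral>\<^sup>+x. ennreal ((norm (v x - u k x))^2) \<partial>M) <= C"
   using le by (auto simp: eventually_sequentially)
  then have "liminf (%k. \<integral>\<^sup>+x. ennreal ((norm (v x - u k x))^2) \<partial>M) <= liminf (%k. C)" by (rule Liminf_mono)
  then show ?thesis by (simp add: Liminf_const)
 qed
 finally show ?thesis .
qed

lemma nn_integral_norm_abs_l2:
 "sqint lebesgue f ==> (\<integral>\<^sup>+x. ennreal ((norm (f x))^2) \<partial>lebesgue) = ennreal ((norm (abs_l2 f))^2)"
 by (subst norm_abs_l2) (auto simp: sqint_def nn_integral_eq_integral)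

instance l2 :: (euclidean_space, euclidean_space) complete_space
proof
 fix X :: "nat => ('a, 'b) l2" assume X: "Cauchy X"
 have "EX f. ALL n. sqint lebesgue (f n) & X n = abs_l2 (f n)" by (intro choice allI) (metis l2_cases)
 then obtain f where f: "!!n. sqint lebesgue (f n)" "!!n. X n = abs_l2 (f n)" by blast
 have dst: "(\<integral>\<^sup>+x. ennreal ((norm (f m x - f n x))^2) \<partial>lebesgue) = ennreal ((dist (X m) (X n))^2)" for m n
  using nn_integral_norm_abs_l2[OF sqint_diff[OF f(1) f(1), of m n]] by (simp add: abs_l2_diff f dist_norm)
 have "EX N. ALL m>=N. ALL n>=N. dist (X m) (X n) < (1/4)^k" for k
  using metric_CauchyD[OF X, of "(1/4)^k"] by simp
 then obtain N where N: "!!k m n. m >= N k ==> n >= N k ==> dist (X m) (X n) < (1/4)^k" by metis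
 \<comment> \<open>Summing the thresholds makes the indices monotone, and adding k makes them
   unbounded, while r k >= N k is kept.\<close>
 define r where "r k = (\<Sum>j\<le>k. N j) + k" for k
 have r: "r k >= N k" "r (Suc k) >= r k" "r k >= k" for k
  by (auto simp: r_def intro!: trans_le_add1 member_le_sum)
 have "EX F. F : borel_measurable lebesgue & (AE x in lebesgue. (%k. f (r k) x) ---> F x)"
 proof (rule sqint_AE_limit)
  fix k show "sqint lebesgue (f (r k))" by (rule f)
  have "dist (X (r (Suc k))) (X (r k)) <= (1/4)^k" using N[of k "r (Suc k)" "r k"] r[of k] by auto
  then have "(dist (X (r (Suc k))) (X (r k)))^2 <= ((1/4)^k)^2" by (rule power_mono) simp
  also have "... = (1/16)^k" by (simp add: power2_eq_square power_mult_distrib[symmetric])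
  finally show "(\<integral>\<^sup>+x. ennreal ((norm (f (r (Suc k)) x - f (r k) x))^2) \<partial>lebesgue) <= ennreal ((1/16)^k)"
   unfolding dst by (rule ennreal_leI)
 qed
 then obtain F where F[measurable]: "F : borel_measurable lebesgue" and ae: "AE x in lebesgue. (%k. f (r k) x) ---> F x" by blast
 have [measurable]: "f n : borel_measurable lebesgue" for n using f by (simp add: sqint_def)
 have est: "(\<integral>\<^sup>+x. ennreal ((norm (f n x - F x))^2) \<partial>lebesgue) <= ennreal (((1/4)^k)^2)" if n: "n >= N k" for n k
 proof (rule nn_integral_norm_square_diff_limit[where N = "N k", OF _ _ F ae])
  fix j assume "j >= N k"
  then have "dist (X n) (X (r j)) < (1/4)^k" using r(3)[of j] n by (intro N) auto
  then have "(dist (X n) (X (r j)))^2 <= ((1/4)^k)^2" by (intro power_mono) auto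
  then show "(\<integral>\<^sup>+x. ennreal ((norm (f n x - f (r j) x))^2) \<partial>lebesgue) <= ennreal (((1/4)^k)^2)"
   unfolding dst by (rule ennreal_leI)
 qed measurable
 have "sqint lebesgue (%x. f (N 0) x - F x)"
  unfolding sqint_nn using est[of 0 "N 0"] by (auto intro: le_less_trans)
 from sqint_diff[OF f(1)[of "N 0"] this] have sF: "sqint lebesgue F" by simp
 have "dist (X n) (abs_l2 F) <= (1/4)^k" if n: "n >= N k" for n k
 proof -
  have "ennreal ((dist (X n) (abs_l2 F))^2) <= ennreal (((1/4)^k)^2)"
   using est[OF n] nn_integral_norm_abs_l2[OF sqint_diff[OF f(1)[of n] sF]]
   by (simp add: abs_l2_diff f sF dist_norm)
  then have "(dist (X n) (abs_l2 F))^2 <= ((1/4)^k)^2" by (simp add: ennreal_le_iff)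
  then show ?thesis by (rule power2_le_imp_le) simp
 qed
 then have "X ---> abs_l2 F"
 proof (intro metric_LIMSEQ_I)
  fix e :: real assume e: "e > 0"
  obtain k where "(1/4::real)^k < e" using real_arch_pow_inv[OF e, of "1/4"] by auto
  then show "EX no. ALL n>=no. dist (X n) (abs_l2 F) < e"
   using \<open>!!n k. n >= N k ==> dist (X n) (abs_l2 F) <= (1/4)^k\<close> by (meson le_less_trans)
 qed
 then show "convergent X" by (auto simp: convergent_def)
qed

text \<open>Functions on a set are extended by zero, so all spaces embed into one Hilbert space.\<close>

definition sq_on :: "'a::euclidean_space set => ('a => 'b::euclidean_space) => bool" where
 "sq_on D f \<longleftrightarrow> sqint lebesgue (%x. ind D x *R f x)"

definition cls :: "'a::euclidean_space set => ('a => 'b::euclidean_space) => ('a, 'b) l2" where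
 "cls D f = abs_l2 (%x. ind D x *R f x)"

lemma L2_iff_sq_on: "L2 D u \<longleftrightarrow> sq_on D u"
 and L2v_iff_sq_on: "L2v D F \<longleftrightarrow> sq_on D F"
proof -
 have "(%x. ind D x *R (norm (F x))^2) = (%x. (norm (ind D x *R F x))^2)"
  "(%x. ind D x *R (u x)^2) = (%x. (norm (ind D x *R u x))^2)"
  by (auto simp: indicator_def fun_eq_iff)
 then show "L2 D u \<longleftrightarrow> sq_on D u" "L2v D F \<longleftrightarrow> sq_on D F"
  by (simp_all add: L2_def L2v_def sq_on_def sqint_def set_borel_measurable_def set_integrable_def)
qed

lemma sq_on_add: "sq_on D f ==> sq_on D g ==> sq_on D (%x. f x + g x)"
 unfolding sq_on_def scaleR_add_right by (rule sqint_add)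
lemma sq_on_diff: "sq_on D f ==> sq_on D g ==> sq_on D (%x. f x - g x)"
 unfolding sq_on_def scaleR_diff_right by (rule sqint_diff)
lemma sq_on_scaleR: "sq_on D f ==> sq_on D (%x. c *R f x)"
 unfolding sq_on_def using sqint_scaleR[of lebesgue "%x. ind D x *R f x" c]
 by (simp add: mult.commute)
lemma sq_on_zero: "sq_on D (%x. 0)"
 by (simp add: sq_on_def sqint_zero)

lemma cls_add: "sq_on D f ==> sq_on D g ==> cls D (%x. f x + g x) = cls D f + cls D g"
 unfolding sq_on_def cls_def by (simp add: scaleR_add_right abs_l2_add)
lemma cls_diff: "sq_on D f ==> sq_on D g ==> cls D (%x. f x - g x) = cls D f - cls D g"
 unfolding sq_on_def cls_def by (simp add: scaleR_diff_right abs_l2_diff)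
lemma cls_scaleR: "sq_on D f ==> cls D (%x. c *R f x) = c *R cls D f"
 unfolding sq_on_def cls_def by (simp add: abs_l2_scaleR[symmetric] mult.commute)
lemma cls_zero: "cls D (%x. 0) = 0"
 by (simp add: cls_def zero_l2.abs_eq)

lemma sq_on_sum: "finite I ==> (!!i. i : I ==> sq_on D (f i)) ==> sq_on D (%x. SUM i:I. f i x)"
 by (induction I rule: finite_induct) (auto intro: sq_on_zero sq_on_add)
lemma cls_sum: "finite I ==> (!!i. i : I ==> sq_on D (f i)) ==> cls D (%x. SUM i:I. f i x) = (SUM i:I. cls D (f i))"
 by (induction I rule: finite_induct) (auto simp: cls_zero cls_add sq_on_sum)

lemma inner_cls: "sq_on D f ==> sq_on D g ==> inner (cls D f) (cls D g) = (LINT x:D|lebesgue. inner (f x) (g x))"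
 unfolding sq_on_def cls_def set_lebesgue_integral_def
 by (subst inner_abs_l2) (auto intro!: Bochner_Integration.integral_cong simp: indicator_def)

lemma set_integrable_inner: "sq_on D f ==> sq_on D g ==> set_integrable lebesgue D (%x. inner (f x) (g x))"
 unfolding sq_on_def set_integrable_def
 by (drule (1) integrable_inner) (auto elim!: back_subst[of "integrable lebesgue"] simp: indicator_def)

lemma norm_cls: "sq_on D f ==> (norm (cls D f))^2 = (LINT x:D|lebesgue. (norm (f x))^2)"
 by (simp add: power2_norm_eq_inner inner_cls)

lemma cls_eq_iff: "sq_on D f ==> sq_on D g ==> cls D f = cls D g \<longleftrightarrow> (AE x in lebesgue. x : D --> f x = g x)"
 unfolding sq_on_def cls_def
 by (subst abs_l2_eq_iff) (auto simp: indicator_def elim!: eventually_mono)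

lemma sq_on_bound:
 assumes "sq_on D f" "(%x. ind D x *R g x) : borel_measurable lebesgue"
  "AE x in lebesgue. x : D --> norm (g x) <= C * norm (f x)"
 shows "sq_on D g"
 using assms(1) unfolding sq_on_def
 by (rule sqint_bound[OF _ assms(2)]) (use assms(3) in "auto simp: indicator_def elim!: eventually_mono")

lemma norm_cls_le:
 assumes "sq_on D f" "sq_on D g" "AE x in lebesgue. x : D --> norm (g x) <= C * norm (f x)" "0 <= C"
 shows "norm (cls D g) <= C * norm (cls D f)"
proof (rule power2_le_imp_le)
 have "(norm (cls D g))^2 <= (LINT x:D|lebesgue. C^2 * (norm (f x))^2)"
  unfolding norm_cls[OF assms(2)] set_lebesgue_integral_def
 proof (rule integral_mono_AE)
  show "integrable lebesgue (%x. ind D x *R (norm (g x))^2)"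
   using set_integrable_inner[OF assms(2,2)] by (simp add: power2_norm_eq_inner set_integrable_def)
  show "integrable lebesgue (%x. ind D x *R (C^2 * (norm (f x))^2))"
   using set_integrable_mult_right[OF set_integrable_inner[OF assms(1,1)], of "C^2"] by (simp add: power2_norm_eq_inner set_integrable_def)
  show "AE x in lebesgue. ind D x *R (norm (g x))^2 <= ind D x *R (C^2 * (norm (f x))^2)"
   using assms(3)
  proof eventually_elim
   case (elim x)
   then show ?case using power_mono[of "norm (g x)" "C * norm (f x)" 2] by (auto simp: indicator_def power_mult_distrib)
  qed
 qed
 also have "... = (C * norm (cls D f))^2"
  by (simp add: power_mult_distrib norm_cls[OF assms(1)])
 finally show "(norm (cls D g))^2 <= (C * norm (cls D f))^2" .
qed (use assms(4) in auto)

definition repr :: "('a::euclidean_space, 'b::euclidean_space) l2 => 'a => 'b" where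
 "repr X = (SOME f. sqint lebesgue f & X = abs_l2 f)"

lemma repr: "sqint lebesgue (repr X)" "abs_l2 (repr X) = X"
proof -
 have "EX f. sqint lebesgue f & X = abs_l2 f" by (metis l2_cases)
 from someI_ex[OF this] show "sqint lebesgue (repr X)" "abs_l2 (repr X) = X"
  unfolding repr_def by auto
qed

lemma repr_cls_AE:
 assumes "sq_on D f" shows "AE x in lebesgue. repr (cls D f) x = ind D x *R f x"
 using abs_l2_eq_iff[OF repr(1)[of "cls D f"] assms[unfolded sq_on_def]] by (simp add: repr(2) cls_def)

lemma sq_on_measurable: "sq_on D f ==> (%x. ind D x *R f x) : borel_measurable lebesgue"
 by (simp add: sq_on_def sqint_def)

lemma sq_on_subset:
 assumes "sq_on D f" "D' : sets lebesgue" "D' <= D"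
 shows "sq_on D' f"
proof -
 have eq: "(%x. ind D' x *R f x) = (%x. ind D' x *R (ind D x *R f x))"
  using assms(3) by (auto simp: indicator_def fun_eq_iff)
 show ?thesis unfolding sq_on_def
 proof (rule sqint_bound[OF assms(1)[unfolded sq_on_def], of _ 1])
  show "(%x. ind D' x *R f x) : borel_measurable lebesgue"
   unfolding eq by (rule borel_measurable_scaleR[OF borel_measurable_indicator[OF assms(2)] sq_on_measurable[OF assms(1)]])
  show "AE x in lebesgue. norm (ind D' x *R f x) <= 1 * norm (ind D x *R f x)"
   using assms(3) by (auto simp: indicator_def)
 qed
qed

lemma sq_on_repr: "D : sets lebesgue ==> sq_on D (repr X)"
 using sq_on_subset[of UNIV "repr X" D] repr(1)[of X] by (simp add: sq_on_def)

lemma sq_on_bounded_measurable: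
 assumes "D : lmeasurable" "(%x. ind D x *R f x) : borel_measurable lebesgue"
  "!!x. x : D ==> norm (f x) <= C"
 shows "sq_on D f"
 unfolding sq_on_def sqint_def
proof (intro conjI assms(2))
 have "integrable lebesgue (%x. C^2 * ind D x)"
  using assms(1) by (intro integrable_mult_right integrable_real_indicator) (auto simp: fmeasurable_def)
 then show "integrable lebesgue (%x. (norm (ind D x *R f x))^2)"
 proof (rule Bochner_Integration.integrable_bound)
  show "(%x. (norm (ind D x *R f x))^2) : borel_measurable lebesgue" using assms(2) by measurable
  show "AE x in lebesgue. norm ((norm (ind D x *R f x))^2) <= norm (C^2 * ind D x)"
   using assms(3) by (auto simp: indicator_def intro!: power_mono)
 qed
qed

lemma sq_on_cont_compact:
 assumes "compact D" "continuous_on D f"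
 shows "sq_on D f"
proof -
 obtain C where "!!x. x : D ==> norm (f x) <= C"
  using compact_imp_bounded[OF compact_continuous_image[OF assms(2,1)]] by (auto simp: bounded_iff)
 moreover have "(%x. ind D x *R f x) : borel_measurable lebesgue"
  using borel_measurable_continuous_on_indicator[OF _ assms(2)] borel_compact[OF assms(1)]
  by (intro measurable_completion) auto
 ultimately show ?thesis using lmeasurable_compact[OF assms(1)] by (intro sq_on_bounded_measurable) auto
qed

section \<open>Smooth functions and test functions\<close>

definition pd :: "'n => (real^'n => real) => real^'n => real" where
 "pd i ph x = frechet_derivative ph (at x) (axis i 1)"

lemma grad_nth: "grad ph x $ i = pd i ph x"
 by (simp add: grad_def pd_def)

lemma has_derivative_grad:
 assumes "ph differentiable (at x)"
 shows "(ph has_derivative (%h. grad ph x \<bullet> h)) (at x)"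
proof -
 have d: "(ph has_derivative frechet_derivative ph (at x)) (at x)"
  using assms frechet_derivative_works by blast
 interpret f: bounded_linear "frechet_derivative ph (at x)" using d by (rule has_derivative_bounded_linear)
 have "frechet_derivative ph (at x) h = grad ph x \<bullet> h" for h
 proof -
  have "frechet_derivative ph (at x) h = frechet_derivative ph (at x) (SUM i:UNIV. h $ i *R axis i 1)"
   by (simp add: basis_expansion[of h, unfolded scalar_mult_eq_scaleR])
  also have "... = grad ph x \<bullet> h"
   by (simp add: f.sum f.scaleR inner_vec_def grad_def mult.commute)
  finally show ?thesis .
 qed
 then have "frechet_derivative ph (at x) = (%h. grad ph x \<bullet> h)" by auto
 with d show ?thesis by simp
qed

lemma pd_eq:
 assumes "(ph has_derivative f') (at x)" shows "pd i ph x = f' (axis i 1)"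
 unfolding pd_def using frechet_derivative_at[OF assms] by simp

lemma grad_eq:
 assumes "(ph has_derivative (%h. g \<bullet> h)) (at x)" shows "grad ph x = g"
 by (simp add: vec_eq_iff grad_nth pd_eq[OF assms] inner_axis)

lemma Ck_Suc_iff: "Ck (Suc k) ph \<longleftrightarrow> (ALL x. ph differentiable (at x)) & (ALL i. Ck k (pd i ph))"
 by (simp add: pd_def[abs_def])

lemma Ck_Suc_imp: "Ck (Suc k) ph ==> Ck k ph"
proof (induction k arbitrary: ph)
 case 0
 then show ?case by (auto simp: Ck_Suc_iff simp: differentiable_imp_continuous_within continuous_on_eq_continuous_within)
next
 case (Suc k)
 have "Ck (Suc k) (pd i ph)" for i using Suc.prems unfolding Ck_Suc_iff[of "Suc k"] by blast
 then have "Ck k (pd i ph)" for i by (rule Suc.IH)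
 moreover have "ph differentiable (at x)" for x using Suc.prems unfolding Ck_Suc_iff[of "Suc k"] by blast
 ultimately show ?case unfolding Ck_Suc_iff[of k] by blast
qed

lemma smooth_diffble: "smooth ph ==> ph differentiable (at x)"
proof -
 assume "smooth ph"
 then have "Ck (Suc 0) ph" unfolding smooth_def by blast
 then show ?thesis by (simp only: Ck_Suc_iff)
qed

lemma smooth_pd: assumes "smooth ph" shows "smooth (pd i ph)"
 unfolding smooth_def
proof
 fix k
 have "Ck (Suc k) ph" using assms unfolding smooth_def by blast
 then show "Ck k (pd i ph)" by (simp only: Ck_Suc_iff)
qed

lemma smoothI:
 assumes "!!x. ph differentiable (at x)" "!!i. smooth (pd i ph)"
 shows "smooth ph"
 unfolding smooth_def
proof
 fix k
 have "Ck (Suc k) ph" using assms by (simp add: Ck_Suc_iff smooth_def del: Ck.simps)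
 then show "Ck k ph" by (rule Ck_Suc_imp)
qed

lemma smooth_has_derivative: "smooth ph ==> (ph has_derivative (%h. grad ph x \<bullet> h)) (at x)"
 by (rule has_derivative_grad[OF smooth_diffble])

lemma smooth_cont: "smooth ph ==> continuous_on UNIV ph"
 unfolding smooth_def using Ck.simps(1) by blast

lemma smooth_cont_grad: "smooth ph ==> continuous_on UNIV (grad ph)"
 unfolding grad_def pd_def[symmetric]
 by (intro continuous_on_vec_lambda smooth_cont smooth_pd)

lemma pd_const: "pd i (%x. c) = (%x. 0)"
 by (simp add: pd_def fun_eq_iff)

lemma Ck_const: "Ck k (%x. c)"
 by (induction k arbitrary: c) (simp_all add: Ck_Suc_iff pd_const del: Ck.simps(2))

lemma smooth_const: "smooth (%x. c)"
 by (simp add: smooth_def Ck_const)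

lemma grad_add:
 "ph differentiable (at x) ==> ps differentiable (at x) ==> grad (%x. ph x + ps x) x = grad ph x + grad ps x"
 by (rule grad_eq) (auto simp: inner_add_left intro!: has_derivative_add has_derivative_grad)

lemma grad_mult:
 "ph differentiable (at x) ==> ps differentiable (at x) ==>
  grad (%x. ph x * ps x) x = ph x *R grad ps x + ps x *R grad ph x"
 by (rule grad_eq, rule has_derivative_eq_rhs[OF has_derivative_mult[OF has_derivative_grad has_derivative_grad]])
  (auto simp: fun_eq_iff inner_add_left)

lemma Ck_add: "Ck k f ==> Ck k g ==> Ck k (%x. f x + g x)"
proof (induction k arbitrary: f g)
 case (Suc k)
 then have d: "!!x. f differentiable (at x)" "!!x. g differentiable (at x)" by (auto simp only: Ck_Suc_iff)
 have "pd i (%x. f x + g x) = (%x. pd i f x + pd i g x)" for i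
  unfolding grad_nth[symmetric] using d by (simp add: grad_add)
 with Suc d show ?case by (auto simp only: Ck_Suc_iff intro!: differentiable_add)
qed (auto intro: continuous_on_add)

lemma Ck_mult: "Ck k f ==> Ck k g ==> Ck k (%x. f x * g x)"
proof (induction k arbitrary: f g)
 case (Suc k)
 then have d: "!!x. f differentiable (at x)" "!!x. g differentiable (at x)" by (auto simp only: Ck_Suc_iff)
 have "pd i (%x. f x * g x) = (%x. f x * pd i g x + g x * pd i f x)" for i
  unfolding grad_nth[symmetric] using d by (simp add: grad_mult)
 moreover have "Ck k f" "Ck k g" using Suc.prems by (auto intro: Ck_Suc_imp)
 moreover have "Ck k (pd i f)" "Ck k (pd i g)" for i using Suc.prems by (auto simp only: Ck_Suc_iff)
 ultimately show ?case using d by (auto simp only: Ck_Suc_iff intro!: differentiable_mult Ck_add Suc.IH)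
qed (auto intro: continuous_on_mult)

lemma smooth_add: "smooth f ==> smooth g ==> smooth (%x. f x + g x)"
 and smooth_mult: "smooth f ==> smooth g ==> smooth (%x. f x * g x)"
 by (auto simp: smooth_def intro: Ck_add Ck_mult)

lemma smooth_cmult: "smooth f ==> smooth (%x. c * f x)"
 by (rule smooth_mult[OF smooth_const])

lemma smooth_diff: "smooth f ==> smooth g ==> smooth (%x. f x - g x)"
 using smooth_add[OF _ smooth_cmult[of g "-1"]] by simp

lemma smooth_prod: "finite I ==> (!!i. i : I ==> smooth (f i)) ==> smooth (%x. PROD i:I. f i x)"
 by (induction I rule: finite_induct) (auto intro: smooth_const smooth_mult)

lemma smooth_power: "smooth f ==> smooth (%x. f x ^ k)"
 by (induction k) (auto intro: smooth_const smooth_mult)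

text \<open>The family \<open>d\<close> lists the successive derivatives of the outer function;
  stating the claim for all \<open>n\<close> lets the chain rule close the induction on the order of
  differentiability.\<close>

lemma smooth_compose:
 assumes "smooth f" and d: "!!n t. (d n has_real_derivative d (Suc n) t) (at t)"
 shows "smooth (%x. d n (f x))"
 unfolding smooth_def
proof
 fix k show "Ck k (%x. d n (f x))"
 proof (induction k arbitrary: n)
  case 0
  have "continuous_on UNIV (d n)" using d by (auto intro!: continuous_at_imp_continuous_on DERIV_isCont)
  then show ?case using continuous_on_compose[OF smooth_cont[OF assms(1)], of "d n"]
   by (auto simp: o_def intro: continuous_on_subset)
 next
  case (Suc k)
  have der: "((%x. d n (f x)) has_derivative (%h. (d (Suc n) (f x) *R grad f x) \<bullet> h)) (at x)" for x
   by (rule has_derivative_eq_rhs[OF has_derivative_compose[OF smooth_has_derivative[OF assms(1)] d[unfolded has_field_derivative_def]]])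
    (simp add: fun_eq_iff)
  have "pd i (%x. d n (f x)) = (%x. d (Suc n) (f x) * pd i f x)" for i
   unfolding grad_nth[symmetric] by (simp add: grad_eq[OF der])
  moreover have "Ck k (pd i f)" for i using smooth_pd[OF assms(1)] by (simp add: smooth_def)
  ultimately have "Ck k (pd i (%x. d n (f x)))" for i using Suc.IH by (simp add: Ck_mult)
  moreover have "(%x. d n (f x)) differentiable (at x)" for x using der unfolding differentiable_def by blast
  ultimately show ?case unfolding Ck_Suc_iff by blast
 qed
qed

lemma smooth_linear: "smooth (%x. a \<bullet> x + c)"
proof (rule smoothI)
 have der: "((%x. a \<bullet> x + c) has_derivative (%h. a \<bullet> h)) (at x)" for x
  by (auto intro!: derivative_eq_intros)
 show "(%x. a \<bullet> x + c) differentiable (at x)" for x using der by (auto simp: differentiable_def)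
 show "smooth (pd i (%x. a \<bullet> x + c))" for i
 proof -
  have "pd i (%x. a \<bullet> x + c) = (%x. a \<bullet> axis i 1)" using pd_eq[OF der] by (simp add: fun_eq_iff)
  then show ?thesis by (simp add: smooth_const)
 qed
qed

lemma grad_linear: "grad (%x. a \<bullet> x + c) x = a"
 by (rule grad_eq) (auto intro!: derivative_eq_intros)

lemma smooth_sin: "smooth f ==> smooth (%x. sin (f x))"
 and smooth_cos: "smooth f ==> smooth (%x. cos (f x))"
proof -
 assume f: "smooth f"
 \<comment> \<open>The n-th derivative of sine as a phase shift; cosine is the case n = 1, so one
   family serves both claims.\<close>
 define d where "d n t = sin (t + real n * (pi/2))" for n t
 have "(d n has_real_derivative d (Suc n) t) (at t)" for n t
 proof -
  have "d (Suc n) t = cos (t + real n * (pi/2))"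
  proof -
   have "t + real (Suc n) * (pi/2) = (t + real n * (pi/2)) + pi/2" by (simp add: ring_distribs add_divide_distrib)
   then show ?thesis unfolding d_def by (simp only: sin_add) simp
  qed
  then show ?thesis unfolding d_def by (auto intro!: derivative_eq_intros)
 qed
 note s = smooth_compose[where d = d, OF f this]
 show "smooth (%x. sin (f x))" using s[of 0] by (simp add: d_def)
 have "(%x. d 1 (f x)) = (%x. cos (f x))" by (simp add: d_def sin_add fun_eq_iff)
 with s[of 1] show "smooth (%x. cos (f x))" by metis
qed

text \<open>With s = 1/t the exponential beats every polynomial in s. The difference quotient at 0
  is of the same form, with s p(s) in place of p(s).\<close>

lemma exp_inverse_deriv_at_0:
 "((%t::real. if t > 0 then poly p (1/t) * exp (- 1/t) else 0) has_real_derivative 0) (at 0)"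
proof -
 have lim: "((%t::real. poly q (1/t) * exp (- 1/t)) \<longlongrightarrow> 0) (at_right 0)" for q :: "real poly"
 proof -
  have "((%s. poly q s * exp (- s)) \<longlongrightarrow> (\<Sum>i\<le>degree q. coeff q i * 0)) at_top"
  proof -
   have "((%s. \<Sum>i\<le>degree q. coeff q i * (s ^ i / exp s)) \<longlongrightarrow> (\<Sum>i\<le>degree q. coeff q i * 0)) at_top"
    by (intro tendsto_intros tendsto_power_div_exp_0)
   moreover have "(\<Sum>i\<le>degree q. coeff q i * (s ^ i / exp s)) = poly q s * exp (- s)" for s
    by (simp add: poly_altdef sum_distrib_right exp_minus divide_inverse mult.assoc)
   ultimately show ?thesis by simp
  qed
  then have "((%s. poly q s * exp (- s)) \<longlongrightarrow> 0) at_top" by simp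
  from filterlim_compose[OF this filterlim_inverse_at_top_right] show ?thesis
   by (simp add: inverse_eq_divide)
 qed
 let ?f = "%t::real. if t > 0 then poly p (1/t) * exp (- 1/t) else 0"
 have "((%h. (?f (0 + h) - ?f 0) / h) \<longlongrightarrow> 0) (at_right 0)"
 proof (rule Lim_transform_eventually[OF lim[of "pCons 0 p"]])
  show "\<forall>\<^sub>F h in at_right 0. poly (pCons 0 p) (1/h) * exp (- 1/h) = (?f (0 + h) - ?f 0) / h"
   by (auto simp: eventually_at_right_field intro!: exI[of _ 1])
 qed
 moreover have "((%h. (?f (0 + h) - ?f 0) / h) \<longlongrightarrow> 0) (at_left 0)"
  by (rule Lim_transform_eventually[OF tendsto_const]) (auto simp: eventually_at_left_field intro!: exI[of _ "-1"])
 ultimately show ?thesis unfolding DERIV_def by (simp add: filterlim_at_split)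
qed

lemma smooth_exp_inverse:
 assumes "smooth f"
 shows "smooth (%x. if f x > 0 then exp (- 1 / f x) else 0)"
proof -
 \<comment> \<open>Differentiating p(1/t) exp(-1/t) gives the same expression with s^2 (p(s) -
   p'(s)) in place of p(s), where s = 1/t.\<close>
 define p :: "nat => real poly" where "p n = ((%q. [:0,0,1:] * (q - pderiv q)) ^^ n) 1" for n
 define d where "d n t = (if t > 0 then poly (p n) (1/t) * exp (- 1/t) else 0)" for n and t :: real
 have "(d n has_real_derivative d (Suc n) t) (at t)" for n t
 proof -
  consider "t > 0" | "t = 0" | "t < 0" by linarith
  then show ?thesis
  proof cases
   case 1
   have "((%t. poly (p n) (1/t) * exp (- 1/t)) has_real_derivative
     poly (pderiv (p n)) (1/t) * (- 1 / t^2) * exp (- 1/t) + poly (p n) (1/t) * (exp (- 1/t) * (1/t^2))) (at t)"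
    using 1 by (auto intro!: derivative_eq_intros DERIV_chain'[OF _ poly_DERIV] simp: power2_eq_square field_simps)
   also have "poly (pderiv (p n)) (1/t) * (- 1 / t^2) * exp (- 1/t) + poly (p n) (1/t) * (exp (- 1/t) * (1/t^2)) = d (Suc n) t"
    using 1 by (simp add: d_def p_def power2_eq_square field_simps)
   finally show ?thesis
    by (rule has_field_derivative_transform_within_open[of _ _ _ "{0<..}"]) (use 1 in "auto simp: d_def")
  next
   case 2
   then show ?thesis unfolding d_def using exp_inverse_deriv_at_0[of "p n"] by simp
  next
   case 3
   have "((%t. 0) has_real_derivative 0) (at t)" by simp
   then have "(d n has_real_derivative 0) (at t)"
    by (rule has_field_derivative_transform_within_open[of _ _ _ "{..<0}"]) (use 3 in "auto simp: d_def")
   then show ?thesis using 3 by (simp add: d_def)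
  qed
 qed
 from smooth_compose[of f d, OF assms this, of 0] show ?thesis by (simp add: d_def p_def cong: if_cong)
qed

lemma test_funI:
 assumes "smooth ph" "compact K" "K <= Om" "!!x. x ~: K ==> ph x = 0"
 shows "test_fun Om ph"
proof -
 have "{x. ph x ~= 0} <= K" using assms(4) by auto
 then have "closure {x. ph x ~= 0} <= K" using assms(2) by (intro closure_minimal compact_imp_closed)
 moreover have "compact (closure {x. ph x ~= 0})"
  using compact_Int_closed[OF assms(2) closed_closure[of "{x. ph x ~= 0}"]] calculation by (simp add: Int_absorb1)
 ultimately show ?thesis unfolding test_fun_def using assms by auto
qed

lemma test_funD:
 assumes "test_fun Om ph"
 obtains K where "compact K" "K <= Om" "!!x. x ~: K ==> ph x = 0" "smooth ph"
proof (rule that)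
 show "compact (closure {x. ph x ~= 0})" "closure {x. ph x ~= 0} <= Om" "smooth ph"
  using assms by (auto simp: test_fun_def)
 fix x assume "x ~: closure {x. ph x ~= 0}"
 then have "x ~: {x. ph x ~= 0}" using closure_subset[of "{x. ph x ~= 0}"] by (meson subsetD)
 then show "ph x = 0" by simp
qed

lemma test_fun_smooth: "test_fun Om ph ==> smooth ph" by (simp add: test_fun_def)

lemma test_fun_mult: assumes "test_fun Om ph" "smooth f" shows "test_fun Om (%x. ph x * f x)"
proof -
 obtain K where "compact K" "K <= Om" "!!x. x ~: K ==> ph x = 0" "smooth ph" by (rule test_funD[OF assms(1)]) blast
 then show ?thesis by (intro test_funI[of _ K] smooth_mult assms) auto
qed

lemma test_fun_add: assumes "test_fun Om ph" "test_fun Om ps" shows "test_fun Om (%x. ph x + ps x)"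
proof -
 obtain K where "compact K" "K <= Om" "!!x. x ~: K ==> ph x = 0" "smooth ph" by (rule test_funD[OF assms(1)]) blast
 moreover obtain L where "compact L" "L <= Om" "!!x. x ~: L ==> ps x = 0" "smooth ps" by (rule test_funD[OF assms(2)]) blast
 ultimately show ?thesis by (intro test_funI[of _ "K \<union> L"] smooth_add) auto
qed

lemma test_fun_zero: "test_fun Om (%x. 0)"
 by (rule test_funI[of _ "{}"]) (auto intro: smooth_const)

lemma test_fun_cmult: "test_fun Om ph ==> test_fun Om (%x. c * ph x)"
 using test_fun_mult[OF _ smooth_const[of c]] by (simp add: mult.commute)

lemma grad_zero_outside:
 assumes "closed K" "!!x. x ~: K ==> ph x = 0" "x ~: K" shows "grad ph x = 0"
proof (rule grad_eq)
 have "((%x. 0) has_derivative (%h. 0 \<bullet> h)) (at x)" by simp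
 then show "(ph has_derivative (%h. 0 \<bullet> h)) (at x)"
  by (rule has_derivative_transform_within_open[of _ _ _ _ "- K"]) (use assms in auto)
qed

lemma test_fun_pd: assumes "test_fun Om ph" shows "test_fun Om (pd i ph)"
proof -
 obtain K where K: "compact K" "K <= Om" "!!x. x ~: K ==> ph x = 0" "smooth ph" by (rule test_funD[OF assms(1)]) blast
 have "pd i ph x = 0" if "x ~: K" for x
  using grad_zero_outside[OF compact_imp_closed[OF K(1)] K(3) that] by (simp add: grad_nth[symmetric])
 with K show ?thesis by (intro test_funI[of _ K] smooth_pd) auto
qed

text \<open>A product over the coordinates of exp(-1/t) profiles. Positivity exactly on the box is
  what lets powers of it approximate the indicator of the box, and what makes its integral
  nonzero.\<close>

lemma box_bump:
 fixes a b :: "real^'n"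
 shows "EX ph. smooth ph & (ALL x. 0 <= ph x & ph x <= 1) & (ALL x. ph x > 0 \<longleftrightarrow> x : box a b)"
proof -
 define e where "e t = (if t > 0 then exp (- 1 / t) else 0)" for t :: real
 define ph where "ph x = (PROD i:UNIV. e (x $ i - a $ i) * e (b $ i - x $ i))" for x :: "real^'n"
 have e: "0 <= e t" "e t <= 1" "e t > 0 \<longleftrightarrow> t > 0" for t by (auto simp: e_def)
 have sm: "smooth (%x. e (f x))" if "smooth f" for f :: "real^'n => real"
  unfolding e_def by (rule smooth_exp_inverse[OF that])
 have l1: "smooth (%x. x $ i - a $ i)" for i using smooth_linear[of "axis i 1" "- a $ i"] by (simp add: inner_axis')
 have l2: "smooth (%x. b $ i - x $ i)" for i using smooth_linear[of "axis i (- 1)" "b $ i"] by (simp add: inner_axis')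
 have "smooth ph" unfolding ph_def by (intro smooth_prod smooth_mult sm l1 l2) auto
 moreover have "0 <= ph x & ph x <= 1" for x unfolding ph_def using e by (auto intro!: prod_nonneg prod_le_1 mult_le_one)
 moreover have "ph x > 0 \<longleftrightarrow> x : box a b" for x
 proof
  assume "x : box a b"
  then show "ph x > 0" unfolding ph_def using e by (auto intro!: prod_pos mult_pos_pos simp: mem_box_cart)
 next
  assume "ph x > 0"
  then have "ph x ~= 0" by simp
  then have "ALL i. e (x $ i - a $ i) ~= 0 & e (b $ i - x $ i) ~= 0" by (simp add: ph_def)
  then have "a $ i < x $ i & x $ i < b $ i" for i
   by (drule_tac spec[of _ i]) (simp add: e_def split: if_splits)
  then show "x : box a b" by (simp add: mem_box_cart)
 qed
 ultimately show ?thesis by blast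
qed

lemma lborel_integral_translate:
 fixes f :: "'a::euclidean_space => 'b::{banach, second_countable_topology}"
 assumes [measurable]: "f : borel_measurable borel"
 shows "(\<integral>x. f (c + x) \<partial>lborel) = (\<integral>x. f x \<partial>lborel)"
  and "integrable lborel (%x. f (c + x)) \<longleftrightarrow> integrable lborel f"
proof -
 show "(\<integral>x. f (c + x) \<partial>lborel) = (\<integral>x. f x \<partial>lborel)"
  by (subst (2) lborel_distr_plus[of c, symmetric]) (simp add: integral_distr)
 show "integrable lborel (%x. f (c + x)) \<longleftrightarrow> integrable lborel f"
  by (subst (2) lborel_distr_plus[of c, symmetric]) (simp add: integrable_distr_eq)
qed

lemma integrable_cont_support:
 fixes f :: "'a::euclidean_space => 'b::{banach, second_countable_topology}"
 assumes "continuous_on UNIV f" "compact K" "!!x. x ~: K ==> f x = 0"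
 shows "integrable lborel f" "integrable lebesgue f"
proof -
 have "set_integrable lborel K f"
  by (rule borel_integrable_compact[OF assms(2), folded set_integrable_def])
   (use assms(1) in "auto intro: continuous_on_subset")
 moreover have "(%x. indicator K x *R f x) = f" using assms(3) by (auto simp: fun_eq_iff indicator_def)
 ultimately show "integrable lborel f" by (simp add: set_integrable_def)
 then show "integrable lebesgue f" using assms(1)
  by (simp add: integrable_completion borel_measurable_continuous_onI)
qed

lemma integrable_test_fun: "test_fun Om ph ==> integrable lebesgue ph"
 by (rule test_funD) (auto intro: integrable_cont_support smooth_cont)

lemma bounded_grad_test_fun:
 assumes "test_fun Om ph" shows "EX C>0. ALL x. norm (grad ph x) <= C & \<bar>ph x\<bar> <= C"
proof -
 obtain K where K: "compact K" "K <= Om" "!!x. x ~: K ==> ph x = 0" "smooth ph" by (rule test_funD[OF assms(1)]) blast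
 have "bounded (grad ph ` K)" "bounded (ph ` K)"
  using K by (auto intro!: compact_imp_bounded compact_continuous_image
   intro: continuous_on_subset[OF smooth_cont_grad] continuous_on_subset[OF smooth_cont])
 then obtain C1 C2 where C: "!!x. x : K ==> norm (grad ph x) <= C1" "!!x. x : K ==> \<bar>ph x\<bar> <= C2"
  by (auto simp: bounded_iff)
 have "norm (grad ph x) <= \<bar>C1\<bar> + \<bar>C2\<bar> + 1 & \<bar>ph x\<bar> <= \<bar>C1\<bar> + \<bar>C2\<bar> + 1" for x
 proof (cases "x : K")
  case True then show ?thesis using C[of x] by linarith
 next
  case False then show ?thesis using K(3) grad_zero_outside[OF compact_imp_closed[OF K(1)] K(3) False] by simp
 qed
 then show ?thesis by (intro exI[of _ "\<bar>C1\<bar> + \<bar>C2\<bar> + 1"]) auto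
qed

lemma lipschitz_of_grad_bound:
 assumes "!!x. ph differentiable (at x)" "!!x. norm (grad ph x) <= C"
 shows "\<bar>ph y - ph x\<bar> <= C * norm (y - x)"
proof -
 have "norm (ph y - ph x) <= C * norm (y - x)"
 proof (rule differentiable_bound[of UNIV ph "%x h. grad ph x \<bullet> h"])
  show "!!z. z : UNIV ==> (ph has_derivative (\<bullet>) (grad ph z)) (at z within UNIV)"
   using has_derivative_grad[OF assms(1)] by simp
  show "onorm ((\<bullet>) (grad ph z)) <= C" for z
  proof (rule onorm_le)
   fix h show "norm (grad ph z \<bullet> h) <= C * norm h"
    using Cauchy_Schwarz_ineq2[of "grad ph z" h] mult_right_mono[OF assms(2)[of z] norm_ge_zero[of h]] by simp
  qed
 qed auto
 then show ?thesis by simp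
qed

lemma has_real_derivative_line:
 assumes "ph differentiable (at (p + t *R a))"
 shows "((%t. ph (p + t *R a)) has_real_derivative grad ph (p + t *R a) \<bullet> a) (at t)"
proof -
 have "((%t. p + t *R a) has_derivative (%h. h *R a)) (at t)" by (auto intro!: derivative_eq_intros)
 from has_derivative_compose[OF this has_derivative_grad[OF assms]]
 show ?thesis by (simp add: has_field_derivative_def mult_commute_abs)
qed

text \<open>Translation invariance makes every difference quotient integrate to zero; the Lipschitz
  bound from the gradient dominates them all on one compact set.\<close>

lemma integral_pd_eq_0:
 assumes "test_fun Om g" shows "(\<integral>x. pd i g x \<partial>lebesgue) = 0"
proof -
 obtain K where K: "compact K" "K <= Om" "!!x. x ~: K ==> g x = 0" "smooth g" by (rule test_funD[OF assms(1)]) blast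
 obtain C where C: "C > 0" "!!x. norm (grad g x) <= C" using bounded_grad_test_fun[OF assms] by blast
 define e where "e = axis i (1::real)"
 have ne: "norm e = 1" by (simp add: e_def)
 define r where "r n = 1 / real (Suc n)" for n
 have r: "0 < r n" "r n <= 1" for n by (auto simp: r_def)
 have rlim: "r ---> 0" unfolding r_def using LIMSEQ_inverse_real_of_nat by (simp add: inverse_eq_divide)
 define q where "q n x = (g (x + r n *R e) - g x) / r n" for n x
 \<comment> \<open>The support enlarged by distance 1; as the increments are at most 1, it contains
   the supports of all difference quotients.\<close>
 define K' where "K' = (%(x,y). x + y) ` (K \<times> cball 0 1)"
 have K': "compact K'" unfolding K'_def using K(1)
  by (auto intro!: compact_continuous_image compact_Times continuous_intros simp: split_def)
 have KK': "K <= K'" unfolding K'_def by (auto intro!: image_eqI[of _ _ "(x, 0)" for x])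
 have gc[measurable]: "g : borel_measurable borel" using smooth_cont[OF K(4)] by (rule borel_measurable_continuous_onI)
 have gi: "integrable lborel g" by (rule integrable_cont_support[OF smooth_cont[OF K(4)] K(1,3)])
 have pc: "continuous_on UNIV (pd i g)" by (rule smooth_cont[OF smooth_pd[OF K(4)]])
 have q0: "(\<integral>x. q n x \<partial>lborel) = 0" for n
 proof -
  have i1: "integrable lborel (%x. g (x + r n *R e))"
   using lborel_integral_translate(2)[OF gc, of "r n *R e"] gi by (simp add: add.commute)
  have "(\<integral>x. g (x + r n *R e) \<partial>lborel) = (\<integral>x. g x \<partial>lborel)"
   using lborel_integral_translate(1)[OF gc, of "r n *R e"] by (simp add: add.commute)
  then show ?thesis unfolding q_def using i1 gi by simp
 qed
 have "(%n. \<integral>x. q n x \<partial>lborel) ---> (\<integral>x. pd i g x \<partial>lborel)"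
 proof (rule integral_dominated_convergence[where w = "%x. C * indicator K' x"])
  show "pd i g : borel_measurable lborel" using pc by (simp add: borel_measurable_continuous_onI)
  show "q n : borel_measurable lborel" for n unfolding q_def[abs_def] by measurable
  show "integrable lborel (%x. C * indicator K' x)"
   using emeasure_bounded_finite[OF compact_imp_bounded[OF K']] borel_compact[OF K']
   by (intro integrable_mult_right integrable_real_indicator) auto
  show "AE x in lborel. (%n. q n x) ---> pd i g x"
  proof (rule AE_I2)
   fix x
   have "((%t. g (x + t *R e)) has_real_derivative pd i g x) (at 0)"
    using has_real_derivative_line[of g x 0 e] smooth_diffble[OF K(4)]
    by (simp add: e_def inner_axis grad_nth)
   then have "((%h. (g (x + h *R e) - g x) / h) \<longlongrightarrow> pd i g x) (at 0)" by (simp add: DERIV_def)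
   moreover have "filterlim r (at 0) sequentially"
    using rlim r(1) by (auto simp: filterlim_at intro!: always_eventually less_imp_neq[symmetric])
   ultimately show "(%n. q n x) ---> pd i g x" unfolding q_def by (rule filterlim_compose)
  qed
  show "AE x in lborel. norm (q n x) <= C * indicator K' x" for n
  proof (rule AE_I2)
   fix x
   show "norm (q n x) <= C * indicator K' x"
   proof (cases "x : K'")
    case True
    have "\<bar>g (x + r n *R e) - g x\<bar> <= C * norm (r n *R e)"
     using lipschitz_of_grad_bound[OF smooth_diffble[OF K(4)] C(2), of "x + r n *R e" x] by simp
    then show ?thesis using True r[of n] ne by (simp add: q_def field_simps)
   next
    case False
    have "x + r n *R e ~: K"
    proof
     assume "x + r n *R e : K"
     then have "(x + r n *R e) + (- r n *R e) : K'"
      unfolding K'_def using r[of n] ne by (intro image_eqI[of _ _ "(x + r n *R e, - r n *R e)"]) auto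
     with False show False by simp
    qed
    moreover have "x ~: K" using False KK' by blast
    ultimately show ?thesis using K(3) False by (simp add: q_def)
   qed
  qed
 qed
 then have "(\<integral>x. pd i g x \<partial>lborel) = 0" using q0 by (simp add: LIMSEQ_const_iff)
 then show ?thesis using pc by (simp add: integral_completion borel_measurable_continuous_onI)
qed

lemma pd_mult: "smooth f ==> smooth g ==> pd i (%x. f x * g x) x = f x * pd i g x + g x * pd i f x"
 using grad_mult[OF smooth_diffble[of f x] smooth_diffble[of g x]] by (simp add: vec_eq_iff grad_nth)

lemma grad_cmult: "smooth f ==> grad (%x. c * f x) x = c *R grad f x"
 using grad_mult[of "%x. c" x f] smooth_diffble[of f x]
 by (simp add: vec_eq_iff grad_nth pd_const)

lemma grad_const: "grad (%x. c) x = 0"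
 by (simp add: vec_eq_iff grad_nth pd_const)

lemma integral_by_parts:
 assumes "test_fun Om ph" "smooth u"
 shows "(\<integral>x. u x * pd i ph x \<partial>lebesgue) = - (\<integral>x. pd i u x * ph x \<partial>lebesgue)"
proof -
 have i1: "integrable lebesgue (%x. pd i ph x * u x)" "integrable lebesgue (%x. ph x * pd i u x)"
  using assms by (auto intro!: integrable_test_fun[of Om] test_fun_mult test_fun_pd smooth_pd)
 have "0 = (\<integral>x. pd i (%x. ph x * u x) x \<partial>lebesgue)"
  by (rule integral_pd_eq_0[OF test_fun_mult[OF assms], symmetric])
 also have "... = (\<integral>x. pd i ph x * u x + ph x * pd i u x \<partial>lebesgue)"
  using assms by (simp add: pd_mult test_fun_smooth algebra_simps)
 also have "... = (\<integral>x. pd i ph x * u x \<partial>lebesgue) + (\<integral>x. ph x * pd i u x \<partial>lebesgue)"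
  using i1 by (rule Bochner_Integration.integral_add)
 finally show ?thesis by (simp add: mult.commute)
qed

lemma set_integral_test_fun:
 assumes "!!x. x ~: Om ==> f x = 0"
 shows "(LINT x:Om|M. f x) = (\<integral>x. f x \<partial>M)"
 unfolding set_lebesgue_integral_def using assms by (intro Bochner_Integration.integral_cong) (auto simp: indicator_def)

lemma test_fun_outside: "test_fun Om ph ==> x ~: Om ==> ph x = 0"
 by (erule test_funD) blast

lemma smooth_is_weak_grad:
 assumes "smooth u" shows "is_weak_grad Om u (grad u)"
 unfolding is_weak_grad_def
proof (intro allI impI)
 fix ph i assume ph: "test_fun Om ph"
 have "(LINT x:Om|lebesgue. u x * grad ph x $ i) = (\<integral>x. u x * pd i ph x \<partial>lebesgue)"
  unfolding grad_nth using test_fun_outside[OF test_fun_pd[OF ph]] by (intro set_integral_test_fun) auto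
 also have "... = - (\<integral>x. pd i u x * ph x \<partial>lebesgue)" by (rule integral_by_parts[OF ph assms])
 also have "(\<integral>x. pd i u x * ph x \<partial>lebesgue) = (LINT x:Om|lebesgue. grad u x $ i * ph x)"
  unfolding grad_nth using test_fun_outside[OF ph] by (intro set_integral_test_fun[symmetric]) auto
 finally show "(LINT x:Om|lebesgue. u x * grad ph x $ i) = - (LINT x:Om|lebesgue. grad u x $ i * ph x)" .
qed

text \<open>The mean value theorem, once in each direction. The second difference is symmetric in
  \<open>i\<close> and \<open>j\<close>, so it expresses both mixed derivatives at nearby points,
  whence their equality by continuity.\<close>

lemma second_difference_mvt:
 assumes "smooth ph" "h > 0"
 shows "EX s t. 0 < s & s < h & 0 < t & t < h & 
  ph (x + h *R axis i 1 + h *R axis j 1) - ph (x + h *R axis i 1) - ph (x + h *R axis j 1) + ph x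
   = h^2 * pd j (pd i ph) (x + s *R axis i 1 + t *R axis j 1)"
proof -
 let ?a = "axis i (1::real)" and ?b = "axis j (1::real)"
 define g where "g s = ph ((x + h *R ?b) + s *R ?a) - ph (x + s *R ?a)" for s
 have dg: "(g has_real_derivative (pd i ph ((x + h *R ?b) + s *R ?a) - pd i ph (x + s *R ?a))) (at s)" for s
  unfolding g_def
  using has_real_derivative_line[OF smooth_diffble[OF assms(1)], where t = s and a = ?a]
  by (intro DERIV_diff) (auto simp: inner_axis grad_nth)
 from MVT2[OF assms(2), of g, OF dg]
 obtain s where s: "0 < s" "s < h" "g h - g 0 = h * (pd i ph ((x + h *R ?b) + s *R ?a) - pd i ph (x + s *R ?a))" by auto
 have dk: "((%t. pd i ph ((x + s *R ?a) + t *R ?b)) has_real_derivative pd j (pd i ph) ((x + s *R ?a) + t *R ?b)) (at t)" for t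
  using has_real_derivative_line[OF smooth_diffble[OF smooth_pd[OF assms(1), of i]], where p = "x + s *R ?a" and t = t and a = ?b]
  by (simp add: inner_axis grad_nth)
 from MVT2[OF assms(2), of "%t. pd i ph ((x + s *R ?a) + t *R ?b)", OF dk]
 obtain t where t: "0 < t" "t < h" "pd i ph ((x + s *R ?a) + h *R ?b) - pd i ph (x + s *R ?a) = h * pd j (pd i ph) ((x + s *R ?a) + t *R ?b)" by auto
 have "g h - g 0 = h^2 * pd j (pd i ph) (x + s *R ?a + t *R ?b)"
  using s(3) t(3) by (simp add: power2_eq_square algebra_simps)
 then show ?thesis using s t by (intro exI[of _ s] exI[of _ t]) (simp add: g_def algebra_simps)
qed

lemma pd_commute:
 assumes "smooth ph" shows "pd i (pd j ph) x = pd j (pd i ph) x"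
proof -
 let ?a = "axis i (1::real)" and ?b = "axis j (1::real)"
 define h where "h n = 1 / real (Suc n)" for n
 have h: "h n > 0" for n by (simp add: h_def)
 have hlim: "h ---> 0" unfolding h_def using LIMSEQ_inverse_real_of_nat by (simp add: inverse_eq_divide)
 have "EX s t s' t'. 0 < s & s < h n & 0 < t & t < h n & 0 < s' & s' < h n & 0 < t' & t' < h n & 
   pd j (pd i ph) (x + s *R ?a + t *R ?b) = pd i (pd j ph) (x + s' *R ?b + t' *R ?a)" for n
 proof -
  obtain s t where a: "0 < s" "s < h n" "0 < t" "t < h n"
   "ph (x + h n *R ?a + h n *R ?b) - ph (x + h n *R ?a) - ph (x + h n *R ?b) + ph x
    = (h n)^2 * pd j (pd i ph) (x + s *R ?a + t *R ?b)"
   using second_difference_mvt[OF assms h[of n], of x i j] by blast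
  obtain s' t' where b: "0 < s'" "s' < h n" "0 < t'" "t' < h n"
   "ph (x + h n *R ?b + h n *R ?a) - ph (x + h n *R ?b) - ph (x + h n *R ?a) + ph x
    = (h n)^2 * pd i (pd j ph) (x + s' *R ?b + t' *R ?a)"
   using second_difference_mvt[OF assms h[of n], of x j i] by blast
  have "x + h n *R ?b + h n *R ?a = x + h n *R ?a + h n *R ?b" by (simp add: algebra_simps)
  from a(5) b(5)[unfolded this] have "(h n)^2 * pd j (pd i ph) (x + s *R ?a + t *R ?b) = (h n)^2 * pd i (pd j ph) (x + s' *R ?b + t' *R ?a)"
   by linarith
  then have "pd j (pd i ph) (x + s *R ?a + t *R ?b) = pd i (pd j ph) (x + s' *R ?b + t' *R ?a)"
   using h[of n] by simp
  with a b show ?thesis by blast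
 qed
 then obtain s t s' t' where st: "!!n. 0 < s n & s n < h n & 0 < t n & t n < h n & 0 < s' n & s' n < h n & 0 < t' n & t' n < h n"
  "!!n. pd j (pd i ph) (x + s n *R ?a + t n *R ?b) = pd i (pd j ph) (x + s' n *R ?b + t' n *R ?a)" by metis
 have lim0: "r ---> 0" if "!!n. 0 < r n & r n < h n" for r :: "nat => real"
  by (rule tendsto_sandwich[OF _ _ tendsto_const hlim]) (use that in "auto intro!: always_eventually less_imp_le")
 have l: "s ---> 0" "t ---> 0" "s' ---> 0" "t' ---> 0" using st(1) by (auto intro!: lim0)
 have cont: "isCont (pd j (pd i ph)) x" "isCont (pd i (pd j ph)) x"
  using smooth_cont[OF smooth_pd[OF smooth_pd[OF assms]]] by (auto simp: continuous_on_eq_continuous_at)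
 have "(%n. x + s n *R ?a + t n *R ?b) ---> x + 0 *R ?a + 0 *R ?b" by (intro tendsto_intros l)
 then have 1: "(%n. pd j (pd i ph) (x + s n *R ?a + t n *R ?b)) ---> pd j (pd i ph) x"
  using isCont_tendsto_compose[OF cont(1)] by simp
 have "(%n. x + s' n *R ?b + t' n *R ?a) ---> x + 0 *R ?b + 0 *R ?a" by (intro tendsto_intros l)
 then have 2: "(%n. pd i (pd j ph) (x + s' n *R ?b + t' n *R ?a)) ---> pd i (pd j ph) x"
  using isCont_tendsto_compose[OF cont(2)] by simp
 show ?thesis using LIMSEQ_unique[OF 1 2[folded st(2)]] by simp
qed

section \<open>The fundamental lemma of the calculus of variations\<close>

lemma enn2real_inj: "a ~= \<infinity> ==> b ~= \<infinity> ==> enn2real a = enn2real b ==> a = b"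
 by (cases a; cases b) auto

text \<open>The positive and the negative part of a Borel representative define finite measures that
  agree on boxes, an intersection-stable generator; hence the measures and then their densities
  coincide.\<close>

lemma AE_zero_if_box_integrals_zero:
 fixes f :: "'a::euclidean_space => real"
 assumes int: "set_integrable lebesgue (box a b) f"
  and z: "!!c d. box c d <= box a b ==> (LINT x:box c d|lebesgue. f x) = 0"
 shows "AE x in lebesgue. x : box a b --> f x = 0"
proof -
 let ?g = "%x. ind (box a b) x *R f x"
 have gi: "integrable lebesgue ?g" using int by (simp add: set_integrable_def)
 then have "?g : borel_measurable lebesgue" by auto
 from completion_ex_borel_measurable_real[OF this]
 obtain g where [measurable]: "g : borel_measurable lborel" and ae: "AE x in lborel. ?g x = g x" by blast
 have aeL: "AE x in lebesgue. ?g x = g x" using ae by (rule AE_completion)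
 have gi': "integrable lebesgue g" using integrable_cong_AE_imp[OF gi _ aeL] by (simp add: measurable_completion)
 then have gi'': "integrable lborel g" by (simp add: integrable_completion)
 have bz: "(\<integral>x. g x * indicator (box c d) x \<partial>lborel) = 0" for c d
 proof -
  have "(\<integral>x. g x * indicator (box c d) x \<partial>lborel) = (\<integral>x. g x * indicator (box c d) x \<partial>lebesgue)"
   by (rule integral_completion[symmetric]) measurable
  also have "... = (\<integral>x. ?g x * indicator (box c d) x \<partial>lebesgue)"
  proof (rule integral_cong_AE)
   show "(%x. g x * indicator (box c d) x) : borel_measurable lebesgue" by (intro measurable_completion) measurable
   show "(%x. ?g x * indicator (box c d) x) : borel_measurable lebesgue"
    by (intro borel_measurable_times borel_measurable_integrable[OF gi] measurable_completion) auto
   show "AE x in lebesgue. g x * indicator (box c d) x = ?g x * indicator (box c d) x" using aeL by eventually_elim simp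
  qed
  also have "... = (LINT x:(box a b \<inter> box c d)|lebesgue. f x)"
   unfolding set_lebesgue_integral_def by (intro Bochner_Integration.integral_cong) (auto simp: indicator_def)
  also have "... = 0"
  proof -
   obtain p q where pq: "box a b \<inter> box c d = box p q" using box_Int_box by blast
   then show ?thesis using z[of p q] by auto
  qed
  finally show ?thesis .
 qed
 have fin: "(\<integral>\<^sup>+x. ennreal (g x) \<partial>lborel) ~= \<infinity>" "(\<integral>\<^sup>+x. ennreal (- g x) \<partial>lborel) ~= \<infinity>"
  using gi'' by (auto simp: real_integrable_def)
 \<comment> \<open>\<open>ennreal\<close> sends negative reals to 0, so these are the measures with
   the positive and the negative part of \<open>g\<close> as density.\<close>
 have eq: "density lborel (%x. ennreal (g x)) = density lborel (%x. ennreal (- g x))"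
 proof (rule measure_eqI_generator_eq)
  let ?E = "range (%(a, b). box a b::'a set)"
  show "Int_stable ?E" by (auto simp: Int_stable_def box_Int_box)
  show "?E <= Pow UNIV" "sets (density lborel (%x. ennreal (g x))) = sigma_sets UNIV ?E"
   "sets (density lborel (%x. ennreal (- g x))) = sigma_sets UNIV ?E"
   by (simp_all add: borel_eq_box)
  let ?A = "%n::nat. box (- (real n *R One)) (real n *R One) :: 'a set"
  show "range ?A <= ?E" "(\<Union>i. ?A i) = UNIV" unfolding UN_box_eq_UNIV by auto
  show "emeasure (density lborel (%x. ennreal (g x))) (?A i) ~= \<infinity>" for i
  proof -
   have "emeasure (density lborel (%x. ennreal (g x))) (?A i) <= (\<integral>\<^sup>+x. ennreal (g x) \<partial>lborel)"
    by (subst emeasure_density) (auto intro!: nn_integral_mono simp: indicator_def)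
   then show ?thesis using fin(1) by (auto simp: top_unique)
  qed
  fix X assume "X : ?E"
  then obtain c d where X: "X = box c d" by auto
  have i: "integrable lborel (%x. g x * indicator (box c d) x)"
   using gi'' by (intro integrable_real_mult_indicator) auto
  have "(\<integral>\<^sup>+x. ennreal (g x * indicator (box c d) x) \<partial>lborel) ~= \<infinity>"
    "(\<integral>\<^sup>+x. ennreal (- (g x * indicator (box c d) x)) \<partial>lborel) ~= \<infinity>"
   using i by (auto simp: real_integrable_def)
  moreover have "enn2real (\<integral>\<^sup>+x. ennreal (g x * indicator (box c d) x) \<partial>lborel)
    = enn2real (\<integral>\<^sup>+x. ennreal (- (g x * indicator (box c d) x)) \<partial>lborel)"
   using bz[of c d] real_lebesgue_integral_def[OF i] by simp
  ultimately have "(\<integral>\<^sup>+x. ennreal (g x * indicator (box c d) x) \<partial>lborel)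
    = (\<integral>\<^sup>+x. ennreal (- (g x * indicator (box c d) x)) \<partial>lborel)"
   using enn2real_inj by simp
  moreover have "ennreal (g x * indicator (box c d) x) = ennreal (g x) * indicator (box c d) x"
   "ennreal (- (g x * indicator (box c d) x)) = ennreal (- g x) * indicator (box c d) x" for x
   by (auto simp: indicator_def)
  ultimately show "emeasure (density lborel (%x. ennreal (g x))) X = emeasure (density lborel (%x. ennreal (- g x))) X"
   by (simp add: emeasure_density X)
 qed
 have "AE x in lborel. ennreal (g x) = ennreal (- g x)"
  using finite_density_unique[of "%x. ennreal (g x)" lborel "%x. ennreal (- g x)"] eq fin by simp
 then have "AE x in lborel. g x = 0"
 proof eventually_elim
  case (elim x) then show ?case by (cases "g x >= 0") (auto simp: ennreal_neg)
 qed
 with ae have "AE x in lborel. x : box a b --> f x = 0" by eventually_elim (auto simp: indicator_def)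
 then show ?thesis by (rule AE_completion)
qed

text \<open>Test functions 1 - (1 - ph)^n built from a bump on a box converge boundedly to the
  indicator of the box, which reduces the claim to box integrals; countably many boxes exhaust the
  open set.\<close>

lemma AE_zero_if_test_integrals_zero:
 fixes f :: "real^'n => real"
 assumes D: "open D"
  and int: "!!a b. cbox a b <= D ==> set_integrable lebesgue (cbox a b) f"
  and z: "!!ph. test_fun D ph ==> (LINT x:D|lebesgue. f x * ph x) = 0"
 shows "AE x in lebesgue. x : D --> f x = 0"
proof -
 have on_box: "AE x in lebesgue. x : cbox a b --> f x = 0" if ab: "cbox a b <= D" for a b
 proof -
  have "AE x in lebesgue. x : box a b --> f x = 0"
  proof (rule AE_zero_if_box_integrals_zero)
   show "set_integrable lebesgue (box a b) f"
    by (rule set_integrable_subset[OF int[OF ab]]) (auto simp: box_subset_cbox)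
   fix c d assume sub: "box c d <= box a b"
   show "(LINT x:box c d|lebesgue. f x) = 0"
   proof (cases "box c d = {}")
    case False
    then have cd: "cbox c d <= D" using sub ab closure_mono[OF sub]
     by (metis box_eq_empty(1) closure_box dual_order.trans subset_empty)
    obtain ph where ph: "smooth ph" "!!x. 0 <= ph x" "!!x. ph x <= 1" "!!x. ph x > 0 \<longleftrightarrow> x : box c d"
     using box_bump[of c d] by blast
    \<comment> \<open>Increases to 1 where \<open>ph\<close> is positive, that is on the open box,
      and is 0 elsewhere.\<close>
    define ps where "ps n x = 1 - (1 - ph x) ^ n" for n :: nat and x
    have ph0: "ph x = 0" if "x ~: box c d" for x using ph(2)[of x] ph(4)[of x] that by force
    have ps0: "ps n x = 0" if "x ~: box c d" for n x using ph0[OF that] by (simp add: ps_def)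
    have pst: "test_fun D (ps n)" for n
    proof (rule test_funI[OF _ compact_cbox cd])
     show "smooth (ps n)" unfolding ps_def[abs_def] by (intro smooth_diff smooth_power smooth_const ph(1))
    qed (use ps0 box_subset_cbox[of c d] in blast)
    have ps1: "\<bar>ps n x\<bar> <= 1" for n x
     using ph(2,3)[of x] power_le_one[of "1 - ph x" n] zero_le_power[of "1 - ph x" n] by (auto simp: ps_def)
    have ic: "integrable lebesgue (%x. ind (cbox c d) x * f x)" using int[OF cd] by (simp add: set_integrable_def)
    have psm: "ps n : borel_measurable lebesgue" for n
     using smooth_cont[OF test_fun_smooth[OF pst]] by (intro measurable_completion) (simp add: borel_measurable_continuous_onI)
    have eq: "(LINT x:D|lebesgue. f x * ps n x) = (\<integral>x. (ind (cbox c d) x * f x) * ps n x \<partial>lebesgue)" for n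
     unfolding set_lebesgue_integral_def
     by (rule Bochner_Integration.integral_cong[OF refl])
      (use ps0 cd box_subset_cbox[of c d] in "auto simp: indicator_def")
    have "(%n. \<integral>x. (ind (cbox c d) x * f x) * ps n x \<partial>lebesgue) ---> (\<integral>x. ind (box c d) x *R f x \<partial>lebesgue)"
    proof (rule integral_dominated_convergence[where w = "%x. norm (ind (cbox c d) x * f x)"])
     show "integrable lebesgue (%x. norm (ind (cbox c d) x * f x))" using ic by (rule integrable_norm)
     have "(%x. ind (box c d) x *R (ind (cbox c d) x * f x)) : borel_measurable lebesgue"
      by (intro borel_measurable_scaleR borel_measurable_integrable[OF ic] measurable_completion) auto
     moreover have "(%x. ind (box c d) x *R (ind (cbox c d) x * f x)) = (%x. ind (box c d) x *R f x)"
      using box_subset_cbox[of c d] by (auto simp: indicator_def fun_eq_iff)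
     ultimately show "(%x. ind (box c d) x *R f x) : borel_measurable lebesgue" by simp
     show "(%x. ind (cbox c d) x * f x * ps n x) : borel_measurable lebesgue" for n
      by (intro borel_measurable_times[OF borel_measurable_integrable[OF ic] psm])
     show "AE x in lebesgue. (%n. ind (cbox c d) x * f x * ps n x) ---> ind (box c d) x *R f x"
     proof (rule AE_I2)
      fix x
      show "(%n. ind (cbox c d) x * f x * ps n x) ---> ind (box c d) x *R f x"
      proof (cases "x : box c d")
       case True
       then have "\<bar>1 - ph x\<bar> < 1" using ph(3)[of x] ph(4)[of x] by auto
       then have "(%n. ps n x) ---> 1 - 0" unfolding ps_def by (intro tendsto_intros LIMSEQ_power_zero) simp
       then have "(%n. f x * ps n x) ---> f x * 1" by (intro tendsto_intros) simp
       then show ?thesis using True box_subset_cbox[of c d] by (auto simp: indicator_def)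
      qed (simp add: ps0)
     qed
     show "AE x in lebesgue. norm (ind (cbox c d) x * f x * ps n x) <= norm (ind (cbox c d) x * f x)" for n
      by (rule AE_I2) (use ps1 in "simp add: abs_mult mult_left_le")
    qed
    then have "(%n. 0) ---> (LINT x:box c d|lebesgue. f x)"
     unfolding eq[symmetric] z[OF pst] by (simp only: set_lebesgue_integral_def)
    then show ?thesis by (simp add: LIMSEQ_const_iff)
   qed (simp add: set_lebesgue_integral_def)
  qed
  moreover have "AE x in lebesgue. x ~: cbox a b - box a b"
   using negligible_frontier_interval[of a b] by (intro AE_not_in) (simp add: negligible_iff_null_sets)
  ultimately show ?thesis by eventually_elim auto
 qed
 obtain \<D> where \<D>: "countable \<D>" "\<D> <= Pow D" "!!X. X : \<D> ==> EX a b. X = cbox a b" "\<Union>\<D> = D"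
  by (rule open_countable_Union_open_cbox[OF D]) blast
 have "AE x in lebesgue. x : X --> f x = 0" if X: "X : \<D>" for X
 proof -
  obtain a b where "X = cbox a b" "X <= D" using \<D>(2,3) X by blast
  then show ?thesis using on_box[of a b] by simp
 qed
 then have "ALL X : \<D>. AE x in lebesgue. x : X --> f x = 0" by blast
 then have "AE x in lebesgue. ALL X : \<D>. x : X --> f x = 0"
  by (rule AE_ball_countable[OF \<D>(1), THEN iffD2])
 then show ?thesis by eventually_elim (use \<D>(4) in blast)
qed

section \<open>Sobolev spaces and the Dirichlet problem\<close>

lemma continuous_matrix_vector_mult:
 "continuous_on UNIV (%p. fst p *v (snd p :: real^'n) :: real^'m)"
 unfolding matrix_vector_mult_def by (intro continuous_intros)

definition coef :: "(real^'n) set => real => real => (real^'n => real^'n^'n) => bool" where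
 "coef D mu La A \<longleftrightarrow> D : sets lebesgue & set_borel_measurable lebesgue D A & 0 <= La & 
   (ALL x : D. ALL xi. mu * (norm xi)^2 <= (A x *v xi) \<bullet> xi & norm (A x *v xi) <= La * norm xi)"

text \<open>Cutting off outside \<open>D\<close> makes this a bounded operator of the whole space;
  coercivity holds on classes of fields living on \<open>D\<close>.\<close>

definition mulop :: "(real^'n) set => (real^'n => real^'n^'n) => (real^'n, real^'n) l2 => (real^'n, real^'n) l2" where
 "mulop D A V = cls D (%x. A x *v repr V x)"

lemma sq_on_matrix_mult:
 fixes A :: "real^'n => real^'n^'n"
 assumes A: "set_borel_measurable lebesgue D A" "!!x xi. x : D ==> norm (A x *v xi) <= La * norm xi" and F: "sq_on D F"
 shows "sq_on D (%x. A x *v F x)"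
proof (rule sq_on_bound[OF F, of _ La])
 have "(%x. (ind D x *R A x) *v (ind D x *R F x)) : borel_measurable lebesgue"
  by (rule borel_measurable_continuous_Pair[where H = "%(a::real^'n^'n) (v::real^'n). a *v v", OF A(1)[unfolded set_borel_measurable_def]
   sq_on_measurable[OF F] continuous_matrix_vector_mult])
 moreover have "(%x. (ind D x *R A x) *v (ind D x *R F x)) = (%x. ind D x *R (A x *v F x))"
  by (auto simp: indicator_def fun_eq_iff)
 ultimately show "(%x. ind D x *R (A x *v F x)) : borel_measurable lebesgue" by simp
qed (use A(2) in auto)

lemma coefD:
 fixes A :: "real^'n => real^'n^'n"
 assumes "coef D mu La A"
 shows "D : sets lebesgue" "set_borel_measurable lebesgue D A" "0 <= La"
  "!!x xi. x : D ==> mu * (norm xi)^2 <= (A x *v xi) \<bullet> xi" "!!x xi. x : D ==> norm (A x *v xi) <= La * norm xi"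
  "sq_on D F ==> sq_on D (%x. A x *v F x)"
 using assms sq_on_matrix_mult[of D A La F] by (auto simp: coef_def)

lemma mulop_cls:
 assumes "coef D mu La A" "sq_on D F"
 shows "mulop D A (cls D F) = cls D (%x. A x *v F x)"
 unfolding mulop_def
proof (subst cls_eq_iff)
 note c = coefD[OF assms(1)]
 show "sq_on D (%x. A x *v repr (cls D F) x)" by (rule c(6)[OF sq_on_repr[OF c(1)]])
 show "sq_on D (%x. A x *v F x)" by (rule c(6)[OF assms(2)])
 show "AE x in lebesgue. x : D --> A x *v repr (cls D F) x = A x *v F x"
  using repr_cls_AE[OF assms(2)] by eventually_elim auto
qed

lemma norm_mulop_le:
 assumes "coef D mu La A" shows "norm (mulop D A V) <= La * norm V"
proof -
 note c = coefD[OF assms(1)]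
 have "norm (mulop D A V) <= La * norm (cls D (repr V))"
  unfolding mulop_def by (rule norm_cls_le[OF sq_on_repr[OF c(1)] c(6)[OF sq_on_repr[OF c(1)]] _ c(3)]) (simp add: c(5))
 also have "norm (cls D (repr V)) <= norm V"
 proof -
  have "norm (cls D (repr V)) <= 1 * norm (cls UNIV (repr V))"
  proof -
   have "norm (cls UNIV (%x. ind D x *R repr V x)) <= 1 * norm (cls UNIV (repr V))"
   proof (rule norm_cls_le)
    show "sq_on UNIV (repr V)" by (rule sq_on_repr) simp
    show "sq_on UNIV (%x. ind D x *R repr V x)" using sq_on_repr[OF c(1), of V] by (simp add: sq_on_def)
   qed (auto simp: indicator_def)
   then show ?thesis by (simp add: cls_def)
  qed
  also have "cls UNIV (repr V) = V" by (simp add: cls_def repr(2))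
  finally show ?thesis by simp
 qed
 finally show ?thesis using c(3) by (simp add: mult_left_mono)
qed

lemma blin_mulop:
 fixes A :: "real^'n => real^'n^'n"
 assumes "coef D mu La A" shows "bounded_linear (mulop D A)"
proof -
 note c = coefD[OF assms(1)]
 have sr: "sq_on D (repr V)" for V :: "(real^'n, real^'n) l2" by (rule sq_on_repr[OF c(1)])
 have r1: "AE x in lebesgue. repr (V + W) x = repr V x + repr W x" for V W :: "(real^'n, real^'n) l2"
  using abs_l2_eq_iff[OF repr(1)[of "V + W"] sqint_add[OF repr(1)[of V] repr(1)[of W]]]
  by (simp add: abs_l2_add repr)
 have r2: "AE x in lebesgue. repr (k *R V) x = k *R repr V x" for k and V :: "(real^'n, real^'n) l2"
  using abs_l2_eq_iff[OF repr(1)[of "k *R V"] sqint_scaleR[OF repr(1)[of V], of k]]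
  by (simp add: abs_l2_scaleR repr)
 show ?thesis
 proof (rule bounded_linear_intro[of _ La])
  fix V W :: "(real^'n, real^'n) l2"
  have "mulop D A (V + W) = cls D (%x. A x *v repr V x + A x *v repr W x)"
   unfolding mulop_def
   by (subst cls_eq_iff[OF c(6)[OF sr] sq_on_add[OF c(6)[OF sr] c(6)[OF sr]]])
    (rule eventually_mono[OF r1[of V W]], simp add: matrix_vector_right_distrib)
  then show "mulop D A (V + W) = mulop D A V + mulop D A W" by (simp add: mulop_def cls_add c(6) sr)
  fix k
  have "mulop D A (k *R V) = cls D (%x. k *R (A x *v repr V x))"
   unfolding mulop_def
   by (subst cls_eq_iff[OF c(6)[OF sr] sq_on_scaleR[OF c(6)[OF sr]]])
    (rule eventually_mono[OF r2[of k V]], simp add: matrix_vector_mult_scaleR)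
  then show "mulop D A (k *R V) = k *R mulop D A V" by (simp add: mulop_def cls_scaleR c(6) sr)
  show "norm (mulop D A V) <= norm V * La" using norm_mulop_le[OF assms, of V] by (simp add: mult.commute)
 qed
qed

lemma mulop_coercive:
 assumes "coef D mu La A" "sq_on D F"
 shows "mu * (norm (cls D F))^2 <= inner (mulop D A (cls D F)) (cls D F)"
proof -
 note c = coefD[OF assms(1)]
 have "mu * (norm (cls D F))^2 = (LINT x:D|lebesgue. mu * (norm (F x))^2)"
  by (simp add: norm_cls[OF assms(2)])
 also have "... <= (LINT x:D|lebesgue. (A x *v F x) \<bullet> F x)"
  unfolding set_lebesgue_integral_def
 proof (rule integral_mono)
  show "integrable lebesgue (%x. ind D x *R (mu * (norm (F x))^2))"
   using set_integrable_mult_right[OF set_integrable_inner[OF assms(2,2)], of "mu"] by (simp add: power2_norm_eq_inner set_integrable_def)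
  show "integrable lebesgue (%x. ind D x *R ((A x *v F x) \<bullet> F x))"
   using set_integrable_inner[OF c(6)[OF assms(2)] assms(2)] by (simp add: set_integrable_def)
 qed (use c(4) in "auto simp: indicator_def")
 also have "... = inner (mulop D A (cls D F)) (cls D F)"
  unfolding mulop_cls[OF assms] by (rule inner_cls[symmetric, OF c(6)[OF assms(2)] assms(2)])
 finally show ?thesis .
qed

lemma sq_on_cont_support:
 fixes f :: "real^'n => 'b::euclidean_space"
 assumes f: "continuous_on UNIV f" "compact K" "K <= D" "!!x. x ~: K ==> f x = 0"
 shows "sq_on D f"
proof -
 have "sq_on K f" by (rule sq_on_cont_compact[OF f(2)]) (use f(1) in "auto intro: continuous_on_subset")
 moreover have "(%x. ind K x *R f x) = (%x. ind D x *R f x)"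
  using f by (auto simp: indicator_def fun_eq_iff)
 ultimately show ?thesis by (simp add: sq_on_def)
qed

lemma sq_on_test_fun: assumes "test_fun D ph" shows "sq_on D ph"
 by (rule test_funD[OF assms]) (auto intro: sq_on_cont_support smooth_cont)

lemma sq_on_test_fun_grad: assumes "test_fun D ph" shows "sq_on D (grad ph)"
proof -
 obtain K where K: "compact K" "K <= D" "!!x. x ~: K ==> ph x = 0" "smooth ph" by (rule test_funD[OF assms(1)]) blast
 show ?thesis by (rule sq_on_cont_support[OF smooth_cont_grad[OF K(4)] K(1,2)])
  (rule grad_zero_outside[OF compact_imp_closed[OF K(1)] K(3)])
qed

lemma sq_on_test_scaleR: assumes "test_fun D ph" shows "sq_on D (%x. ph x *R (v::'b::euclidean_space))"
proof -
 obtain K where K: "compact K" "K <= D" "!!x. x ~: K ==> ph x = 0" "smooth ph" by (rule test_funD[OF assms(1)]) blast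
 show ?thesis by (rule sq_on_cont_support[OF _ K(1,2)])
   (use K smooth_cont in "auto intro!: continuous_intros")
qed

lemma is_weak_grad_iff:
 assumes "sq_on D u" "sq_on D G"
 shows "is_weak_grad D u G \<longleftrightarrow> (ALL ph i. test_fun D ph -->
   inner (cls D u) (cls D (pd i ph)) + inner (cls D G) (cls D (%x. ph x *R axis i 1)) = 0)"
proof -
 have "(LINT x:D|lebesgue. u x * grad ph x $ i) = inner (cls D u) (cls D (pd i ph))"
  "(LINT x:D|lebesgue. G x $ i * ph x) = inner (cls D G) (cls D (%x. ph x *R axis i 1))" if "test_fun D ph" for ph i
  by (subst inner_cls[OF assms(1) sq_on_test_fun[OF test_fun_pd[OF that]]], simp add: grad_nth)
   (subst inner_cls[OF assms(2) sq_on_test_scaleR[OF that]], simp add: inner_axis mult.commute)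
 then show ?thesis unfolding is_weak_grad_def by (auto simp: eq_neg_iff_add_eq_0)
qed

lemma AE_eq_if_weak_integrals_eq:
 fixes G1 G2 :: "real^'n => real^'n"
 assumes "open D" "!!a b. cbox a b <= D ==> sq_on (cbox a b) G1 & sq_on (cbox a b) G2"
  and eq: "!!ph i. test_fun D ph ==> (LINT x:D|lebesgue. (G1 x $ i - G2 x $ i) * ph x) = 0"
 shows "AE x in lebesgue. x : D --> G1 x = G2 x"
proof -
 have "AE x in lebesgue. x : D --> G1 x $ i - G2 x $ i = 0" for i
 proof (rule AE_zero_if_test_integrals_zero[OF assms(1) _ eq])
  fix a b assume "cbox a b <= D"
  with assms(2) have 1: "sq_on (cbox a b) (%x. G1 x - G2 x)" by (auto intro: sq_on_diff)
  have 2: "sq_on (cbox a b) (%x. axis i (1::real) :: real^'n)" by (rule sq_on_cont_compact) auto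
  from set_integrable_inner[OF 1 2] show "set_integrable lebesgue (cbox a b) (%x. G1 x $ i - G2 x $ i)"
   by (simp add: inner_axis)
 qed
 then have "AE x in lebesgue. ALL i : UNIV. x : D --> G1 x $ i - G2 x $ i = 0"
  by (intro AE_finite_allI) auto
 then show ?thesis by eventually_elim (auto simp: vec_eq_iff)
qed

lemma set_integrable_weak_pair:
 assumes "sq_on D G" "test_fun D ph"
 shows "set_integrable lebesgue D (%x. G x $ i * ph x)"
 using set_integrable_inner[OF assms(1) sq_on_test_scaleR[OF assms(2)], of "axis i 1"] by (simp add: inner_axis mult.commute)

lemma weak_grad_unique:
 assumes "open D" "sq_on D G1" "sq_on D G2" "is_weak_grad D u G1" "is_weak_grad D u G2"
 shows "AE x in lebesgue. x : D --> G1 x = G2 x"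
proof (rule AE_eq_if_weak_integrals_eq[OF assms(1)])
 show "sq_on (cbox a b) G1 & sq_on (cbox a b) G2" if "cbox a b <= D" for a b
  using assms(2,3) that by (auto intro: sq_on_subset)
 fix ph i assume ph: "test_fun D ph"
 have "(LINT x:D|lebesgue. (G1 x $ i - G2 x $ i) * ph x) = (LINT x:D|lebesgue. G1 x $ i * ph x) - (LINT x:D|lebesgue. G2 x $ i * ph x)"
  using set_integral_diff(2)[OF set_integrable_weak_pair[OF assms(2) ph] set_integrable_weak_pair[OF assms(3) ph], of i i]
  by (simp add: algebra_simps)
 also have "... = 0"
 proof -
  have "(LINT x:D|lebesgue. u x * grad ph x $ i) = - (LINT x:D|lebesgue. G1 x $ i * ph x)"
   "(LINT x:D|lebesgue. u x * grad ph x $ i) = - (LINT x:D|lebesgue. G2 x $ i * ph x)"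
   using assms(4,5) ph unfolding is_weak_grad_def by blast+
  then show ?thesis by simp
 qed
 finally show "(LINT x:D|lebesgue. (G1 x $ i - G2 x $ i) * ph x) = 0" .
qed

text \<open>The graph embedding u -> (u, grad u). It is isometric for the H^1 inner product, so
  Sobolev statements become statements about subspaces of a product of two Hilbert spaces.\<close>

definition emb :: "(real^'n) set => (real^'n => real) => (real^'n, real) l2 \<times> (real^'n, real^'n) l2" where
 "emb D u = (cls D u, cls D (wgrad D u))"

lemma H1D:
 assumes "u : H1 D"
 shows "sq_on D u" "sq_on D (wgrad D u)" "is_weak_grad D u (wgrad D u)"
proof -
 have "EX G. L2v D G & is_weak_grad D u G" using assms by (simp add: H1_def)
 from someI_ex[OF this] show "sq_on D (wgrad D u)" "is_weak_grad D u (wgrad D u)"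
  by (auto simp: wgrad_def L2v_iff_sq_on)
 show "sq_on D u" using assms by (simp add: H1_def L2_iff_sq_on)
qed

lemma H1I: "sq_on D u ==> sq_on D G ==> is_weak_grad D u G ==> u : H1 D"
 by (auto simp: H1_def L2_iff_sq_on L2v_iff_sq_on)

lemma emb_eq:
 assumes "open D" "sq_on D u" "sq_on D G" "is_weak_grad D u G"
 shows "emb D u = (cls D u, cls D G)"
proof -
 note h = H1D[OF H1I[OF assms(2-4)]]
 show ?thesis unfolding emb_def
  using cls_eq_iff[OF h(2) assms(3)] weak_grad_unique[OF assms(1) h(2) assms(3) h(3) assms(4)] by simp
qed

lemma h1_inner_emb: "u : H1 D ==> v : H1 D ==> h1_inner D u v = inner (emb D u) (emb D v)"
 using H1D[of u D] H1D[of v D] by (simp add: h1_inner_def emb_def inner_cls)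

lemma h1_norm_emb: "u : H1 D ==> h1_norm D u = norm (emb D u)"
 by (simp add: h1_norm_def h1_inner_emb norm_eq_sqrt_inner)

lemma H1_lincomb:
 assumes "open D" "u : H1 D" "v : H1 D"
 shows "(%x. a * u x + b * v x) : H1 D" "emb D (%x. a * u x + b * v x) = a *R emb D u + b *R emb D v"
proof -
 note u = H1D[OF assms(2)] and v = H1D[OF assms(3)]
 let ?w = "%x. a *R u x + b *R v x" and ?G = "%x. a *R wgrad D u x + b *R wgrad D v x"
 have s: "sq_on D ?w" "sq_on D ?G" by (intro sq_on_add sq_on_scaleR u v)+
 have c: "cls D ?w = a *R cls D u + b *R cls D v" "cls D ?G = a *R cls D (wgrad D u) + b *R cls D (wgrad D v)"
  using u v by (simp_all add: cls_add cls_scaleR sq_on_scaleR del: real_scaleR_def)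
 have w: "is_weak_grad D ?w ?G"
  unfolding is_weak_grad_iff[OF s] c
 proof (intro allI impI)
  fix ph i assume "test_fun D ph"
  with u(3)[unfolded is_weak_grad_iff[OF u(1,2)]] v(3)[unfolded is_weak_grad_iff[OF v(1,2)]]
  have "inner (cls D u) (cls D (pd i ph)) + inner (cls D (wgrad D u)) (cls D (%x. ph x *R axis i 1)) = 0"
   "inner (cls D v) (cls D (pd i ph)) + inner (cls D (wgrad D v)) (cls D (%x. ph x *R axis i 1)) = 0" by auto
  then have "a * (inner (cls D u) (cls D (pd i ph)) + inner (cls D (wgrad D u)) (cls D (%x. ph x *R axis i 1)))
   + b * (inner (cls D v) (cls D (pd i ph)) + inner (cls D (wgrad D v)) (cls D (%x. ph x *R axis i 1))) = 0" by simp
  then show "inner (a *R cls D u + b *R cls D v) (cls D (pd i ph)) +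
    inner (a *R cls D (wgrad D u) + b *R cls D (wgrad D v)) (cls D (%x. ph x *R axis i 1)) = 0"
   by (simp add: inner_add_left algebra_simps)
 qed
 show "(%x. a * u x + b * v x) : H1 D" using H1I[OF s w] by simp
 show "emb D (%x. a * u x + b * v x) = a *R emb D u + b *R emb D v"
  using emb_eq[OF assms(1) s w] unfolding c by (simp add: emb_def)
qed

lemma H1_diff:
 assumes "open D" "u : H1 D" "v : H1 D"
 shows "(%x. u x - v x) : H1 D" "emb D (%x. u x - v x) = emb D u - emb D v"
 using H1_lincomb[OF assms, of 1 "-1"] by simp_all

lemma test_fun_H1:
 assumes "open D" "test_fun D ph"
 shows "ph : H1 D" "emb D ph = (cls D ph, cls D (grad ph))"
 using H1I[OF sq_on_test_fun[OF assms(2)] sq_on_test_fun_grad[OF assms(2)] smooth_is_weak_grad[OF test_fun_smooth[OF assms(2)]]]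
  emb_eq[OF assms(1) sq_on_test_fun[OF assms(2)] sq_on_test_fun_grad[OF assms(2)] smooth_is_weak_grad[OF test_fun_smooth[OF assms(2)]]]
 by auto

text \<open>H^1_0 modulo null sets: a closed subspace of a complete space, to which projection,
  Lax-Milgram and Riesz apply directly.\<close>

definition H10space :: "(real^'n) set => ((real^'n, real) l2 \<times> (real^'n, real^'n) l2) set" where
 "H10space D = closure (emb D ` {ph. test_fun D ph})"

lemma subspace_emb_test_fun: assumes "open D" shows "subspace (emb D ` {ph. test_fun D ph})"
 unfolding subspace_def
proof (intro conjI ballI allI)
 note H = H1_lincomb(2)[OF assms test_fun_H1(1)[OF assms] test_fun_H1(1)[OF assms]]
 show "0 : emb D ` {ph. test_fun D ph}"
  using H[OF test_fun_zero test_fun_zero, of 0 0] test_fun_zero by (intro image_eqI[of _ _ "%x. 0"]) auto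
 fix X Y assume "X : emb D ` {ph. test_fun D ph}" "Y : emb D ` {ph. test_fun D ph}"
 then obtain ph ps where "X = emb D ph" "Y = emb D ps" "test_fun D ph" "test_fun D ps" by auto
 then show "X + Y : emb D ` {ph. test_fun D ph}"
  using H[of ph ps 1 1] test_fun_add[of D ph ps] by (intro image_eqI[of _ _ "%x. ph x + ps x"]) auto
next
 note H = H1_lincomb(2)[OF assms test_fun_H1(1)[OF assms] test_fun_H1(1)[OF assms]]
 fix c :: real and X assume "X : emb D ` {ph. test_fun D ph}"
 then obtain ph where "X = emb D ph" "test_fun D ph" by auto
 then show "c *R X : emb D ` {ph. test_fun D ph}"
  using H[of ph ph c 0] test_fun_cmult[of D ph c] by (intro image_eqI[of _ _ "%x. c * ph x"]) auto
qed

lemma H10space: assumes "open D" shows "subspace (H10space D)" "closed (H10space D)"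
 unfolding H10space_def using subspace_closure[OF subspace_emb_test_fun[OF assms]] by auto

lemma H10_iff:
 assumes "open D" shows "u : H10 D \<longleftrightarrow> u : H1 D & emb D u : H10space D"
proof (intro iffI conjI)
 assume "u : H10 D"
 then obtain ph where u: "u : H1 D" and ph: "!!k. test_fun D (ph k)" "(%k. h1_norm D (%x. u x - ph k x)) ---> 0"
  by (auto simp: H10_def)
 show "u : H1 D" by fact
 have "h1_norm D (%x. u x - ph k x) = norm (emb D (ph k) - emb D u)" for k
  using H1_diff[OF assms u test_fun_H1(1)[OF assms ph(1)], of k] by (simp add: h1_norm_emb norm_minus_commute)
 with ph(2) have "(%k. emb D (ph k)) ---> emb D u" by (simp add: LIM_zero_cancel tendsto_norm_zero_iff)
 then show "emb D u : H10space D" unfolding H10space_def closure_sequential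
  using ph(1) by (intro exI[of _ "%k. emb D (ph k)"]) auto
next
 assume "u : H1 D & emb D u : H10space D"
 then have u: "u : H1 D" and "emb D u : closure (emb D ` {ph. test_fun D ph})" by (auto simp: H10space_def)
 then obtain X where X: "!!k. X k : emb D ` {ph. test_fun D ph}" "X ---> emb D u" by (auto simp: closure_sequential)
 then obtain ph where ph: "!!k. test_fun D (ph k)" "!!k. X k = emb D (ph k)" by (simp add: image_iff) metis
 have "h1_norm D (%x. u x - ph k x) = norm (emb D (ph k) - emb D u)" for k
  using H1_diff[OF assms u test_fun_H1(1)[OF assms ph(1)], of k] by (simp add: h1_norm_emb norm_minus_commute)
 moreover have "(%k. norm (emb D (ph k) - emb D u)) ---> 0"
  using X(2)[THEN LIM_zero, THEN tendsto_norm_zero] by (simp add: ph(2))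
 ultimately show "u : H10 D" unfolding H10_def using u ph(1) by (intro CollectI conjI exI[of _ ph]) auto
qed

text \<open>The weak gradient relation and vanishing outside \<open>D\<close> are both orthogonality
  relations to fixed vectors. They hold for embedded test functions and therefore on the closure, so
  every element of the closure is the graph pair of a genuine function.\<close>

lemma H10space_realize:
 fixes D :: "(real^'n) set"
 assumes "open D" "X : H10space D"
 shows "EX u : H10 D. emb D u = X"
proof -
 obtain U V where X: "X = (U, V)" by (cases X)
 have Ds: "D : sets lebesgue" using assms(1) by simp
 have Dc: "- D : sets lebesgue" using sets.compl_sets[OF Ds] by (simp add: Compl_eq_Diff_UNIV)
 have P: "inner (fst X) (cls D (pd i ph)) + inner (snd X) (cls D (%x. ph x *R axis i 1)) = 0" if "test_fun D ph" for ph i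
 proof -
  have "inner (cls D (pd i ph), cls D (%x. ph x *R axis i 1)) X = 0"
  proof (rule inner_zero_on_closure[OF _ assms(2)[unfolded H10space_def]])
   fix Y assume "Y : emb D ` {ph. test_fun D ph}"
   then obtain ps where ps: "test_fun D ps" "Y = emb D ps" by auto
   have "is_weak_grad D ps (grad ps)" by (rule smooth_is_weak_grad[OF test_fun_smooth[OF ps(1)]])
   then show "inner (cls D (pd i ph), cls D (%x. ph x *R axis i 1)) Y = 0"
    unfolding is_weak_grad_iff[OF sq_on_test_fun[OF ps(1)] sq_on_test_fun_grad[OF ps(1)]]
    using that by (simp add: ps(2) test_fun_H1(2)[OF assms(1) ps(1)] inner_commute)
  qed
  then show ?thesis by (simp add: inner_prod_def inner_commute)
 qed
 have Z: "inner (fst X) (cls UNIV (%x. ind (- D) x *R repr (fst X) x)) = 0"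
  "inner (snd X) (cls UNIV (%x. ind (- D) x *R repr (snd X) x)) = 0"
 proof -
  have s: "sq_on UNIV (%x. ind (- D) x *R repr U x)" for U :: "(real^'n, 'b::euclidean_space) l2"
   using sq_on_repr[OF Dc, of U] by (simp add: sq_on_def)
  have z: "inner (cls D F) (cls UNIV (%x. ind (- D) x *R repr U x)) = 0" if "sq_on D F" for F and U :: "(real^'n, 'b::euclidean_space) l2"
  proof -
   have "cls D F = cls UNIV (%x. ind D x *R F x)" by (simp add: cls_def)
   moreover have "sq_on UNIV (%x. ind D x *R F x)" using that by (simp add: sq_on_def)
   moreover have "inner (ind D x *R F x) (ind (- D) x *R repr U x) = 0" for x
    by (simp add: indicator_def)
   ultimately show ?thesis using s[of U] by (simp only: inner_cls) simp
  qed
  have "inner (cls UNIV (%x. ind (- D) x *R repr (fst X) x), 0) X = 0"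
  proof (rule inner_zero_on_closure[OF _ assms(2)[unfolded H10space_def]])
   fix Y assume "Y : emb D ` {ph. test_fun D ph}"
   then obtain ps where ps: "test_fun D ps" "Y = emb D ps" by auto
   show "inner (cls UNIV (%x. ind (- D) x *R repr (fst X) x), 0) Y = 0"
    unfolding ps(2) emb_def inner_prod_def using z[OF H1D(1)[OF test_fun_H1(1)[OF assms(1) ps(1)]], of "fst X"]
    by (simp add: inner_commute del: real_scaleR_def)
  qed
  then show "inner (fst X) (cls UNIV (%x. ind (- D) x *R repr (fst X) x)) = 0" by (simp add: inner_prod_def inner_commute)
  have "inner (0, cls UNIV (%x. ind (- D) x *R repr (snd X) x)) X = 0"
  proof (rule inner_zero_on_closure[OF _ assms(2)[unfolded H10space_def]])
   fix Y assume "Y : emb D ` {ph. test_fun D ph}"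
   then obtain ps where ps: "test_fun D ps" "Y = emb D ps" by auto
   show "inner (0, cls UNIV (%x. ind (- D) x *R repr (snd X) x)) Y = 0"
    unfolding ps(2) emb_def inner_prod_def using z[OF H1D(2)[OF test_fun_H1(1)[OF assms(1) ps(1)]], of "snd X"]
    by (simp add: inner_commute del: real_scaleR_def)
  qed
  then show "inner (snd X) (cls UNIV (%x. ind (- D) x *R repr (snd X) x)) = 0" by (simp add: inner_prod_def inner_commute)
 qed
 \<comment> \<open>The part of \<open>U\<close> outside \<open>D\<close> has with \<open>U\<close>
   an inner product equal to its own squared norm, so orthogonality makes it vanish.\<close>
 have supp: "cls D (repr U) = U" if "inner U (cls UNIV (%x. ind (- D) x *R repr U x)) = 0" for U :: "(real^'n, 'b::euclidean_space) l2"
 proof -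
  let ?r = "cls UNIV (%x. ind (- D) x *R repr U x)"
  have s: "sq_on UNIV (%x. ind (- D) x *R repr U x)" "sq_on UNIV (%x. ind D x *R repr U x)"
   using sq_on_repr[OF Dc, of U] sq_on_repr[OF Ds, of U] by (simp_all add: sq_on_def)
  have c: "cls D (repr U) = cls UNIV (%x. ind D x *R repr U x)" by (simp add: cls_def)
  have "U = cls UNIV (%x. ind D x *R repr U x + ind (- D) x *R repr U x)"
  proof -
   have "(%x. ind D x *R repr U x + ind (- D) x *R repr U x) = repr U" by (auto simp: indicator_def fun_eq_iff)
   then show ?thesis by (simp add: cls_def repr(2))
  qed
  then have U: "U = cls D (repr U) + ?r" unfolding c using cls_add[OF s(2,1)] by simp
  have "inner (ind D x *R repr U x) (ind (- D) x *R repr U x) = 0" for x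
   by (simp add: indicator_def)
  then have "inner (cls D (repr U)) ?r = 0" unfolding c using s by (simp only: inner_cls) simp
  moreover have "inner U ?r = inner (cls D (repr U)) ?r + inner ?r ?r"
   unfolding inner_add_left[symmetric] by (rule arg_cong[OF U, of "%z. inner z ?r"])
  ultimately have "?r = 0" using that by simp
  then show ?thesis using U by (metis add.right_neutral)
 qed
 define u where "u = repr U" define G where "G = repr V"
 have s: "sq_on D u" "sq_on D G" unfolding u_def G_def by (auto intro: sq_on_repr[OF Ds])
 have c: "cls D u = U" "cls D G = V" unfolding u_def G_def using Z by (auto intro!: supp simp: X)
 have w: "is_weak_grad D u G" unfolding is_weak_grad_iff[OF s] c using P by (auto simp: X)
 have "u : H1 D" by (rule H1I[OF s w])
 moreover have "emb D u = X" using emb_eq[OF assms(1) s w] by (simp add: c X)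
 ultimately show ?thesis using assms(2) by (auto simp: H10_iff[OF assms(1)])
qed

text \<open>Integrating the derivative of x_i ph^2 in the direction i gives that the integral of
  ph^2 is -2 times that of x_i ph d_i ph; then |x_i| <= R and the Cauchy-Schwarz inequality yield
  the constant 2 R.\<close>

lemma poincare_test_fun:
 fixes D :: "(real^'n) set"
 assumes "D <= cball 0 R" "0 <= R" "test_fun D ph"
 shows "norm (cls D ph) <= 2 * R * norm (cls D (grad ph))"
proof -
 obtain i :: 'n where True by simp
 have sm: "smooth ph" by (rule test_fun_smooth[OF assms(3)])
 have l: "smooth (%x::real^'n. x $ i)" "pd i (%x::real^'n. x $ i) x = 1" for x
  using smooth_linear[of "axis i 1" 0] grad_linear[of "axis i 1" 0 x]
  by (simp_all add: inner_axis' grad_nth[symmetric])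
 have t: "test_fun D (%x. ph x * x $ i)" by (rule test_fun_mult[OF assms(3) l(1)])
 have t2: "test_fun D (%x. (ph x * x $ i) * ph x)" by (rule test_fun_mult[OF t sm])
 have i1: "integrable lebesgue (%x. ph x * ph x)" "integrable lebesgue (%x. (ph x * x $ i) * pd i ph x)"
  by (auto intro!: integrable_test_fun[of D] test_fun_mult assms(3) sm smooth_pd t)
 have "pd i (%x. (ph x * x $ i) * ph x) x = 2 * ((ph x * x $ i) * pd i ph x) + ph x * ph x" for x
  using pd_mult[OF smooth_mult[OF sm l(1)] sm, of i x] pd_mult[OF sm l(1), of i x] l(2)[of x] by (simp add: algebra_simps)
 then have "0 = (\<integral>x. 2 * ((ph x * x $ i) * pd i ph x) + ph x * ph x \<partial>lebesgue)"
  using integral_pd_eq_0[OF t2, of i] by simp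
 also have "... = 2 * (\<integral>x. (ph x * x $ i) * pd i ph x \<partial>lebesgue) + (\<integral>x. ph x * ph x \<partial>lebesgue)"
  using i1 by simp
 also have "(\<integral>x. ph x * ph x \<partial>lebesgue) = (norm (cls D ph))^2"
  unfolding norm_cls[OF sq_on_test_fun[OF assms(3)]]
  by (subst set_integral_test_fun) (auto simp: test_fun_outside[OF assms(3)] power2_eq_square)
 also have "(\<integral>x. (ph x * x $ i) * pd i ph x \<partial>lebesgue) = inner (cls D (%x. ph x * x $ i)) (cls D (pd i ph))"
  unfolding inner_cls[OF sq_on_test_fun[OF t] sq_on_test_fun[OF test_fun_pd[OF assms(3)]]]
  by (subst set_integral_test_fun) (auto simp: test_fun_outside[OF assms(3)])
 finally have eq: "(norm (cls D ph))^2 = - 2 * inner (cls D (%x. ph x * x $ i)) (cls D (pd i ph))" by simp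
 have n1: "norm (cls D (%x. ph x * x $ i)) <= R * norm (cls D ph)"
 proof (rule norm_cls_le[OF sq_on_test_fun[OF assms(3)] sq_on_test_fun[OF t] _ assms(2)])
  have "norm (ph x * x $ i) <= R * norm (ph x)" if "x : D" for x
  proof -
   have "\<bar>x $ i\<bar> <= R" using that assms(1) component_le_norm_cart[of x i] by force
   then have "\<bar>ph x\<bar> * \<bar>x $ i\<bar> <= \<bar>ph x\<bar> * R" by (rule mult_left_mono) simp
   then show ?thesis by (simp add: abs_mult mult.commute[of R])
  qed
  then show "AE x in lebesgue. x : D --> norm (ph x * x $ i) <= R * norm (ph x)" by simp
 qed
 have n2: "norm (cls D (pd i ph)) <= 1 * norm (cls D (grad ph))"
  by (rule norm_cls_le[OF sq_on_test_fun_grad[OF assms(3)] sq_on_test_fun[OF test_fun_pd[OF assms(3)]]])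
   (auto simp: grad_nth[symmetric] component_le_norm_cart)
 have "(norm (cls D ph))^2 <= 2 * (norm (cls D (%x. ph x * x $ i)) * norm (cls D (pd i ph)))"
  using eq Cauchy_Schwarz_ineq2[of "cls D (%x. ph x * x $ i)" "cls D (pd i ph)"] by linarith
 also have "... <= 2 * ((R * norm (cls D ph)) * (1 * norm (cls D (grad ph))))"
  by (intro mult_left_mono mult_mono n1 n2) (use assms(2) in auto)
 finally have *: "norm (cls D ph) * norm (cls D ph) <= (2 * R * norm (cls D (grad ph))) * norm (cls D ph)"
  by (simp only: power2_eq_square mult_ac mult_1_left)
 show ?thesis
 proof (cases "norm (cls D ph) = 0")
  case False
  then show ?thesis by (intro mult_right_le_imp_le[OF *]) simp
 qed (use assms(2) in auto)
qed

lemma poincare: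
 assumes "open D" "D <= cball 0 R" "0 <= R" "X : H10space D"
 shows "norm (fst X) <= 2 * R * norm (snd X)" "norm X <= (1 + 2 * R) * norm (snd X)"
proof -
 have "closed {X. norm (fst X) <= 2 * R * norm (snd (X :: (real^'a, real) l2 \<times> (real^'a, real^'a) l2))}"
  by (intro closed_Collect_le continuous_intros)
 then have "H10space D <= {X. norm (fst X) <= 2 * R * norm (snd X)}"
  unfolding H10space_def using poincare_test_fun[OF assms(2,3)]
  by (intro closure_minimal) (auto simp: test_fun_H1(2)[OF assms(1)])
 then show 1: "norm (fst X) <= 2 * R * norm (snd X)" using assms(4) by blast
 have "norm X <= norm (fst X) + norm (snd X)" using norm_Pair_le[of "fst X" "snd X"] by simp
 with 1 show "norm X <= (1 + 2 * R) * norm (snd X)" by (simp add: algebra_simps)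
qed

section \<open>Solvability, bounds and perturbation of the Dirichlet problem\<close>

lemma transpose_inner: "(transpose A *v x) \<bullet> y = x \<bullet> (A *v y)" for A :: "real^'n^'n"
 by (simp add: dot_lmul_matrix)

lemma transpose_bound:
 fixes A :: "real^'n^'n"
 assumes "!!xi. norm (A *v xi) <= La * norm xi"
 shows "norm (transpose A *v xi) <= La * norm xi"
proof -
 let ?t = "transpose A *v xi"
 have "norm ?t * norm ?t = xi \<bullet> (A *v ?t)" by (simp only: transpose_inner[symmetric] power2_norm_eq_inner[symmetric] power2_eq_square)
 also have "... <= norm xi * norm (A *v ?t)" by (rule norm_cauchy_schwarz)
 also have "... <= norm xi * (La * norm ?t)" by (rule mult_left_mono[OF assms]) simp
 finally have *: "norm ?t * norm ?t <= (La * norm xi) * norm ?t" by (simp only: mult_ac)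
 show ?thesis
 proof (cases "norm ?t = 0")
  case True
  have "0 <= La * norm xi" using assms[of xi] norm_ge_zero order_trans by blast
  with True show ?thesis by simp
 next
  case False
  then show ?thesis by (intro mult_right_le_imp_le[OF *]) simp
 qed
qed

lemma coef_transpose:
 fixes A :: "real^'n => real^'n^'n"
 assumes "coef D mu La A" shows "coef D mu La (%x. transpose (A x))"
 unfolding coef_def
proof (intro conjI ballI allI)
 note c = coefD[OF assms]
 show "D : sets lebesgue" "0 <= La" by (rule c)+
 have "continuous_on UNIV (transpose :: real^'n^'n => real^'n^'n)" unfolding transpose_def by (intro continuous_intros)
 then have "transpose : borel_measurable (borel :: (real^'n^'n) measure)" by (rule borel_measurable_continuous_onI)
 from measurable_compose[OF c(2)[unfolded set_borel_measurable_def] this]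
 have "(%x. transpose (ind D x *R A x)) : borel_measurable lebesgue" .
 moreover have "(%x. transpose (ind D x *R A x)) = (%x. ind D x *R transpose (A x))"
  by (auto simp: indicator_def transpose_def vec_eq_iff fun_eq_iff)
 ultimately show "set_borel_measurable lebesgue D (%x. transpose (A x))" by (simp add: set_borel_measurable_def)
 fix x xi assume x: "x : D"
 show "mu * (norm xi)^2 <= (transpose (A x) *v xi) \<bullet> xi"
  unfolding transpose_inner using c(4)[OF x, of xi] by (simp add: inner_commute)
 show "norm (transpose (A x) *v xi) <= La * norm xi" by (rule transpose_bound[OF c(5)[OF x]])
qed

lemma mulop_transpose:
 assumes "coef D mu La A" "sq_on D F" "sq_on D H"
 shows "inner (mulop D A (cls D F)) (cls D H) = inner (cls D F) (mulop D (%x. transpose (A x)) (cls D H))"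
 unfolding mulop_cls[OF assms(1,2)] mulop_cls[OF coef_transpose[OF assms(1)] assms(3)]
  inner_cls[OF coefD(6)[OF assms(1,2)] assms(3)] inner_cls[OF assms(2) coefD(6)[OF coef_transpose[OF assms(1)] assms(3)]]
 by (simp only: inner_commute[of "F _"] transpose_inner) (simp only: inner_commute)

lemma H10space_cls:
 assumes "open D" "X : H10space D" obtains F where "sq_on D F" "snd X = cls D F"
 using H10space_realize[OF assms] H1D(2) by (force simp: H10_iff[OF assms(1)] emb_def)

text \<open>The form sees only the gradient component; by the Poincare inequality it is coercive for
  the full norm with constant mu / (1 + 2 R)^2. The datum \<open>F\<close> is any vector of the
  product space, which the later duality argument exploits.\<close>

lemma lax_milgram_H10:
 fixes D :: "(real^'n) set"
 assumes D: "open D" "D <= cball 0 R" "0 <= R" and A: "coef D mu La A" and mu: "0 < mu"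
 shows "EX V : H10space D. ALL X : H10space D. inner (mulop D A (snd V)) (snd X) = inner F X"
proof -
 interpret m: bounded_linear "mulop D A" by (rule blin_mulop[OF A])
 define T where "T X = (0 :: (real^'n, real) l2, mulop D A (snd X))" for X :: "(real^'n, real) l2 \<times> (real^'n, real^'n) l2"
 have "bounded_linear T" unfolding T_def
  by (intro bounded_linear_Pair bounded_linear_zero bounded_linear_compose[OF m.bounded_linear_axioms bounded_linear_snd, unfolded o_def])
 moreover have "mu / (1 + 2 * R)^2 * (norm X)^2 <= inner (T X) X" if X: "X : H10space D" for X
 proof -
  obtain G where G: "sq_on D G" "snd X = cls D G" by (rule H10space_cls[OF D(1) X])
  have "(norm X)^2 <= ((1 + 2 * R) * norm (snd X))^2" by (rule power_mono[OF poincare(2)[OF D X]]) simp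
  then have "mu / (1 + 2 * R)^2 * (norm X)^2 <= mu / (1 + 2 * R)^2 * ((1 + 2 * R) * norm (snd X))^2"
   using mu D(3) by (intro mult_left_mono) auto
  also have "... = mu * (norm (snd X))^2"
  proof -
   have "1 + 2 * R ~= 0" using D(3) by simp
   then show ?thesis by (simp add: power_mult_distrib)
  qed
  also have "mu * (norm (snd X))^2 <= inner (T X) X" using mulop_coercive[OF A G(1)] by (simp add: T_def G(2) inner_prod_def)
  finally show ?thesis .
 qed
 moreover have "0 < mu / (1 + 2 * R)^2" using mu D(3) by simp
 ultimately obtain V where "V : H10space D" "ALL s : H10space D. inner (T V) s = inner F s"
  using lax_milgram[OF H10space[OF D(1)], of T] by blast
 then show ?thesis by (auto simp: T_def inner_prod_def)
qed

text \<open>A functional in \<open>Hminus1\<close> acts on functions rather than classes. Its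
  boundedness forces equal values on functions with the same embedding, so it descends to
  \<open>H10space\<close> and Riesz applies.\<close>

lemma Hminus1_representation:
 assumes D: "open D" and f: "Hminus1 D f"
 shows "EX F : H10space D. ALL u : H10 D. f u = inner F (emb D u)"
proof -
 from f obtain C where lin: "!!u v a b. u : H10 D ==> v : H10 D ==> f (%x. a * u x + b * v x) = a * f u + b * f v"
  and C: "!!u. u : H10 D ==> \<bar>f u\<bar> <= C * h1_norm D u" unfolding Hminus1_def by blast
 have comb: "(%x. a * u x + b * v x) : H10 D" if "u : H10 D" "v : H10 D" for u v a b
  using that H1_lincomb[OF D, of u v a b] H10space(1)[OF D] by (auto simp: H10_iff[OF D] intro!: subspace_add subspace_scale)
 have wd: "f u = f v" if uv: "u : H10 D" "v : H10 D" "emb D u = emb D v" for u v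
 proof -
  have H: "u : H1 D" "v : H1 D" using uv by (auto simp: H10_iff[OF D])
  have "\<bar>f u - f v\<bar> = \<bar>f (%x. 1 * u x + (-1) * v x)\<bar>" using lin[OF uv(1,2), of 1 "-1"] by simp
  also have "... <= C * h1_norm D (%x. 1 * u x + (-1) * v x)" by (rule C[OF comb[OF uv(1,2)]])
  also have "h1_norm D (%x. 1 * u x + (-1) * v x) = 0"
   unfolding h1_norm_emb[OF H1_lincomb(1)[OF D H]] H1_lincomb(2)[OF D H] using uv(3) by simp
  finally show ?thesis by simp
 qed
 define h where "h X = f (SOME u. u : H10 D & emb D u = X)" for X
 have h: "h (emb D u) = f u" if "u : H10 D" for u
 proof -
  have "EX v. v : H10 D & emb D v = emb D u" using that by blast
  from someI_ex[OF this] show ?thesis unfolding h_def using wd that by blast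
 qed
 have "EX F : H10space D. ALL X : H10space D. h X = inner F X"
 proof (rule riesz_representation[OF H10space[OF D], of h C])
  fix X Y a b assume "X : H10space D" "Y : H10space D"
  then obtain u v where uv: "u : H10 D" "v : H10 D" "X = emb D u" "Y = emb D v" using H10space_realize[OF D] by metis
  have H: "u : H1 D" "v : H1 D" using uv by (auto simp: H10_iff[OF D])
  show "h (a *R X + b *R Y) = a * h X + b * h Y"
   unfolding uv(3,4) H1_lincomb(2)[OF D H, symmetric] h[OF comb[OF uv(1,2)]] h[OF uv(1)] h[OF uv(2)] by (rule lin[OF uv(1,2)])
 next
  fix X assume "X : H10space D"
  then obtain u where u: "u : H10 D" "X = emb D u" using H10space_realize[OF D] by metis
  then show "\<bar>h X\<bar> <= C * norm X" using C[OF u(1)] h[OF u(1)] h1_norm_emb[of u D] by (simp add: H10_iff[OF D])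
 qed
 then show ?thesis using h H10_iff[OF D] by metis
qed

text \<open>The weak formulation on classes: \<open>F\<close> is the Riesz representative of the
  right-hand side and \<open>g\<close> the embedded boundary datum.\<close>

definition sol :: "(real^'n) set => (real^'n => real^'n^'n) => _ => _ => ((real^'n, real) l2 \<times> (real^'n, real^'n) l2) => bool" where
 "sol D A F g U \<longleftrightarrow> U - g : H10space D & (ALL X : H10space D. inner (mulop D A (snd U)) (snd X) = inner F X)"

lemma weak_sol_imp_sol:
 assumes D: "open D" and A: "coef D mu La A" and F: "!!u. u : H10 D ==> f u = inner F (emb D u)"
  and G: "G : H1 D" and u: "weak_sol D A f G u"
 shows "u : H1 D" "sol D A F (emb D G) (emb D u)"
proof -
 show u1: "u : H1 D" using u by (simp add: weak_sol_def)
 show "sol D A F (emb D G) (emb D u)" unfolding sol_def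
 proof (intro conjI ballI)
  show "emb D u - emb D G : H10space D"
   using u H1_diff(2)[OF D u1 G] by (simp add: weak_sol_def H10_iff[OF D])
  fix X assume "X : H10space D"
  then obtain v where v: "v : H10 D" "X = emb D v" using H10space_realize[OF D] by metis
  then have v1: "v : H1 D" by (simp add: H10_iff[OF D])
  have "inner (mulop D A (snd (emb D u))) (snd X) = (LINT x:D|lebesgue. (A x *v wgrad D u x) \<bullet> wgrad D v x)"
   unfolding v(2) emb_def snd_conv mulop_cls[OF A H1D(2)[OF u1]] by (rule inner_cls[OF coefD(6)[OF A H1D(2)[OF u1]] H1D(2)[OF v1]])
  also have "... = inner F X" using u v F by (simp add: weak_sol_def)
  finally show "inner (mulop D A (snd (emb D u))) (snd X) = inner F X" .
 qed
qed

lemma sol_exists: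
 assumes D: "open D" "D <= cball 0 R" "0 <= R" and A: "coef D mu La A" and mu: "0 < mu"
 shows "EX U. sol D A F g U"
proof -
 interpret m: bounded_linear "mulop D A" by (rule blin_mulop[OF A])
 obtain V where V: "V : H10space D" "!!X. X : H10space D ==> inner (mulop D A (snd V)) (snd X) = inner (F - (0, mulop D A (snd g))) X"
  using lax_milgram_H10[OF D A mu] by blast
 have "sol D A F g (V + g)" unfolding sol_def
  using V by (simp add: m.add inner_add_left inner_diff_left) (simp add: inner_prod_def)
 then show ?thesis by blast
qed

lemma sol_bound:
 assumes D: "open D" "D <= cball 0 R" "0 <= R" and A: "coef D mu La A" and mu: "0 < mu" and U: "sol D A F g U"
 shows "norm U <= (1 + 2 * R) * ((1 + 2 * R) * norm F + La * norm g) / mu + norm g"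
proof -
 interpret m: bounded_linear "mulop D A" by (rule blin_mulop[OF A])
 define V where "V = U - g"
 have V: "V : H10space D" "inner (mulop D A (snd U)) (snd V) = inner F V" using U by (auto simp: sol_def V_def)
 obtain H where H: "sq_on D H" "snd V = cls D H" by (rule H10space_cls[OF D(1) V(1)])
 have "mu * (norm (snd V))^2 <= inner (mulop D A (snd V)) (snd V)" unfolding H(2) by (rule mulop_coercive[OF A H(1)])
 also have "mulop D A (snd V) = mulop D A (snd U) - mulop D A (snd g)" by (simp add: V_def m.diff)
 also have "inner ... (snd V) = inner F V - inner (mulop D A (snd g)) (snd V)" by (simp add: inner_diff_left V(2))
 also have "... <= norm F * norm V + norm (mulop D A (snd g)) * norm (snd V)"
  using norm_cauchy_schwarz[of F V] Cauchy_Schwarz_ineq2[of "mulop D A (snd g)" "snd V"] by linarith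
 also have "... <= norm F * ((1 + 2 * R) * norm (snd V)) + (La * norm g) * norm (snd V)"
 proof (intro add_mono mult_left_mono mult_right_mono poincare(2)[OF D V(1)])
  have "norm (mulop D A (snd g)) <= La * norm (snd g)" by (rule norm_mulop_le[OF A])
  also have "... <= La * norm g" using coefD(3)[OF A] norm_snd_le[of "snd g" "fst g"] by (intro mult_left_mono) auto
  finally show "norm (mulop D A (snd g)) <= La * norm g" .
 qed auto
 finally have "(mu * norm (snd V)) * norm (snd V) <= ((1 + 2 * R) * norm F + La * norm g) * norm (snd V)"
  by (simp add: power2_eq_square algebra_simps)
 then have "mu * norm (snd V) <= (1 + 2 * R) * norm F + La * norm g"
  using D(3) coefD(3)[OF A] by (cases "norm (snd V) = 0") (auto dest: mult_right_le_imp_le)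
 then have "norm (snd V) <= ((1 + 2 * R) * norm F + La * norm g) / mu" using mu by (simp add: field_simps)
 then have "norm V <= (1 + 2 * R) * (((1 + 2 * R) * norm F + La * norm g) / mu)"
  using poincare(2)[OF D V(1)] D(3) by (meson add_nonneg_nonneg mult_left_mono order_trans zero_le_one mult_nonneg_nonneg zero_le_numeral)
 moreover have "norm U <= norm V + norm g" using norm_triangle_ineq[of V g] by (simp add: V_def)
 ultimately show ?thesis by simp
qed

text \<open>Testing the difference of the two equations with U - U' leaves on the right only the
  discrepancy of the two fluxes at the one solution U'. Equal coefficients give uniqueness.\<close>

lemma sol_unique_perturb:
 assumes D: "open D" "D <= cball 0 R" "0 <= R" and A: "coef D mu La A" and mu: "0 < mu"
  and A': "coef D mu' La' A'" and U: "sol D A F g U" "sol D A' F g U'"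
  and d: "norm (mulop D A (snd U') - mulop D A' (snd U')) <= ta"
 shows "norm (U - U') <= (1 + 2 * R) * ta / mu"
proof -
 interpret m: bounded_linear "mulop D A" by (rule blin_mulop[OF A])
 define V where "V = U - U'"
 have V: "V : H10space D"
  using subspace_diff[OF H10space(1)[OF D(1)], of "U - g" "U' - g"] U by (simp add: sol_def V_def)
 obtain H where H: "sq_on D H" "snd V = cls D H" by (rule H10space_cls[OF D(1) V(1)])
 have "mu * (norm (snd V))^2 <= inner (mulop D A (snd V)) (snd V)" unfolding H(2) by (rule mulop_coercive[OF A H(1)])
 also have "... = inner (mulop D A (snd U)) (snd V) - inner (mulop D A (snd U')) (snd V)" by (simp add: V_def m.diff inner_diff_left)
 also have "... = inner (mulop D A' (snd U') - mulop D A (snd U')) (snd V)" using U V by (simp add: sol_def inner_diff_left)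
 also have "... <= norm (mulop D A' (snd U') - mulop D A (snd U')) * norm (snd V)" by (rule norm_cauchy_schwarz)
 also have "... <= ta * norm (snd V)" using d by (intro mult_right_mono) (simp_all add: norm_minus_commute)
 finally have "(mu * norm (snd V)) * norm (snd V) <= ta * norm (snd V)" by (simp add: power2_eq_square algebra_simps)
 then have "mu * norm (snd V) <= ta"
  using order_trans[OF norm_ge_zero d] by (cases "norm (snd V) = 0") (auto dest: mult_right_le_imp_le)
 then have "norm (snd V) <= ta / mu" using mu by (simp add: field_simps)
 then have "norm V <= (1 + 2 * R) * (ta / mu)"
  using poincare(2)[OF D V] D(3) by (meson add_nonneg_nonneg mult_left_mono order_trans zero_le_one mult_nonneg_nonneg zero_le_numeral)
 then show ?thesis by (simp add: V_def)
qed

lemma norm_cls_repr_le: "D : sets lebesgue ==> norm (cls D (repr V)) <= norm V"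
proof -
 assume D: "D : sets lebesgue"
 have "norm (cls UNIV (%x. ind D x *R repr V x)) <= 1 * norm (cls UNIV (repr V))"
 proof (rule norm_cls_le)
  show "sq_on UNIV (repr V)" by (rule sq_on_repr) simp
  show "sq_on UNIV (%x. ind D x *R repr V x)" using sq_on_repr[OF D, of V] by (simp add: sq_on_def)
 qed (auto simp: indicator_def)
 then show ?thesis by (simp add: cls_def repr(2))
qed

lemma mulop_diff_le:
 fixes A :: "real^'n => real^'n^'n"
 assumes A: "coef D mu La A" and A': "coef D mu' La' A'" and ta: "0 <= ta"
  "!!x xi. x : D ==> norm (A x *v xi - A' x *v xi) <= ta * norm xi"
 shows "norm (mulop D A V - mulop D A' V) <= ta * norm V"
proof -
 have r: "sq_on D (repr V)" by (rule sq_on_repr[OF coefD(1)[OF A]])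
 have "mulop D A V - mulop D A' V = cls D (%x. A x *v repr V x - A' x *v repr V x)"
  unfolding mulop_def by (rule cls_diff[symmetric, OF coefD(6)[OF A r] coefD(6)[OF A' r]])
 moreover have "norm ... <= ta * norm (cls D (repr V))"
  by (rule norm_cls_le[OF r sq_on_diff[OF coefD(6)[OF A r] coefD(6)[OF A' r]] _ ta(1)]) (simp add: ta(2))
 moreover have "... <= ta * norm V" by (rule mult_left_mono[OF norm_cls_repr_le[OF coefD(1)[OF A]] ta(1)])
 ultimately show ?thesis by simp
qed

section \<open>Weak convergence by duality\<close>

lemma weak_null_on_closure_span:
 fixes X :: "nat => 'a::real_inner"
 assumes bd: "!!m. norm (X m) <= C" and z: "!!Ps. Ps : S ==> (%m. inner (X m) Ps) ---> 0"
  and Y: "Y : closure (span S)"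
 shows "(%m. inner (X m) Y) ---> 0"
proof -
 have sp: "(%m. inner (X m) Z) ---> 0" if "Z : span S" for Z
  using that
 proof (induction rule: span_induct_alt)
  case (step c x y)
  have "(%m. c * inner (X m) x + inner (X m) y) ---> c * 0 + 0" by (intro tendsto_intros z step)
  then show ?case by (simp add: inner_add_right)
 qed simp
 have C: "0 <= C" using order_trans[OF norm_ge_zero bd] .
 show ?thesis
 proof (rule LIMSEQ_I)
  fix e :: real assume e: "e > 0"
  have "e / (2 * (C + 1)) > 0" using e C by simp
  with Y obtain Z where Z: "Z : span S" "dist Z Y < e / (2 * (C + 1))" using closure_approachable by metis
  from LIMSEQ_D[OF sp[OF Z(1)], of "e/2"] e
  obtain N where N: "!!m. m >= N ==> \<bar>inner (X m) Z\<bar> < e / 2" by auto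
  show "EX no. ALL n>=no. norm (inner (X n) Y - 0) < e"
  proof (intro exI allI impI)
   fix m assume m: "N <= m"
   have "\<bar>inner (X m) (Y - Z)\<bar> <= norm (X m) * norm (Y - Z)" by (rule Cauchy_Schwarz_ineq2)
   also have "... <= (C + 1) * (e / (2 * (C + 1)))"
    using Z(2) bd[of m] C by (intro mult_mono) (auto simp: dist_norm norm_minus_commute)
   also have "... = e / 2" using C by (simp add: field_simps)
   finally have "\<bar>inner (X m) (Y - Z)\<bar> <= e / 2" .
   with N[OF m] show "norm (inner (X m) Y - 0) < e" unfolding inner_diff_right real_norm_def by linarith
  qed
 qed
qed

text \<open>Let X m be the difference of the fluxes of A m and Ah on the same gradient. If V solves
  the adjoint homogenized problem with datum Q, the two equations give (U m - U0, Q) = -(X m, grad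
  V). So weak nullity of X m, assumed on a generating set \<open>S\<close> and extended by
  boundedness, yields weak convergence of the solutions and then of the fluxes.\<close>

lemma sol_weak_convergence:
 fixes D :: "(real^'n) set"
 assumes D: "open D" "D <= cball 0 R" "0 <= R" and mu: "0 < mu"
  and A: "!!m. coef D mu La (A m)" and Ah: "coef D mu La Ah"
  and U: "!!m. sol D (A m) F g (U m)" and U0: "sol D Ah F g U0"
  and K: "!!Ps. Ps : S ==> (%m. inner (mulop D (A m) (snd (U m)) - mulop D Ah (snd (U m))) Ps) ---> 0"
  and S: "!!H. sq_on D H ==> cls D H : closure (span S)"
 shows "(%m. inner (U m) V) ---> inner U0 V"
  and "sq_on D H ==> (%m. inner (mulop D (A m) (snd (U m))) (cls D H)) ---> inner (mulop D Ah (snd U0)) (cls D H)"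
proof -
 interpret h: bounded_linear "mulop D Ah" by (rule blin_mulop[OF Ah])
 obtain C where C: "!!m. norm (U m) <= C" using sol_bound[OF D A mu U] by blast
 define X where "X m = mulop D (A m) (snd (U m)) - mulop D Ah (snd (U m))" for m
 have Xb: "norm (X m) <= La * C + La * C" for m
 proof -
  have s: "norm (snd (U m)) <= C" using norm_snd_le[of "snd (U m)" "fst (U m)"] C[of m] by simp
  have "norm (X m) <= norm (mulop D (A m) (snd (U m))) + norm (mulop D Ah (snd (U m)))"
   unfolding X_def by (rule norm_triangle_ineq4)
  also have "... <= La * norm (snd (U m)) + La * norm (snd (U m))" by (intro add_mono norm_mulop_le[OF A] norm_mulop_le[OF Ah])
  also have "... <= La * C + La * C" using s coefD(3)[OF Ah] by (intro add_mono mult_left_mono) auto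
  finally show ?thesis .
 qed
 have X0: "(%m. inner (X m) (cls D H)) ---> 0" if "sq_on D H" for H
  by (rule weak_null_on_closure_span[OF Xb K[folded X_def] S[OF that]])
 have diffW: "U m - U0 : H10space D" for m
  using subspace_diff[OF H10space(1)[OF D(1)], of "U m - g" "U0 - g"] U[of m] U0 by (simp add: sol_def)
 have weak: "(%m. inner (U m - U0) Q) ---> 0" for Q
 proof -
  \<comment> \<open>The adjoint problem with \<open>Q\<close> as datum; it turns testing U m - U0
    with \<open>Q\<close> into testing fluxes with grad V.\<close>
  obtain V where V: "V : H10space D" "!!Y. Y : H10space D ==> inner (mulop D (%x. transpose (Ah x)) (snd V)) (snd Y) = inner Q Y"
   using lax_milgram_H10[OF D coef_transpose[OF Ah] mu] by blast
  obtain H where H: "sq_on D H" "snd V = cls D H" by (rule H10space_cls[OF D(1) V(1)])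
  have "inner (U m - U0) Q = - inner (X m) (cls D H)" for m
  proof -
   obtain H' where H': "sq_on D H'" "snd (U m - U0) = cls D H'" by (rule H10space_cls[OF D(1) diffW])
   have "inner (U m - U0) Q = inner (mulop D (%x. transpose (Ah x)) (snd V)) (snd (U m - U0))"
    using V(2)[OF diffW[of m]] by (simp add: inner_commute)
   also have "... = inner (mulop D Ah (snd (U m - U0))) (snd V)"
    unfolding H(2) H'(2) by (subst mulop_transpose[OF Ah H'(1) H(1)]) (rule inner_commute)
   also have "... = inner (mulop D Ah (snd (U m))) (snd V) - inner (mulop D Ah (snd U0)) (snd V)"
    by (simp add: h.diff inner_diff_left)
   also have "inner (mulop D Ah (snd U0)) (snd V) = inner (mulop D (A m) (snd (U m))) (snd V)"
    using U0 U[of m] V(1) by (simp add: sol_def)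
   finally show ?thesis by (simp add: X_def inner_diff_left H(2))
  qed
  then show ?thesis using tendsto_minus[OF X0[OF H(1)]] by simp
 qed
 from weak[of V] show "(%m. inner (U m) V) ---> inner U0 V" by (simp add: inner_diff_left LIM_zero_iff)
 assume H: "sq_on D H"
 let ?T = "mulop D (%x. transpose (Ah x)) (cls D H)"
 have eq: "inner (mulop D (A m) (snd (U m))) (cls D H)
   = inner (X m) (cls D H) + (inner (U m - U0) (0, ?T) + inner (mulop D Ah (snd U0)) (cls D H))" for m
 proof -
  obtain H' where H': "sq_on D H'" "snd (U m - U0) = cls D H'" by (rule H10space_cls[OF D(1) diffW])
  have "inner (U m - U0) (0, ?T) = inner (snd (U m - U0)) ?T" by (simp add: inner_prod_def)
  also have "... = inner (mulop D Ah (snd (U m - U0))) (cls D H)" unfolding H'(2) by (rule mulop_transpose[OF Ah H'(1) H, symmetric])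
  finally show ?thesis by (simp add: h.diff inner_diff_left X_def)
 qed
 have "(%m. inner (X m) (cls D H) + (inner (U m - U0) (0, ?T) + inner (mulop D Ah (snd U0)) (cls D H)))
   ---> 0 + (0 + inner (mulop D Ah (snd U0)) (cls D H))"
  by (intro tendsto_add X0[OF H] weak tendsto_const)
 then show "(%m. inner (mulop D (A m) (snd (U m))) (cls D H)) ---> inner (mulop D Ah (snd U0)) (cls D H)"
  unfolding eq by simp
qed

lemma LIMSEQ_uniform_approx:
 fixes a :: "nat => real"
 assumes b: "!!n. b n ---> b0 n" and ab: "!!n m. \<bar>a m - b n m\<bar> <= sgm n" "!!n. \<bar>a0 - b0 n\<bar> <= sgm n"
  and sgm: "sgm ---> 0"
 shows "a ---> a0"
proof (rule LIMSEQ_I)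
 fix e :: real assume e: "e > 0"
 obtain n where n: "sgm n < e / 3" using order_tendstoD(2)[OF sgm, of "e/3"] e by (auto simp: eventually_sequentially)
 from LIMSEQ_D[OF b[of n], of "e/3"] e obtain N where N: "!!m. m >= N ==> \<bar>b n m - b0 n\<bar> < e/3" by auto
 show "EX no. ALL m>=no. norm (a m - a0) < e"
 proof (intro exI allI impI)
  fix m assume "N <= m"
  from N[OF this] n ab(1)[of m n] ab(2)[of n] show "norm (a m - a0) < e" unfolding real_norm_def by linarith
 qed
qed

text \<open>The limits in the truncation n and in the scales m may be exchanged because the
  truncation error of solutions and fluxes is at most a constant times \<open>ta n\<close> uniformly
  in m. Hypothesis \<open>K\<close> thus concerns truncated coefficients only.\<close>

lemma sol_weak_convergence_approx:
 fixes D :: "(real^'n) set"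
 assumes D: "open D" "D <= cball 0 R" "0 <= R" and mu: "0 < mu"
  and A: "!!m. coef D mu La (A m)" and Ah: "coef D mu La Ah"
  and An: "!!n m. coef D mu La (An n m)" and Ahn: "!!n. coef D mu La (Ahn n)"
  and ta: "!!n. 0 <= ta n" "ta ---> 0"
   "!!n m x xi. x : D ==> norm (A m x *v xi - An n m x *v xi) <= ta n * norm xi"
   "!!n x xi. x : D ==> norm (Ah x *v xi - Ahn n x *v xi) <= ta n * norm xi"
  and U: "!!m. sol D (A m) F g (U m)" and U0: "sol D Ah F g U0"
  and K: "!!n W Ps. (!!m. sol D (An n m) F g (W m)) ==> Ps : S ==>
    (%m. inner (mulop D (An n m) (snd (W m)) - mulop D (Ahn n) (snd (W m))) Ps) ---> 0"
  and S: "!!H. sq_on D H ==> cls D H : closure (span S)"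
 shows "(%m. inner (U m) V) ---> inner U0 V"
  and "sq_on D H ==> (%m. inner (mulop D (A m) (snd (U m))) (cls D H)) ---> inner (mulop D Ah (snd U0)) (cls D H)"
proof -
 have "ALL n m. EX W. sol D (An n m) F g W" using sol_exists[OF D An mu] by blast
 then obtain W where W: "!!n m. sol D (An n m) F g (W n m)" by metis
 have "ALL n. EX W. sol D (Ahn n) F g W" using sol_exists[OF D Ahn mu] by blast
 then obtain W0 where W0: "!!n. sol D (Ahn n) F g (W0 n)" by metis
 define C where "C = (1 + 2 * R) * ((1 + 2 * R) * norm F + La * norm g) / mu + norm g"
 have Cb: "norm (W n m) <= C" "norm (W0 n) <= C" for n m
  unfolding C_def using sol_bound[OF D An mu W] sol_bound[OF D Ahn mu W0] by auto
 have C0: "0 <= C" using order_trans[OF norm_ge_zero Cb(2)] .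
 define c where "c = (1 + 2 * R) * C / mu"
 have c0: "0 <= c" using C0 D(3) mu by (simp add: c_def)
 have snd_le: "norm (snd Y) <= norm Y" for Y :: "(real^'n, real) l2 \<times> (real^'n, real^'n) l2"
  using norm_snd_le[of "snd Y" "fst Y"] by simp
 have dop: "norm (mulop D (A m) (snd (W n m)) - mulop D (An n m) (snd (W n m))) <= ta n * C"
   "norm (mulop D Ah (snd (W0 n)) - mulop D (Ahn n) (snd (W0 n))) <= ta n * C" for n m
  using mulop_diff_le[OF A[of m] An[of n m] ta(1)[of n] ta(3)[where n = n and m = m], where V = "snd (W n m)"]
   mulop_diff_le[OF Ah Ahn[of n] ta(1)[of n] ta(4)[where n = n], where V = "snd (W0 n)"]
   mult_left_mono[OF order_trans[OF snd_le Cb(1)[of n m]] ta(1)[of n]] mult_left_mono[OF order_trans[OF snd_le Cb(2)[of n]] ta(1)[of n]]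
  by linarith+
 have dU: "norm (U m - W n m) <= c * ta n" "norm (U0 - W0 n) <= c * ta n" for n m
  using sol_unique_perturb[OF D A[of m] mu An[of n m] U[of m] W[of n m] dop(1)] sol_unique_perturb[OF D Ah mu Ahn[of n] U0 W0[of n] dop(2)]
  by (simp_all add: c_def mult_ac)
 note conv = sol_weak_convergence[OF D mu An Ahn W W0 K[OF W] S]
 show "(%m. inner (U m) V) ---> inner U0 V"
 proof (rule LIMSEQ_uniform_approx[where sgm = "%n. c * ta n * norm V"])
  show "(%m. inner (W n m) V) ---> inner (W0 n) V" for n by (rule conv(1)) auto
  show "\<bar>inner (U m) V - inner (W n m) V\<bar> <= c * ta n * norm V" for n m
   unfolding inner_diff_left[symmetric]
   by (rule order_trans[OF Cauchy_Schwarz_ineq2 mult_right_mono[OF dU(1)]]) simp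
  show "\<bar>inner U0 V - inner (W0 n) V\<bar> <= c * ta n * norm V" for n
   unfolding inner_diff_left[symmetric]
   by (rule order_trans[OF Cauchy_Schwarz_ineq2 mult_right_mono[OF dU(2)]]) simp
  have "(%n. c * ta n * norm V) ---> c * 0 * norm V" by (intro tendsto_intros ta(2))
  then show "(%n. c * ta n * norm V) ---> 0" by simp
 qed
 assume H: "sq_on D H"
 define s where "s n = (La * (c * ta n) + ta n * C) * norm (cls D H)" for n
 have La: "0 <= La" by (rule coefD(3)[OF Ah])
 show "(%m. inner (mulop D (A m) (snd (U m))) (cls D H)) ---> inner (mulop D Ah (snd U0)) (cls D H)"
 proof (rule LIMSEQ_uniform_approx[where sgm = s])
  show "(%m. inner (mulop D (An n m) (snd (W n m))) (cls D H)) ---> inner (mulop D (Ahn n) (snd (W0 n))) (cls D H)" for n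
   by (rule conv(2)) (use H in auto)
  fix n
  show "\<bar>inner (mulop D (A m) (snd (U m))) (cls D H) - inner (mulop D (An n m) (snd (W n m))) (cls D H)\<bar> <= s n" for m
  proof -
   interpret a: bounded_linear "mulop D (A m)" by (rule blin_mulop[OF A])
   have "mulop D (A m) (snd (U m)) - mulop D (An n m) (snd (W n m))
    = mulop D (A m) (snd (U m - W n m)) + (mulop D (A m) (snd (W n m)) - mulop D (An n m) (snd (W n m)))" by (simp add: a.diff)
   also have "norm ... <= norm (mulop D (A m) (snd (U m - W n m))) + norm (mulop D (A m) (snd (W n m)) - mulop D (An n m) (snd (W n m)))"
    by (rule norm_triangle_ineq)
   also have "... <= La * (c * ta n) + ta n * C"
    by (intro add_mono order_trans[OF norm_mulop_le[OF A]] mult_left_mono[OF order_trans[OF snd_le dU(1)] La] dop)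
   finally show ?thesis unfolding s_def inner_diff_left[symmetric]
    by (intro order_trans[OF Cauchy_Schwarz_ineq2] mult_right_mono) auto
  qed
  interpret a: bounded_linear "mulop D Ah" by (rule blin_mulop[OF Ah])
  have "mulop D Ah (snd U0) - mulop D (Ahn n) (snd (W0 n))
   = mulop D Ah (snd (U0 - W0 n)) + (mulop D Ah (snd (W0 n)) - mulop D (Ahn n) (snd (W0 n)))" by (simp add: a.diff)
  also have "norm ... <= norm (mulop D Ah (snd (U0 - W0 n))) + norm (mulop D Ah (snd (W0 n)) - mulop D (Ahn n) (snd (W0 n)))"
   by (rule norm_triangle_ineq)
  also have "... <= La * (c * ta n) + ta n * C"
   by (intro add_mono order_trans[OF norm_mulop_le[OF Ah]] mult_left_mono[OF order_trans[OF snd_le dU(2)] La] dop)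
  finally show "\<bar>inner (mulop D Ah (snd U0)) (cls D H) - inner (mulop D (Ahn n) (snd (W0 n))) (cls D H)\<bar> <= s n"
   unfolding s_def inner_diff_left[symmetric]
   by (intro order_trans[OF Cauchy_Schwarz_ineq2] mult_right_mono) auto
 next
  have "s ---> (La * (c * 0) + 0 * C) * norm (cls D H)" unfolding s_def by (intro tendsto_intros ta(2))
  then show "s ---> 0" by simp
 qed
qed

section \<open>Periodic functions and their weak gradients\<close>

text \<open>The half-open cell: its integer translates tile the space exactly, while it differs from
  the closed cell by a null set.\<close>

definition hcell :: "(real^'n) set" where "hcell = {x. ALL i. 0 <= x $ i & x $ i < 1}"

lemma One_nth: "(SUM x:Basis. (x :: real^'n) $ i) = 1"
proof -
 have "(SUM x:Basis. (x :: real^'n) $ i) = (SUM x:Basis. if x = axis i (1::real) then 1 else 0)"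
  by (rule sum.cong) (auto simp: cart_eq_inner_axis inner_Basis axis_in_Basis_iff)
 also have "... = 1" by (simp add: axis_in_Basis_iff)
 finally show ?thesis .
qed

lemma mem_unit_cell: "x : cell \<longleftrightarrow> (ALL i. 0 <= x $ i & x $ i <= 1)"
 by (simp add: unit_cell_def mem_box_cart One_nth)

lemma hcell_subset: "hcell <= cell" "box 0 One <= hcell"
 by (auto simp: mem_unit_cell hcell_def mem_box_cart One_nth less_imp_le)

lemma AE_unit_cell_hcell: "AE x in lborel. x : cell \<longleftrightarrow> x : (hcell :: (real^'n) set)"
proof -
 have "negligible (cbox 0 One - box 0 (One :: real^'n))" by (rule negligible_frontier_interval)
 then have "AE x in lebesgue. x ~: cbox 0 One - box 0 (One :: real^'n)"
  by (intro AE_not_in) (simp add: negligible_iff_null_sets)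
 then have "AE x in lborel. x ~: cbox 0 One - box 0 (One :: real^'n)" by (simp add: AE_completion_iff)
 then show ?thesis
 proof eventually_elim
  case (elim x)
  then show ?case using hcell_subset unfolding unit_cell_def by blast
 qed
qed

lemma hcell_borel[measurable]: "hcell : sets borel"
proof -
 have "hcell = (\<Inter>i\<in>UNIV. {x::real^'n. 0 <= x $ i} \<inter> {x. x $ i < 1})" by (auto simp: hcell_def)
 also have "... : sets borel"
  by (intro sets.countable_INT'' sets.Int borel_closed borel_open closed_Collect_le open_Collect_less continuous_intros) auto
 finally show ?thesis .
qed

lemma int_vec_add: "int_vec a ==> int_vec b ==> int_vec (a + b)"
 and int_vec_minus: "int_vec a ==> int_vec (- a)"
 and int_vec_diff: "int_vec a ==> int_vec b ==> int_vec (a - b)"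
 and int_vec_zero: "int_vec 0"
 by (auto simp: int_vec_def)

lemma int_vec_enum: "EX e :: nat => real^'n. bij_betw e UNIV {ka. int_vec ka}"
proof -
 have "{ka::real^'n. int_vec ka} <= range (%k::'n => int. \<chi> i. of_int (k i))"
 proof
  fix ka :: "real^'n" assume "ka : {ka. int_vec ka}"
  then have "ka = (\<chi> i. of_int \<lfloor>ka $ i\<rfloor>)" by (auto simp: int_vec_def vec_eq_iff Ints_def)
  then show "ka : range (%k::'n => int. \<chi> i. of_int (k i))"
   by (rule image_eqI[where x = "%i. \<lfloor>ka $ i\<rfloor>"]) simp
 qed
 then have c: "countable {ka::real^'n. int_vec ka}" by (rule countable_subset) simp
 have "infinite (range (%k::nat. (\<chi> i. real k) :: real^'n))"
  by (rule range_inj_infinite) (auto simp: inj_def vec_eq_iff)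
 moreover have "range (%k::nat. (\<chi> i. real k) :: real^'n) <= {ka. int_vec ka}" by (auto simp: int_vec_def)
 ultimately have i: "infinite {ka::real^'n. int_vec ka}" using finite_subset by blast
 obtain g where "bij_betw g {ka::real^'n. int_vec ka} (UNIV::nat set)" by (rule countableE_infinite[OF c i])
 then show ?thesis using bij_betw_the_inv_into by blast
qed

lemma int_vec_unique_shift: "EX! ka. int_vec ka & x + ka : hcell"
proof (rule ex1I[of _ "\<chi> i. - of_int \<lfloor>x $ i\<rfloor>"])
 have "0 <= x $ i - of_int \<lfloor>x $ i\<rfloor> & x $ i - of_int \<lfloor>x $ i\<rfloor> < 1" for i by linarith
 then show "int_vec (\<chi> i. - of_int \<lfloor>x $ i\<rfloor>) & x + (\<chi> i. - of_int \<lfloor>x $ i\<rfloor>) : hcell"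
  by (auto simp: int_vec_def hcell_def)
 fix ka assume ka: "int_vec ka & x + ka : hcell"
 have "ka $ i = - of_int \<lfloor>x $ i\<rfloor>" for i
 proof -
  obtain k :: int where k: "ka $ i = of_int k" using ka by (auto simp: int_vec_def Ints_def)
  have "0 <= x $ i + of_int k" "x $ i + of_int k < 1" using ka k by (auto simp: hcell_def dest: spec[of _ i])
  then have "\<lfloor>x $ i\<rfloor> = - k" by linarith
  then show ?thesis by (simp add: k)
 qed
 then show "ka = (\<chi> i. - of_int \<lfloor>x $ i\<rfloor>)" by (simp add: vec_eq_iff)
qed

lemma suminf_int_vec_indicator:
 fixes e :: "nat => real^'n"
 assumes e: "bij_betw e UNIV {ka. int_vec ka}"
 shows "(\<Sum>n. indicator hcell (x + e n) :: ennreal) = 1"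
proof -
 obtain ka where ka: "int_vec ka" "x + ka : hcell" "!!ka'. int_vec ka' ==> x + ka' : hcell ==> ka' = ka"
  using int_vec_unique_shift[of x] by blast
 obtain n where n: "e n = ka" using e ka(1) by (metis (mono_tags) bij_betw_imp_surj_on imageE mem_Collect_eq)
 have ei: "int_vec (e m)" for m using e by (auto simp: bij_betw_def)
 have inj: "inj e" using e by (simp add: bij_betw_def)
 have "(\<Sum>n. indicator hcell (x + e n) :: ennreal) = (SUM m:{n}. indicator hcell (x + e m))"
 proof (rule suminf_finite)
  fix m assume "m ~: {n}"
  then have "e m ~= ka" using inj n by (auto simp: inj_def)
  then show "(indicator hcell (x + e m) :: ennreal) = 0" using ka(3)[OF ei] by (auto simp: indicator_def)
 qed simp
 then show ?thesis using ka(2) n by simp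
qed

text \<open>The exceptional null set may depend on the period. This is all that Borel
  representatives and weak gradients inherit from an exactly periodic function.\<close>

definition ae_periodic :: "(real^'n => 'b) => bool" where
 "ae_periodic f \<longleftrightarrow> (ALL ka. int_vec ka --> (AE x in lborel. f (ka + x) = f x))"

lemma nn_integral_lborel_translate:
 fixes f :: "'a::euclidean_space => ennreal"
 assumes [measurable]: "f : borel_measurable borel"
 shows "(\<integral>\<^sup>+x. f (c + x) \<partial>lborel) = (\<integral>\<^sup>+x. f x \<partial>lborel)"
 by (subst (2) lborel_distr_plus[of c, symmetric]) (simp add: nn_integral_distr)

text \<open>Cut the shifted cell into its intersections with the integer translates of the cell and
  move each piece back by periodicity; both cells meet every orbit of the integer lattice exactly
  once.\<close>

lemma nn_integral_hcell_shift:
 fixes f :: "real^'n => ennreal"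
 assumes f[measurable]: "f : borel_measurable borel" and per: "ae_periodic f"
 shows "(\<integral>\<^sup>+x. f (a + x) * indicator hcell x \<partial>lborel) = (\<integral>\<^sup>+x. f x * indicator hcell x \<partial>lborel)"
proof -
 obtain e :: "nat => real^'n" where e: "bij_betw e UNIV {ka. int_vec ka}" using int_vec_enum by blast
 have ei: "int_vec (e m)" for m using e by (auto simp: bij_betw_def)
 have e': "bij_betw (%n. - e n) UNIV {ka. int_vec ka}"
 proof -
  have "bij_betw uminus {ka::real^'n. int_vec ka} {ka. int_vec ka}"
   by (rule bij_betwI[of _ _ _ uminus]) (auto simp: int_vec_minus)
  from bij_betw_trans[OF e this] show ?thesis by (simp add: o_def)
 qed
 have "(\<integral>\<^sup>+x. f (a + x) * indicator hcell x \<partial>lborel) = (\<integral>\<^sup>+x. f (a + x) * indicator hcell (- a + (a + x)) \<partial>lborel)"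
  by simp
 also have "... = (\<integral>\<^sup>+x. f x * indicator hcell (- a + x) \<partial>lborel)"
  by (rule nn_integral_lborel_translate[of "%x. f x * indicator hcell (- a + x)" a]) measurable
 also have "... = (\<integral>\<^sup>+x. f x * indicator hcell (- a + x) * (\<Sum>n. indicator hcell (x + e n)) \<partial>lborel)"
  by (simp add: suminf_int_vec_indicator[OF e])
 also have "... = (\<integral>\<^sup>+x. (\<Sum>n. f x * indicator hcell (- a + x) * indicator hcell (x + e n)) \<partial>lborel)"
  by (simp add: ennreal_suminf_cmult)
 also have "... = (\<Sum>n. \<integral>\<^sup>+x. f x * indicator hcell (- a + x) * indicator hcell (x + e n) \<partial>lborel)"
  by (rule nn_integral_suminf) measurable
 also have "... = (\<Sum>n. \<integral>\<^sup>+x. f x * indicator hcell (x - a + - e n) * indicator hcell x \<partial>lborel)"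
 proof (rule suminf_cong)
  fix n
  have "(\<integral>\<^sup>+x. f x * indicator hcell (- a + x) * indicator hcell (x + e n) \<partial>lborel)
    = (\<integral>\<^sup>+x. f (- e n + x) * indicator hcell (- a + (- e n + x)) * indicator hcell ((- e n + x) + e n) \<partial>lborel)"
   by (rule nn_integral_lborel_translate[symmetric, of "%x. f x * indicator hcell (- a + x) * indicator hcell (x + e n)" "- e n"]) measurable
  also have "... = (\<integral>\<^sup>+x. f x * indicator hcell (x - a + - e n) * indicator hcell x \<partial>lborel)"
  proof (rule nn_integral_cong_AE)
   have "AE x in lborel. f (- e n + x) = f x" using per int_vec_minus[OF ei[of n]] unfolding ae_periodic_def by blast
   then show "AE x in lborel. f (- e n + x) * indicator hcell (- a + (- e n + x)) * indicator hcell ((- e n + x) + e n)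
     = f x * indicator hcell (x - a + - e n) * indicator hcell x"
    by eventually_elim (simp add: algebra_simps)
  qed
  finally show "(\<integral>\<^sup>+x. f x * indicator hcell (- a + x) * indicator hcell (x + e n) \<partial>lborel)
   = (\<integral>\<^sup>+x. f x * indicator hcell (x - a + - e n) * indicator hcell x \<partial>lborel)" .
 qed
 also have "... = (\<integral>\<^sup>+x. (\<Sum>n. f x * indicator hcell (x - a + - e n) * indicator hcell x) \<partial>lborel)"
  by (rule nn_integral_suminf[symmetric]) measurable
 also have "... = (\<integral>\<^sup>+x. f x * indicator hcell x * (\<Sum>n. indicator hcell (x - a + - e n)) \<partial>lborel)"
 proof (rule nn_integral_cong)
  fix x
  have "(\<Sum>n. f x * indicator hcell (x - a + - e n) * indicator hcell x)
   = (\<Sum>n. (f x * indicator hcell x) * indicator hcell (x - a + - e n))"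
   by (rule suminf_cong) (simp only: mult_ac)
  then show "(\<Sum>n. f x * indicator hcell (x - a + - e n) * indicator hcell x)
   = f x * indicator hcell x * (\<Sum>n. indicator hcell (x - a + - e n))"
   by (simp only: ennreal_suminf_cmult)
 qed
 also have "... = (\<integral>\<^sup>+x. f x * indicator hcell x \<partial>lborel)"
  by (simp only: suminf_int_vec_indicator[OF e'] mult_1_right)
 finally show ?thesis .
qed

lemma integral_hcell_shift:
 fixes h :: "real^'n => real"
 assumes h[measurable]: "h : borel_measurable borel" and per: "ae_periodic h"
 shows "(\<integral>x. ind hcell x * h (a + x) \<partial>lborel) = (\<integral>x. ind hcell x * h x \<partial>lborel)"
  and "integrable lborel (%x. ind hcell x * h x) ==> integrable lborel (%x. ind hcell x * h (a + x))"
proof -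
 have p: "ae_periodic (%x. ennreal (h x))" "ae_periodic (%x. ennreal (- h x))" "ae_periodic (%x. ennreal \<bar>h x\<bar>)"
  using per by (auto simp: ae_periodic_def elim!: eventually_mono)
 have m: "(%x. ennreal (h x)) : borel_measurable borel" "(%x. ennreal (- h x)) : borel_measurable borel" "(%x. ennreal \<bar>h x\<bar>) : borel_measurable borel"
  by measurable
 have e: "ennreal (ind hcell x * h y) = ennreal (h y) * indicator hcell x"
  "ennreal (- (ind hcell x * h y)) = ennreal (- h y) * indicator hcell x"
  "ennreal (norm (ind hcell x * h y)) = ennreal \<bar>h y\<bar> * indicator hcell x" for x y
  by (auto simp: indicator_def)
 have eq: "(\<integral>\<^sup>+x. ennreal (norm (ind hcell x * h (a + x))) \<partial>lborel) = (\<integral>\<^sup>+x. ennreal (norm (ind hcell x * h x)) \<partial>lborel)"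
  unfolding e by (rule nn_integral_hcell_shift[OF m(3) p(3)])
 have i: "integrable lborel (%x. ind hcell x * h (a + x)) \<longleftrightarrow> integrable lborel (%x. ind hcell x * h x)"
  unfolding integrable_iff_bounded eq by simp
 show "integrable lborel (%x. ind hcell x * h x) ==> integrable lborel (%x. ind hcell x * h (a + x))"
  using i by simp
 show "(\<integral>x. ind hcell x * h (a + x) \<partial>lborel) = (\<integral>x. ind hcell x * h x \<partial>lborel)"
 proof (cases "integrable lborel (%x. ind hcell x * h x)")
  case True
  then show ?thesis using i unfolding real_lebesgue_integral_def[OF True] real_lebesgue_integral_def[OF i[THEN iffD2, OF True]] e
   by (simp only: nn_integral_hcell_shift[OF m(1) p(1)] nn_integral_hcell_shift[OF m(2) p(2)])
 next
  case False
  then show ?thesis using i by (simp add: not_integrable_integral_eq)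
 qed
qed

text \<open>Averaging the position of the cutoff over one cell decouples it from the periodic
  factor: after Fubini the inner integral is a shifted cell integral, independent of the shift. This
  converts identities with compactly supported test functions into cell integrals.\<close>

lemma average_over_cell:
 fixes h :: "real^'n => real"
 assumes h[measurable]: "h : borel_measurable borel" and per: "ae_periodic h"
  and hi: "integrable lborel (%x. ind hcell x * h x)"
  and th: "continuous_on UNIV te" "compact K" "!!x. x ~: K ==> te x = 0"
 shows "(\<integral>a. ind hcell a * (\<integral>x. te (x - a) * h x \<partial>lborel) \<partial>lborel)
  = (\<integral>x. te x \<partial>lborel) * (\<integral>x. ind hcell x * h x \<partial>lborel)"
proof -
 have [measurable]: "te : borel_measurable borel" using th(1) by (rule borel_measurable_continuous_onI)
 have ti: "integrable lborel te" by (rule integrable_cont_support[OF th])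
 define f where "f x a = ind hcell a * (te x * h (x + a))" for x a
 have fm: "case_prod f : borel_measurable (lborel \<Otimes>\<^sub>M lborel)" unfolding f_def by measurable
 have pabs: "ae_periodic (%x. \<bar>h x\<bar>)" using per by (auto simp: ae_periodic_def elim!: eventually_mono)
 have fi: "integrable (lborel \<Otimes>\<^sub>M lborel) (case_prod f)"
 proof (rule integrableI_bounded[OF fm])
  have "(\<integral>\<^sup>+p. ennreal (norm (case_prod f p)) \<partial>(lborel \<Otimes>\<^sub>M lborel)) = (\<integral>\<^sup>+x. \<integral>\<^sup>+a. ennreal (norm (f x a)) \<partial>lborel \<partial>lborel)"
   using fm by (subst lborel.nn_integral_fst[symmetric]) (auto simp: split_def)
  also have "... = (\<integral>\<^sup>+x. ennreal \<bar>te x\<bar> * (\<integral>\<^sup>+a. ennreal \<bar>h a\<bar> * indicator hcell a \<partial>lborel) \<partial>lborel)"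
  proof (rule nn_integral_cong)
   fix x :: "real^'n"
   have "(\<integral>\<^sup>+a. ennreal (norm (f x a)) \<partial>lborel) = (\<integral>\<^sup>+a. ennreal \<bar>te x\<bar> * (ennreal \<bar>h (x + a)\<bar> * indicator hcell a) \<partial>lborel)"
    by (rule nn_integral_cong) (auto simp: f_def indicator_def abs_mult ennreal_mult)
   also have "... = ennreal \<bar>te x\<bar> * (\<integral>\<^sup>+a. ennreal \<bar>h (x + a)\<bar> * indicator hcell a \<partial>lborel)"
    by (rule nn_integral_cmult) measurable
   also have "(\<integral>\<^sup>+a. ennreal \<bar>h (x + a)\<bar> * indicator hcell a \<partial>lborel) = (\<integral>\<^sup>+a. ennreal \<bar>h a\<bar> * indicator hcell a \<partial>lborel)"
    by (rule nn_integral_hcell_shift) (use pabs in "auto simp: ae_periodic_def elim!: eventually_mono")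
   finally show "(\<integral>\<^sup>+a. ennreal (norm (f x a)) \<partial>lborel) = ennreal \<bar>te x\<bar> * (\<integral>\<^sup>+a. ennreal \<bar>h a\<bar> * indicator hcell a \<partial>lborel)" .
  qed
  also have "... = (\<integral>\<^sup>+x. ennreal \<bar>te x\<bar> \<partial>lborel) * (\<integral>\<^sup>+a. ennreal \<bar>h a\<bar> * indicator hcell a \<partial>lborel)"
   by (rule nn_integral_multc) measurable
  also have "... < \<infinity>"
  proof (rule ennreal_mult_less_top[THEN iffD2, unfolded infinity_ennreal_def[symmetric]], intro disjI2 conjI)
   show "(\<integral>\<^sup>+x. ennreal \<bar>te x\<bar> \<partial>lborel) < \<infinity>" using ti by (simp add: integrable_iff_bounded)
   have "(\<integral>\<^sup>+a. ennreal \<bar>h a\<bar> * indicator hcell a \<partial>lborel) = (\<integral>\<^sup>+x. ennreal (norm (ind hcell x * h x)) \<partial>lborel)"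
    by (rule nn_integral_cong) (auto simp: indicator_def)
   then show "(\<integral>\<^sup>+a. ennreal \<bar>h a\<bar> * indicator hcell a \<partial>lborel) < \<infinity>" using hi by (simp add: integrable_iff_bounded)
  qed
  finally show "(\<integral>\<^sup>+p. ennreal (norm (case_prod f p)) \<partial>(lborel \<Otimes>\<^sub>M lborel)) < \<infinity>" .
 qed
 have "(\<integral>a. ind hcell a * (\<integral>x. te (x - a) * h x \<partial>lborel) \<partial>lborel) = (\<integral>a. (\<integral>x. f x a \<partial>lborel) \<partial>lborel)"
 proof (rule Bochner_Integration.integral_cong[OF refl])
  fix a :: "real^'n"
  have "(\<integral>x. te (x - a) * h x \<partial>lborel) = (\<integral>x. te ((a + x) - a) * h (a + x) \<partial>lborel)"
   by (rule lborel_integral_translate(1)[symmetric, of "%x. te (x - a) * h x" a]) measurable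
  then show "ind hcell a * (\<integral>x. te (x - a) * h x \<partial>lborel) = (\<integral>x. f x a \<partial>lborel)"
   by (simp add: f_def add.commute)
 qed
 also have "... = (\<integral>x. (\<integral>a. f x a \<partial>lborel) \<partial>lborel)" by (rule lborel_pair.Fubini_integral[OF fi])
 also have "... = (\<integral>x. te x * (\<integral>a. ind hcell a * h a \<partial>lborel) \<partial>lborel)"
 proof (rule Bochner_Integration.integral_cong[OF refl])
  fix x :: "real^'n"
  have "(\<integral>a. f x a \<partial>lborel) = (\<integral>a. te x * (ind hcell a * h (x + a)) \<partial>lborel)"
   by (rule Bochner_Integration.integral_cong) (auto simp: f_def)
  then show "(\<integral>a. f x a \<partial>lborel) = te x * (\<integral>a. ind hcell a * h a \<partial>lborel)"
   by (simp add: integral_hcell_shift(1)[OF h per])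
 qed
 also have "... = (\<integral>x. te x \<partial>lborel) * (\<integral>x. ind hcell x * h x \<partial>lborel)" by simp
 finally show ?thesis .
qed

section \<open>Orthogonality of periodic gradients and solenoidal fields\<close>

lemma Ck_translate: "Ck k f ==> Ck k (%x. f (x - a))" and pd_translate: "(!!x. f differentiable (at x)) ==> pd i (%x. f (x - a)) = (%x. pd i f (x - a))"
proof -
 have d: "((%x. f (x - a)) has_derivative (%h. grad f (x - a) \<bullet> h)) (at x)" if "!!x. f differentiable (at x)" for f :: "real^'a => real" and x a
 proof -
  have "((%x. x - a) has_derivative (%h. h)) (at x)" by (auto intro!: derivative_eq_intros)
  from has_derivative_compose[OF this has_derivative_grad[OF that]] show ?thesis by simp
 qed
 have p: "pd i (%x. f (x - a)) = (%x. pd i f (x - a))" if "!!x. f differentiable (at x)" for f :: "real^'a => real" and a i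
  using grad_eq[OF d[OF that]] by (simp add: grad_nth[symmetric] fun_eq_iff)
 show "pd i (%x. f (x - a)) = (%x. pd i f (x - a))" if "!!x. f differentiable (at x)" by (rule p[OF that])
 show "Ck k f ==> Ck k (%x. f (x - a))"
 proof (induction k arbitrary: f)
  case 0
  then show ?case by (auto intro!: continuous_on_compose2[of UNIV f] continuous_intros)
 next
  case (Suc k)
  then have f: "!!x. f differentiable (at x)" "!!i. Ck k (pd i f)" unfolding Ck_Suc_iff by blast+
  show ?case unfolding Ck_Suc_iff p[OF f(1)] using Suc.IH[OF f(2)] d[OF f(1), of a] by (auto simp: differentiable_def)
 qed
qed

lemma smooth_translate: "smooth f ==> smooth (%x. f (x - a))"
 by (simp add: smooth_def Ck_translate)

lemma test_fun_translate: assumes "test_fun UNIV te" shows "test_fun UNIV (%x. te (x - a))"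
proof -
 obtain K where K: "compact K" "K <= UNIV" "!!x. x ~: K ==> te x = 0" "smooth te" by (rule test_funD[OF assms]) blast
 show ?thesis
 proof (rule test_funI[OF smooth_translate[OF K(4)], of "(+) a ` K"])
  show "compact ((+) a ` K)" by (rule compact_translation[OF K(1)])
  fix x assume "x ~: (+) a ` K"
  then have "x - a ~: K" by (metis add_diff_cancel_left' image_eqI diff_add_cancel add.commute)
  then show "te (x - a) = 0" by (rule K(3))
 qed simp
qed

text \<open>The field t et is periodic and divergence free. The weak gradient is tested with a
  cutoff at \<open>a\<close> times t and the result is averaged over \<open>a\<close>: the cutoff on
  the gradient side becomes its nonzero integral, and on the other side its derivative appears,
  whose integral is zero.\<close>

lemma gradient_orthogonal_solenoidal_borel:
 fixes w :: "real^'n => real" and G :: "real^'n => real^'n"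
 assumes w[measurable]: "w : borel_measurable borel" and G[measurable]: "G : borel_measurable borel"
  and per: "ae_periodic w" "ae_periodic G"
  and loc: "!!K. compact K ==> set_integrable lborel K w" "!!K. compact K ==> set_integrable lborel K G"
  and weak: "!!ph i. test_fun UNIV ph ==> (\<integral>x. w x * pd i ph x \<partial>lborel) = - (\<integral>x. G x $ i * ph x \<partial>lborel)"
  and t: "smooth t" "periodic t" "!!x. et \<bullet> grad t x = 0"
 shows "(\<integral>x. ind hcell x * ((G x \<bullet> et) * t x) \<partial>lborel) = 0"
proof -
 obtain te :: "real^'n => real" where te: "smooth te" "!!x. 0 <= te x" "!!x. te x <= 1" "!!x. te x > 0 \<longleftrightarrow> x : box 0 One"
  using box_bump[of 0 One] by blast
 have te0: "te x = 0" if "x ~: cbox 0 One" for x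
  using te(2)[of x] te(4)[of x] that box_subset_cbox[of 0 "One :: real^'n"] by force
 have tet: "test_fun UNIV te" by (rule test_funI[OF te(1) compact_cbox _ te0]) auto
 have tec: "continuous_on UNIV te" by (rule smooth_cont[OF te(1)])
 have tc: "continuous_on UNIV t" by (rule smooth_cont[OF t(1)])
 have tm[measurable]: "t : borel_measurable borel" using tc by (rule borel_measurable_continuous_onI)
 have tei: "integrable lborel te" by (rule integrable_cont_support[OF tec compact_cbox te0])
 have pos: "(\<integral>x. te x \<partial>lborel) ~= 0"
 proof
  assume "(\<integral>x. te x \<partial>lborel) = 0"
  then have "AE x in lborel. te x = 0" using integral_nonneg_eq_0_iff_AE[OF tei] te(2) by simp
  then have "AE x in lborel. x ~: box 0 (One :: real^'n)" by eventually_elim (metis te(4) less_irrefl)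
  then have "emeasure lborel (box 0 (One :: real^'n)) = 0" by (subst (asm) AE_iff_measurable[of "box 0 One"]) auto
  then show False by (simp add: emeasure_lborel_box_eq)
 qed
 have int_mult: "integrable lborel (%x. u x * f x)"
  if ul: "!!K. compact K ==> set_integrable lborel K u" and um: "u : borel_measurable borel" and ft: "test_fun UNIV f" for u f :: "real^'n => real"
 proof -
  obtain K where K: "compact K" "K <= UNIV" "!!x. x ~: K ==> f x = 0" "smooth f" by (rule test_funD[OF ft]) blast
  obtain C where C: "!!x. \<bar>f x\<bar> <= C" using bounded_grad_test_fun[OF ft] by blast
  have fm[measurable]: "f : borel_measurable borel" using smooth_cont[OF K(4)] by (rule borel_measurable_continuous_onI)
  show ?thesis
  proof (rule Bochner_Integration.integrable_bound)
   show "integrable lborel (%x. C * (ind K x * u x))"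
    using ul[OF K(1)] by (simp add: set_integrable_def)
   show "(%x. u x * f x) : borel_measurable lborel" using um by measurable
   have "norm (u x * f x) <= norm (C * (ind K x * u x))" for x
   proof (cases "x : K")
    case True
    have "\<bar>u x\<bar> * \<bar>f x\<bar> <= \<bar>u x\<bar> * \<bar>C\<bar>" using C[of x] by (intro mult_left_mono) auto
    then show ?thesis using True by (simp add: abs_mult mult.commute)
   qed (simp add: K(3))
   then show "AE x in lborel. norm (u x * f x) <= norm (C * (ind K x * u x))" by simp
  qed
 qed
 have Gm[measurable]: "(%x. G x $ i) : borel_measurable borel" for i
 proof -
  have "(%x. G x \<bullet> axis i 1) : borel_measurable borel" by measurable
  then show ?thesis by (simp add: inner_axis)
 qed
 have locG: "set_integrable lborel K (%x. G x $ i)" if "compact K" for K i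
 proof -
  have "integrable lborel (%x. (ind K x *R G x) $ i)"
   using integrable_bounded_linear[OF bounded_linear_vec_nth loc(2)[OF that, unfolded set_integrable_def]] by simp
  then show ?thesis by (simp add: set_integrable_def)
 qed
 define h1 where "h1 x = w x * t x" for x
 define h2 where "h2 x = (G x \<bullet> et) * t x" for x
 have hm[measurable]: "h1 : borel_measurable borel" "h2 : borel_measurable borel" unfolding h1_def h2_def by measurable
 have hp: "ae_periodic h1" "ae_periodic h2"
 proof -
  have tp: "t (ka + x) = t x" if "int_vec ka" for ka x
   using t(2)[unfolded periodic_def, rule_format, OF that, of x] by (simp only: add.commute[of x])
  show "ae_periodic h1" "ae_periodic h2" using per unfolding ae_periodic_def h1_def h2_def
   by (auto elim!: eventually_mono simp: tp)
 qed
 have hci: "integrable lborel (%x. ind hcell x * h1 x)" "integrable lborel (%x. ind hcell x * h2 x)"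
 proof -
  obtain C where C: "!!x. x : cbox 0 One ==> norm (t x) <= C"
   using compact_imp_bounded[OF compact_continuous_image[OF continuous_on_subset[OF tc subset_UNIV] compact_cbox[of 0 "One :: real^'n"]]]
   by (auto simp: bounded_iff)
  have hc: "hcell <= cbox 0 (One :: real^'n)" using hcell_subset by (simp add: unit_cell_def)
  have gen: "integrable lborel (%x. ind hcell x * (u x * t x))"
   if u: "set_integrable lborel (cbox 0 One) u" and [measurable]: "u : borel_measurable borel" for u :: "real^'n => real"
  proof (rule Bochner_Integration.integrable_bound)
   show "integrable lborel (%x. C * (ind (cbox 0 One) x * u x))" using u by (simp add: set_integrable_def)
   have "norm (ind hcell x * (u x * t x)) <= norm (C * (ind (cbox 0 One) x * u x))" for x
   proof (cases "x : hcell")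
    case True
    then have x: "x : cbox 0 One" using hc by blast
    have "\<bar>u x\<bar> * \<bar>t x\<bar> <= \<bar>u x\<bar> * \<bar>C\<bar>" using C[OF x] by (intro mult_left_mono) auto
    then show ?thesis using True x by (simp add: abs_mult mult.commute)
   qed simp
   then show "AE x in lborel. norm (ind hcell x * (u x * t x)) <= norm (C * (ind (cbox 0 One) x * u x))" by simp
  qed measurable
  show "integrable lborel (%x. ind hcell x * h1 x)" unfolding h1_def by (rule gen[OF loc(1)[OF compact_cbox] w])
  have "integrable lborel (%x. (ind (cbox 0 One) x *R G x) \<bullet> et)"
   using loc(2)[OF compact_cbox, unfolded set_integrable_def] by (rule integrable_inner_left)
  then have "set_integrable lborel (cbox 0 One) (%x. G x \<bullet> et)" by (simp add: set_integrable_def)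
  from gen[OF this] show "integrable lborel (%x. ind hcell x * h2 x)" unfolding h2_def by simp
 qed
 \<comment> \<open>As et . grad t = 0, the derivative of the product along \<open>et\<close> falls
   on the cutoff alone.\<close>
 have id: "(\<integral>x. (et \<bullet> grad te (x - a)) * h1 x \<partial>lborel) = - (\<integral>x. te (x - a) * h2 x \<partial>lborel)" for a
 proof -
  define ph where "ph x = te (x - a) * t x" for x
  have pht: "test_fun UNIV ph" unfolding ph_def by (rule test_fun_mult[OF test_fun_translate[OF tet] t(1)])
  have g: "et \<bullet> grad ph x = t x * (et \<bullet> grad te (x - a))" for x
  proof -
   have "grad (%x. te (x - a)) x = grad te (x - a)"
    using pd_translate[OF smooth_diffble[OF te(1)]] by (simp add: vec_eq_iff grad_nth)
   then have "grad ph x = te (x - a) *R grad t x + t x *R grad te (x - a)"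
    unfolding ph_def using grad_mult[OF smooth_diffble[OF smooth_translate[OF te(1)]] smooth_diffble[OF t(1)]] by simp
   then show ?thesis using t(3) by (simp add: inner_add_right)
  qed
  have i1: "integrable lborel (%x. w x * pd i ph x)" "integrable lborel (%x. G x $ i * ph x)" for i
   by (rule int_mult[OF loc(1) w test_fun_pd[OF pht]], assumption) (rule int_mult[OF locG Gm pht])
  have "(\<integral>x. (et \<bullet> grad te (x - a)) * h1 x \<partial>lborel) = (\<integral>x. (SUM i:UNIV. et $ i * (w x * pd i ph x)) \<partial>lborel)"
  proof (rule Bochner_Integration.integral_cong[OF refl])
   fix x
   have "(et \<bullet> grad te (x - a)) * h1 x = w x * (et \<bullet> grad ph x)" by (simp add: g h1_def)
   also have "... = (SUM i:UNIV. et $ i * (w x * pd i ph x))" by (simp add: inner_vec_def grad_nth sum_distrib_left mult_ac)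
   finally show "(et \<bullet> grad te (x - a)) * h1 x = (SUM i:UNIV. et $ i * (w x * pd i ph x))" .
  qed
  also have "... = (SUM i:UNIV. et $ i * (\<integral>x. w x * pd i ph x \<partial>lborel))" using i1 by (subst Bochner_Integration.integral_sum) auto
  also have "... = - (SUM i:UNIV. et $ i * (\<integral>x. G x $ i * ph x \<partial>lborel))" by (simp add: weak[OF pht] sum_negf)
  also have "(SUM i:UNIV. et $ i * (\<integral>x. G x $ i * ph x \<partial>lborel)) = (\<integral>x. (SUM i:UNIV. et $ i * (G x $ i * ph x)) \<partial>lborel)"
   using i1 by (subst Bochner_Integration.integral_sum) auto
  also have "... = (\<integral>x. te (x - a) * h2 x \<partial>lborel)"
   by (rule Bochner_Integration.integral_cong[OF refl]) (simp add: h2_def ph_def inner_vec_def sum_distrib_left sum_distrib_right mult_ac)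
  finally show ?thesis .
 qed
 define te' where "te' x = et \<bullet> grad te x" for x
 have te'c: "continuous_on UNIV te'" unfolding te'_def by (intro continuous_intros smooth_cont_grad te(1))
 have te'0: "te' x = 0" if "x ~: cbox 0 One" for x
  using grad_zero_outside[OF closed_cbox te0 that] by (simp add: te'_def)
 have te'i: "(\<integral>x. te' x \<partial>lborel) = 0"
 proof -
  have "pd i te x = 0" if "x ~: cbox 0 One" for i x
   using grad_zero_outside[of "cbox 0 One" te, OF closed_cbox te0 that] unfolding grad_nth[symmetric] by simp
  then have "integrable lborel (pd i te)" for i
   by (rule integrable_cont_support[OF smooth_cont[OF smooth_pd[OF te(1)]] compact_cbox[of 0 One]])
  then have "(\<integral>x. te' x \<partial>lborel) = (SUM i:UNIV. et $ i * (\<integral>x. pd i te x \<partial>lborel))"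
   unfolding te'_def inner_vec_def grad_nth by (subst Bochner_Integration.integral_sum) auto
  also have "... = 0"
  proof -
   have "(\<integral>x. pd i te x \<partial>lborel) = 0" for i
    using integral_pd_eq_0[OF tet, of i] smooth_cont[OF smooth_pd[OF te(1)], of i]
    by (simp add: integral_completion borel_measurable_continuous_onI)
   then show ?thesis by simp
  qed
  finally show ?thesis .
 qed
 have "(\<integral>x. te' x \<partial>lborel) * (\<integral>x. ind hcell x * h1 x \<partial>lborel) = - ((\<integral>x. te x \<partial>lborel) * (\<integral>x. ind hcell x * h2 x \<partial>lborel))"
 proof -
  have e: "ind hcell a * (\<integral>x. te' (x - a) * h1 x \<partial>lborel) = - (ind hcell a * (\<integral>x. te (x - a) * h2 x \<partial>lborel))" for a
   using id[of a] by (simp add: te'_def)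
  have "(\<integral>x. te' x \<partial>lborel) * (\<integral>x. ind hcell x * h1 x \<partial>lborel)
   = (\<integral>a. ind hcell a * (\<integral>x. te' (x - a) * h1 x \<partial>lborel) \<partial>lborel)"
   by (rule average_over_cell[OF hm(1) hp(1) hci(1) te'c compact_cbox te'0, symmetric])
  also have "... = - (\<integral>a. ind hcell a * (\<integral>x. te (x - a) * h2 x \<partial>lborel) \<partial>lborel)"
   unfolding e by simp
  also have "(\<integral>a. ind hcell a * (\<integral>x. te (x - a) * h2 x \<partial>lborel) \<partial>lborel)
   = (\<integral>x. te x \<partial>lborel) * (\<integral>x. ind hcell x * h2 x \<partial>lborel)"
   by (rule average_over_cell[OF hm(2) hp(2) hci(2) tec compact_cbox te0])
  finally show ?thesis .
 qed
 then show ?thesis using pos te'i by (simp add: h2_def)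
qed

lemma AE_lborel_translate:
 fixes c :: "'a::euclidean_space"
 assumes "AE x in lborel. P x" shows "AE x in lborel. P (c + x)"
proof -
 obtain N where N: "{x : space lborel. ~ P x} <= N" "emeasure lborel N = 0" "N : sets lborel" using assms by (rule AE_E)
 have Nb[measurable]: "N : sets borel" using N(3) by simp
 have eq: "indicator N (c + x) = (indicator ((+) c -` N) x :: ennreal)" for x by (simp add: indicator_def)
 have "(+) c : borel_measurable borel" by measurable
 then have m: "(+) c -` N : sets borel" using measurable_sets[OF _ Nb, of "(+) c" borel] by simp
 have "(\<integral>\<^sup>+x. indicator N (c + x) \<partial>lborel) = (\<integral>\<^sup>+x. indicator N x \<partial>(lborel :: 'a measure))"
  by (rule nn_integral_lborel_translate) measurable
 then have "emeasure lborel ((+) c -` N) = 0" unfolding eq using N(2,3) m by simp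
 then show ?thesis by (intro AE_I[of _ _ "(+) c -` N"]) (use N(1) m in auto)
qed

text \<open>A translate of \<open>G\<close> by a period is again a weak gradient of
  \<open>w\<close>, so it agrees with \<open>G\<close> almost everywhere by the fundamental
  lemma.\<close>

lemma ae_periodic_weak_grad:
 fixes w :: "real^'n => real" and G :: "real^'n => real^'n"
 assumes w[measurable]: "w : borel_measurable borel" and G: "!!i. (%x. G x $ i) : borel_measurable borel"
  and per: "ae_periodic w"
  and loc: "!!K i. compact K ==> set_integrable lborel K (%x. G x $ i)"
  and weak: "!!ph i. test_fun UNIV ph ==> (\<integral>x. w x * pd i ph x \<partial>lborel) = - (\<integral>x. G x $ i * ph x \<partial>lborel)"
 shows "ae_periodic G"
 unfolding ae_periodic_def
proof (intro allI impI)
 fix ka :: "real^'n" assume ka: "int_vec ka"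
 note [measurable] = G
 have "AE x in lborel. G (ka + x) $ i - G x $ i = 0" for i
 proof -
  have locK: "set_integrable lborel K (%x. G (ka + x) $ i)" if K: "compact K" for K
  proof -
   have [measurable]: "(+) ka ` K : sets borel" by (intro borel_compact compact_translation K)
   have "integrable lborel (%x. ind ((+) ka ` K) (ka + x) *R G (ka + x) $ i)"
    using loc[OF compact_translation[OF K, of ka], of i]
    by (subst lborel_integral_translate(2)[of "%x. ind ((+) ka ` K) x *R G x $ i" ka]) (auto simp: set_integrable_def)
   moreover have "ind ((+) ka ` K) (ka + x) = ind K x" for x by (auto simp: indicator_def)
   ultimately show ?thesis by (simp add: set_integrable_def)
  qed
  have mult: "integrable lborel (%x. u x * f x)"
   if ul: "!!K. compact K ==> set_integrable lborel K u" and [measurable]: "u : borel_measurable borel" and ft: "test_fun UNIV f" for u f :: "real^'n => real"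
  proof -
   obtain K where K: "compact K" "K <= UNIV" "!!x. x ~: K ==> f x = 0" "smooth f" by (rule test_funD[OF ft]) blast
   obtain C where C: "!!x. \<bar>f x\<bar> <= C" using bounded_grad_test_fun[OF ft] by blast
   have [measurable]: "f : borel_measurable borel" using smooth_cont[OF K(4)] by (rule borel_measurable_continuous_onI)
   show ?thesis
   proof (rule Bochner_Integration.integrable_bound)
    show "integrable lborel (%x. C * (ind K x * u x))" using ul[OF K(1)] by (simp add: set_integrable_def)
    have "norm (u x * f x) <= norm (C * (ind K x * u x))" for x
    proof (cases "x : K")
     case True
     have "\<bar>u x\<bar> * \<bar>f x\<bar> <= \<bar>u x\<bar> * \<bar>C\<bar>" using C[of x] by (intro mult_left_mono) auto
     then show ?thesis using True by (simp add: abs_mult mult.commute)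
    qed (simp add: K(3))
    then show "AE x in lborel. norm (u x * f x) <= norm (C * (ind K x * u x))" by simp
   qed measurable
  qed
  have "AE x in lebesgue. x : UNIV --> G (ka + x) $ i - G x $ i = 0"
  proof (rule AE_zero_if_test_integrals_zero[OF open_UNIV])
   fix a b
   have "set_integrable lborel (cbox a b) (%x. G (ka + x) $ i - G x $ i)"
    by (rule set_integral_diff(1)[OF locK loc]) auto
   then show "set_integrable lebesgue (cbox a b) (%x. G (ka + x) $ i - G x $ i)"
    unfolding set_integrable_def by (subst integrable_completion) auto
  next
   fix ph :: "real^'n => real" assume ph: "test_fun UNIV ph"
   have phm[measurable]: "ph : borel_measurable borel" using smooth_cont[OF test_fun_smooth[OF ph]] by (rule borel_measurable_continuous_onI)
   have pm[measurable]: "pd i ph : borel_measurable borel" using smooth_cont[OF smooth_pd[OF test_fun_smooth[OF ph]]] by (rule borel_measurable_continuous_onI)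
   define ps where "ps x = ph (x - ka)" for x
   have pst: "test_fun UNIV ps" unfolding ps_def by (rule test_fun_translate[OF ph])
   have psp: "pd i ps x = pd i ph (x - ka)" for x
    unfolding ps_def by (simp add: pd_translate[OF smooth_diffble[OF test_fun_smooth[OF ph]]])
   have "(\<integral>x. G (ka + x) $ i * ph x \<partial>lborel) = (\<integral>x. G (ka + x) $ i * ph ((ka + x) - ka) \<partial>lborel)" by simp
   also have "... = (\<integral>x. G x $ i * ps x \<partial>lborel)" unfolding ps_def
    by (rule lborel_integral_translate(1)[of "%x. G x $ i * ph (x - ka)" ka]) measurable
   also have "... = - (\<integral>x. w x * pd i ps x \<partial>lborel)" using weak[OF pst, of i] by simp
   also have "(\<integral>x. w x * pd i ps x \<partial>lborel) = (\<integral>x. w (ka + x) * pd i ph ((ka + x) - ka) \<partial>lborel)"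
    unfolding psp by (rule lborel_integral_translate(1)[symmetric, of "%x. w x * pd i ph (x - ka)" ka]) measurable
   also have "... = (\<integral>x. w x * pd i ph x \<partial>lborel)"
   proof (rule integral_cong_AE)
    have "AE x in lborel. w (ka + x) = w x" using per ka by (simp add: ae_periodic_def)
    then show "AE x in lborel. w (ka + x) * pd i ph ((ka + x) - ka) = w x * pd i ph x" by eventually_elim simp
   qed measurable
   also have "- ... = (\<integral>x. G x $ i * ph x \<partial>lborel)" using weak[OF ph, of i] by simp
   finally have eq: "(\<integral>x. G (ka + x) $ i * ph x \<partial>lborel) = (\<integral>x. G x $ i * ph x \<partial>lborel)" .
   have "(LINT x:UNIV|lebesgue. (G (ka + x) $ i - G x $ i) * ph x) = (\<integral>x. (G (ka + x) $ i - G x $ i) * ph x \<partial>lborel)"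
    unfolding set_lebesgue_integral_def by (subst integral_completion) auto
   also have "... = (\<integral>x. G (ka + x) $ i * ph x - G x $ i * ph x \<partial>lborel)" by (simp add: left_diff_distrib)
   also have "... = 0"
    by (subst Bochner_Integration.integral_diff[OF mult[OF locK _ ph] mult[OF loc _ ph]]) (auto simp: eq)
   finally show "(LINT x:UNIV|lebesgue. (G (ka + x) $ i - G x $ i) * ph x) = 0" .
  qed
  then show ?thesis by (simp add: AE_completion_iff)
 qed
 then have "AE x in lborel. ALL i : UNIV. G (ka + x) $ i - G x $ i = 0" by (intro AE_finite_allI) auto
 then show "AE x in lborel. G (ka + x) = G x" by eventually_elim (auto simp: vec_eq_iff)
qed

lemma set_integrable_of_sq_on_balls:
 fixes f :: "real^'n => real"
 assumes "!!r. sq_on (ball 0 r) f" "compact K" shows "set_integrable lebesgue K f"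
proof -
 obtain r where r: "K <= ball 0 r" using bounded_subset_ballD[OF compact_imp_bounded[OF assms(2)], of 0] by blast
 have Ks: "K : sets lebesgue" using assms(2) by (simp add: lmeasurable_compact fmeasurableD)
 have 1: "sq_on K f" by (rule sq_on_subset[OF assms(1) Ks r])
 have 2: "sq_on K (%x::real^'n. 1::real)" by (rule sq_on_cont_compact[OF assms(2)]) auto
 from set_integrable_inner[OF 1 2] show ?thesis by simp
qed

lemma sq_on_component:
 fixes G :: "real^'n => real^'n"
 assumes "sq_on D G" shows "sq_on D (%x. G x $ i)"
proof (rule sq_on_bound[OF assms, of _ 1])
 have "(%x. (ind D x *R G x) \<bullet> axis i 1) : borel_measurable lebesgue"
  using sq_on_measurable[OF assms] by (intro borel_measurable_inner) auto
 then show "(%x. ind D x *R G x $ i) : borel_measurable lebesgue" by (simp add: inner_axis)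
qed (simp add: component_le_norm_cart)

lemma sq_on_balls_measurable:
 fixes f :: "'a::euclidean_space => real"
 assumes "!!r. sq_on (ball 0 r) f" shows "f : borel_measurable lebesgue"
proof (rule borel_measurable_LIMSEQ_real)
 show "(%x. ind (ball 0 (real n)) x *R f x) : borel_measurable lebesgue" for n
  by (rule sq_on_measurable[OF assms])
 fix x :: 'a
 obtain N :: nat where N: "norm x < real N" using reals_Archimedean2 by blast
 then have "\<forall>\<^sub>F n in sequentially. ind (ball 0 (real n)) x *R f x = f x"
  by (auto simp: eventually_sequentially indicator_def intro!: exI[of _ N])
 then show "(%n. ind (ball 0 (real n)) x *R f x) ---> f x" by (rule tendsto_eventually)
qed

lemma unit_cell_subset_ball: "EX r. cell <= ball (0::real^'n) r"
 unfolding unit_cell_def using bounded_subset_ballD[OF bounded_cbox, of 0 "One :: real^'n" 0] by blast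

lemma unit_cell_sets[simp]: "cell : sets lebesgue" "compact cell" "cell : sets borel"
 unfolding unit_cell_def by auto

text \<open>Passes from Lebesgue to Borel measurable representatives. Only the potential is assumed
  periodic, as in \<open>cell_sol\<close>; periodicity of the gradient is derived.\<close>

lemma cell_gradient_orthogonal:
 fixes w :: "real^'n => real" and G :: "real^'n => real^'n"
 assumes per: "periodic w" and sq: "!!r. sq_on (ball 0 r) w" "!!r. sq_on (ball 0 r) G"
  and weak: "is_weak_grad UNIV w G"
  and t: "smooth t" "periodic t" "!!x. et \<bullet> grad t x = 0"
 shows "inner (cls cell G) (cls cell (%x. t x *R et)) = 0"
proof -
 have wm: "w : borel_measurable lebesgue" by (rule sq_on_balls_measurable[OF sq(1)])
 have Gm: "(%x. G x $ i) : borel_measurable lebesgue" for i by (rule sq_on_balls_measurable[OF sq_on_component[OF sq(2)]])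
 obtain w' where w'[measurable]: "w' : borel_measurable lborel" and wae: "AE x in lborel. w x = w' x"
  using completion_ex_borel_measurable_real[OF wm] by blast
 have "EX g. g : borel_measurable lborel & (AE x in lborel. G x $ i = g x)" for i
  using completion_ex_borel_measurable_real[OF Gm[of i]] by blast
 then obtain g where g[measurable]: "!!i. g i : borel_measurable lborel" and gae: "!!i. AE x in lborel. G x $ i = g i x" by metis
 define G' where "G' x = (\<chi> i. g i x)" for x
 have G'i: "G' x $ i = g i x" for x i by (simp add: G'_def)
 have Gae: "AE x in lborel. G x = G' x"
 proof -
  have "AE x in lborel. ALL i : UNIV. G x $ i = g i x" using gae by (intro AE_finite_allI) auto
  then show ?thesis by eventually_elim (simp add: vec_eq_iff G'i)
 qed
 have G'm[measurable]: "G' : borel_measurable borel"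
 proof -
  have "G' = (%x. SUM i:UNIV. g i x *R axis i 1)"
   by (rule ext) (simp add: G'_def vec_eq_iff axis_def if_distrib sum.delta' cong: if_cong)
  also have "... : borel_measurable borel" using g by measurable
  finally show ?thesis .
 qed
 have loc: "set_integrable lborel K w'" "set_integrable lborel K (%x. G' x $ i)" if K: "compact K" for K i
 proof -
  have gen: "set_integrable lborel K f'"
   if f: "set_integrable lebesgue K f" and [measurable]: "f' : borel_measurable borel" and ae: "AE x in lborel. f x = f' x" for f f' :: "real^'n => real"
  proof -
   have [measurable]: "K : sets borel" by (rule borel_compact[OF K])
   have "integrable lebesgue (%x. ind K x *R f' x)"
   proof (rule integrable_cong_AE_imp[OF f[unfolded set_integrable_def]])
    show "(%x. ind K x *R f' x) : borel_measurable lebesgue" by (intro measurable_completion) measurable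
    have "AE x in lebesgue. f x = f' x" using ae by (rule AE_completion)
    then show "AE x in lebesgue. ind K x *R f x = ind K x *R f' x" by eventually_elim simp
   qed
   then show ?thesis unfolding set_integrable_def by (subst (asm) integrable_completion) auto
  qed
  show "set_integrable lborel K w'" by (rule gen[OF set_integrable_of_sq_on_balls[OF sq(1) K] _ wae]) (use w' in simp)
  show "set_integrable lborel K (%x. G' x $ i)" unfolding G'i
   by (rule gen[OF set_integrable_of_sq_on_balls[OF sq_on_component[OF sq(2)] K] _ gae]) (use g in simp)
 qed
 have weak': "(\<integral>x. w' x * pd i ph x \<partial>lborel) = - (\<integral>x. G' x $ i * ph x \<partial>lborel)" if ph: "test_fun UNIV ph" for ph i
 proof -
  have pm[measurable]: "pd i ph : borel_measurable borel" using smooth_cont[OF smooth_pd[OF test_fun_smooth[OF ph]]] by (rule borel_measurable_continuous_onI)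
  have phm[measurable]: "ph : borel_measurable borel" using smooth_cont[OF test_fun_smooth[OF ph]] by (rule borel_measurable_continuous_onI)
  have gen: "(\<integral>x. f' x * q x \<partial>lborel) = (LINT x:UNIV|lebesgue. f x * q x)"
   if fm: "f : borel_measurable lebesgue" and [measurable]: "f' : borel_measurable borel" "q : borel_measurable borel" and ae: "AE x in lborel. f x = f' x"
   for f f' q :: "real^'n => real"
  proof -
   have "(\<integral>x. f' x * q x \<partial>lborel) = (\<integral>x. f' x * q x \<partial>lebesgue)" by (rule integral_completion[symmetric]) measurable
   also have "... = (\<integral>x. f x * q x \<partial>lebesgue)"
   proof (rule integral_cong_AE)
    show "(%x. f' x * q x) : borel_measurable lebesgue" by (intro measurable_completion) measurable
    show "(%x. f x * q x) : borel_measurable lebesgue" by (intro borel_measurable_times fm measurable_completion) measurable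
    have "AE x in lebesgue. f x = f' x" using ae by (rule AE_completion)
    then show "AE x in lebesgue. f' x * q x = f x * q x" by eventually_elim simp
   qed
   finally show ?thesis by (simp add: set_lebesgue_integral_def)
  qed
  have "(LINT x:UNIV|lebesgue. w x * pd i ph x) = - (LINT x:UNIV|lebesgue. G x $ i * ph x)"
   using weak ph by (simp add: is_weak_grad_def grad_nth)
  then show ?thesis using gen[OF wm _ pm wae] gen[OF Gm _ phm gae] w' g by (simp add: G'i)
 qed
 have pw: "ae_periodic w'" unfolding ae_periodic_def
 proof (intro allI impI)
  fix ka :: "real^'n" assume ka: "int_vec ka"
  have "w (ka + x) = w x" for x using per[unfolded periodic_def, rule_format, OF ka, of x] by (simp only: add.commute[of x])
  with AE_lborel_translate[OF wae, of ka] wae show "AE x in lborel. w' (ka + x) = w' x" by (auto elim: eventually_elim2)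
 qed
 have locG: "set_integrable lborel K G'" if K: "compact K" for K
 proof -
  have "(%x. ind K x *R G' x) = (%x. SUM i:UNIV. (ind K x *R G' x $ i) *R axis i 1)"
   by (rule ext) (simp add: vec_eq_iff axis_def if_distrib sum.delta' cong: if_cong)
  moreover have "integrable lborel (%x. SUM i:UNIV. (ind K x *R G' x $ i) *R (axis i 1 :: real^'n))"
   by (intro Bochner_Integration.integrable_sum integrable_scaleR_left) (use loc(2)[OF K] in "simp add: set_integrable_def")
  ultimately show ?thesis by (simp add: set_integrable_def)
 qed
 have pG: "ae_periodic G'" by (rule ae_periodic_weak_grad[OF _ _ pw loc(2) weak']) (use w' g in "simp_all add: G'i")
 have z: "(\<integral>x. ind hcell x * ((G' x \<bullet> et) * t x) \<partial>lborel) = 0"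
  by (rule gradient_orthogonal_solenoidal_borel[OF _ G'm pw pG loc(1) locG weak' t]) (use w' in simp)
 obtain r where r: "cell <= ball (0::real^'n) r" using unit_cell_subset_ball by blast
 have sG: "sq_on cell G" by (rule sq_on_subset[OF sq(2) _ r]) simp
 have tc: "continuous_on UNIV t" by (rule smooth_cont[OF t(1)])
 have [measurable]: "t : borel_measurable borel" using tc by (rule borel_measurable_continuous_onI)
 have st: "sq_on cell (%x. t x *R et)"
  by (rule sq_on_cont_compact) (auto intro!: continuous_intros continuous_on_subset[OF tc])
 have "inner (cls cell G) (cls cell (%x. t x *R et)) = (\<integral>x. ind cell x *R (G x \<bullet> (t x *R et)) \<partial>lebesgue)"
  by (simp add: inner_cls[OF sG st] set_lebesgue_integral_def)
 also have "... = (\<integral>x. ind hcell x * ((G' x \<bullet> et) * t x) \<partial>lebesgue)"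
 proof (rule integral_cong_AE)
  show "(%x. ind cell x *R (G x \<bullet> (t x *R et))) : borel_measurable lebesgue"
   using set_integrable_inner[OF sG st] by (simp add: set_integrable_def)
  show "(%x. ind hcell x * ((G' x \<bullet> et) * t x)) : borel_measurable lebesgue" by (intro measurable_completion) measurable
  have "AE x in lborel. ind cell x *R (G x \<bullet> (t x *R et)) = ind hcell x * ((G' x \<bullet> et) * t x)"
   using Gae AE_unit_cell_hcell by eventually_elim (auto simp: indicator_def)
  then show "AE x in lebesgue. ind cell x *R (G x \<bullet> (t x *R et)) = ind hcell x * ((G' x \<bullet> et) * t x)"
   by (rule AE_completion)
 qed
 also have "... = 0" using z by (subst integral_completion) auto
 finally show ?thesis .
qed

text \<open>The functions \<open>g\<close> may fail to separate points of \<open>X\<close>, as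
  periodic functions do on opposite faces. \<open>X\<close> is therefore mapped by all of them into
  a product of lines; on the compact image the coordinates separate points, and \<open>f\<close>
  descends to it because it is constant on the fibres.\<close>

lemma Stone_Weierstrass_factor:
 fixes X :: "'a::topological_space set" and g :: "'i::countable => 'a => real"
 assumes X: "compact X" and f: "continuous_on X f"
  and R: "!!c. (%x. c) : R" "!!h k. h : R ==> k : R ==> (%x. h x + k x) : R" "!!h k. h : R ==> k : R ==> (%x. h x * k x) : R"
  and g: "!!i. g i : R" "!!i. continuous_on X (g i)"
  and sep: "!!x y. x : X ==> y : X ==> (!!i. g i x = g i y) ==> f x = f y"
  and e: "e > 0"
 shows "EX h : R. ALL x : X. \<bar>f x - h x\<bar> < e"
proof -
 define Ph where "Ph x = (%i. g i x)" for x
 define Y where "Y = Ph ` X"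
 have Phc: "continuous_on X Ph" unfolding Ph_def by (rule continuous_on_coordinatewise_then_product) (rule g(2))
 have Y: "compact Y" unfolding Y_def by (rule compact_continuous_image[OF Phc X])
 define f' where "f' y = f (SOME x. x : X & Ph x = y)" for y
 have f': "f' (Ph x) = f x" if "x : X" for x
 proof -
  have "EX z. z : X & Ph z = Ph x" using that by blast
  from someI_ex[OF this] show ?thesis unfolding f'_def using sep[OF _ that] by (auto simp: Ph_def fun_eq_iff)
 qed
 \<comment> \<open>On a compact set \<open>Ph\<close> is a closed map onto a Hausdorff image, so
   preimages of closed sets under the descended function are closed.\<close>
 have f'c: "continuous_on Y f'"
 proof (subst continuous_on_closed_vimage[OF compact_imp_closed[OF Y]], intro allI impI)
  fix C :: "real set" assume C: "closed C"
  have "f' -` C \<inter> Y = Ph ` (X \<inter> f -` C)" using f' by (auto simp: Y_def)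
  moreover have "compact (X \<inter> f -` C)"
   using continuous_closedin_preimage[OF f C] X by (rule closedin_compact[rotated])
  then have "compact (Ph ` (X \<inter> f -` C))"
   by (intro compact_continuous_image continuous_on_subset[OF Phc]) auto
  ultimately show "closed (f' -` C \<inter> Y)" by (simp add: compact_imp_closed)
 qed
 define R' where "R' = {h. continuous_on Y h & (EX k : R. ALL x : X. k x = h (Ph x))}"
 interpret function_ring_on R' Y
 proof
  show "compact Y" by (rule Y)
  show "f : R' ==> continuous_on Y f" for f by (simp add: R'_def)
  show "(%x. c) : R'" for c using R(1) by (auto simp: R'_def)
  fix h k assume "h : R'" "k : R'"
  then obtain h' k' where hk: "continuous_on Y h" "continuous_on Y k" "h' : R" "k' : R" "!!x. x : X ==> h' x = h (Ph x)" "!!x. x : X ==> k' x = k (Ph x)"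
   by (auto simp: R'_def)
  show "(%x. h x + k x) : R'" unfolding R'_def
   using hk by (auto intro!: continuous_intros bexI[OF _ R(2)[OF hk(3,4)]])
  show "(%x. h x * k x) : R'" unfolding R'_def
   using hk by (auto intro!: continuous_intros bexI[OF _ R(3)[OF hk(3,4)]])
 next
  fix x y :: "'i => real" assume "x : Y" "y : Y" "x ~= y"
  then obtain i where "x i ~= y i" by auto
  moreover have "(%y. y i) : R'" unfolding R'_def
   using g(1)[of i] by (auto simp: Ph_def intro!: continuous_on_subset[OF continuous_on_product_coordinates])
  ultimately show "EX f : R'. f x ~= f y" by (intro bexI[of _ "%y. y i"])
 qed
 obtain h where h: "h : R'" "!!y. y : Y ==> \<bar>f' y - h y\<bar> < e" using Stone_Weierstrass_basic[OF f'c e] by blast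
 then obtain k where k: "k : R" "!!x. x : X ==> k x = h (Ph x)" by (auto simp: R'_def)
 show ?thesis
 proof (intro bexI[OF _ k(1)] ballI)
  fix x assume "x : X"
  then show "\<bar>f x - k x\<bar> < e" using h(2)[of "Ph x"] k(2) f' by (simp add: Y_def)
 qed
qed

section \<open>Trigonometric polynomials and the Helmholtz decomposition\<close>

definition tcos :: "real^'n => real^'n => real" where "tcos ka x = cos (2 * pi * (ka \<bullet> x))"
definition tsin :: "real^'n => real^'n => real" where "tsin ka x = sin (2 * pi * (ka \<bullet> x))"

lemma smooth_tcos: "smooth (tcos ka)" and smooth_tsin: "smooth (tsin ka)"
 unfolding tcos_def[abs_def] tsin_def[abs_def]
 using smooth_linear[of "(2 * pi) *R ka" 0] by (auto intro!: smooth_cos smooth_sin)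

lemma grad_tcos: "grad (tcos ka) x = (- 2 * pi * tsin ka x) *R ka"
 by (rule grad_eq) (auto simp: tcos_def[abs_def] tsin_def algebra_simps intro!: derivative_eq_intros)

lemma grad_tsin: "grad (tsin ka) x = (2 * pi * tcos ka x) *R ka"
 by (rule grad_eq) (auto simp: tsin_def[abs_def] tcos_def algebra_simps intro!: derivative_eq_intros)

lemma int_vec_inner: "int_vec ka ==> int_vec z ==> ka \<bullet> z : \<int>"
 unfolding inner_vec_def int_vec_def by (intro Ints_sum) (simp add: Ints_mult)

lemma trig_shift:
 assumes "int_vec ka" "int_vec z"
 shows "cos (2 * pi * (ka \<bullet> (x + z))) = cos (2 * pi * (ka \<bullet> x))" "sin (2 * pi * (ka \<bullet> (x + z))) = sin (2 * pi * (ka \<bullet> x))"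
proof -
 obtain n where n: "ka \<bullet> z = of_int n" using int_vec_inner[OF assms] by (auto elim: Ints_cases)
 have "2 * pi * (ka \<bullet> (x + z)) = 2 * pi * (ka \<bullet> x) + (2 * pi) * of_int n" by (simp add: inner_add_right n ring_distribs)
 then show "cos (2 * pi * (ka \<bullet> (x + z))) = cos (2 * pi * (ka \<bullet> x))" "sin (2 * pi * (ka \<bullet> (x + z))) = sin (2 * pi * (ka \<bullet> x))"
  by (simp_all only: cos_add sin_add cos_int_2pin sin_int_2pin mult_1_right mult_zero_right add_0_right diff_zero)
qed

lemma periodic_tcos: "int_vec ka ==> periodic (tcos ka)" and periodic_tsin: "int_vec ka ==> periodic (tsin ka)"
 by (simp_all add: periodic_def tcos_def tsin_def trig_shift)

inductive trigpoly :: "(real^'n => real) => bool" where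
 trigpoly_cos: "int_vec ka ==> trigpoly (%x. c * tcos ka x)"
| trigpoly_sin: "int_vec ka ==> trigpoly (%x. c * tsin ka x)"
| trigpoly_add: "trigpoly f ==> trigpoly g ==> trigpoly (%x. f x + g x)"

lemma trigpoly_const: "trigpoly (%x. c)"
 using trigpoly_cos[OF int_vec_zero, of c] by (simp add: tcos_def)

lemma trigpoly_cmult: "trigpoly f ==> trigpoly (%x. c * f x)"
proof (induction rule: trigpoly.induct)
 case (trigpoly_cos ka d)
 then show ?case using trigpoly.trigpoly_cos[of ka "c * d"] by (simp add: mult.assoc)
next
 case (trigpoly_sin ka d)
 then show ?case using trigpoly.trigpoly_sin[of ka "c * d"] by (simp add: mult.assoc)
next
 case (trigpoly_add f g)
 then show ?case using trigpoly.trigpoly_add by (simp add: ring_distribs)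
qed

lemma trigpoly_tcos: "int_vec ka ==> trigpoly (tcos ka)" and trigpoly_tsin: "int_vec ka ==> trigpoly (tsin ka)"
 using trigpoly_cos[of ka 1] trigpoly_sin[of ka 1] by simp_all

lemma trig_product:
 "tcos a x * tcos b x = 1/2 * tcos (a - b) x + 1/2 * tcos (a + b) x"
 "tsin a x * tsin b x = 1/2 * tcos (a - b) x + (-1/2) * tcos (a + b) x"
 "tsin a x * tcos b x = 1/2 * tsin (a + b) x + 1/2 * tsin (a - b) x"
 by (simp_all add: tcos_def tsin_def inner_add_left inner_diff_left ring_distribs cos_add cos_diff sin_add sin_diff)

lemma trigpoly_trig_mult:
 assumes "trigpoly f" "int_vec ka"
 shows "trigpoly (%x. tcos ka x * f x) & trigpoly (%x. tsin ka x * f x)"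
 using assms(1)
proof (induction rule: trigpoly.induct)
 case (trigpoly_cos b c)
 have e: "tcos ka x * (c * tcos b x) = c * (1/2 * tcos (ka - b) x + 1/2 * tcos (ka + b) x)"
  "tsin ka x * (c * tcos b x) = c * (1/2 * tsin (ka + b) x + 1/2 * tsin (ka - b) x)" for x
  unfolding trig_product[symmetric] by simp_all
 show ?case unfolding e using assms(2) trigpoly_cos
  by (intro conjI trigpoly_cmult trigpoly.trigpoly_add trigpoly_tcos trigpoly_tsin int_vec_add int_vec_diff)
next
 case (trigpoly_sin b c)
 have e: "tcos ka x * (c * tsin b x) = c * (1/2 * tsin (b + ka) x + 1/2 * tsin (b - ka) x)"
  "tsin ka x * (c * tsin b x) = c * (1/2 * tcos (ka - b) x + (-1/2) * tcos (ka + b) x)" for x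
  unfolding trig_product[symmetric] by simp_all
 show ?case unfolding e using assms(2) trigpoly_sin
  by (intro conjI trigpoly_cmult trigpoly.trigpoly_add trigpoly_tcos trigpoly_tsin int_vec_add int_vec_diff)
next
 case (trigpoly_add f g)
 then show ?case by (simp add: ring_distribs trigpoly.trigpoly_add)
qed

lemma trigpoly_mult:
 assumes "trigpoly f" "trigpoly g" shows "trigpoly (%x. f x * g x)"
 using assms(1)
proof (induction rule: trigpoly.induct)
 case (trigpoly_add f g)
 then show ?case by (simp add: ring_distribs trigpoly.trigpoly_add)
qed (simp_all add: mult.assoc trigpoly_cmult trigpoly_trig_mult[OF assms(2)])

lemma trigpoly_smooth: "trigpoly f ==> smooth f"
 by (induction rule: trigpoly.induct) (auto intro: smooth_cmult smooth_add smooth_tcos smooth_tsin)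

lemma axis_int_vec: "int_vec (axis i 1)"
 by (auto simp: int_vec_def axis_def)

lemma int_vec_diff_if_trig_eq:
 assumes "!!i. tcos (axis i 1) x = tcos (axis i 1) y" "!!i. tsin (axis i 1) x = tsin (axis i 1) y"
 shows "int_vec (x - y)"
 unfolding int_vec_def
proof
 fix i
 have "cos (2 * pi * (x $ i)) = cos (2 * pi * (y $ i))" "sin (2 * pi * (x $ i)) = sin (2 * pi * (y $ i))"
  using assms[of i] by (simp_all add: tcos_def tsin_def inner_axis')
 then obtain n :: int where "2 * pi * (x $ i) = 2 * pi * (y $ i) + 2 * pi * n" using sin_cos_eq_iff by metis
 then have "2 * pi * (x $ i - y $ i - n) = 0" by (simp add: algebra_simps)
 then have "x $ i - y $ i = n" by simp
 then show "(x - y) $ i : \<int>" by simp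
qed

lemma periodic_trig_approx:
 fixes f :: "real^'n => real"
 assumes f: "continuous_on cell f" and e: "e > 0"
  and per: "!!x y. x : cell ==> y : cell ==> int_vec (x - y) ==> f x = f y"
 shows "EX h. trigpoly h & (ALL x : cell. \<bar>f x - h x\<bar> < e)"
proof -
 define g where "g p = (if snd p then tcos (axis (fst p) 1) else tsin (axis (fst p) 1) :: real^'n => real)" for p :: "'n \<times> bool"
 have "EX h : {h. trigpoly h}. ALL x : cell. \<bar>f x - h x\<bar> < e"
 proof (rule Stone_Weierstrass_factor[where g = g, OF unit_cell_sets(2) f _ _ _ _ _ _ e])
  show "(%x. c) : {h. trigpoly h}" for c by (simp add: trigpoly_const)
  show "(%x. h x + k x) : {h. trigpoly h}" "(%x. h x * k x) : {h. trigpoly h}" if "h : {h. trigpoly h}" "k : {h. trigpoly h}" for h k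
   using that by (auto intro: trigpoly_add trigpoly_mult)
  show gi: "g i : {h. trigpoly h}" for i
   using trigpoly_cos[OF axis_int_vec, of 1 "fst i"] trigpoly_sin[OF axis_int_vec, of 1 "fst i"] by (simp add: g_def)
  show "continuous_on cell (g i)" for i
   using gi[of i] by (auto intro: continuous_on_subset[OF smooth_cont[OF trigpoly_smooth]])
  fix x y :: "real^'n" assume xy: "x : cell" "y : cell" "!!i. g i x = g i y"
  have "int_vec (x - y)"
   by (rule int_vec_diff_if_trig_eq) (use xy(3)[of "(_, True)"] xy(3)[of "(_, False)"] in "simp_all add: g_def")
  then show "f x = f y" by (rule per[OF xy(1,2)])
 qed
 then show ?thesis by blast
qed

lemma sq_on_cell_cont: "continuous_on UNIV f ==> sq_on cell f"
 by (rule sq_on_cont_compact) (auto intro: continuous_on_subset)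

lemma sq_on_cell_trigpoly: "trigpoly f ==> sq_on cell f"
 by (rule sq_on_cell_cont[OF smooth_cont[OF trigpoly_smooth]])

text \<open>A test function in the open box takes equal values on opposite faces of the cell, hence
  is a uniform limit of trigonometric polynomials; the fundamental lemma then applies.\<close>

lemma trig_complete:
 fixes f :: "real^'n => real"
 assumes f: "sq_on cell f"
  and z: "!!t. trigpoly t ==> inner (cls cell f) (cls cell t) = 0"
 shows "AE x in lebesgue. x : cell --> f x = 0"
proof -
 have sub: "box 0 One <= (cell :: (real^'n) set)" unfolding unit_cell_def by (rule box_subset_cbox)
 have "AE x in lebesgue. x : box 0 One --> f x = 0"
 proof (rule AE_zero_if_test_integrals_zero[OF open_box])
  fix a b :: "real^'n" assume "cbox a b <= box 0 One"
  then have 1: "sq_on (cbox a b) f" using sub by (intro sq_on_subset[OF f]) auto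
  have 2: "sq_on (cbox a b) (%x::real^'n. 1::real)" by (rule sq_on_cont_compact) auto
  from set_integrable_inner[OF 1 2] show "set_integrable lebesgue (cbox a b) f" by simp
 next
  fix ph :: "real^'n => real" assume ph: "test_fun (box 0 One) ph"
  have phc: "continuous_on UNIV ph" by (rule smooth_cont[OF test_fun_smooth[OF ph]])
  have sph: "sq_on cell ph" by (rule sq_on_cell_cont[OF phc])
  have 1: "sq_on cell (%x::real^'n. 1::real)" by (rule sq_on_cell_cont) auto
  have "(LINT x:box 0 One|lebesgue. f x * ph x) = inner (cls cell f) (cls cell ph)"
   unfolding inner_cls[OF f sph] set_lebesgue_integral_def
   by (rule Bochner_Integration.integral_cong[OF refl])
    (use test_fun_outside[OF ph] sub in "auto simp: indicator_def")
  moreover have "\<bar>inner (cls cell f) (cls cell ph)\<bar> <= e * (norm (cls cell f) * norm (cls cell (%x::real^'n. 1::real)))" if e: "e > 0" for e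
  proof -
   \<comment> \<open>Two different points of the closed cell that differ by an integer vector both
     lie on its boundary, where \<open>ph\<close> vanishes.\<close>
   have per: "ph x = ph y" if xy: "x : cell" "y : cell" "int_vec (x - y)" for x y
   proof (cases "x = y")
    case False
    then obtain i where i: "x $ i ~= y $ i" by (auto simp: vec_eq_iff)
    obtain k :: int where k: "x $ i - y $ i = of_int k" using xy(3) by (auto simp: int_vec_def elim!: Ints_cases dest: spec[of _ i])
    have b: "0 <= x $ i" "x $ i <= 1" "0 <= y $ i" "y $ i <= 1" using xy(1,2) by (auto simp: mem_unit_cell)
    have "k = 1 | k = -1"
    proof -
     have "k ~= 0" using k i by auto
     moreover have "real_of_int k <= 1" "real_of_int k >= -1" using k b by linarith+
     ultimately show ?thesis by linarith
    qed
    then have "(x $ i = 1 & y $ i = 0) | (x $ i = 0 & y $ i = 1)" using k b by auto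
    then have "x ~: box 0 One" "y ~: box 0 One" by (auto simp: mem_box_cart One_nth intro: exI[of _ i])
    then show ?thesis using test_fun_outside[OF ph] by simp
   qed simp
   obtain h where h: "trigpoly h" "!!x. x : cell ==> \<bar>ph x - h x\<bar> < e"
    using periodic_trig_approx[OF continuous_on_subset[OF phc subset_UNIV] e per] by blast
   note sh = sq_on_cell_trigpoly[OF h(1)]
   have "inner (cls cell f) (cls cell ph) = inner (cls cell f) (cls cell (%x. ph x - h x))"
    using z[OF h(1)] by (simp add: cls_diff[OF sph sh] inner_diff_right)
   also have "\<bar>...\<bar> <= norm (cls cell f) * norm (cls cell (%x. ph x - h x))" by (rule Cauchy_Schwarz_ineq2)
   also have "... <= norm (cls cell f) * (e * norm (cls cell (%x::real^'n. 1::real)))"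
    by (intro mult_left_mono norm_cls_le[OF 1 sq_on_diff[OF sph sh]]) (use h(2) e in "auto simp: less_imp_le")
   finally show ?thesis by (simp add: mult_ac)
  qed
  ultimately have b: "\<bar>LINT x:box 0 One|lebesgue. f x * ph x\<bar> <= e * (norm (cls cell f) * norm (cls cell (%x::real^'n. 1::real)))" if "e > 0" for e
   using that by simp
  define C where "C = norm (cls cell f) * norm (cls cell (%x::real^'n. 1::real))"
  have C: "0 <= C" by (simp add: C_def)
  have "\<bar>LINT x:box 0 One|lebesgue. f x * ph x\<bar> <= 0 + d" if d: "d > 0" for d
  proof -
   have "\<bar>LINT x:box 0 One|lebesgue. f x * ph x\<bar> <= (d / (C + 1)) * C" using b[of "d / (C + 1)", folded C_def] d C by simp
   also have "... <= d" using d C by (simp add: field_simps)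
   finally show ?thesis by simp
  qed
  then have "\<bar>LINT x:box 0 One|lebesgue. f x * ph x\<bar> <= 0" by (rule field_le_epsilon)
  then show "(LINT x:box 0 One|lebesgue. f x * ph x) = 0" by simp
 qed
 moreover have "AE x in lebesgue. x ~: cbox 0 One - box 0 (One :: real^'n)"
  using negligible_frontier_interval[of 0 "One :: real^'n"] by (intro AE_not_in) (simp add: negligible_iff_null_sets)
 ultimately show ?thesis by eventually_elim (auto simp: unit_cell_def)
qed

lemma inner_cls_repr:
 assumes "D : sets lebesgue" "sq_on D F"
 shows "inner V (cls D F) = inner (cls D (repr V)) (cls D F)"
proof -
 have 1: "sq_on UNIV (repr V)" "sq_on UNIV (%x. ind D x *R F x)"
  using repr(1)[of V] assms(2) by (simp_all add: sq_on_def)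
 have "inner V (cls D F) = inner (cls UNIV (repr V)) (cls UNIV (%x. ind D x *R F x))"
  by (simp add: cls_def repr(2))
 also have "... = inner (cls D (repr V)) (cls D F)"
  unfolding inner_cls[OF 1] inner_cls[OF sq_on_repr[OF assms(1)] assms(2)] set_lebesgue_integral_def
  by (rule Bochner_Integration.integral_cong) (auto simp: indicator_def)
 finally show ?thesis .
qed

lemma cell_field_complete:
 fixes V :: "(real^'n, real^'n) l2"
 assumes z: "!!t et. trigpoly t ==> inner V (cls cell (%x. t x *R et)) = 0" and F: "sq_on cell F"
 shows "inner V (cls cell F) = 0"
proof -
 note r = sq_on_repr[OF unit_cell_sets(1), of V]
 have "AE x in lebesgue. x : cell --> repr V x $ i = 0" for i
 proof (rule trig_complete[OF sq_on_component[OF r]])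
  fix t :: "real^'n => real" assume t: "trigpoly t"
  have s: "sq_on cell (%x. t x *R (axis i 1 :: real^'n))"
   using smooth_cont[OF trigpoly_smooth[OF t]] by (intro sq_on_cell_cont continuous_intros)
  have "inner (cls cell (%x. repr V x $ i)) (cls cell t) = inner (cls cell (repr V)) (cls cell (%x. t x *R axis i 1))"
   unfolding inner_cls[OF sq_on_component[OF r] sq_on_cell_trigpoly[OF t]] inner_cls[OF r s] by (simp add: inner_axis mult.commute)
  also have "... = 0" using z[OF t, of "axis i 1"] inner_cls_repr[OF unit_cell_sets(1) s, of V] by simp
  finally show "inner (cls cell (%x. repr V x $ i)) (cls cell t) = 0" .
 qed
 then have "AE x in lebesgue. ALL i : UNIV. x : cell --> repr V x $ i = 0" by (intro AE_finite_allI) auto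
 then have "AE x in lebesgue. x : cell --> repr V x = 0" by eventually_elim (auto simp: vec_eq_iff)
 then have "cls cell (repr V) = cls cell (%x. 0)" by (simp add: cls_eq_iff[OF r sq_on_zero])
 then show ?thesis by (subst inner_cls_repr[OF unit_cell_sets(1) F]) (simp add: cls_zero)
qed

section \<open>The Helmholtz decomposition by Fourier modes\<close>

definition trigfuns :: "(real^'n => real) set" where
 "trigfuns = {t. EX ka. int_vec ka & ka ~= 0 & (t = tcos ka | t = tsin ka)}"

definition gradset :: "(real^'n, real^'n) l2 set" where
 "gradset = (%t. cls cell (grad t)) ` trigfuns"

definition solset :: "(real^'n, real^'n) l2 set" where
 "solset = {cls cell (%x. t x *R et) | t ka et. int_vec ka & ka \<bullet> et = 0 & (t = tcos ka | t = tsin ka)}"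

lemma trigfuns_smooth: "t : trigfuns ==> smooth t" "t : trigfuns ==> periodic t"
 by (auto simp: trigfuns_def smooth_tcos smooth_tsin periodic_tcos periodic_tsin)

lemma sq_on_compact_smooth: "smooth u ==> bounded D ==> D : sets lebesgue ==> sq_on D u"
 and sq_on_compact_smooth_grad: "smooth u ==> bounded D ==> D : sets lebesgue ==> sq_on D (grad u)"
proof -
 assume u: "smooth u" and D: "bounded D" "D : sets lebesgue"
 have c: "compact (closure D)" using D(1) by (simp add: compact_closure)
 show "sq_on D u" by (rule sq_on_subset[OF sq_on_cont_compact[OF c] D(2) closure_subset])
  (rule continuous_on_subset[OF smooth_cont[OF u]], simp)
 show "sq_on D (grad u)" by (rule sq_on_subset[OF sq_on_cont_compact[OF c] D(2) closure_subset])
  (rule continuous_on_subset[OF smooth_cont_grad[OF u]], simp)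
qed

lemma smooth_periodic_gradient_orthogonal:
 assumes "smooth u" "periodic u" "smooth t" "periodic t" "!!x. et \<bullet> grad t x = 0"
 shows "inner (cls cell (grad u)) (cls cell (%x. t x *R et)) = 0"
 by (rule cell_gradient_orthogonal[OF assms(2) _ _ smooth_is_weak_grad[OF assms(1)] assms(3-5)])
  (auto intro!: sq_on_compact_smooth sq_on_compact_smooth_grad assms)

lemma solset_trig:
 assumes "ka \<bullet> et = 0" "t = tcos ka | t = tsin ka"
 shows "smooth t" "et \<bullet> grad t x = 0"
 using assms by (auto simp: smooth_tcos smooth_tsin grad_tcos grad_tsin inner_commute)

lemma periodic_gradient_orthogonal_solset:
 assumes "periodic w" "!!r. sq_on (ball 0 r) w" "!!r. sq_on (ball 0 r) G" "is_weak_grad UNIV w G" "z : solset"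
 shows "inner (cls cell G) z = 0"
proof -
 obtain t ka et where z: "z = cls cell (%x. t x *R et)" and t: "int_vec ka" "ka \<bullet> et = 0" "t = tcos ka | t = tsin ka"
  using assms(5) unfolding solset_def by blast
 show ?thesis unfolding z
  by (rule cell_gradient_orthogonal[OF assms(1-4) solset_trig(1)[OF t(2,3)] _ solset_trig(2)[OF t(2,3)]])
   (use t periodic_tcos periodic_tsin in auto)
qed

lemma gradset_orthogonal_solset: "g : gradset ==> z : solset ==> inner g z = 0"
 unfolding gradset_def
 by (auto intro!: periodic_gradient_orthogonal_solset smooth_is_weak_grad sq_on_compact_smooth sq_on_compact_smooth_grad trigfuns_smooth)

text \<open>For a nonzero frequency the amplitude splits into a part along the frequency, which is a
  multiple of a gradient mode, and a perpendicular part, which is solenoidal. Gradients and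
  solenoidal modes together thus span all trigonometric fields.\<close>

lemma orthogonal_gradset_solset:
 fixes V :: "(real^'n, real^'n) l2"
 assumes "!!g. g : gradset ==> inner V g = 0" "!!z. z : solset ==> inner V z = 0" "sq_on cell F"
 shows "inner V (cls cell F) = 0"
proof (rule cell_field_complete[OF _ assms(3)])
 have st: "sq_on cell (%x. t x *R (et :: real^'n))" if "smooth t" for t et
  using smooth_cont[OF that] by (intro sq_on_cell_cont continuous_intros)
 have base: "inner V (cls cell (%x. t x *R et)) = 0"
  if ka: "int_vec ka" and t: "t = tcos ka | t = tsin ka" for ka t et
 proof (cases "ka = 0")
  case True
  then show ?thesis using ka t
   by (intro assms(2)) (unfold solset_def, intro CollectI exI[of _ t] exI[of _ ka] exI[of _ et], auto)
 next
  case False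
  define et' where "et' = et - ((ka \<bullet> et) / (ka \<bullet> ka)) *R ka"
  have o: "ka \<bullet> et' = 0" using False by (simp add: et'_def inner_diff_right)
  have sm: "smooth t" using t by (auto simp: smooth_tcos smooth_tsin)
  have par: "inner V (cls cell (%x. t x *R ka)) = 0"
  proof -
   have g: "tcos ka : trigfuns" "tsin ka : trigfuns" using False ka by (auto simp: trigfuns_def)
   have "cls cell (grad (tsin ka)) = (2 * pi) *R cls cell (%x. tcos ka x *R ka)"
    "cls cell (grad (tcos ka)) = (- 2 * pi) *R cls cell (%x. tsin ka x *R ka)"
   proof -
    have "grad (tsin ka) = (%x. (2 * pi) *R (tcos ka x *R ka))" by (simp add: fun_eq_iff grad_tsin)
    then show "cls cell (grad (tsin ka)) = (2 * pi) *R cls cell (%x. tcos ka x *R ka)"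
     by (simp only: cls_scaleR[OF st[OF smooth_tcos]])
    have "grad (tcos ka) = (%x. (- 2 * pi) *R (tsin ka x *R ka))" by (simp add: fun_eq_iff grad_tcos)
    then show "cls cell (grad (tcos ka)) = (- 2 * pi) *R cls cell (%x. tsin ka x *R ka)"
     by (simp only: cls_scaleR[OF st[OF smooth_tsin]])
   qed
   moreover have "inner V (cls cell (grad (tsin ka))) = 0" "inner V (cls cell (grad (tcos ka))) = 0"
    using g by (auto intro!: assms(1) simp: gradset_def)
   ultimately show ?thesis using t by auto
  qed
  have "(%x. t x *R et) = (%x. t x *R et' + ((ka \<bullet> et) / (ka \<bullet> ka)) *R (t x *R ka))"
   by (simp add: et'_def fun_eq_iff algebra_simps)
  then have "cls cell (%x. t x *R et) = cls cell (%x. t x *R et') + ((ka \<bullet> et) / (ka \<bullet> ka)) *R cls cell (%x. t x *R ka)"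
   by (simp only: cls_add[OF st[OF sm] sq_on_scaleR[OF st[OF sm]]] cls_scaleR[OF st[OF sm]])
  moreover have "inner V (cls cell (%x. t x *R et')) = 0" using ka t o
   by (intro assms(2)) (unfold solset_def, intro CollectI exI[of _ t] exI[of _ ka] exI[of _ et'], auto)
  ultimately show ?thesis using par by (simp add: inner_add_right)
 qed
 fix t :: "real^'n => real" and et assume "trigpoly t"
 then show "inner V (cls cell (%x. t x *R et)) = 0"
 proof (induction rule: trigpoly.induct)
  case (trigpoly_cos ka c)
  have "cls cell (%x. (c * tcos ka x) *R et) = c *R cls cell (%x. tcos ka x *R et)"
   by (subst cls_scaleR[symmetric]) (auto intro: st smooth_tcos)
  then show ?case using base[OF trigpoly_cos, of "tcos ka" et] by simp
 next
  case (trigpoly_sin ka c)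
  have "cls cell (%x. (c * tsin ka x) *R et) = c *R cls cell (%x. tsin ka x *R et)"
   by (subst cls_scaleR[symmetric]) (auto intro: st smooth_tsin)
  then show ?case using base[OF trigpoly_sin, of "tsin ka" et] by simp
 next
  case (trigpoly_add f g)
  have "cls cell (%x. (f x + g x) *R et) = cls cell (%x. f x *R et) + cls cell (%x. g x *R et)"
   unfolding scaleR_add_left using trigpoly_add by (intro cls_add st trigpoly_smooth)
  then show ?case using trigpoly_add by (simp add: inner_add_right)
 qed
qed

text \<open>With p the projection of \<open>X\<close> onto the closed span of \<open>S\<close>, the
  remainder X - p is orthogonal to \<open>S\<close> by construction and to \<open>T\<close> because
  \<open>X\<close> and p are; completeness of the pair kills it. The roles of gradients and
  solenoidal modes are exchanged in a later use.\<close>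

lemma in_closure_span_if_orthogonal_complement:
 fixes S :: "'a::{real_inner,complete_space} set"
 assumes "!!g z. g : S ==> z : T ==> inner g z = 0"
  and c: "!!V. (!!g. g : S ==> inner V g = 0) ==> (!!z. z : T ==> inner V z = 0) ==> inner V X = 0"
  and X: "!!z. z : T ==> inner X z = 0"
 shows "X : closure (span S)"
proof -
 have cs: "subspace (closure (span S))" "closed (closure (span S))" by (auto intro: subspace_closure subspace_span)
 define p where "p = proj (closure (span S)) X"
 have p: "p : closure (span S)" unfolding p_def by (rule proj_in[OF cs])
 have o: "inner (X - p) s = 0" if "s : closure (span S)" for s unfolding p_def by (rule proj_orthogonal[OF cs that])
 have pT: "inner p z = 0" if z: "z : T" for z
 proof -
  have "inner z s = 0" if "s : span S" for s
   using that by (induction rule: span_induct_alt) (use assms(1)[OF _ z] in "auto simp: inner_add_right inner_commute[of z]")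
  from inner_zero_on_closure[OF this p] show ?thesis by (simp add: inner_commute)
 qed
 have "inner (X - p) X = 0"
 proof (rule c)
  show "inner (X - p) g = 0" if "g : S" for g using that span_base closure_subset by (intro o) blast
  show "inner (X - p) z = 0" if "z : T" for z using X[OF that] pT[OF that] by (simp add: inner_diff_left)
 qed
 moreover have "inner (X - p) p = 0" by (rule o[OF p])
 ultimately have "inner (X - p) (X - p) = 0" by (simp add: inner_diff_right)
 then show ?thesis using p by simp
qed

lemma helmholtz_grad:
 assumes "sq_on cell F" "!!z. z : solset ==> inner (cls cell F) z = 0"
 shows "cls cell F : closure (span gradset)"
 by (rule in_closure_span_if_orthogonal_complement[OF gradset_orthogonal_solset orthogonal_gradset_solset[OF _ _ assms(1)] assms(2)])

section \<open>Correctors\<close>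

lemma cls_repr_cls: "D : sets lebesgue ==> sq_on D f ==> cls D (repr (cls D f)) = cls D f"
 by (subst cls_eq_iff[OF sq_on_repr]) (auto elim!: eventually_mono intro: eventually_mono[OF repr_cls_AE])

lemma cls_repr_diff:
 assumes "D : sets lebesgue" shows "cls D (repr (X - Y)) = cls D (repr X) - cls D (repr Y)"
proof -
 have "AE x in lebesgue. repr (X - Y) x = repr X x - repr Y x"
  using abs_l2_eq_iff[OF repr(1)[of "X - Y"] sqint_diff[OF repr(1)[of X] repr(1)[of Y]]]
  by (simp add: abs_l2_diff repr)
 then have "cls D (repr (X - Y)) = cls D (%x. repr X x - repr Y x)"
  by (subst cls_eq_iff[OF sq_on_repr sq_on_diff[OF sq_on_repr sq_on_repr]]) (auto simp: assms elim: eventually_mono)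
 then show ?thesis by (simp add: cls_diff sq_on_repr assms)
qed

text \<open>Cutting off outside \<open>D\<close> does not increase norms, so a limit of classes
  living on \<open>D\<close> lives on \<open>D\<close>.\<close>

lemma cls_limit:
 assumes D: "D : sets lebesgue" and f: "!!k. sq_on D (f k)" and l: "(%k. cls D (f k)) ---> X"
 shows "cls D (repr X) = X"
proof -
 have le: "norm (cls D (f k) - cls D (repr X)) <= norm (cls D (f k) - X)" for k
  using norm_cls_repr_le[OF D, of "cls D (f k) - X"] by (simp add: cls_repr_diff[OF D] cls_repr_cls[OF D f])
 have "(%k. norm (cls D (f k) - X)) ---> 0" using l[THEN LIM_zero] by (simp add: tendsto_norm_zero_iff)
 then have "(%k. norm (cls D (f k) - cls D (repr X))) ---> 0"
  by (rule tendsto_sandwich[OF _ _ tendsto_const, rotated 2]) (use le in auto)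
 then have "(%k. cls D (f k)) ---> cls D (repr X)" by (simp add: LIM_zero_cancel tendsto_norm_zero_iff)
 then show ?thesis using l LIMSEQ_unique by blast
qed

lemma cls_closure_span:
 assumes D: "D : sets lebesgue" and S: "!!s. s : S ==> EX F. sq_on D F & s = cls D F" and x: "x : closure (span S)"
 shows "EX F. sq_on D F & x = cls D F"
proof -
 have sp: "EX F. sq_on D F & s = cls D F" if "s : span S" for s
  using that
 proof (induction rule: span_induct_alt)
  case base
  show ?case by (intro exI[of _ "%x. 0"]) (simp add: sq_on_zero cls_zero)
 next
  case (step c a y)
  from S[OF step(1)] step(2) obtain F G where "sq_on D F" "a = cls D F" "sq_on D G" "y = cls D G" by blast
  then show ?case by (intro exI[of _ "%x. c *R F x + G x"]) (simp add: sq_on_add sq_on_scaleR cls_add cls_scaleR)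
 qed
 obtain s where s: "!!k. s k : span S" "s ---> x" using x by (auto simp: closure_sequential)
 have "ALL k. EX F. sq_on D F & s k = cls D F" using sp s(1) by blast
 then obtain F where F: "!!k. sq_on D (F k)" "!!k. s k = cls D (F k)" by metis
 have "(%k. cls D (F k)) ---> x" using s(2) by (simp add: F(2)[abs_def])
 from cls_limit[OF D F(1) this] have "cls D (repr x) = x" .
 then show ?thesis using sq_on_repr[OF D] by metis
qed

text \<open>The gradients of periodic H^1 functions on the cell, obtained here as a closure; that
  its elements do have periodic potentials is shown in \<open>gradspace_realize\<close>.\<close>

definition gradspace :: "(real^'n, real^'n) l2 set" where "gradspace = closure (span gradset)"

lemma gradspace: "subspace gradspace" "closed gradspace"
 unfolding gradspace_def by (auto intro: subspace_closure subspace_span)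

lemma gradset_sq_on: "s : gradset ==> EX F. sq_on cell F & s = cls cell F"
 unfolding gradset_def by (auto intro!: sq_on_cell_cont smooth_cont_grad trigfuns_smooth(1))

lemma gradspace_cls: assumes "s : gradspace" obtains F where "sq_on cell F" "s = cls cell F"
 using cls_closure_span[OF unit_cell_sets(1) gradset_sq_on assms[unfolded gradspace_def]] by blast

lemma gradset_gradspace: "s : gradset ==> s : gradspace"
 unfolding gradspace_def using span_base closure_subset by blast

lemma inner_zero_gradspace:
 fixes z :: "(real^'n, real^'n) l2"
 assumes "!!s. s : gradset ==> inner z s = 0" "x : gradspace" shows "inner z x = 0"
proof (rule inner_zero_on_closure[OF _ assms(2)[unfolded gradspace_def]])
 fix s :: "(real^'n, real^'n) l2" assume "s : span gradset"
 then show "inner z s = 0" by (induction rule: span_induct_alt) (auto simp: inner_add_right assms(1))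
qed

definition cst :: "real^'n => (real^'n, real^'n) l2" where "cst xi = cls cell (%_. xi)"

lemma sq_on_cst: "sq_on cell (%_::real^'n. xi::'b::euclidean_space)"
 by (rule sq_on_cell_cont) auto

lemma cst_add: "cst (a + b) = cst a + cst b" and cst_scaleR: "cst (c *R a) = c *R cst a"
 unfolding cst_def by (auto intro!: cls_add cls_scaleR sq_on_cst)

lemma gradset_orthogonal_cst: assumes "g : gradset" shows "inner g (cst et) = 0"
proof (rule gradset_orthogonal_solset[OF assms])
 have "(%_. et) = (%x. tcos 0 x *R et)" by (simp add: tcos_def)
 then have "cst et = cls cell (%x. tcos 0 x *R et)" unfolding cst_def by (rule arg_cong)
 then show "cst et : solset" unfolding solset_def
  by (intro CollectI exI[of _ "tcos 0"] exI[of _ 0] exI[of _ et]) (simp add: int_vec_zero)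
qed

lemma gradspace_orthogonal_cst: "g : gradspace ==> inner g (cst et) = 0"
 by (subst inner_commute, rule inner_zero_gradspace, subst inner_commute, rule gradset_orthogonal_cst)

text \<open>The gradient of the corrector in the direction \<open>xi\<close>, as a class. Working
  with the gradient makes the cell problem a coercive problem on \<open>gradspace\<close> for every
  direction, not only for basis vectors.\<close>

definition corr :: "(real^'n => real^'n^'n) => real^'n => (real^'n, real^'n) l2" where
 "corr M xi = (SOME p. p : gradspace & (ALL s : gradspace. inner (mulop cell M (cst xi + p)) s = 0))"

lemma corr:
 assumes M: "coef cell mu La M" and mu: "0 < mu"
 shows "corr M xi : gradspace" "s : gradspace ==> inner (mulop cell M (cst xi + corr M xi)) s = 0"
proof -
 interpret m: bounded_linear "mulop cell M" by (rule blin_mulop[OF M])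
 have "EX p : gradspace. ALL s : gradspace. inner (mulop cell M p) s = inner (- mulop cell M (cst xi)) s"
 proof (rule lax_milgram[OF gradspace m.bounded_linear_axioms mu])
  fix s :: "(real^'a, real^'a) l2" assume "s : gradspace"
  then obtain F where "sq_on cell F" "s = cls cell F" by (rule gradspace_cls)
  then show "mu * (norm s)^2 <= inner (mulop cell M s) s" using mulop_coercive[OF M] by simp
 qed
 then have "EX p. p : gradspace & (ALL s : gradspace. inner (mulop cell M (cst xi + p)) s = 0)"
  by (auto simp: m.add inner_add_left)
 from someI_ex[OF this] show "corr M xi : gradspace" "s : gradspace ==> inner (mulop cell M (cst xi + corr M xi)) s = 0"
  unfolding corr_def by blast+
qed

lemma corr_unique:
 assumes M: "coef cell mu La M" and mu: "0 < mu"
  and p: "p : gradspace" "!!s. s : gradset ==> inner (mulop cell M (cst xi + p)) s = 0"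
 shows "p = corr M xi"
proof -
 interpret m: bounded_linear "mulop cell M" by (rule blin_mulop[OF M])
 define d where "d = p - corr M xi"
 have d: "d : gradspace" unfolding d_def by (rule subspace_diff[OF gradspace(1) p(1) corr(1)[OF M mu]])
 obtain F where F: "sq_on cell F" "d = cls cell F" by (rule gradspace_cls[OF d])
 have "mu * (norm d)^2 <= inner (mulop cell M d) d" using mulop_coercive[OF M F(1)] F(2) by simp
 also have "mulop cell M d = mulop cell M (cst xi + p) - mulop cell M (cst xi + corr M xi)"
  unfolding d_def m.diff[symmetric] by simp
 also have "inner ... d = 0"
  using inner_zero_gradspace[OF p(2) d] corr(2)[OF M mu d] by (simp add: inner_diff_left)
 finally have "mu * (norm d)^2 <= 0" .
 then have "d = 0" using mu by (simp add: mult_le_0_iff)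
 then show ?thesis by (simp add: d_def)
qed

lemma corr_lincomb:
 assumes M: "coef cell mu La M" and mu: "0 < mu"
 shows "corr M (a *R xi + et) = a *R corr M xi + corr M et"
proof (rule corr_unique[OF M mu, symmetric])
 interpret m: bounded_linear "mulop cell M" by (rule blin_mulop[OF M])
 show "a *R corr M xi + corr M et : gradspace"
  by (intro subspace_add subspace_scale gradspace corr(1)[OF M mu])
 fix s :: "(real^'a, real^'a) l2" assume "s : gradset"
 then have s: "s : gradspace" by (rule gradset_gradspace)
 have "cst (a *R xi + et) + (a *R corr M xi + corr M et) = a *R (cst xi + corr M xi) + (cst et + corr M et)"
  by (simp add: cst_add cst_scaleR algebra_simps)
 then have "inner (mulop cell M (cst (a *R xi + et) + (a *R corr M xi + corr M et))) s
  = a * inner (mulop cell M (cst xi + corr M xi)) s + inner (mulop cell M (cst et + corr M et)) s"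
  by (simp only: m.add m.scaleR inner_add_left inner_scaleR_left)
 then show "inner (mulop cell M (cst (a *R xi + et) + (a *R corr M xi + corr M et))) s = 0"
  using corr(2)[OF M mu s] by simp
qed

lemma corr_sum:
 assumes M: "coef cell mu La M" and mu: "0 < mu" and "finite I"
 shows "corr M (SUM i:I. c i *R xi i) = (SUM i:I. c i *R corr M (xi i))"
 using assms(3)
proof (induction I rule: finite_induct)
 case empty
 show ?case using corr_lincomb[OF M mu, of "-1" 0 0] by simp
qed (simp add: corr_lincomb[OF M mu])

lemma cst_sum: "finite I ==> cst (SUM i:I. f i) = (SUM i:I. cst (f i))"
 by (induction I rule: finite_induct) (auto simp: cst_add cst_scaleR[of 0 0, simplified])

text \<open>A mode of frequency ka is an eigenfunction of the periodic Laplacian with eigenvalue 4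
  pi^2 |ka|^2, at least 1 for nonzero integer ka. Integration by parts on the torus is obtained from
  the orthogonality of the gradient of u s to the constant field ka.\<close>

lemma trig_eigen:
 assumes "t : trigfuns"
 shows "EX l>=1. ALL u. smooth u --> periodic u -->
  inner (cls cell (grad t)) (cls cell (grad u)) = l * inner (cls cell t) (cls cell u)"
proof -
 obtain ka where ka: "int_vec ka" "ka ~= 0" and t: "t = tcos ka | t = tsin ka" using assms by (auto simp: trigfuns_def)
 define l where "l = 4 * pi^2 * (ka \<bullet> ka)"
 have "1 <= ka \<bullet> ka"
 proof -
  obtain i where i: "ka $ i ~= 0" using ka(2) by (auto simp: vec_eq_iff)
  obtain k :: int where k: "ka $ i = of_int k" using ka(1) by (auto simp: int_vec_def elim!: Ints_cases dest: spec[of _ i])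
  have "k ~= 0" using i k by auto
  then have "1 <= \<bar>k\<bar>" by linarith
  then have "1 <= k^2" by (metis one_le_power power2_abs)
  then have "1 <= (ka $ i)^2" unfolding k by (metis of_int_1_le_iff of_int_power)
  also have "... <= (SUM j:UNIV. (ka $ j)^2)" by (rule member_le_sum) auto
  finally show ?thesis by (simp add: inner_vec_def power2_eq_square)
 qed
 moreover have "1 <= 4 * pi^2"
 proof -
  have "(1::real)^2 <= pi^2" by (rule power_mono) (use pi_ge_two in auto)
  then show ?thesis by simp
 qed
 ultimately have l: "1 <= l" unfolding l_def using mult_mono[of 1 "4 * pi^2" 1 "ka \<bullet> ka"] by simp
 have main: "inner (cls cell (grad t)) (cls cell (grad u)) = l * inner (cls cell t) (cls cell u)"
  if u: "smooth u" "periodic u" for u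
 proof -
  \<comment> \<open>The conjugate mode and the constant \<open>a\<close> are chosen so that grad t =
    a s ka and grad s = -a t ka.\<close>
  define s where "s = (if t = tcos ka then tsin ka else tcos ka)"
  define a where "a = (if t = tcos ka then - (2 * pi) else 2 * pi)"
  have s: "smooth s" "periodic s" using ka(1) by (auto simp: s_def smooth_tcos smooth_tsin periodic_tcos periodic_tsin)
  have ts: "smooth t" by (rule trigfuns_smooth(1)[OF assms])
  have gt: "grad t x = (a * s x) *R ka" and gs: "grad s x = (- a * t x) *R ka" for x
   using t by (auto simp: s_def a_def grad_tcos grad_tsin)
  have sq: "sq_on cell f" "sq_on cell (grad f)" if "smooth f" for f
   using that by (auto intro: sq_on_cell_cont smooth_cont smooth_cont_grad)
  have "0 = inner (cls cell (grad (%x. u x * s x))) (cls cell (%x. 1 *R ka))"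
   by (rule smooth_periodic_gradient_orthogonal[symmetric])
    (use u s in "auto simp: periodic_def grad_const intro!: smooth_mult smooth_const")
  also have "... = (LINT x:cell|lebesgue. grad (%x. u x * s x) x \<bullet> ka)"
   by (subst inner_cls[OF sq(2)[OF smooth_mult[OF u(1) s(1)]]]) (auto intro: sq_on_cst)
  also have "... = (LINT x:cell|lebesgue. (- a * (ka \<bullet> ka)) * (t x * u x) + s x * (ka \<bullet> grad u x))"
  proof -
   have "grad (%x. u x * s x) x \<bullet> ka = (- a * (ka \<bullet> ka)) * (t x * u x) + s x * (ka \<bullet> grad u x)" for x
    unfolding grad_mult[OF smooth_diffble[OF u(1)] smooth_diffble[OF s(1)]]
    by (simp add: gs inner_add_left inner_commute inner_diff_right)
   then show ?thesis by presburger
  qed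
  also have "... = (- a * (ka \<bullet> ka)) * inner (cls cell t) (cls cell u) + (LINT x:cell|lebesgue. s x * (ka \<bullet> grad u x))"
  proof (subst set_integral_add(2))
   show "set_integrable lebesgue cell (%x. (- a * (ka \<bullet> ka)) * (t x * u x))"
    using set_integrable_inner[OF sq(1)[OF ts] sq(1)[OF u(1)]] by (intro set_integrable_mult_right) simp
   have "sq_on cell (%x. s x *R ka)"
    using smooth_cont[OF s(1)] by (intro sq_on_cell_cont continuous_intros)
   from set_integrable_inner[OF this sq(2)[OF u(1)]]
   show "set_integrable lebesgue cell (%x. s x * (ka \<bullet> grad u x))" by simp
  qed (simp only: inner_cls[OF sq(1)[OF ts] sq(1)[OF u(1)]] set_integral_mult_right inner_real_def)
  finally have eq: "(LINT x:cell|lebesgue. s x * (ka \<bullet> grad u x)) = a * (ka \<bullet> ka) * inner (cls cell t) (cls cell u)" by simp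
  have "inner (cls cell (grad t)) (cls cell (grad u)) = (LINT x:cell|lebesgue. a * (s x * (ka \<bullet> grad u x)))"
   unfolding inner_cls[OF sq(2)[OF ts] sq(2)[OF u(1)]] gt by (simp add: mult.assoc)
  also have "... = a * (LINT x:cell|lebesgue. s x * (ka \<bullet> grad u x))" by simp
  also have "... = (a * a) * (ka \<bullet> ka) * inner (cls cell t) (cls cell u)" by (simp add: eq)
  also have "a * a = 4 * pi^2" by (simp add: a_def power2_eq_square)
  finally show ?thesis by (simp add: l_def)
 qed
 show ?thesis using l main by blast
qed

section \<open>Potentials of limits of periodic gradients\<close>

definition trigpairs :: "((real^'n, real) l2 \<times> (real^'n, real^'n) l2) set" where
 "trigpairs = (%t. (cls cell t, cls cell (grad t))) ` trigfuns"

text \<open>Modes with different eigenvalues are orthogonal, since the gradient form is symmetric.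
  Hence |grad|^2 - |potential|^2 is the squared norm of the combination with coefficients weighted
  by sqrt (l - 1), and so is nonnegative.\<close>

lemma poincare_trig:
 fixes X :: "(real^'n, real) l2 \<times> (real^'n, real^'n) l2"
 assumes "X : span trigpairs" shows "norm (fst X) <= norm (snd X)"
proof -
 have "ALL a : trigpairs. EX l>=1. ALL b : trigpairs. inner (snd a) (snd b) = l * inner (fst a) (fst (b :: (real^'n, real) l2 \<times> (real^'n, real^'n) l2))"
 proof
  fix a :: "(real^'n, real) l2 \<times> (real^'n, real^'n) l2" assume "a : trigpairs"
  then obtain t where t: "t : trigfuns" "a = (cls cell t, cls cell (grad t))" by (auto simp: trigpairs_def)
  obtain l where l: "l >= 1" "!!u. smooth u ==> periodic u ==>
   inner (cls cell (grad t)) (cls cell (grad u)) = l * inner (cls cell t) (cls cell u)"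
   using trig_eigen[OF t(1)] by blast
  show "EX l>=1. ALL b : trigpairs. inner (snd a) (snd b) = l * inner (fst a) (fst (b :: (real^'n, real) l2 \<times> (real^'n, real^'n) l2))"
   using l(1) l(2)[OF trigfuns_smooth] by (intro exI[of _ l]) (auto simp: trigpairs_def t(2))
 qed
 then obtain l where l: "!!a. a : trigpairs ==> l a >= 1" "!!a b. a : trigpairs ==> b : trigpairs ==> inner (snd a) (snd b) = l a * inner (fst a) (fst (b :: (real^'n, real) l2 \<times> (real^'n, real^'n) l2))"
  by metis
 obtain T r where T: "finite T" "T <= trigpairs" "X = (SUM a:T. r a *R a)"
  using assms unfolding span_explicit by blast
 have f: "fst X = (SUM a:T. r a *R fst a)" "snd X = (SUM a:T. r a *R snd a)"
  unfolding T(3) by (simp_all add: fst_sum snd_sum)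
 define Y where "Y = (SUM a:T. (sqrt (l a - 1) * r a) *R fst a)"
 have sym: "l a * inner (fst a) (fst b) = l b * inner (fst a) (fst b)" if "a : T" "b : T" for a b
  using l(2)[of a b] l(2)[of b a] that T(2) by (auto simp: inner_commute)
 have e: "inner (r a *R snd a) (r b *R snd b) - inner (r a *R fst a) (r b *R fst b)
   = inner ((sqrt (l a - 1) * r a) *R fst a) ((sqrt (l b - 1) * r b) *R fst b)" if ab: "a : T" "b : T" for a b
 proof (cases "inner (fst a) (fst b) = 0")
  case True
  then show ?thesis using l(2)[of a b] ab T(2) by auto
 next
  case False
  then have "l a = l b" using sym[OF ab] by simp
  moreover have "sqrt (l b - 1) * sqrt (l b - 1) = l b - 1" using l(1)[of b] ab T(2) by auto
  moreover have "inner (snd a) (snd b) = l a * inner (fst a) (fst b)" using l(2)[of a b] ab T(2) by auto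
  moreover have "inner ((sqrt (l b - 1) * r a) *R fst a) ((sqrt (l b - 1) * r b) *R fst b)
   = (sqrt (l b - 1) * sqrt (l b - 1)) * (r a * (r b * inner (fst a) (fst b)))" by simp
  ultimately show ?thesis by (simp add: algebra_simps)
 qed
 have "(norm (snd X))^2 - (norm (fst X))^2 = (norm Y)^2"
  unfolding power2_norm_eq_inner f Y_def inner_sum_left inner_sum_right sum_subtractf[symmetric]
  by (intro sum.cong refl e)
 then have "(norm (fst X))^2 <= (norm (snd X))^2" using zero_le_power2[of "norm Y"] by linarith
 then show ?thesis by (rule power2_le_imp_le) simp
qed

lemma span_trigpairs:
 assumes "X : span trigpairs"
 shows "EX ph. smooth ph & periodic ph & X = (cls cell ph, cls cell (grad ph)) & inner (cls cell ph) (cls cell (%_. 1)) = 0"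
 using assms
proof (induction rule: span_induct_alt)
 case base
 show ?case by (intro exI[of _ "%x. 0"]) (auto simp: smooth_const periodic_def cls_zero grad_const[abs_def] zero_prod_def)
next
 case (step c a y)
 obtain ph where ph: "smooth ph" "periodic ph" "y = (cls cell ph, cls cell (grad ph))" "inner (cls cell ph) (cls cell (%_. 1)) = 0"
  using step(2) by blast
 obtain t where t: "t : trigfuns" "a = (cls cell t, cls cell (grad t))" using step(1) by (auto simp: trigpairs_def)
 note ts = trigfuns_smooth[OF t(1)]
 have sq: "sq_on cell f" "sq_on cell (grad f)" if "smooth f" for f
  using that by (auto intro: sq_on_cell_cont smooth_cont smooth_cont_grad)
 have g: "grad (%x. c * t x + ph x) = (%x. c *R grad t x + grad ph x)"
  using grad_add[OF smooth_diffble[OF smooth_cmult[OF ts(1)]] smooth_diffble[OF ph(1)]] grad_cmult[OF ts(1)] by (simp add: fun_eq_iff)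
 obtain l where l: "l >= 1" "inner (cls cell (grad t)) (cls cell (grad (%_. 1))) = l * inner (cls cell t) (cls cell (%_. 1))"
  using trig_eigen[OF t(1)] smooth_const[of 1] by (metis (mono_tags, lifting) periodic_def)
 then have t0: "inner (cls cell t) (cls cell (%_. 1)) = 0" by (simp add: grad_const[abs_def] cls_zero)
 have c1: "cls cell (%x. c * t x + ph x) = c *R cls cell t + cls cell ph"
  using cls_add[OF sq_on_scaleR[OF sq(1)[OF ts(1)]] sq(1)[OF ph(1)], of c] cls_scaleR[OF sq(1)[OF ts(1)], of c] by simp
 have c2: "cls cell (grad (%x. c * t x + ph x)) = c *R cls cell (grad t) + cls cell (grad ph)"
  unfolding g by (simp add: cls_add cls_scaleR sq_on_scaleR sq ts ph)
 show ?case
 proof (intro exI[of _ "%x. c * t x + ph x"] conjI)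
  show "smooth (%x. c * t x + ph x)" by (intro smooth_add smooth_cmult ts ph)
  show "periodic (%x. c * t x + ph x)" using ts(2) ph(2) by (simp add: periodic_def)
  show "c *R a + y = (cls cell (%x. c * t x + ph x), cls cell (grad (%x. c * t x + ph x)))"
   by (simp add: c1 c2 t(2) ph(3))
  show "inner (cls cell (%x. c * t x + ph x)) (cls cell (%_. 1)) = 0"
   by (simp add: c1 inner_add_left t0 ph(4))
 qed
qed

text \<open>By the Poincare inequality on modes, potentials of a Cauchy sequence of gradients are
  themselves Cauchy.\<close>

lemma gradspace_potentials:
 assumes "p : gradspace"
 shows "EX ph W. (ALL k. smooth (ph k) & periodic (ph k) & inner (cls cell (ph k)) (cls cell (%_. 1)) = 0) & 
   (%k. cls cell (ph k)) ---> W & (%k. cls cell (grad (ph k))) ---> p"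
proof -
 have im: "gradset = snd ` trigpairs" unfolding gradset_def trigpairs_def by (simp add: image_image)
 have sp: "span gradset = snd ` span (trigpairs :: ((real^'a, real) l2 \<times> (real^'a, real^'a) l2) set)"
  unfolding im by (rule linear_span_image) (rule bounded_linear.linear[OF bounded_linear_snd])
 obtain s where s: "!!k. s k : span gradset" "s ---> p" using assms by (auto simp: gradspace_def closure_sequential)
 have "ALL k. EX X. X : span trigpairs & s k = snd X" using s(1) unfolding sp by blast
 then obtain X where X: "!!k. X k : span trigpairs" "!!k. s k = snd (X k)" by metis
 have "Cauchy (%k. fst (X k))"
 proof (rule metric_CauchyI)
  fix e :: real assume "e > 0"
  then obtain N where N: "!!m n. m >= N ==> n >= N ==> dist (s m) (s n) < e" using LIMSEQ_imp_Cauchy[OF s(2)] metric_CauchyD by metis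
  have "dist (fst (X m)) (fst (X n)) <= dist (s m) (s n)" for m n
   using poincare_trig[OF span_diff[OF X(1) X(1)], of m n] by (simp add: dist_norm X(2))
  then show "EX N. ALL m>=N. ALL n>=N. dist (fst (X m)) (fst (X n)) < e" using N by (meson le_less_trans)
 qed
 then obtain W where W: "(%k. fst (X k)) ---> W" using Cauchy_convergent convergent_def by blast
 have "ALL k. EX ph. smooth ph & periodic ph & X k = (cls cell ph, cls cell (grad ph)) & inner (cls cell ph) (cls cell (%_. 1)) = 0"
  using span_trigpairs[OF X(1)] by blast
 then obtain ph where ph: "!!k. smooth (ph k)" "!!k. periodic (ph k)" "!!k. X k = (cls cell (ph k), cls cell (grad (ph k)))"
  "!!k. inner (cls cell (ph k)) (cls cell (%_. 1)) = 0" by metis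
 have "(%k. cls cell (ph k)) ---> W" using W by (simp add: ph(3))
 moreover have "s = (%k. cls cell (grad (ph k)))" by (rule ext) (simp add: X(2) ph(3))
 then have "(%k. cls cell (grad (ph k))) ---> p" using s(2) by simp
 ultimately show ?thesis using ph by blast
qed

text \<open>The representative in \<open>hcell\<close> modulo integer vectors; composing with it
  extends a function from the cell to an exactly periodic one.\<close>

definition fr :: "real^'n => real^'n" where "fr x = (\<chi> i. x $ i - of_int \<lfloor>x $ i\<rfloor>)"

lemma borel_measurable_vec_lambda:
 assumes "!!i. (%x. f x i) : borel_measurable M"
 shows "(%x. (\<chi> i. f x i) :: real^'n) : borel_measurable M"
proof -
 have "(%x. (\<chi> i. f x i) :: real^'n) = (%x. SUM i:UNIV. f x i *R axis i 1)"
  by (rule ext) (simp add: vec_eq_iff axis_def if_distrib sum.delta' cong: if_cong)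
 also have "... : borel_measurable M" using assms by (intro borel_measurable_sum borel_measurable_scaleR) auto
 finally show ?thesis .
qed

lemma borel_measurable_vec_component: "(%x::real^'n. x $ i) : borel_measurable borel"
 by (intro borel_measurable_continuous_onI continuous_intros)

lemma fr_measurable[measurable]: "fr : borel_measurable borel"
 unfolding fr_def[abs_def]
proof (rule borel_measurable_vec_lambda)
 fix i :: 'a
 note [measurable] = borel_measurable_vec_component[of i]
 show "(%x::real^'a. x $ i - real_of_int \<lfloor>x $ i\<rfloor>) : borel_measurable borel" by measurable
qed

lemma fr_hcell: "x : hcell ==> fr x = x"
proof -
 assume "x : hcell"
 then have "\<lfloor>x $ i\<rfloor> = 0" for i by (auto simp: hcell_def floor_eq_iff)
 then show ?thesis by (simp add: fr_def vec_eq_iff)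
qed

lemma fr_periodic: assumes "int_vec ka" shows "fr (x + ka) = fr x"
proof -
 have "x $ i + ka $ i - of_int \<lfloor>x $ i + ka $ i\<rfloor> = x $ i - of_int \<lfloor>x $ i\<rfloor>" for i
 proof -
  obtain k :: int where "ka $ i = of_int k" using assms by (auto simp: int_vec_def elim!: Ints_cases dest: spec[of _ i])
  then show ?thesis by simp
 qed
 then show ?thesis by (simp add: fr_def vec_eq_iff)
qed

lemma axis_expansion: "(SUM i:UNIV. v $ i *R axis i 1) = (v :: real^'n)"
 by (simp add: vec_eq_iff axis_def if_distrib sum.delta' cong: if_cong)

text \<open>A ball is covered by finitely many integer translates of the cell. The number depends on
  the radius only, so convergence on the cell gives convergence on every ball.\<close>

lemma ball_cell_bound:
 "EX N::nat. ALL u::real^'n => ennreal. u : borel_measurable borel --> (ALL x ka. int_vec ka --> u (x + ka) = u x) -->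
  (\<integral>\<^sup>+x. u x * indicator (ball 0 r) x \<partial>lborel) <= of_nat N * (\<integral>\<^sup>+x. u x * indicator hcell x \<partial>lborel)"
proof -
 define m where "m = \<lceil>\<bar>r\<bar>\<rceil> + 1"
 define F where "F = {ka::real^'n. int_vec ka & (ALL i. \<bar>ka $ i\<bar> <= of_int m)}"
 have "F <= (%k. \<chi> i. of_int (k i)) ` (PiE UNIV (%_. {-m..m}))"
 proof
  fix ka assume ka: "ka : F"
  then have e: "ka = (\<chi> i. of_int \<lfloor>ka $ i\<rfloor>)" by (auto simp: F_def int_vec_def vec_eq_iff Ints_def)
  have "\<lfloor>ka $ i\<rfloor> : {-m..m}" for i
  proof -
   have "\<bar>ka $ i\<bar> <= of_int m" using ka by (simp add: F_def)
   moreover have "ka $ i = of_int \<lfloor>ka $ i\<rfloor>" using arg_cong[OF e, of "%v. v $ i"] by simp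
   ultimately have "\<bar>\<lfloor>ka $ i\<rfloor>\<bar> <= m" by linarith
   then show ?thesis by auto
  qed
  then show "ka : (%k. \<chi> i. of_int (k i)) ` (PiE UNIV (%_. {-m..m}))"
   by (subst e) (rule imageI, auto)
 qed
 then have F: "finite F" by (rule finite_subset) (intro finite_imageI finite_PiE; simp)
 have cov: "EX ka : F. x + ka : hcell" if x: "x : ball 0 r" for x :: "real^'n"
 proof (rule bexI[of _ "\<chi> i. - of_int \<lfloor>x $ i\<rfloor>"])
  have "0 <= x $ i - of_int \<lfloor>x $ i\<rfloor> & x $ i - of_int \<lfloor>x $ i\<rfloor> < 1" for i by linarith
  then show "x + (\<chi> i. - of_int \<lfloor>x $ i\<rfloor>) : hcell" by (auto simp: hcell_def)
  have "\<bar>x $ i\<bar> <= \<bar>r\<bar>" for i using component_le_norm_cart[of x i] x by simp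
  moreover have "of_int \<lfloor>x $ i\<rfloor> <= x $ i" "x $ i < of_int \<lfloor>x $ i\<rfloor> + 1" "\<bar>r\<bar> <= of_int \<lceil>\<bar>r\<bar>\<rceil>" for i by linarith+
  ultimately have "\<bar>real_of_int \<lfloor>x $ i\<rfloor>\<bar> <= of_int m" for i unfolding m_def of_int_add of_int_1 by (smt (verit))
  then show "(\<chi> i. - of_int \<lfloor>x $ i\<rfloor>) : F" by (auto simp: F_def int_vec_def)
 qed
 show ?thesis
 proof (intro exI[of _ "card F"] allI impI)
  fix u :: "real^'n => ennreal" assume u[measurable]: "u : borel_measurable borel" and per: "ALL x ka. int_vec ka --> u (x + ka) = u x"
  have "(\<integral>\<^sup>+x. u x * indicator (ball 0 r) x \<partial>lborel) <= (\<integral>\<^sup>+x. (SUM ka:F. u x * indicator hcell (ka + x)) \<partial>lborel)"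
  proof (rule nn_integral_mono)
   fix x
   show "u x * indicator (ball 0 r) x <= (SUM ka:F. u x * indicator hcell (ka + x))"
   proof (cases "x : ball 0 r")
    case True
    then obtain ka where ka: "ka : F" "x + ka : hcell" using cov by blast
    then have "u x * indicator (ball 0 r) x = u x * indicator hcell (ka + x)" using True by (simp add: add.commute)
    also have "... <= (SUM ka:F. u x * indicator hcell (ka + x))" using member_le_sum[OF ka(1) _ F, of "%ka. u x * indicator hcell (ka + x)"] by simp
    finally show ?thesis .
   qed simp
  qed
  also have "... = (SUM ka:F. \<integral>\<^sup>+x. u x * indicator hcell (ka + x) \<partial>lborel)" by (rule nn_integral_sum) measurable
  also have "... = (SUM ka:F. \<integral>\<^sup>+x. u x * indicator hcell x \<partial>lborel)"
  proof (rule sum.cong[OF refl])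
   fix ka assume "ka : F"
   then have "int_vec ka" by (simp add: F_def)
   then have e: "u (ka + x) = u x" for x using per[rule_format, of ka x] by (simp only: add.commute[of x])
   have "(\<integral>\<^sup>+x. u x * indicator hcell (ka + x) \<partial>lborel) = (\<integral>\<^sup>+x. u (ka + x) * indicator hcell (ka + x) \<partial>lborel)" by (simp add: e)
   also have "... = (\<integral>\<^sup>+x. u x * indicator hcell x \<partial>lborel)" by (rule nn_integral_lborel_translate[of "%x. u x * indicator hcell x"]) measurable
   finally show "(\<integral>\<^sup>+x. u x * indicator hcell (ka + x) \<partial>lborel) = (\<integral>\<^sup>+x. u x * indicator hcell x \<partial>lborel)" .
  qed
  finally show "(\<integral>\<^sup>+x. u x * indicator (ball 0 r) x \<partial>lborel) <= of_nat (card F) * (\<integral>\<^sup>+x. u x * indicator hcell x \<partial>lborel)" by simp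
 qed
qed

lemma nn_integral_norm_cls:
 fixes f :: "'a::euclidean_space => 'b::euclidean_space"
 assumes [measurable]: "f : borel_measurable borel" "D : sets borel"
 shows "sq_on D f \<longleftrightarrow> (\<integral>\<^sup>+x. ennreal ((norm (f x))^2) * indicator D x \<partial>lborel) < \<infinity>"
  and "sq_on D f ==> ennreal ((norm (cls D f))^2) = (\<integral>\<^sup>+x. ennreal ((norm (f x))^2) * indicator D x \<partial>lborel)"
proof -
 have e: "(\<integral>\<^sup>+x. ennreal ((norm (ind D x *R f x))^2) \<partial>lebesgue) = (\<integral>\<^sup>+x. ennreal ((norm (f x))^2) * indicator D x \<partial>lborel)"
  unfolding nn_integral_completion by (rule nn_integral_cong) (auto simp: indicator_def)
 have m: "(%x. ind D x *R f x) : borel_measurable lebesgue" by (intro measurable_completion) measurable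
 show "sq_on D f \<longleftrightarrow> (\<integral>\<^sup>+x. ennreal ((norm (f x))^2) * indicator D x \<partial>lborel) < \<infinity>"
  unfolding sq_on_def sqint_nn e using m by simp
 show "sq_on D f ==> ennreal ((norm (cls D f))^2) = (\<integral>\<^sup>+x. ennreal ((norm (f x))^2) * indicator D x \<partial>lborel)"
  unfolding sq_on_def cls_def e[symmetric] by (rule nn_integral_norm_abs_l2[symmetric])
qed

lemma periodic_ball_bound:
 fixes f :: "real^'n => 'b::euclidean_space"
 assumes N: "ALL u::real^'n => ennreal. u : borel_measurable borel --> (ALL x ka. int_vec ka --> u (x + ka) = u x) -->
  (\<integral>\<^sup>+x. u x * indicator (ball 0 r) x \<partial>lborel) <= of_nat N * (\<integral>\<^sup>+x. u x * indicator hcell x \<partial>lborel)"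
  and f[measurable]: "f : borel_measurable borel" and per: "periodic f" and sq: "sq_on cell f"
 shows "sq_on (ball 0 r) f" "norm (cls (ball 0 r) f) <= sqrt N * norm (cls cell f)"
proof -
 have "(\<integral>\<^sup>+x. ennreal ((norm (f x))^2) * indicator hcell x \<partial>lborel) = (\<integral>\<^sup>+x. ennreal ((norm (f x))^2) * indicator cell x \<partial>lborel)"
 proof (rule nn_integral_cong_AE)
  show "AE x in lborel. ennreal ((norm (f x))^2) * indicator hcell x = ennreal ((norm (f x))^2) * indicator cell x"
   using AE_unit_cell_hcell by eventually_elim (auto simp: indicator_def)
 qed
 then have le: "(\<integral>\<^sup>+x. ennreal ((norm (f x))^2) * indicator (ball 0 r) x \<partial>lborel) <= of_nat N * ennreal ((norm (cls cell f))^2)"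
  unfolding nn_integral_norm_cls(2)[OF f unit_cell_sets(3) sq] using N[rule_format, of "%x. ennreal ((norm (f x))^2)"] per
  by (simp add: periodic_def)
 have e: "of_nat N * ennreal ((norm (cls cell f))^2) = ennreal (real N * (norm (cls cell f))^2)"
  by (simp add: ennreal_mult ennreal_of_nat_eq_real_of_nat)
 show s: "sq_on (ball 0 r) f" unfolding nn_integral_norm_cls(1)[OF f borel_open[OF open_ball]]
  using le unfolding e by (rule le_less_trans) simp
 have "ennreal ((norm (cls (ball 0 r) f))^2) <= ennreal (real N * (norm (cls cell f))^2)"
  unfolding nn_integral_norm_cls(2)[OF f borel_open[OF open_ball] s] using le unfolding e .
 then have "(norm (cls (ball 0 r) f))^2 <= real N * (norm (cls cell f))^2" by (simp add: ennreal_le_iff)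
 also have "... = (sqrt N * norm (cls cell f))^2" by (simp add: power_mult_distrib)
 finally show "norm (cls (ball 0 r) f) <= sqrt N * norm (cls cell f)" by (rule power2_le_imp_le) simp
qed

text \<open>A Borel representative composed with \<open>fr\<close> is exactly periodic, as
  \<open>cell_sol\<close> requires of the potential.\<close>

lemma periodic_borel_representative:
 fixes W :: "(real^'n, real) l2"
 assumes "cls cell (repr W) = W"
 shows "EX w. w : borel_measurable borel & periodic w & sq_on cell w & cls cell w = W"
proof -
 have "repr W : borel_measurable lebesgue" using repr(1)[of W] by (simp add: sqint_def)
 then obtain w0 where w0[measurable]: "w0 : borel_measurable lborel" and ae: "AE x in lborel. repr W x = w0 x"
  using completion_ex_borel_measurable_real by blast
 define w where "w x = w0 (fr x)" for x
 have w[measurable]: "w : borel_measurable borel" unfolding w_def using w0 by measurable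
 have aeL: "AE x in lebesgue. x : cell --> repr W x = w x"
 proof (rule AE_completion)
  show "AE x in lborel. x : cell --> repr W x = w x"
   using ae AE_unit_cell_hcell by eventually_elim (auto simp: w_def fr_hcell)
 qed
 have r: "sq_on cell (repr W)" by (rule sq_on_repr) simp
 have s: "sq_on cell w"
 proof (rule sq_on_bound[OF r, of _ 1])
  show "(%x. ind cell x *R w x) : borel_measurable lebesgue"
   by (intro measurable_completion borel_measurable_scaleR borel_measurable_indicator) (use unit_cell_sets(3) w in auto)
  show "AE x in lebesgue. x : cell --> norm (w x) <= 1 * norm (repr W x)" using aeL by eventually_elim auto
 qed
 have "cls cell w = W" using cls_eq_iff[OF r s] aeL assms by simp
 moreover have "periodic w" by (simp add: periodic_def w_def fr_periodic)
 ultimately show ?thesis using w s by blast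
qed

lemma periodic_borel_representative_vec:
 fixes W :: "(real^'n, real^'n) l2"
 assumes "cls cell (repr W) = W"
 shows "EX w. w : borel_measurable borel & periodic w & sq_on cell w & cls cell w = W"
proof -
 have r: "sq_on cell (repr W)" by (rule sq_on_repr) simp
 have c: "sq_on cell (%x. repr W x $ i)" for i by (rule sq_on_component[OF r])
 have "ALL i. EX w. w : borel_measurable borel & periodic w & sq_on cell w & cls cell w = cls cell (%x. repr W x $ i)"
  by (intro allI periodic_borel_representative cls_repr_cls c) simp
 then obtain w where w: "!!i. w i : borel_measurable borel" "!!i. periodic (w i)" "!!i. sq_on cell (w i)" "!!i. cls cell (w i) = cls cell (%x. repr W x $ i)"
  by metis
 define v where "v x = (\<chi> i. w i x)" for x
 have vm: "v : borel_measurable borel" unfolding v_def[abs_def] by (rule borel_measurable_vec_lambda) (rule w(1))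
 have "AE x in lebesgue. ALL i : UNIV. x : cell --> w i x = repr W x $ i"
  by (intro AE_finite_allI) (use w(4) in "auto simp: cls_eq_iff[OF w(3) c]")
 then have ae: "AE x in lebesgue. x : cell --> repr W x = v x" by eventually_elim (auto simp: v_def vec_eq_iff)
 have s: "sq_on cell v"
 proof (rule sq_on_bound[OF r, of _ 1])
  show "(%x. ind cell x *R v x) : borel_measurable lebesgue"
   by (intro measurable_completion borel_measurable_scaleR borel_measurable_indicator) (use unit_cell_sets(3) vm in auto)
  show "AE x in lebesgue. x : cell --> norm (v x) <= 1 * norm (repr W x)" using ae by eventually_elim auto
 qed
 have "cls cell v = W" using cls_eq_iff[OF r s] ae assms by simp
 moreover have "periodic v" using w(2) by (simp add: periodic_def v_def)
 ultimately show ?thesis using vm s by blast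
qed

lemma weak_grad_limit_on_balls:
 fixes w :: "real^'n => real" and G :: "real^'n => real^'n"
 assumes sq: "!!r. sq_on (ball 0 r) w" "!!r. sq_on (ball 0 r) G" and ph: "!!k. smooth (ph k)"
  and l: "!!r. (%k. cls (ball 0 r) (ph k)) ---> cls (ball 0 r) w" "!!r. (%k. cls (ball 0 r) (grad (ph k))) ---> cls (ball 0 r) G"
 shows "is_weak_grad UNIV w G"
 unfolding is_weak_grad_def
proof (intro allI impI)
 fix ps :: "real^'n => real" and i assume ps: "test_fun UNIV ps"
 obtain K where K: "compact K" "K <= UNIV" "!!x. x ~: K ==> ps x = 0" "smooth ps" by (rule test_funD[OF ps]) blast
 obtain r where r: "K <= ball 0 r" using bounded_subset_ballD[OF compact_imp_bounded[OF K(1)], of 0] by blast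
 have psr: "test_fun (ball 0 r) ps" by (rule test_funI[OF K(4) K(1) r K(3)])
 have sk: "sq_on (ball 0 r) (ph k)" "sq_on (ball 0 r) (grad (ph k))" for k
  by (auto intro: sq_on_compact_smooth sq_on_compact_smooth_grad ph)
 let ?I = "%X Y. inner X (cls (ball 0 r) (pd i ps)) + inner Y (cls (ball 0 r) (%x. ps x *R axis i 1))"
 have z: "?I (cls (ball 0 r) (ph k)) (cls (ball 0 r) (grad (ph k))) = 0" for k
  using smooth_is_weak_grad[OF ph[of k], of "ball 0 r"] psr unfolding is_weak_grad_iff[OF sk] by blast
 have "(%k. ?I (cls (ball 0 r) (ph k)) (cls (ball 0 r) (grad (ph k)))) ---> ?I (cls (ball 0 r) w) (cls (ball 0 r) G)"
  by (intro tendsto_intros l)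
 then have I0: "?I (cls (ball 0 r) w) (cls (ball 0 r) G) = 0" unfolding z by (simp add: LIMSEQ_const_iff)
 have 1: "inner (cls (ball 0 r) w) (cls (ball 0 r) (pd i ps)) = (LINT x:ball 0 r|lebesgue. w x * pd i ps x)"
  by (subst inner_cls[OF sq(1) sq_on_test_fun[OF test_fun_pd[OF psr]]]) simp
 have 2: "inner (cls (ball 0 r) G) (cls (ball 0 r) (%x. ps x *R axis i 1)) = (LINT x:ball 0 r|lebesgue. G x $ i * ps x)"
  by (subst inner_cls[OF sq(2) sq_on_test_scaleR[OF psr]]) (simp add: inner_axis mult.commute)
 have 3: "(LINT x:ball 0 r|lebesgue. w x * pd i ps x) = (LINT x:UNIV|lebesgue. w x * grad ps x $ i)"
  using test_fun_outside[OF test_fun_pd[OF psr]] by (subst set_integral_test_fun) (auto simp: grad_nth set_lebesgue_integral_def)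
 have 4: "(LINT x:ball 0 r|lebesgue. G x $ i * ps x) = (LINT x:UNIV|lebesgue. G x $ i * ps x)"
  using test_fun_outside[OF psr] by (subst set_integral_test_fun) (auto simp: set_lebesgue_integral_def)
 show "(LINT x:UNIV|lebesgue. w x * grad ps x $ i) = - (LINT x:UNIV|lebesgue. G x $ i * ps x)"
  using I0 unfolding 1 2 3 4 by simp
qed

text \<open>Smooth periodic potentials converge on the cell together with their gradients, hence on
  every ball, and the weak gradient relation survives. This supplies the functions on the whole
  space demanded by \<open>cell_sol\<close>.\<close>

lemma gradspace_realize:
 fixes p :: "(real^'n, real^'n) l2"
 assumes "p : gradspace"
 shows "EX w G. periodic w & (ALL r. sq_on (ball 0 r) w & sq_on (ball 0 r) G) & is_weak_grad UNIV w G & 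
  (LINT y:cell|lebesgue. w y) = 0 & sq_on cell G & cls cell G = p"
proof -
 obtain ph W where ph: "!!k. smooth (ph k)" "!!k. periodic (ph k)" "!!k. inner (cls cell (ph k)) (cls cell (%_. 1)) = 0"
  and l: "(%k. cls cell (ph k)) ---> W" "(%k. cls cell (grad (ph k))) ---> p"
  using gradspace_potentials[OF assms] by blast
 have sk: "sq_on cell (ph k)" "sq_on cell (grad (ph k))" for k
  by (auto intro: sq_on_cell_cont smooth_cont smooth_cont_grad ph)
 obtain w where w: "w : borel_measurable borel" "periodic w" "sq_on cell w" "cls cell w = W"
  using periodic_borel_representative[OF cls_limit[OF unit_cell_sets(1) sk(1) l(1)]] by blast
 obtain G where G: "G : borel_measurable borel" "periodic G" "sq_on cell G" "cls cell G = p"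
  using periodic_borel_representative_vec[OF cls_limit[OF unit_cell_sets(1) sk(2) l(2)]] by blast
 have km: "ph k : borel_measurable borel" "grad (ph k) : borel_measurable borel" for k
  using smooth_cont[OF ph(1)] smooth_cont_grad[OF ph(1)] by (auto intro: borel_measurable_continuous_onI)
 have pg: "periodic (grad (ph k))" for k unfolding periodic_def
 proof (intro allI impI)
  fix x ka :: "real^'n" assume ka: "int_vec ka"
  have "(%x. ph k (x - (- ka))) = ph k" using ph(2)[of k] ka by (simp add: periodic_def)
  then have "pd i (ph k) = (%x. pd i (ph k) (x - (- ka)))" for i
   using pd_translate[OF smooth_diffble[OF ph(1)], of i k "- ka"] by simp
  then have "pd i (ph k) x = pd i (ph k) (x + ka)" for i by (metis diff_minus_eq_add)
  then show "grad (ph k) (x + ka) = grad (ph k) x" by (simp add: vec_eq_iff grad_nth)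
 qed
 have lim: "(%k. cls (ball 0 r) (f k)) ---> cls (ball 0 r) F" "sq_on (ball 0 r) F"
  if F: "F : borel_measurable borel" "periodic F" "sq_on cell F"
   and f: "!!k. f k : borel_measurable borel" "!!k. periodic (f k)" "!!k. sq_on cell (f k)" and c: "(%k. cls cell (f k)) ---> cls cell F"
  for r and F :: "real^'n => 'c::euclidean_space" and f
 proof -
  obtain N :: nat where N: "ALL u::real^'n => ennreal. u : borel_measurable borel --> (ALL x ka. int_vec ka --> u (x + ka) = u x) -->
   (\<integral>\<^sup>+x. u x * indicator (ball 0 r) x \<partial>lborel) <= of_nat N * (\<integral>\<^sup>+x. u x * indicator hcell x \<partial>lborel)" using ball_cell_bound[of r] by blast
  note b = periodic_ball_bound[OF N]
  show s: "sq_on (ball 0 r) F" by (rule b(1)[OF F])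
  have sf: "sq_on (ball 0 r) (f k)" for k by (rule b(1)[OF f])
  have "norm (cls (ball 0 r) (f k) - cls (ball 0 r) F) <= sqrt N * norm (cls cell (f k) - cls cell F)" for k
   unfolding cls_diff[OF sf s, symmetric] cls_diff[OF f(3) F(3), symmetric]
   by (rule b(2)) (use F f in "auto simp: periodic_def intro!: borel_measurable_diff sq_on_diff")
  moreover have "(%k. sqrt N * norm (cls cell (f k) - cls cell F)) ---> sqrt N * 0"
   by (intro tendsto_intros tendsto_norm_zero LIM_zero c)
  ultimately have "(%k. norm (cls (ball 0 r) (f k) - cls (ball 0 r) F)) ---> 0"
   by (intro Lim_null_comparison[where f = "%k. norm (cls (ball 0 r) (f k) - cls (ball 0 r) F)"]) (auto intro: always_eventually)
  then show "(%k. cls (ball 0 r) (f k)) ---> cls (ball 0 r) F" by (simp add: LIM_zero_cancel tendsto_norm_zero_iff)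
 qed
 note lw = lim[OF w(1-3) km(1) ph(2) sk(1) l(1)[folded w(4)]] and lG = lim[OF G(1-3) km(2) pg sk(2) l(2)[folded G(4)]]
 have "is_weak_grad UNIV w G" by (rule weak_grad_limit_on_balls[OF lw(2) lG(2) ph(1) lw(1) lG(1)])
 moreover have "(LINT y:cell|lebesgue. w y) = 0"
 proof -
  have "(%k. inner (cls cell (ph k)) (cls cell (%_. 1))) ---> inner W (cls cell (%_. 1))" by (intro tendsto_intros l)
  then have "inner W (cls cell (%_. 1)) = 0" unfolding ph(3) by (simp add: LIMSEQ_const_iff)
  then show ?thesis unfolding w(4)[symmetric] by (simp add: inner_cls[OF w(3) sq_on_cst])
 qed
 ultimately show ?thesis using w G lw(2) lG(2) by blast
qed

section \<open>Cell solutions and the entries of the effective matrix\<close>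

lemma cell_flux:
 fixes M :: "real^'n => real^'n^'n"
 assumes M: "coef cell mu La M" and G: "sq_on cell G" and ph: "smooth ph"
 shows "(LINT y:cell|lebesgue. (M y *v (G y + axis j 1)) \<bullet> grad ph y) = inner (mulop cell M (cst (axis j 1) + cls cell G)) (cls cell (grad ph))"
proof -
 have s: "sq_on cell (%y. G y + axis j 1)" by (rule sq_on_add[OF G sq_on_cst])
 have g: "sq_on cell (grad ph)" by (intro sq_on_cell_cont smooth_cont_grad ph)
 have "cst (axis j 1) + cls cell G = cls cell (%y. G y + axis j 1)"
  unfolding cst_def cls_add[OF G sq_on_cst] by (rule add.commute)
 then show ?thesis by (simp add: mulop_cls[OF M s] inner_cls[OF coefD(6)[OF M s] g])
qed

lemma grad_in_gradspace:
 assumes "smooth ph" "periodic ph" shows "cls cell (grad ph) : gradspace"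
 unfolding gradspace_def
proof (rule helmholtz_grad)
 show "sq_on cell (grad ph)" by (intro sq_on_cell_cont smooth_cont_grad assms)
 fix z :: "(real^'a, real^'a) l2" assume "z : solset"
 then show "inner (cls cell (grad ph)) z = 0"
  by (intro periodic_gradient_orthogonal_solset[OF assms(2) _ _ smooth_is_weak_grad[OF assms(1)]])
   (auto intro: sq_on_compact_smooth sq_on_compact_smooth_grad assms)
qed

lemma cell_sol_exists:
 fixes M :: "real^'n => real^'n^'n"
 assumes M: "coef cell mu La M" and mu: "0 < mu"
 shows "EX w G. cell_sol M j w G"
proof -
 obtain w G where wG: "periodic w" "!!r. sq_on (ball 0 r) w" "!!r. sq_on (ball 0 r) G" "is_weak_grad UNIV w G"
  "(LINT y:cell|lebesgue. w y) = 0" "sq_on cell G" "cls cell G = corr M (axis j 1)"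
  using gradspace_realize[OF corr(1)[OF M mu, of "axis j 1"]] by blast
 have "(LINT y:cell|lebesgue. (M y *v (G y + axis j 1)) \<bullet> grad ph y) = 0" if "smooth ph" "periodic ph" for ph
  unfolding cell_flux[OF M wG(6) that(1)] wG(7) by (rule corr(2)[OF M mu grad_in_gradspace[OF that]])
 then have "cell_sol M j w G" unfolding cell_sol_def using wG by (simp add: L2_iff_sq_on L2v_iff_sq_on)
 then show ?thesis by blast
qed

text \<open>Whichever solution the choice operator in \<open>effective\<close> returns, its gradient
  lies in \<open>gradspace\<close> by the Helmholtz decomposition and solves the same coercive
  problem, so its class is determined.\<close>

lemma cell_sol_corr:
 fixes M :: "real^'n => real^'n^'n"
 assumes M: "coef cell mu La M" and mu: "0 < mu" and cs: "cell_sol M j w G"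
 shows "sq_on cell G" "cls cell G = corr M (axis j 1)"
proof -
 have wG: "periodic w" "!!r. sq_on (ball 0 r) w" "!!r. sq_on (ball 0 r) G" "is_weak_grad UNIV w G"
  "!!ph. smooth ph ==> periodic ph ==> (LINT y:cell|lebesgue. (M y *v (G y + axis j 1)) \<bullet> grad ph y) = 0"
  using cs by (simp_all add: cell_sol_def L2_iff_sq_on L2v_iff_sq_on)
 obtain r where r: "cell <= ball (0::real^'n) r" using unit_cell_subset_ball by blast
 show sG: "sq_on cell G" by (rule sq_on_subset[OF wG(3) unit_cell_sets(1) r])
 have gs: "cls cell G : gradspace" unfolding gradspace_def
  by (rule helmholtz_grad[OF sG periodic_gradient_orthogonal_solset[OF wG(1-4)]])
 show "cls cell G = corr M (axis j 1)"
 proof (rule corr_unique[OF M mu gs])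
  fix s :: "(real^'n, real^'n) l2" assume "s : gradset"
  then obtain t where t: "t : trigfuns" "s = cls cell (grad t)" by (auto simp: gradset_def)
  show "inner (mulop cell M (cst (axis j 1) + cls cell G)) s = 0"
   unfolding t(2) cell_flux[OF M sG trigfuns_smooth(1)[OF t(1)], symmetric] by (rule wG(5)[OF trigfuns_smooth[OF t(1)]])
 qed
qed

text \<open>The effective matrix as the mean flux of the corrected field, now for arbitrary
  directions; both sides are expanded in basis vectors. All later properties of
  \<open>effective\<close> go through this identity.\<close>

lemma effective_inner:
 fixes M :: "real^'n => real^'n^'n"
 assumes M: "coef cell mu La M" and mu: "0 < mu"
 shows "(effective M *v xi) \<bullet> et = inner (mulop cell M (cst xi + corr M xi)) (cst et)"
proof -
 interpret m: bounded_linear "mulop cell M" by (rule blin_mulop[OF M])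
 note c = coefD[OF M]
 have ent: "effective M $ i $ j = inner (mulop cell M (cst (axis j 1) + corr M (axis j 1))) (cst (axis i 1))" for i j
 proof -
  define p where "p = (SOME p. cell_sol M j (fst p) (snd p))"
  have "EX p. cell_sol M j (fst p) (snd p)" using cell_sol_exists[OF M mu, of j] by auto
  from someI_ex[OF this] have "cell_sol M j (fst p) (snd p)" unfolding p_def .
  note G = cell_sol_corr[OF M mu this]
  have s: "sq_on cell (%y. axis j 1 + snd p y)" by (rule sq_on_add[OF sq_on_cst G(1)])
  have "mulop cell M (cst (axis j 1) + corr M (axis j 1)) = cls cell (%y. M y *v (axis j 1 + snd p y))"
   unfolding G(2)[symmetric] cst_def cls_add[OF sq_on_cst G(1), symmetric] by (rule mulop_cls[OF M s])
  then have "inner (mulop cell M (cst (axis j 1) + corr M (axis j 1))) (cst (axis i 1)) = (LINT y:cell|lebesgue. (M y *v (axis j 1 + snd p y)) \<bullet> axis i 1)"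
   by (simp add: cst_def inner_cls[OF c(6)[OF s] sq_on_cst])
  also have "... = (LINT y:cell|lebesgue. M y *v (axis j 1 + snd p y)) \<bullet> axis i 1"
  proof -
   have si: "set_integrable lebesgue cell (%y. M y *v (axis j 1 + snd p y))"
   proof -
    have "set_integrable lebesgue cell (%y. SUM k:UNIV. ((M y *v (axis j 1 + snd p y)) \<bullet> axis k 1) *R (axis k 1 :: real^'n))"
     unfolding set_integrable_def scaleR_sum_right scaleR_scaleR
     by (intro Bochner_Integration.integrable_sum integrable_scaleR_left)
      (use set_integrable_inner[OF c(6)[OF s] sq_on_cst] in "simp add: set_integrable_def")
    moreover have "(SUM k:UNIV. (v \<bullet> axis k 1) *R axis k 1) = (v :: real^'n)" for v
     by (simp add: inner_axis axis_expansion)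
    ultimately show ?thesis by simp
   qed
   show ?thesis unfolding set_lebesgue_integral_def
    using si by (subst integral_inner_left[symmetric]) (auto simp: set_integrable_def)
  qed
  finally show ?thesis unfolding effective_def p_def by (simp add: inner_axis)
 qed
 have cx: "cst xi + corr M xi = (SUM j:UNIV. xi $ j *R (cst (axis j 1) + corr M (axis j 1)))"
 proof -
  have "cst xi = cst (SUM i:UNIV. xi $ i *R axis i 1)" "corr M xi = corr M (SUM i:UNIV. xi $ i *R axis i 1)" by (simp_all only: axis_expansion)
  then show ?thesis by (simp add: cst_sum cst_scaleR corr_sum[OF M mu] sum.distrib scaleR_add_right)
 qed
 have ce: "cst et = (SUM i:UNIV. et $ i *R cst (axis i 1))"
 proof -
  have "cst et = cst (SUM i:UNIV. et $ i *R axis i 1)" by (simp only: axis_expansion)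
  then show ?thesis by (simp add: cst_sum cst_scaleR)
 qed
 have "(effective M *v xi) \<bullet> et = (SUM i:UNIV. SUM j:UNIV. xi $ j * (et $ i * effective M $ i $ j))"
  by (simp add: inner_vec_def matrix_vector_mult_def sum_distrib_right sum_distrib_left mult_ac)
 also have "... = inner (mulop cell M (cst xi + corr M xi)) (cst et)"
  unfolding cx ce ent by (simp add: m.sum m.scaleR inner_sum_left inner_sum_right sum_distrib_left) (simp add: mult.left_commute)
 finally show ?thesis .
qed

section \<open>Effective matrices\<close>

text \<open>With zeta = N xi the second inequality is the lower bound be |zeta|^2 <= N^{-1} zeta .
  zeta of the class M(mu, 1/be), written without the inverse.\<close>

definition ell :: "real => real => real^'n^'n => bool" where
 "ell mu be N \<longleftrightarrow> (ALL xi. mu * (norm xi)^2 <= (N *v xi) \<bullet> xi & be * (norm (N *v xi))^2 <= (N *v xi) \<bullet> xi)"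

definition near :: "real => real^'n^'n => real^'n^'n => bool" where
 "near de N N' \<longleftrightarrow> (ALL xi et. \<bar>(N *v xi - N' *v xi) \<bullet> et\<bar> <= de * ((N *v xi) \<bullet> xi + (N' *v et) \<bullet> et))"

lemma ell_norm: assumes "ell mu be N" "0 < be" shows "norm (N *v xi) <= 1 / be * norm xi"
proof (cases "N *v xi = 0")
 case False
 have "be * (norm (N *v xi))^2 <= (N *v xi) \<bullet> xi" using assms(1) by (simp add: ell_def)
 also have "... <= norm (N *v xi) * norm xi" by (rule norm_cauchy_schwarz)
 finally have "norm (N *v xi) * (be * norm (N *v xi)) <= norm (N *v xi) * norm xi" by (simp add: power2_eq_square algebra_simps)
 then have "be * norm (N *v xi) <= norm xi" using False by simp
 then show ?thesis using assms(2) by (simp add: field_simps)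
qed (use assms in simp)

lemma ell_inner_le: assumes "ell mu be N" "0 < be" shows "(N *v xi) \<bullet> xi <= (norm xi)^2 / be"
proof -
 have "(N *v xi) \<bullet> xi <= norm (N *v xi) * norm xi" by (rule norm_cauchy_schwarz)
 also have "... <= (1 / be * norm xi) * norm xi" by (intro mult_right_mono ell_norm[OF assms]) simp
 finally show ?thesis by (simp add: power2_eq_square)
qed

text \<open>Young's inequality and coercivity turn a bound on the norm of the difference into one by
  energies.\<close>

lemma nearI:
 assumes "ell mu be N" "ell mu be N'" "0 <= de" "!!xi. norm (N *v xi - N' *v xi) <= 2 * de * mu * norm xi"
  and "0 < mu"
 shows "near de N N'"
 unfolding near_def
proof (intro allI)
 fix xi et
 have "\<bar>(N *v xi - N' *v xi) \<bullet> et\<bar> <= norm (N *v xi - N' *v xi) * norm et" by (rule Cauchy_Schwarz_ineq2)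
 also have "... <= (2 * de * mu * norm xi) * norm et" by (intro mult_right_mono assms(4)) simp
 also have "... = de * mu * (2 * norm xi * norm et)" by simp
 also have "... <= de * mu * ((norm xi)^2 + (norm et)^2)"
  using assms(3,5) by (intro mult_left_mono sum_squares_bound) auto
 also have "... = de * (mu * (norm xi)^2 + mu * (norm et)^2)" by (simp add: algebra_simps)
 also have "... <= de * ((N *v xi) \<bullet> xi + (N' *v et) \<bullet> et)"
  using assms(1-3) by (intro mult_left_mono add_mono) (auto simp: ell_def)
 finally show "\<bar>(N *v xi - N' *v xi) \<bullet> et\<bar> <= de * ((N *v xi) \<bullet> xi + (N' *v et) \<bullet> et)" .
qed

lemma nearD:
 assumes "near de N N'" "ell mu be N" "ell mu be N'" "0 <= de" "0 < be"
 shows "norm (N *v xi - N' *v xi) <= 2 * de / be * norm xi"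
proof (cases "xi = 0 | N *v xi - N' *v xi = 0")
 case False
 define d where "d = N *v xi - N' *v xi"
 \<comment> \<open>Parallel to the difference and of the length of \<open>xi\<close>, so that both
   energies are at most |xi|^2 / be.\<close>
 define et where "et = (norm xi / norm d) *R d"
 have d: "norm d > 0" "norm xi > 0" using False by (auto simp: d_def)
 have n: "norm et = norm xi" using d by (simp add: et_def)
 have "norm xi * norm d = \<bar>d \<bullet> et\<bar>" using d by (simp add: et_def dot_square_norm power2_eq_square)
 also have "... <= de * ((N *v xi) \<bullet> xi + (N' *v et) \<bullet> et)" using assms(1) by (simp add: near_def d_def)
 also have "... <= de * ((norm xi)^2 / be + (norm xi)^2 / be)"
  using ell_inner_le[OF assms(2,5), of xi] ell_inner_le[OF assms(3,5), of et] assms(4) unfolding n by (intro mult_left_mono add_mono)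
 also have "... = norm xi * (2 * de / be * norm xi)" by (simp add: power2_eq_square field_simps)
 finally show ?thesis using d(2) unfolding d_def by (rule mult_left_le_imp_le)
qed (use assms in auto)

lemma matrix_norm_le:
 fixes A :: "real^'n^'n"
 shows "norm (A *v x) <= real CARD('n) * norm A * norm x"
  and "(!!xi. norm (A *v xi) <= ta * norm xi) ==> norm A <= real CARD('n) * real CARD('n) * ta"
proof -
 have "norm (A *v x) <= (SUM i:UNIV. norm ((A *v x) $ i))" unfolding norm_vec_def[of "A *v x"] by (rule L2_set_le_sum) simp
 also have "... <= (SUM i:(UNIV::'n set). norm A * norm x)"
 proof (rule sum_mono)
  fix i
  have "norm ((A *v x) $ i) <= norm (A $ i) * norm x"
   using Cauchy_Schwarz_ineq2[of "A $ i" x] by (simp add: matrix_vector_mul_component)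
  also have "... <= norm A * norm x" by (intro mult_right_mono Finite_Cartesian_Product.norm_nth_le) simp
  finally show "norm ((A *v x) $ i) <= norm A * norm x" .
 qed
 finally show "norm (A *v x) <= real CARD('n) * norm A * norm x" by simp
 assume le: "!!xi. norm (A *v xi) <= ta * norm xi"
 have c: "norm (A $ i $ j) <= ta" for i j
 proof -
  have "A $ i $ j = (A *v axis j 1) $ i" by (simp add: matrix_vector_mult_basis column_def)
  then show ?thesis using component_le_norm_cart[of "A *v axis j 1" i] le[of "axis j 1"] by simp
 qed
 have "norm A <= (SUM i:UNIV. norm (A $ i))" unfolding norm_vec_def by (rule L2_set_le_sum) simp
 also have "... <= (SUM i:(UNIV::'n set). real CARD('n) * ta)"
 proof (rule sum_mono)
  fix i
  have "norm (A $ i) <= (SUM j:UNIV. norm (A $ i $ j))" unfolding norm_vec_def[of "A $ i"] by (rule L2_set_le_sum) simp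
  also have "... <= real CARD('n) * ta" using sum_bounded_above[of "UNIV::'n set" "%j. norm (A $ i $ j)" ta] c by simp
  finally show "norm (A $ i) <= real CARD('n) * ta" .
 qed
 finally show "norm A <= real CARD('n) * real CARD('n) * ta" by (simp add: algebra_simps)
qed

lemma inner_cst: "inner (cst xi) (cst et) = xi \<bullet> et" for xi et :: "real^'n"
proof -
 have m: "measure lebesgue (cell :: (real^'n) set) = 1" "cell \<inter> space lebesgue = (cell :: (real^'n) set)" "emeasure lebesgue (cell :: (real^'n) set) < \<infinity>"
  by (simp_all add: unit_cell_def content_unit emeasure_lborel_cbox_finite)
 have "inner (cst xi) (cst et) = (LINT x|lebesgue. ind (cell :: (real^'n) set) x *R (xi \<bullet> et))"
  unfolding cst_def inner_cls[OF sq_on_cst sq_on_cst] set_lebesgue_integral_def ..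
 also have "... = (LINT x|lebesgue. ind (cell :: (real^'n) set) x) * (xi \<bullet> et)" by simp
 finally show ?thesis by (simp add: m(1))
qed

lemma cell_const_integral: "(LINT z:(cell::(real^'n) set)|lebesgue. r) = (r::real)"
proof -
 have "inner (cst (r *R axis undefined 1 :: real^'n)) (cst (axis undefined 1)) = (LINT z:(cell::(real^'n) set)|lebesgue. (r *R axis undefined 1) \<bullet> (axis undefined 1 :: real^'n))"
  unfolding cst_def by (rule inner_cls[OF sq_on_cst sq_on_cst])
 then show ?thesis by (simp add: inner_cst inner_axis)
qed

lemma norm_cst: "norm (cst xi) = norm xi" by (simp add: norm_eq_sqrt_inner inner_cst)

lemma coef_cell:
 fixes M :: "real^'n => real^'n^'n"
 assumes "continuous_on cell M" "!!z. z : cell ==> ell mu be (M z)" "0 < be"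
 shows "coef cell mu (1 / be) M"
proof -
 have "set_borel_measurable lebesgue cell M"
  using borel_measurable_continuous_on_indicator[OF unit_cell_sets(3) assms(1)] unfolding set_borel_measurable_def
  by (intro measurable_completion) simp
 then show ?thesis using assms(2,3) ell_norm[OF assms(2) assms(3)] by (auto simp: coef_def ell_def)
qed

lemma corrected_cls:
 assumes "coef cell mu La M" "0 < mu"
 obtains F where "sq_on cell F" "cst xi + corr M xi = cls cell F"
proof -
 obtain F where F: "sq_on cell F" "corr M xi = cls cell F" by (rule gradspace_cls[OF corr(1)[OF assms]])
 show ?thesis
  by (rule that[OF sq_on_add[OF sq_on_cst F(1)]]) (simp add: cst_def F(2) cls_add[OF sq_on_cst F(1)])
qed

lemma effective_energy:
 assumes M: "coef cell mu La M" and mu: "0 < mu"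
 shows "(effective M *v xi) \<bullet> xi = inner (mulop cell M (cst xi + corr M xi)) (cst xi + corr M xi)"
 unfolding effective_inner[OF M mu] inner_add_right corr(2)[OF M mu corr(1)[OF M mu]] by simp

text \<open>The adjoint flux of the adjoint-corrected field is orthogonal to gradients, so the
  pairing does not depend on which gradient \<open>x\<close> is added to the constant
  \<open>xi\<close>. This freedom permits inserting the corrector of another matrix.\<close>

lemma effective_adjoint:
 assumes M: "coef cell mu La M" and mu: "0 < mu"
  and x: "x : gradspace"
 shows "(effective M *v xi) \<bullet> et = inner (mulop cell M (cst xi + x)) (cst et + corr (%z. transpose (M z)) et)"
proof -
 let ?q = "cst et + corr (%z. transpose (M z)) et"
 note Mt = coef_transpose[OF M]
 have tr: "inner (mulop cell M (cst xi + x)) ?q = inner (cst xi) (mulop cell (%z. transpose (M z)) ?q)" if x: "x : gradspace" for x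
 proof -
  obtain F where F: "sq_on cell F" "x = cls cell F" by (rule gradspace_cls[OF x])
  obtain H where H: "sq_on cell H" "?q = cls cell H" by (rule corrected_cls[OF Mt mu])
  have "cst xi + x = cls cell (%z. xi + F z)" by (simp add: cst_def F(2) cls_add[OF sq_on_cst F(1)])
  then have "inner (mulop cell M (cst xi + x)) ?q = inner (cst xi + x) (mulop cell (%z. transpose (M z)) ?q)"
   using mulop_transpose[OF M sq_on_add[OF sq_on_cst F(1)] H(1)] H(2) by simp
  then show ?thesis using corr(2)[OF Mt mu x] by (simp add: inner_add_left inner_commute)
 qed
 have "inner (mulop cell M (cst xi + corr M xi)) ?q = (effective M *v xi) \<bullet> et"
  unfolding effective_inner[OF M mu] inner_add_right corr(2)[OF M mu corr(1)[OF Mt mu]] by simp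
 then show ?thesis using tr[OF corr(1)[OF M mu]] tr[OF x] by simp
qed

text \<open>Lower bound: correctors are orthogonal to constants, so the corrected field is at least
  as long as \<open>xi\<close>. Upper bound: the pointwise inequality integrates to one between the
  squared flux and the energy, and the mean flux is no longer than the flux.\<close>

lemma effective_ell:
 fixes M :: "real^'n => real^'n^'n"
 assumes M: "coef cell mu La M" and mu: "0 < mu" and be: "0 < be" and e: "!!z. z : cell ==> ell mu be (M z)"
 shows "ell mu be (effective M)"
 unfolding ell_def
proof (intro allI conjI)
 fix xi :: "real^'n"
 let ?p = "cst xi + corr M xi"
 let ?N = "mulop cell M ?p"
 obtain F where F: "sq_on cell F" "?p = cls cell F" by (rule corrected_cls[OF M mu])
 have "inner (cst xi) (corr M xi) = 0" using gradspace_orthogonal_cst[OF corr(1)[OF M mu]] by (simp add: inner_commute)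
 then have "(norm xi)^2 <= (norm ?p)^2"
  by (simp add: power2_norm_eq_inner inner_add_left inner_add_right inner_cst[symmetric] inner_commute)
 then have "mu * (norm xi)^2 <= mu * (norm ?p)^2" using mu by simp
 also have "... <= inner ?N ?p" unfolding F(2) by (rule mulop_coercive[OF M F(1)])
 finally show "mu * (norm xi)^2 <= (effective M *v xi) \<bullet> xi" by (simp add: effective_energy[OF M mu])
 note MF = coefD(6)[OF M F(1)]
 have N: "?N = cls cell (%x. M x *v F x)" unfolding F(2) by (rule mulop_cls[OF M F(1)])
 have "be * inner ?N ?N = (LINT z:cell|lebesgue. be * ((M z *v F z) \<bullet> (M z *v F z)))" by (simp add: N inner_cls[OF MF MF])
 also have "... <= (LINT z:cell|lebesgue. (M z *v F z) \<bullet> F z)"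
  using e by (intro set_integral_mono set_integrable_mult_right set_integrable_inner MF F) (auto simp: ell_def dot_square_norm)
 also have "... = (effective M *v xi) \<bullet> xi" unfolding effective_energy[OF M mu] N unfolding F(2) by (rule inner_cls[OF MF F(1), symmetric])
 finally have en: "be * inner ?N ?N <= (effective M *v xi) \<bullet> xi" .
 have "(norm (effective M *v xi))^2 = inner ?N (cst (effective M *v xi))"
  by (simp add: effective_inner[OF M mu, symmetric] power2_norm_eq_inner)
 also have "... <= norm ?N * norm (effective M *v xi)" using norm_cauchy_schwarz[of ?N "cst (effective M *v xi)"] by (simp add: norm_cst)
 finally have "norm (effective M *v xi) <= norm ?N"
  by (cases "effective M *v xi = 0") (simp_all add: power2_eq_square)
 then have "be * (norm (effective M *v xi))^2 <= be * (norm ?N)^2" using be by (simp add: power_mono)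
 then show "be * (norm (effective M *v xi))^2 <= (effective M *v xi) \<bullet> xi" using en by (simp add: dot_square_norm)
qed

text \<open>Let p be the corrected field of M for \<open>xi\<close> and q the adjoint-corrected
  field of M' for \<open>et\<close>. Both effective forms at (xi, et) are the integrals of M p . q
  and M' p . q. The pointwise estimate leaves the energies of p for M and of q for M', and these are
  exactly the effective energies, for q although it solves the adjoint problem.\<close>

lemma effective_near:
 fixes M :: "real^'n => real^'n^'n"
 assumes M: "coef cell mu La M" and M': "coef cell mu La M'" and mu: "0 < mu" and e: "!!z. z : cell ==> near de (M z) (M' z)"
 shows "near de (effective M) (effective M')"
 unfolding near_def
proof (intro allI)
 fix xi et :: "real^'n"
 let ?Mt = "%z. transpose (M' z)"
 note Mt = coef_transpose[OF M']
 let ?p = "cst xi + corr M xi" and ?q = "cst et + corr ?Mt et"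
 obtain P where P: "sq_on cell P" "?p = cls cell P" by (rule corrected_cls[OF M mu])
 obtain Q where Q: "sq_on cell Q" "?q = cls cell Q" by (rule corrected_cls[OF Mt mu])
 note MP = coefD(6)[OF M P(1)] and MP' = coefD(6)[OF M' P(1)] and MQ' = coefD(6)[OF M' Q(1)]
 have 1: "(effective M *v xi) \<bullet> et = inner (mulop cell M ?p) ?q"
  unfolding effective_inner[OF M mu] inner_add_right corr(2)[OF M mu corr(1)[OF Mt mu]] by simp
 have 2: "(effective M' *v xi) \<bullet> et = inner (mulop cell M' ?p) ?q"
  by (rule effective_adjoint[OF M' mu corr(1)[OF M mu]])
 have 3: "(effective M' *v et) \<bullet> et = inner (mulop cell M' ?q) ?q"
  by (rule effective_adjoint[OF M' mu corr(1)[OF Mt mu]])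
 have "\<bar>(effective M *v xi - effective M' *v xi) \<bullet> et\<bar> = \<bar>LINT z:cell|lebesgue. (M z *v P z - M' z *v P z) \<bullet> Q z\<bar>"
  unfolding inner_diff_left[of "effective M *v xi"] 1 2 unfolding P(2) Q(2) mulop_cls[OF M P(1)] mulop_cls[OF M' P(1)] inner_diff_left[symmetric] cls_diff[OF MP MP', symmetric]
  by (subst inner_cls[OF sq_on_diff[OF MP MP'] Q(1)]) simp
 also have "... <= (LINT z:cell|lebesgue. \<bar>(M z *v P z - M' z *v P z) \<bullet> Q z\<bar>)"
  using set_integral_norm_bound[OF set_integrable_inner[OF sq_on_diff[OF MP MP'] Q(1)]] by simp
 also have "... <= (LINT z:cell|lebesgue. de * ((M z *v P z) \<bullet> P z + (M' z *v Q z) \<bullet> Q z))"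
  using e by (intro set_integral_mono set_integrable_mult_right set_integral_add set_integrable_abs set_integrable_inner sq_on_diff MP MP' MQ' P Q)
   (auto simp: near_def)
 also have "... = de * ((LINT z:cell|lebesgue. (M z *v P z) \<bullet> P z) + (LINT z:cell|lebesgue. (M' z *v Q z) \<bullet> Q z))"
  by (simp add: set_integral_add(2)[OF set_integrable_inner[OF MP P(1)] set_integrable_inner[OF MQ' Q(1)]])
 also have "... = de * ((effective M *v xi) \<bullet> xi + (effective M' *v et) \<bullet> et)"
  unfolding 3 effective_energy[OF M mu] unfolding P(2) Q(2) mulop_cls[OF M P(1)] mulop_cls[OF M' Q(1)] by (simp add: inner_cls MP P MQ' Q)
 finally show "\<bar>(effective M *v xi - effective M' *v xi) \<bullet> et\<bar> <= de * ((effective M *v xi) \<bullet> xi + (effective M' *v et) \<bullet> et)" .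
qed

lemma effective_const:
 fixes N :: "real^'n^'n"
 assumes "ell mu be N" "0 < mu" "0 < be" shows "effective (%z. N) = N"
proof -
 have M: "coef cell mu (1 / be) (%z. N)" by (rule coef_cell) (use assms in auto)
 have c: "mulop cell (%z. N) (cst xi) = cst (N *v xi)" for xi unfolding cst_def by (rule mulop_cls[OF M sq_on_cst])
 have "corr (%z. N) xi = 0" for xi
 proof (rule corr_unique[OF M assms(2), symmetric])
  show "0 : gradspace" by (rule subspace_0[OF gradspace(1)])
  fix s :: "(real^'n, real^'n) l2" assume "s : gradset"
  then show "inner (mulop cell (%z. N) (cst xi + 0)) s = 0" using gradset_orthogonal_cst by (simp add: c inner_commute)
 qed
 then have "(effective (%z. N) *v xi) \<bullet> et = (N *v xi) \<bullet> et" for xi et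
  by (simp add: effective_inner[OF M assms(2)] c inner_cst)
 then have "effective (%z. N) *v xi = N *v xi" for xi by (metis vector_eq_rdot)
 then show ?thesis by (simp add: matrix_eq)
qed

text \<open>A matrix at level \<open>k\<close> depends only on \<open>y\<^sub>0, ..., y\<^sub>k\<close> and is periodic in
 \<open>y\<^sub>1, ..., y\<^sub>k\<close>; both are expressed by the last conjunct.\<close>

definition adm :: "(real^'n) set => real => real => nat => ((nat => real^'n) => real^'n^'n) => bool" where
 "adm D mu be k M \<longleftrightarrow> continuous_on {y. y 0 : D} M & (ALL y. y 0 : D --> ell mu be (M y)) & 
   (ALL y y'. y 0 : D --> y 0 = y' 0 --> (ALL i : {1..k}. int_vec (y i - y' i)) --> M y = M y')"

lemma adm_cong:
 assumes "adm D mu be k M" "y 0 : D" "y 0 = y' 0" "!!i. 1 <= i ==> i <= k ==> int_vec (y i - y' i)"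
 shows "M y = M y'"
 using assms by (simp add: adm_def)

lemma continuous_on_fun_upd: "continuous_on S (%p. (fst p)(k := snd p :: 'b::topological_space))"
 unfolding fun_upd_def
proof (rule continuous_on_coordinatewise_then_product)
 fix i
 have "continuous_on S (%p. fst p i)"
  by (rule continuous_on_compose2[OF continuous_on_product_coordinates[of i] continuous_on_fst]) (auto intro: continuous_on_id)
 then show "continuous_on S (%p. if i = k then snd p else fst p i)"
  by (cases "i = k") (auto intro: continuous_intros)
qed

lemma adm_joint_continuous:
 assumes "adm D mu be (Suc k) M"
 shows "continuous_on ({y. y 0 : D} \<times> UNIV) (%p. M ((fst p)(Suc k := snd p)))"
 by (rule continuous_on_compose2[OF _ continuous_on_fun_upd]) (use assms in "auto simp: adm_def")

lemma adm_slice: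
 assumes "adm D mu be (Suc k) M" "y 0 : D" "0 < be"
 shows "continuous_on UNIV (%z. M (y(Suc k := z)))" "ell mu be (M (y(Suc k := z)))" "periodic (%z. M (y(Suc k := z)))"
  "coef cell mu (1 / be) (%z. M (y(Suc k := z)))"
proof -
 have "continuous_on UNIV ((%p. M ((fst p)(Suc k := snd p))) \<circ> (%z. (y, z)))"
  by (rule continuous_on_compose) (auto intro!: continuous_intros continuous_on_subset[OF adm_joint_continuous[OF assms(1)]] simp: assms(2))
 then show c: "continuous_on UNIV (%z. M (y(Suc k := z)))" by (simp add: o_def)
 show e: "ell mu be (M (y(Suc k := z)))" for z using assms(1,2) by (auto simp: adm_def)
 show "periodic (%z. M (y(Suc k := z)))" unfolding periodic_def
 proof (intro allI impI)
  fix x z :: "real^'a" assume "int_vec z"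
  then show "M (y(Suc k := x + z)) = M (y(Suc k := x))"
   by (intro adm_cong[OF assms(1)]) (auto simp: assms(2) int_vec_zero)
 qed
 show "coef cell mu (1 / be) (%z. M (y(Suc k := z)))"
  by (rule coef_cell[OF continuous_on_subset[OF c] e assms(3)]) simp
qed

text \<open>Compactness of the cell turns joint continuity into continuity in the slow variables,
  uniform in the fast one.\<close>

lemma adm_uniform:
 assumes "adm D mu be (Suc k) M" "y0 0 : D" "0 < e"
 shows "\<forall>\<^sub>F y in at y0 within {y. y 0 : D}. ALL z : cell. ALL xi. norm (M (y(Suc k := z)) *v xi - M (y0(Suc k := z)) *v xi) <= e * norm xi"
proof -
 define c where "c = real CARD('a)"
 have c: "c > 0" by (simp add: c_def)
 let ?f = "%p. M ((fst p)(Suc k := snd p))"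
 obtain X0 where X0: "y0 : X0" "open X0" "ALL y : X0 \<inter> {y. y 0 : D}. ALL z : cell. dist (?f (y, z)) (?f (y0, z)) <= e / c"
 proof (rule continuous_on_prod_compactE)
  show "continuous_on ({y. y 0 : D} \<times> cell) ?f"
   by (rule continuous_on_subset[OF adm_joint_continuous[OF assms(1)]]) auto
  show "compact (cell :: (real^'a) set)" by simp
  show "y0 : {y. y 0 : D}" "0 < e / c" using assms(2,3) c by auto
 qed
 have "norm (M (y(Suc k := z)) *v xi - M (y0(Suc k := z)) *v xi) <= e * norm xi" if "y : X0" "y 0 : D" "z : cell" for y z xi
 proof -
  have "norm ((M (y(Suc k := z)) - M (y0(Suc k := z))) *v xi) <= c * norm (M (y(Suc k := z)) - M (y0(Suc k := z))) * norm xi"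
   unfolding c_def by (rule matrix_norm_le(1))
  also have "... <= c * (e / c) * norm xi" using X0(3)[rule_format, of y z] that c by (intro mult_right_mono mult_left_mono) (auto simp: dist_norm)
  finally show ?thesis using c by (simp add: matrix_vector_mult_diff_rdistrib)
 qed
 then show ?thesis unfolding eventually_at_topological using X0(1,2) by blast
qed

text \<open>Homogenizing one variable stays in the class with the same constants. Continuity in the
  remaining variables is the stability estimate applied to two nearby parameters.\<close>

lemma adm_effective:
 fixes D :: "(real^'n) set"
 assumes M: "adm D mu be (Suc k) M" and mu: "0 < mu" and be: "0 < be"
 shows "adm D mu be k (%y. effective (%z. M (y(Suc k := z))))"
proof -
 note s = adm_slice[OF M _ be]
 let ?E = "%y. effective (%z. M (y(Suc k := z)))"
 have e: "ell mu be (?E y)" if "y 0 : D" for y by (rule effective_ell[OF s(4) mu be]) (use that s in auto)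
 have "continuous_on {y. y 0 : D} ?E" unfolding continuous_on_def tendsto_iff
 proof (intro ballI allI impI)
  fix y0 :: "nat => real^'n" and r :: real assume y0: "y0 : {y. y 0 : D}" and r: "r > 0"
  define c where "c = real CARD('n)"
  \<comment> \<open>With this choice the bound c * c * (2 * de / be) on the matrix norm equals r /
    2.\<close>
  define de where "de = r / (4 * c * c) * be"
  have c: "c > 0" by (simp add: c_def)
  have de: "de > 0" "2 * de * mu > 0" using r c be mu by (auto simp: de_def)
  have d: "dist (?E y) (?E y0) < r" if y: "y 0 : D" and u: "ALL z : cell. ALL xi. norm (M (y(Suc k := z)) *v xi - M (y0(Suc k := z)) *v xi) <= 2 * de * mu * norm xi" for y
  proof -
   have "near de (?E y) (?E y0)"
    by (rule effective_near[OF s(4) s(4) mu nearI[where mu = mu and be = be]]) (use y y0 u s(2) de mu in auto)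
   then have "norm (?E y *v xi - ?E y0 *v xi) <= 2 * de / be * norm xi" for xi
    by (rule nearD[OF _ e[of y, OF y] e]) (use y0 de be in auto)
   then have "norm (?E y - ?E y0) <= c * c * (2 * de / be)" unfolding c_def
    by (intro matrix_norm_le(2)) (simp add: matrix_vector_mult_diff_rdistrib)
   also have "... = r / 2" using c be by (simp add: de_def field_simps)
   finally show ?thesis using r by (simp add: dist_norm)
  qed
  have "\<forall>\<^sub>F y in at y0 within {y. y 0 : D}. y 0 : D" by (simp add: eventually_at_filter)
  then show "\<forall>\<^sub>F y in at y0 within {y. y 0 : D}. dist (?E y) (?E y0) < r"
   using adm_uniform[of D mu be k M y0, OF M y0[unfolded mem_Collect_eq] de(2)] by eventually_elim (rule d)
 qed
 moreover have "?E y = ?E y'" if "y 0 : D" "y 0 = y' 0" "ALL i : {1..k}. int_vec (y i - y' i)" for y y'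
 proof -
  have "M (y(Suc k := z)) = M (y'(Suc k := z))" for z
   by (rule adm_cong[OF M]) (use that in "auto simp: int_vec_zero")
  then show ?thesis by simp
 qed
 ultimately show ?thesis unfolding adm_def using e by blast
qed

text \<open>The summed bounds give |A_n xi| <= |xi| / mu, whence mu^3 |A_n xi|^2 <= mu |xi|^2 <= A_n
  xi . xi; this is the origin of the exponent 3.\<close>

lemma standing_adm:
 fixes B :: "nat => (nat => real^'n) => real^'n^'n"
 assumes s: "standing_assms D mu B"
 shows "adm D mu (mu ^ 3) n (Asum B n)"
proof -
 have mu: "0 < mu" and dep: "!!l y y'. (ALL i<=l. y i = y' i) ==> B l y = B l y'" and cont: "!!l. continuous_on {y. y 0 : D} (B l)"
  and el: "!!n y xi. y 0 : D ==> xi \<bullet> (Asum B n y *v xi) >= mu * (norm xi)^2"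
  and per: "!!n y z. n >= 1 ==> z 0 = 0 ==> (ALL i. int_vec (z i)) ==> Asum B n (%i. y i + z i) = Asum B n y"
  using s by (auto simp: standing_assms_def)
 obtain c where c: "!!l y xi. y 0 : D ==> norm (B l y *v xi) <= c l * norm xi" "summable c" "suminf c <= 1 / mu"
  using s unfolding standing_assms_def by (elim conjE exE, intro that) auto
 have A_dep: "Asum B n y = Asum B n y'" if "ALL i<=n. y i = y' i" for n y y'
  unfolding Asum_def using that by (intro sum.cong refl dep) auto
 have "ell mu (mu ^ 3) (Asum B n y)" if y: "y 0 : D" for y
 proof -
  have c0: "0 <= c l" for l using c(1)[of y l "axis undefined 1"] y norm_ge_zero[of "B l y *v axis undefined 1"]
   by simp (meson order_trans norm_ge_zero)
  have "norm (Asum B n y *v xi) <= 1 / mu * norm xi" for xi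
  proof -
   have "(\<Sum>l\<le>n. B l y) *v xi = (\<Sum>l\<le>n. B l y *v xi)"
    by (induction n) (auto simp: matrix_vector_mult_add_rdistrib)
   then have "norm (Asum B n y *v xi) = norm (\<Sum>l\<le>n. B l y *v xi)" by (simp add: Asum_def)
   also have "... <= (\<Sum>l\<le>n. c l * norm xi)" by (rule sum_norm_le) (rule c(1)[of y, OF y])
   also have "... = (\<Sum>l\<le>n. c l) * norm xi" by (simp add: sum_distrib_right)
   also have "... <= 1 / mu * norm xi"
    using sum_le_suminf[OF c(2), of "{..n}"] c(3) c0 by (intro mult_right_mono) auto
   finally show ?thesis .
  qed
  then have "mu ^ 3 * (norm (Asum B n y *v xi))^2 <= mu ^ 3 * (1 / mu * norm xi)^2" for xi
   using mu by (intro mult_left_mono power_mono) auto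
  also have "mu ^ 3 * (1 / mu * norm xi)^2 = mu * (norm xi)^2" for xi :: "real^'n"
   using mu by (simp add: field_simps power2_eq_square power3_eq_cube)
  also have "mu * (norm xi)^2 <= (Asum B n y *v xi) \<bullet> xi" for xi using el[of y, OF y] by (simp add: inner_commute)
  finally show ?thesis using el[of y, OF y] by (simp add: ell_def inner_commute)
 qed
 moreover have "continuous_on {y. y 0 : D} (Asum B n)" unfolding Asum_def[abs_def] by (intro continuous_on_sum cont)
 moreover have "Asum B n y = Asum B n y'" if "y 0 = y' 0" "ALL i : {1..n}. int_vec (y i - y' i)" for y y'
 proof (cases "n = 0")
  case False
  \<comment> \<open>The shift is cut to the indices 1..n, so that periodicity applies; the other
    arguments are covered by the dependence of \<open>Asum B n\<close> on y_0, ..., y_n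
    only.\<close>
  define z where "z i = (if i : {1..n} then y i - y' i else 0)" for i
  have "Asum B n (%i. y' i + z i) = Asum B n y'" using False that(2) by (intro per) (auto simp: z_def int_vec_zero)
  moreover have "Asum B n (%i. y' i + z i) = Asum B n y" using that(1)
   by (intro A_dep) (auto simp: z_def not_less_eq_eq[symmetric])
  ultimately show ?thesis by simp
 qed (use that in "auto intro: A_dep")
 ultimately show ?thesis unfolding adm_def by blast
qed

lemma adm_hom_level:
 assumes "standing_assms D mu B" "m <= n"
 shows "adm D mu (mu ^ 3) (n - m) (hom_level B n m)"
 using assms(2)
proof (induction m)
 case (Suc m)
 then have e: "n - m = Suc (n - Suc m)" by simp
 have mu: "0 < mu" using assms(1) by (simp add: standing_assms_def)
 show ?case unfolding hom_level.simps e by (rule adm_effective) (use Suc e mu in auto)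
qed (simp add: standing_adm[OF assms(1)])

text \<open>The first p homogenizations of the longer truncation integrate out variables on which
  the shorter one does not depend, and a constant matrix is its own effective matrix. From then on
  both are homogenized in the same variable, and the estimate keeps its constant.\<close>

lemma hom_level_near:
 assumes s: "standing_assms D mu B" and de: "!!y. y 0 : D ==> near de (Asum B (n + p) y) (Asum B n y)"
  and "j <= n" "y 0 : D"
 shows "near de (hom_level B (n + p) (p + j) y) (hom_level B n j y)"
proof -
 have mu: "0 < mu" "0 < mu ^ 3" using s by (auto simp: standing_assms_def)
 have sl: "coef cell mu (1 / mu ^ 3) (%z. hom_level B n' m (y(n' - m := z)))" if "m < n'" "y 0 : D" for n' m y
  using adm_slice(4)[of D mu "mu ^ 3" "n' - Suc m" "hom_level B n' m" y] adm_hom_level[OF s, of m n'] that mu by (simp add: Suc_diff_Suc)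
 \<comment> \<open>The stage in which only the longer truncation is homogenized;
   \<open>Asum B n\<close> is treated as constant in the variable being averaged.\<close>
 have base: "near de (hom_level B (n + p) i y) (Asum B n y)" if "i <= p" "y 0 : D" for i y
  using that
 proof (induction i arbitrary: y)
  case (Suc i)
  have e: "n + p - i ~= 0" " ~ n + p - i <= n" using Suc.prems by auto
  have c: "Asum B n (y(n + p - i := z)) = Asum B n y" for z
   by (rule adm_cong[OF standing_adm[OF s, of n]]) (use Suc.prems e in "auto simp: int_vec_zero")
  have E: "ell mu (mu ^ 3) (Asum B n y)" using standing_adm[OF s, of n] Suc.prems by (simp add: adm_def)
  have "near de (effective (%z. hom_level B (n + p) i (y(n + p - i := z)))) (effective (%z. Asum B n y))"
  proof (rule effective_near[OF sl coef_cell mu(1)])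
   fix z
   have "near de (hom_level B (n + p) i (y(n + p - i := z))) (Asum B n (y(n + p - i := z)))"
    by (rule Suc.IH) (use Suc.prems e in auto)
   then show "near de (hom_level B (n + p) i (y(n + p - i := z))) (Asum B n y)" by (simp only: c)
  qed (use Suc.prems E mu in auto)
  then show ?case by (simp add: effective_const[OF E mu])
 qed (use de in auto)
 show ?thesis using assms(3,4)
 proof (induction j arbitrary: y)
  case (Suc j)
  have e: "n + p - (p + j) = n - j" "n - j ~= 0" using Suc.prems by auto
  have "near de (effective (%z. hom_level B (n + p) (p + j) (y(n - j := z)))) (effective (%z. hom_level B n j (y(n - j := z))))"
   by (rule effective_near[OF sl[of "p + j" "n + p", unfolded e(1)] sl mu(1)]) (use Suc e in auto)
  then show ?case by (simp add: e(1))
 qed (use base in auto)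
qed

section \<open>Multiscale trigonometric polynomials\<close>

definition scl :: "(nat => real) => real^'n => nat => real^'n" where
 "scl ep x i = (1 / ep i) *R x"

text \<open>Dependence on y_0, ..., y_k only, and periodicity in y_1, ..., y_k, in one condition:
  the variables beyond k are unconstrained.\<close>

definition lev :: "(real^'n) set => nat => ((nat => real^'n) => 'b) => bool" where
 "lev D k f \<longleftrightarrow> (ALL y y'. y 0 : D --> y 0 = y' 0 --> (ALL i. 1 <= i --> i <= k --> int_vec (y i - y' i)) --> f y = f y')"

text \<open>Compact by Tychonoff, and it meets every orbit of integer shifts in the variables other
  than y_0; the setting for Stone-Weierstrass.\<close>

definition pcell :: "(real^'n) set => (nat => real^'n) set" where
 "pcell K = {y. y 0 : K & (ALL i. i ~= 0 --> y i : cell)}"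

lemma compact_pcell: assumes "compact K" shows "compact (pcell K)"
proof -
 have "pcell K = PiE UNIV (%i. if i = 0 then K else cell)"
  by (auto simp: pcell_def PiE_def Pi_def)
 moreover have "compactin (product_topology (%i. euclidean) UNIV) (PiE UNIV (%i::nat. if i = 0 then K else cell))"
  unfolding compactin_PiE using assms by auto
 ultimately show ?thesis by (simp add: euclidean_product_topology)
qed

definition wrap :: "(nat => real^'n) => nat => real^'n" where
 "wrap y i = (if i = 0 then y 0 else fr (y i))"

lemma wrap: "y 0 : K ==> wrap y : pcell K" "wrap y 0 = y 0" "i ~= 0 ==> int_vec (y i - wrap y i)"
proof -
 have "0 <= fr x $ i & fr x $ i <= 1" for x :: "real^'a" and i
  unfolding fr_def vec_lambda_beta by linarith
 then show "y 0 : K ==> wrap y : pcell K" by (auto simp: pcell_def wrap_def mem_unit_cell)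
qed (auto simp: wrap_def fr_def int_vec_def)

lemma lev_wrap: "lev D k f ==> y 0 : D ==> f (wrap y) = f y"
 unfolding lev_def using wrap(2)[of y] wrap(3)[of _ y] by (metis (no_types, lifting) int_vec_minus minus_diff_eq not_one_le_zero)

inductive pt :: "nat => ((nat => real^'n) => real) => bool" for k where
 pt_const: "pt k (%y. c)"
| pt_coord: "pt k (%y. y 0 $ j)"
| pt_trig: "1 <= i ==> i <= k ==> int_vec ka ==> t = tcos ka | t = tsin ka ==> pt k (%y. t (y i))"
| pt_add: "pt k f ==> pt k g ==> pt k (%y. f y + g y)"
| pt_mult: "pt k f ==> pt k g ==> pt k (%y. f y * g y)"

lemma pt_cmult: "pt k f ==> pt k (%y. c * f y)"
 by (rule pt_mult[OF pt_const])

lemma pt_diff: "pt k f ==> pt k g ==> pt k (%y. f y - g y)"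
 using pt_add[of k f "%y. (-1) * g y"] pt_cmult[of k g "-1"] by simp

lemma trig_continuous: "t = tcos ka | t = tsin ka ==> continuous_on UNIV t"
 using smooth_cont smooth_tcos smooth_tsin by blast

lemma pt_mono: "pt k f ==> k <= k' ==> pt k' f"
 by (induction rule: pt.induct) (auto intro: pt.intros)

lemma pt_continuous: "pt k f ==> continuous_on UNIV f"
proof (induction rule: pt.induct)
 case (pt_trig i ka t)
 show ?case
  by (rule continuous_on_compose2[OF trig_continuous[OF pt_trig(4)] continuous_on_product_coordinates]) auto
qed (auto intro!: continuous_intros continuous_on_product_coordinates)

lemma trig_periodic: "t = tcos ka | t = tsin ka ==> int_vec ka ==> int_vec (x - y) ==> t x = t y"
 using periodic_tcos[of ka] periodic_tsin[of ka] unfolding periodic_def by (metis add.commute diff_add_cancel)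

lemma pt_lev: "pt k f ==> lev D k f"
proof (induction rule: pt.induct)
 case (pt_trig i ka t)
 then show ?case unfolding lev_def using trig_periodic by metis
next
 case (pt_add f g)
 then show ?case unfolding lev_def by metis
next
 case (pt_mult f g)
 then show ?case unfolding lev_def by metis
qed (auto simp: lev_def)

text \<open>Approximation on \<open>pcell K\<close> is enough, since \<open>wrap\<close> moves every
  point there without changing \<open>f\<close> or the approximant.\<close>

lemma pt_dense:
 fixes K :: "(real^'n) set"
 assumes K: "compact K" and f: "continuous_on (pcell K) f" "lev K k f" and e: "e > 0"
 shows "EX h. pt k h & (ALL y. y 0 : K --> \<bar>f y - h y\<bar> < e)"
proof -
 \<comment> \<open>Variables beyond k receive the constant 0, so the functions distinguish exactly
   what a function of level k may depend on.\<close>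
 define g :: "nat \<times> 'n \<times> bool => (nat => real^'n) => real" where
  "g p = (case p of (i, j, b) => if i = 0 then (%y. y 0 $ j) else if i <= k then (%y. (if b then tcos (axis j 1) else tsin (axis j 1)) (y i)) else (%y. 0))" for p
 have "EX h : {h. pt k h}. ALL y : pcell K. \<bar>f y - h y\<bar> < e"
 proof (rule Stone_Weierstrass_factor[where g = g, OF compact_pcell[OF K] f(1) _ _ _ _ _ _ e])
  show "(%x. c) : {h. pt k h}" for c by (simp add: pt_const)
  show "(%x. h x + h' x) : {h. pt k h}" "(%x. h x * h' x) : {h. pt k h}" if "h : {h. pt k h}" "h' : {h. pt k h}" for h h'
   using that by (auto intro: pt_add pt_mult)
  show gi: "g p : {h. pt k h}" for p
   by (auto simp: g_def pt_coord pt_const split: prod.split intro: pt_trig[OF _ _ axis_int_vec])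
  show "continuous_on (pcell K) (g p)" for p
   using gi[of p] by (auto intro: continuous_on_subset[OF pt_continuous])
  fix y y' :: "nat => real^'n" assume y: "y : pcell K" "y' : pcell K" and eq: "!!p. g p y = g p y'"
  have "y 0 = y' 0" using eq[of "(0, _, True)"] by (simp add: g_def vec_eq_iff)
  moreover have "int_vec (y i - y' i)" if "1 <= i" "i <= k" for i
   by (rule int_vec_diff_if_trig_eq) (use eq[of "(i, _, True)"] eq[of "(i, _, False)"] that in "simp_all add: g_def")
  ultimately show "f y = f y'" using f(2) y(1) by (simp add: lev_def pcell_def)
 qed
 then obtain h where h: "pt k h" "!!y. y : pcell K ==> \<bar>f y - h y\<bar> < e" by blast
 have "\<bar>f y - h y\<bar> < e" if "y 0 : K" for y
  using h(2)[OF wrap(1)[of y, OF that]] lev_wrap[of K k f y, OF f(2) that] lev_wrap[of K k h y, OF pt_lev[OF h(1)] that] by simp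
 then show ?thesis using h(1) by blast
qed

lemma scale_vecD:
 assumes "scale_vec ep" shows "0 < ep i" "ep 0 = 1" "i <= k ==> ep k <= ep i"
proof -
 show "0 < ep i" "ep 0 = 1" using assms by (cases i; simp add: scale_vec_def)+
 show "i <= k ==> ep k <= ep i" using assms by (rule_tac lift_Suc_antimono_le[of ep]) (auto simp: scale_vec_def less_imp_le)
qed

lemma scl_0: "scale_vec ep ==> scl ep x 0 = x" by (simp add: scl_def scale_vecD(2))

lemma trig_scl: "tcos ka (c *R x) = tcos (c *R ka) x" "tsin ka (c *R x) = tsin (c *R ka) x"
 by (simp_all add: tcos_def tsin_def)

lemma trig_bounds:
 assumes "t = tcos ka | t = tsin ka"
 shows "smooth t" "\<bar>t x\<bar> <= 1" "norm (grad t x) <= 2 * pi * norm ka"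
proof -
 show "smooth t" using assms smooth_tcos smooth_tsin by auto
 show "\<bar>t x\<bar> <= 1" using assms by (auto simp: tcos_def tsin_def)
 have "\<bar>tsin ka x\<bar> * norm ka <= 1 * norm ka" "\<bar>tcos ka x\<bar> * norm ka <= 1 * norm ka"
  by (intro mult_right_mono; simp add: tcos_def tsin_def)+
 then show "norm (grad t x) <= 2 * pi * norm ka"
  using assms by (auto simp: grad_tcos grad_tsin abs_mult mult.assoc)
qed

text \<open>A derivative costs at most 1 / eps_k, the scales being decreasing with eps_0 = 1. The
  constant is the same for all scale vectors.\<close>

lemma pt_scl:
 assumes "pt k f" "compact K"
 shows "EX C>=0. ALL ep. scale_vec ep --> smooth (%x. f (scl ep x)) & 
  (ALL x : K. \<bar>f (scl ep x)\<bar> <= C & norm (grad (%x. f (scl ep x)) x) <= C / ep k)"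
 using assms(1)
proof (induction rule: pt.induct)
 case (pt_const c)
 show ?case by (intro exI[of _ "\<bar>c\<bar>"]) (auto simp: smooth_const grad_const dest: scale_vecD(1)[of _ k] intro: divide_nonneg_pos)
next
 case (pt_coord j)
 obtain R where R: "!!x. x : K ==> norm x <= R" using compact_imp_bounded[OF assms(2)] by (auto simp: bounded_iff)
 have e: "(%x::real^'a. x $ j) = (%x. axis j 1 \<bullet> x + 0)" by (simp add: inner_axis inner_commute fun_eq_iff)
 show ?case
 proof (intro exI[of _ "max 1 R"] conjI allI impI ballI)
  fix ep assume ep: "scale_vec ep"
  have s: "(%x. scl ep x 0 $ j) = (%x::real^'a. axis j 1 \<bullet> x + 0)" by (simp add: scl_0[OF ep] e)
  show "smooth (%x::real^'a. scl ep x 0 $ j)" unfolding s by (rule smooth_linear)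
  fix x assume x: "x : K"
  show "\<bar>scl ep x 0 $ j\<bar> <= max 1 R" using component_le_norm_cart[of x j] R[OF x] by (simp add: scl_0[OF ep])
  have "1 <= max 1 R / ep k" using scale_vecD(3)[OF ep, of 0 k] scale_vecD(1)[OF ep, of k] scale_vecD(2)[OF ep] by (simp add: field_simps)
  then show "norm (grad (%x. scl ep x 0 $ j) x) <= max 1 R / ep k" unfolding s grad_linear by simp
 qed simp
next
 case (pt_trig i ka t)
 show ?case
 proof (intro exI[of _ "max 1 (2 * pi * norm ka)"] conjI allI impI ballI)
  fix ep assume ep: "scale_vec ep"
  define t' where "t' = (%x. t (scl ep x i))"
  have t': "t' = tcos ((1 / ep i) *R ka) | t' = tsin ((1 / ep i) *R ka)"
   using pt_trig(4) by (auto simp: t'_def scl_def trig_scl fun_eq_iff)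
  show "smooth (%x. t (scl ep x i))" using trig_bounds(1)[OF t'] by (simp add: t'_def)
  fix x
  show "\<bar>t (scl ep x i)\<bar> <= max 1 (2 * pi * norm ka)" using trig_bounds(2)[OF t', of x] by (simp add: t'_def)
  have "norm (grad t' x) <= 2 * pi * norm ((1 / ep i) *R ka)" by (rule trig_bounds(3)[OF t'])
  also have "... = (2 * pi * norm ka) / ep i" using scale_vecD(1)[OF ep, of i] by simp
  also have "... <= max 1 (2 * pi * norm ka) / ep k"
   using scale_vecD(1)[OF ep, of k] scale_vecD(3)[OF ep pt_trig(2)] by (intro frac_le) auto
  finally show "norm (grad (%x. t (scl ep x i)) x) <= max 1 (2 * pi * norm ka) / ep k" by (simp add: t'_def)
 qed simp
next
 case (pt_add f g)
 obtain C where C: "C >= 0" "!!ep. scale_vec ep ==> smooth (%x. f (scl ep x))" "!!ep x. scale_vec ep ==> x : K ==> \<bar>f (scl ep x)\<bar> <= C"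
  "!!ep x. scale_vec ep ==> x : K ==> norm (grad (%x. f (scl ep x)) x) <= C / ep k" using pt_add.IH(1) by auto
 obtain C' where C': "C' >= 0" "!!ep. scale_vec ep ==> smooth (%x. g (scl ep x))" "!!ep x. scale_vec ep ==> x : K ==> \<bar>g (scl ep x)\<bar> <= C'"
  "!!ep x. scale_vec ep ==> x : K ==> norm (grad (%x. g (scl ep x)) x) <= C' / ep k" using pt_add.IH(2) by auto
 show ?case
 proof (intro exI[of _ "C + C'"] conjI allI impI ballI)
  fix ep x assume ep: "scale_vec ep" and x: "x : K"
  show "\<bar>f (scl ep x) + g (scl ep x)\<bar> <= C + C'" using C(3)[OF ep x] C'(3)[OF ep x] by linarith
  show "norm (grad (%x. f (scl ep x) + g (scl ep x)) x) <= (C + C') / ep k"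
   unfolding grad_add[OF smooth_diffble[OF C(2)[OF ep]] smooth_diffble[OF C'(2)[OF ep]]] add_divide_distrib
   by (rule norm_triangle_mono[OF C(4)[OF ep x] C'(4)[OF ep x]])
 qed (use C C' in "auto intro: smooth_add")
next
 case (pt_mult f g)
 obtain C where C: "C >= 0" "!!ep. scale_vec ep ==> smooth (%x. f (scl ep x))" "!!ep x. scale_vec ep ==> x : K ==> \<bar>f (scl ep x)\<bar> <= C"
  "!!ep x. scale_vec ep ==> x : K ==> norm (grad (%x. f (scl ep x)) x) <= C / ep k" using pt_mult.IH(1) by auto
 obtain C' where C': "C' >= 0" "!!ep. scale_vec ep ==> smooth (%x. g (scl ep x))" "!!ep x. scale_vec ep ==> x : K ==> \<bar>g (scl ep x)\<bar> <= C'"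
  "!!ep x. scale_vec ep ==> x : K ==> norm (grad (%x. g (scl ep x)) x) <= C' / ep k" using pt_mult.IH(2) by auto
 show ?case
 proof (intro exI[of _ "C * C' + C' * C"] conjI allI impI ballI)
  fix ep x assume ep: "scale_vec ep" and x: "x : K"
  have "\<bar>f (scl ep x) * g (scl ep x)\<bar> <= C * C'" unfolding abs_mult by (intro mult_mono C(3)[OF ep x] C'(3)[OF ep x] C(1)) simp
  then show "\<bar>f (scl ep x) * g (scl ep x)\<bar> <= C * C' + C' * C" using mult_nonneg_nonneg[OF C(1) C'(1)] by (simp add: mult.commute)
  have "norm (f (scl ep x) *R grad (%x. g (scl ep x)) x) <= C * (C' / ep k)" "norm (g (scl ep x) *R grad (%x. f (scl ep x)) x) <= C' * (C / ep k)"
   unfolding norm_scaleR by (intro mult_mono C C' ep x norm_ge_zero)+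
  from norm_triangle_mono[OF this]
  show "norm (grad (%x. f (scl ep x) * g (scl ep x)) x) <= (C * C' + C' * C) / ep k"
   unfolding grad_mult[OF smooth_diffble[OF C(2)[OF ep]] smooth_diffble[OF C'(2)[OF ep]]] by (simp add: add_divide_distrib)
 qed (use C C' in "auto intro: smooth_mult")
qed

lemma osc_bounds:
 assumes ph: "test_fun D ph" and f: "pt k f"
 shows "EX C>0. ALL ep. scale_vec ep --> test_fun D (%x. ph x * f (scl ep x)) & 
  (ALL x. \<bar>ph x * f (scl ep x)\<bar> <= C & norm (grad (%x. ph x * f (scl ep x)) x) <= C / ep k)"
proof -
 obtain K where K: "compact K" "K <= D" "!!x. x ~: K ==> ph x = 0" "smooth ph" by (rule test_funD[OF ph]) blast
 obtain C1 where C1: "C1 > 0" "!!x. norm (grad ph x) <= C1" "!!x. \<bar>ph x\<bar> <= C1" using bounded_grad_test_fun[OF ph] by blast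
 obtain C where C: "C >= 0" "!!ep. scale_vec ep ==> smooth (%x. f (scl ep x))" "!!ep x. scale_vec ep ==> x : K ==> \<bar>f (scl ep x)\<bar> <= C"
  "!!ep x. scale_vec ep ==> x : K ==> norm (grad (%x. f (scl ep x)) x) <= C / ep k" using pt_scl[OF f K(1)] by auto
 show ?thesis
 proof (intro exI[of _ "C1 * C + C * C1 + 1"] conjI allI impI)
  show p: "0 < C1 * C + C * C1 + 1" using C(1) C1(1) by (intro add_nonneg_pos add_nonneg_nonneg) auto
  fix ep x assume ep: "scale_vec ep"
  show "test_fun D (%x. ph x * f (scl ep x))" by (rule test_fun_mult[OF ph C(2)[OF ep]])
  note e = scale_vecD(1)[OF ep, of k] scale_vecD(3)[OF ep, of 0 k] scale_vecD(2)[OF ep]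
  have z: "\<bar>ph x * f (scl ep x)\<bar> <= C1 * C + C * C1 + 1 & norm (grad (%x. ph x * f (scl ep x)) x) <= (C1 * C + C * C1 + 1) / ep k"
  proof (cases "x : K")
   case True
   have "\<bar>ph x * f (scl ep x)\<bar> <= C1 * C" unfolding abs_mult using C1 C(3)[OF ep True] by (intro mult_mono) auto
   moreover have "0 <= C * C1" using C(1) C1(1) by simp
   moreover have "norm (ph x *R grad (%x. f (scl ep x)) x) <= C1 * (C / ep k)" "norm (f (scl ep x) *R grad ph x) <= C * C1"
    unfolding norm_scaleR real_norm_def by (intro mult_mono C1(2,3) C(3,4)[OF ep True] C(1) less_imp_le[OF C1(1)] norm_ge_zero)+
   from norm_triangle_mono[OF this]
   have "norm (grad (%x. ph x * f (scl ep x)) x) <= C1 * (C / ep k) + C * C1"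
    unfolding grad_mult[OF smooth_diffble[OF K(4)] smooth_diffble[OF C(2)[OF ep]]] .
   moreover have "C * C1 <= C * C1 / ep k" using e C(1) C1(1) by (simp add: divide_simps mult_left_le)
   moreover have "0 < 1 / ep k" using e(1) by simp
   ultimately show ?thesis unfolding add_divide_distrib times_divide_eq_right by linarith
  next
   case False
   have "grad (%x. ph x * f (scl ep x)) x = 0"
    by (rule grad_zero_outside[OF compact_imp_closed[OF K(1)] _ False]) (simp add: K(3))
   then show ?thesis using p e(1) K(3)[OF False] by simp
  qed
  then show "\<bar>ph x * f (scl ep x)\<bar> <= C1 * C + C * C1 + 1" "norm (grad (%x. ph x * f (scl ep x)) x) <= (C1 * C + C * C1 + 1) / ep k" by auto
 qed
qed

section \<open>Averaging over the fastest variable\<close>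

lemma sep_scalesD:
 assumes "sep_scales E" shows "scale_vec (E m)" "(%m. E m (Suc k) / E m k) ---> 0"
proof -
 show s: "scale_vec (E m)" for m using assms by (simp add: sep_scales_def)
 show "(%m. E m (Suc k) / E m k) ---> 0"
  using assms by (cases "k = 0") (auto simp: sep_scales_def scale_vecD(2)[OF s])
qed

lemma norm_cls_bounded:
 fixes f :: "real^'n => 'b::euclidean_space"
 assumes D: "D : lmeasurable" and f: "sq_on D f" "!!x. x : D ==> norm (f x) <= c" and c: "0 <= c"
 shows "norm (cls D f) <= c * sqrt (measure lebesgue D)"
proof -
 have "(norm (cls D f))^2 = (LINT x:D|lebesgue. f x \<bullet> f x)" unfolding power2_norm_eq_inner by (rule inner_cls[OF f(1) f(1)])
 also have "... <= (LINT x:D|lebesgue. c^2)"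
 proof (rule set_integral_mono[OF set_integrable_inner[OF f(1) f(1)]])
  show "set_integrable lebesgue D (%x. c^2)" using D by (auto simp: set_integrable_def fmeasurable_def)
  show "f x \<bullet> f x <= c^2" if "x : D" for x using f(2)[OF that] by (simp add: dot_square_norm power_mono)
 qed
 also have "... = (c * sqrt (measure lebesgue D))^2"
  using D by (simp add: set_lebesgue_integral_def power_mult_distrib)
 finally show ?thesis by (rule power2_le_imp_le) (simp add: c)
qed

lemma trig_primitive:
 assumes "t = tcos ka | t = tsin ka"
 shows "EX s. smooth s & (ALL x. \<bar>s x\<bar> <= 1) & (ALL x. grad s x = (2 * pi * t x) *R ka)"
proof (cases "t = tcos ka")
 case True
 then show ?thesis using trig_bounds(1,2)[of "tsin ka" ka] by (intro exI[of _ "tsin ka"]) (auto simp: grad_tsin)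
next
 case False
 then have "t = tsin ka" using assms by simp
 then show ?thesis using trig_bounds(1,2)[of "tcos ka" ka] smooth_cmult[OF smooth_tcos, of "-1" ka] grad_cmult[OF smooth_tcos, of "-1" ka]
  by (intro exI[of _ "%x. (-1) * tcos ka x"]) (auto simp: grad_tcos)
qed

text \<open>One integration by parts in the direction \<open>i\<close>: the primitive of the
  oscillating factor gains the frequency component, and the derivative falls on the
  amplitude.\<close>

lemma oscillating_integral:
 assumes D: "D : lmeasurable" and Th: "test_fun D Th" "!!x. norm (grad Th x) <= C" and t: "t = tcos ka | t = tsin ka" and i: "ka $ i ~= 0"
 shows "\<bar>LINT x:D|lebesgue. Th x * t x\<bar> <= C * measure lebesgue D / \<bar>ka $ i\<bar>"
proof -
 have C: "0 <= C" using Th(2)[of 0] norm_ge_zero order_trans by blast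
 obtain s where s: "smooth s" "!!x. \<bar>s x\<bar> <= 1" "!!x. grad s x = (2 * pi * t x) *R ka" using trig_primitive[OF t] by blast
 have T: "test_fun D (%x. pd i Th x * s x)" by (rule test_fun_mult[OF test_fun_pd[OF Th(1)] s(1)])
 have one: "sq_on D (%_. 1::real)" by (rule sq_on_bounded_measurable[OF D, of _ 1]) (use D in "auto simp: fmeasurable_def")
 have "(LINT x:D|lebesgue. s x * grad Th x $ i) = - (LINT x:D|lebesgue. grad s x $ i * Th x)"
  using smooth_is_weak_grad[OF s(1)] Th(1) by (simp add: is_weak_grad_def)
 also have "(LINT x:D|lebesgue. grad s x $ i * Th x) = (LINT x:D|lebesgue. (2 * pi * ka $ i) * (Th x * t x))" by (simp add: s(3) mult_ac)
 also have "(LINT x:D|lebesgue. s x * grad Th x $ i) = inner (cls D (%x. pd i Th x * s x)) (cls D (%_. 1))"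
  by (subst inner_cls[OF sq_on_test_fun[OF T] one]) (simp add: grad_nth mult.commute)
 finally have eq: "inner (cls D (%x. pd i Th x * s x)) (cls D (%_. 1)) = - ((2 * pi * ka $ i) * (LINT x:D|lebesgue. Th x * t x))" by simp
 have "\<bar>pd i Th x * s x\<bar> <= C" for x
 proof -
  have "\<bar>pd i Th x\<bar> <= C" using component_le_norm_cart[of "grad Th x" i] Th(2)[of x] by (simp add: grad_nth)
  then have "\<bar>pd i Th x\<bar> * \<bar>s x\<bar> <= C * 1" using s(2) C by (intro mult_mono) auto
  then show ?thesis by (simp add: abs_mult)
 qed
 then have 1: "norm (cls D (%x. pd i Th x * s x)) <= C * sqrt (measure lebesgue D)"
  by (intro norm_cls_bounded[OF D sq_on_test_fun[OF T]]) (auto simp: C)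
 have 2: "norm (cls D (%_. 1::real)) <= 1 * sqrt (measure lebesgue D)" by (rule norm_cls_bounded[OF D one]) auto
 have "2 * pi * (\<bar>ka $ i\<bar> * \<bar>LINT x:D|lebesgue. Th x * t x\<bar>) = \<bar>inner (cls D (%x. pd i Th x * s x)) (cls D (%_. 1))\<bar>"
  unfolding eq by (simp add: abs_mult)
 also have "... <= (C * sqrt (measure lebesgue D)) * (1 * sqrt (measure lebesgue D))"
  using C by (intro order_trans[OF Cauchy_Schwarz_ineq2 mult_mono[OF 1 2]]) auto
 also have "... = C * measure lebesgue D" by (simp add: mult.assoc)
 finally have le: "2 * pi * (\<bar>ka $ i\<bar> * \<bar>LINT x:D|lebesgue. Th x * t x\<bar>) <= C * measure lebesgue D" .
 have "1 * (\<bar>ka $ i\<bar> * \<bar>LINT x:D|lebesgue. Th x * t x\<bar>) <= 2 * pi * (\<bar>ka $ i\<bar> * \<bar>LINT x:D|lebesgue. Th x * t x\<bar>)"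
  by (rule mult_right_mono) (use pi_ge_two in auto)
 then have "\<bar>LINT x:D|lebesgue. Th x * t x\<bar> * \<bar>ka $ i\<bar> <= C * measure lebesgue D" using le by (simp only: mult_1 mult.commute)
 then show ?thesis using i by (simp add: pos_le_divide_eq)
qed

lemma set_integrable_test_fun: "test_fun D ph ==> set_integrable lebesgue D ph"
proof -
 assume ph: "test_fun D ph"
 then have "(%x. ind D x *R ph x) = ph" using test_fun_outside[OF ph] by (auto simp: indicator_def fun_eq_iff)
 then show ?thesis unfolding set_integrable_def using integrable_test_fun[OF ph] by simp
qed

lemma trigfuns_mean: assumes "t : trigfuns" shows "inner (cls cell t) (cls cell (%_. 1)) = 0"
proof -
 obtain l where l: "l >= 1" "inner (cls cell (grad t)) (cls cell (grad (%_. 1))) = l * inner (cls cell t) (cls cell (%_. 1))"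
  using trig_eigen[OF assms] smooth_const[of 1] by (metis (mono_tags, lifting) periodic_def)
 then show ?thesis by (simp add: grad_const[abs_def] cls_zero)
qed

text \<open>The mean value property: h minus its mean in y_{k+1} tends to zero against test
  functions. Existence of the mean within \<open>pt k\<close> is included, so the property is stable
  under sums.\<close>

definition averaged :: "(real^'n) set => nat => ((nat => real^'n) => real) => bool" where
 "averaged D k h \<longleftrightarrow> pt (Suc k) h & (EX hb. pt k hb & (ALL y. hb y = (LINT z:cell|lebesgue. h (y(Suc k := z)))) & 
  (ALL ph E. test_fun D ph --> sep_scales E --> (%m. LINT x:D|lebesgue. ph x * (h (scl (E m) x) - hb (scl (E m) x))) ---> 0))"

lemma pt_slice: assumes "pt k h" shows "sq_on cell (%z. h (y(j := z)))"
proof (rule sq_on_cell_cont)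
 have "continuous_on UNIV (h \<circ> (%p. (fst p)(j := snd p)) \<circ> (%z. (y, z)))"
  by (intro continuous_on_compose continuous_on_Pair continuous_on_const continuous_on_id continuous_on_fun_upd continuous_on_subset[OF pt_continuous[OF assms]]) auto
 then show "continuous_on UNIV (%z. h (y(j := z)))" by (simp add: o_def)
qed

lemma averaged_add:
 assumes "averaged D k f" "averaged D k g" shows "averaged D k (%y. f y + g y)"
proof -
 obtain fb where f: "pt (Suc k) f" "pt k fb" "!!y. fb y = (LINT z:cell|lebesgue. f (y(Suc k := z)))"
  "!!ph E. test_fun D ph ==> sep_scales E ==> (%m. LINT x:D|lebesgue. ph x * (f (scl (E m) x) - fb (scl (E m) x))) ---> 0"
  using assms(1) by (auto simp: averaged_def)
 obtain gb where g: "pt (Suc k) g" "pt k gb" "!!y. gb y = (LINT z:cell|lebesgue. g (y(Suc k := z)))"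
  "!!ph E. test_fun D ph ==> sep_scales E ==> (%m. LINT x:D|lebesgue. ph x * (g (scl (E m) x) - gb (scl (E m) x))) ---> 0"
  using assms(2) by (auto simp: averaged_def)
 show ?thesis unfolding averaged_def
 proof (intro conjI exI[of _ "%y. fb y + gb y"] allI impI)
  show "pt (Suc k) (%y. f y + g y)" "pt k (%y. fb y + gb y)" by (intro pt_add f g)+
  have i: "set_integrable lebesgue cell (%z. h (y(Suc k := z)))" if "pt (Suc k) h" for h and y :: "nat => real^'a"
   using set_integrable_inner[OF pt_slice[OF that] sq_on_cst[of 1]] by simp
  show "fb y + gb y = (LINT z:cell|lebesgue. f (y(Suc k := z)) + g (y(Suc k := z)))" for y
   by (simp add: f(3) g(3) set_integral_add(2)[OF i[OF f(1)] i[OF g(1)]])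
  fix ph E assume ph: "test_fun D ph" and E: "sep_scales E"
  have T: "set_integrable lebesgue D (%x. ph x * (h (scl (E m) x) - h' (scl (E m) x)))" if "pt (Suc k) h" "pt k h'" for m h h'
   using osc_bounds[OF ph pt_diff[OF that(1) pt_mono[OF that(2)]]] sep_scalesD(1)[OF E] by (auto intro: set_integrable_test_fun)
  have "(LINT x:D|lebesgue. ph x * (f (scl (E m) x) + g (scl (E m) x) - (fb (scl (E m) x) + gb (scl (E m) x))))
   = (LINT x:D|lebesgue. ph x * (f (scl (E m) x) - fb (scl (E m) x))) + (LINT x:D|lebesgue. ph x * (g (scl (E m) x) - gb (scl (E m) x)))" for m
   unfolding set_integral_add(2)[OF T[OF f(1,2)] T[OF g(1,2)], symmetric] by (simp add: algebra_simps)
  then show "(%m. LINT x:D|lebesgue. ph x * (f (scl (E m) x) + g (scl (E m) x) - (fb (scl (E m) x) + gb (scl (E m) x)))) ---> 0"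
   using tendsto_add[OF f(4)[OF ph E] g(4)[OF ph E]] by simp
 qed
qed

text \<open>A nonconstant mode in y_{k+1} gains eps_{k+1} from the oscillation and loses 1 / eps_k
  from the slower amplitude; the ratio tends to 0 by scale separation. Frequency 0 is its own
  mean.\<close>

lemma averaged_trig:
 assumes D: "D : lmeasurable" and g: "pt k g" and ka: "int_vec ka" and t: "t = tcos ka | t = tsin ka"
 shows "averaged D k (%y. g y * t (y (Suc k)))"
proof -
 have gy: "g (y(Suc k := z)) = g y" for y z
  by (rule pt_lev[OF g, of UNIV, unfolded lev_def, rule_format]) (auto simp: int_vec_zero)
 have p: "pt (Suc k) (%y. g y * t (y (Suc k)))" by (intro pt_mult pt_mono[OF g] pt_trig[OF _ _ ka t]) auto
 show ?thesis
 proof (cases "ka = 0")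
  case True
  define c where "c = t 0"
  have t: "t = (%_. c)" using t True by (auto simp: c_def tcos_def tsin_def)
  show ?thesis unfolding averaged_def
   by (intro conjI p exI[of _ "%y. c * g y"] allI impI pt_cmult g) (auto simp: t gy cell_const_integral mult.commute)
 next
  case False
  then obtain i where i: "ka $ i ~= 0" by (auto simp: vec_eq_iff)
  have tf: "t : trigfuns" using False t ka by (auto simp: trigfuns_def)
  have m: "(LINT z:cell|lebesgue. t z) = 0"
   using trigfuns_mean[OF tf] by (simp add: inner_cls[OF sq_on_cell_cont[OF trig_continuous[OF t]] sq_on_cst])
  show ?thesis unfolding averaged_def
  proof (intro conjI p exI[of _ "%y. 0"] allI impI pt_const)
   show "0 = (LINT z:cell|lebesgue. g (y(Suc k := z)) * t ((y(Suc k := z)) (Suc k)))" for y by (simp add: gy m)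
   fix ph E assume ph: "test_fun D ph" and E: "sep_scales E"
   note s = sep_scalesD(1)[OF E]
   obtain C where C: "C > 0" "!!m. test_fun D (%x. ph x * g (scl (E m) x))" "!!m x. norm (grad (%x. ph x * g (scl (E m) x)) x) <= C / E m k"
    using osc_bounds[OF ph g] s by metis
   have "\<bar>LINT x:D|lebesgue. ph x * (g (scl (E m) x) * t (scl (E m) x (Suc k)) - 0)\<bar> <= (C * measure lebesgue D / \<bar>ka $ i\<bar>) * (E m (Suc k) / E m k)" for m
   proof -
    define t' where "t' = (%x. t (scl (E m) x (Suc k)))"
    have t': "t' = tcos ((1 / E m (Suc k)) *R ka) | t' = tsin ((1 / E m (Suc k)) *R ka)"
     using t by (auto simp: t'_def scl_def trig_scl fun_eq_iff)
    have "\<bar>LINT x:D|lebesgue. (ph x * g (scl (E m) x)) * t' x\<bar> <= C / E m k * measure lebesgue D / \<bar>((1 / E m (Suc k)) *R ka) $ i\<bar>"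
     by (rule oscillating_integral[OF D C(2,3) t']) (use i scale_vecD(1)[OF s, of m "Suc k"] in auto)
    also have "... = (C * measure lebesgue D / \<bar>ka $ i\<bar>) * (E m (Suc k) / E m k)"
     using scale_vecD(1)[OF s, of m "Suc k"] by (simp add: abs_mult field_simps)
    finally show ?thesis by (simp add: t'_def mult.assoc)
   qed
   moreover have "(%m. (C * measure lebesgue D / \<bar>ka $ i\<bar>) * (E m (Suc k) / E m k)) ---> 0"
    by (rule tendsto_mult_right_zero[OF sep_scalesD(2)[OF E]])
   ultimately show "(%m. LINT x:D|lebesgue. ph x * (g (scl (E m) x) * t (scl (E m) x (Suc k)) - 0)) ---> 0"
    by (rule_tac Lim_null_comparison[OF always_eventually]) auto
  qed
 qed
qed

text \<open>The normal form of elements of \<open>pt (Suc k)\<close>: sums of products in which the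
  last variable is separated.\<close>

inductive pts :: "nat => ((nat => real^'n) => real) => bool" for k where
 pts_base: "pt k g ==> trigpoly t ==> pts k (%y. g y * t (y (Suc k)))"
| pts_add: "pts k f ==> pts k g ==> pts k (%y. f y + g y)"

lemma pts_mult: assumes "pts k f" "pts k g" shows "pts k (%y. f y * g y)"
 using assms
proof (induction arbitrary: g rule: pts.induct)
 case (pts_base h t)
 from pts_base(3) show ?case
 proof (induction rule: pts.induct)
  case (pts_base h' t')
  have "pts k (%y. (h y * h' y) * (t (y (Suc k)) * t' (y (Suc k))))"
   by (rule pts.pts_base[OF pt_mult trigpoly_mult]) (use \<open>pt k h\<close> \<open>trigpoly t\<close> pts_base in auto)
  then show ?case by (simp add: mult_ac)
 qed (simp add: distrib_left pts_add)
qed (simp add: distrib_right pts_add)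

lemma pt_Suc_pts: "pt (Suc k) f ==> pts k f"
proof (induction rule: pt.induct)
 case (pt_const c)
 show ?case using pts_base[OF pt.pt_const[of k c] trigpoly_const[of 1]] by simp
next
 case (pt_coord j)
 show ?case using pts_base[OF pt.pt_coord[of k j] trigpoly_const[of 1]] by simp
next
 case (pt_trig i ka t)
 show ?case
 proof (cases "i = Suc k")
  case True
  have "trigpoly t" using pt_trig(3,4) trigpoly_tcos trigpoly_tsin by auto
  then show ?thesis using pts_base[OF pt.pt_const[of k 1], of t] True by simp
 next
  case False
  then show ?thesis using pts_base[OF pt.pt_trig[of i k ka t] trigpoly_const[of 1]] pt_trig by simp
 qed
qed (auto intro: pts_add pts_mult)

lemma averaged:
 assumes D: "D : lmeasurable" and f: "pt (Suc k) f" shows "averaged D k f"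
 using pt_Suc_pts[OF f]
proof (induction rule: pts.induct)
 case (pts_base g t)
 from pts_base(2) show ?case
 proof (induction rule: trigpoly.induct)
  case (trigpoly_cos ka c)
  show ?case using averaged_trig[OF D pt_cmult[OF pts_base(1), of c] trigpoly_cos, of "tcos ka"] by (simp add: mult_ac)
 next
  case (trigpoly_sin ka c)
  show ?case using averaged_trig[OF D pt_cmult[OF pts_base(1), of c] trigpoly_sin, of "tsin ka"] by (simp add: mult_ac)
 next
  case (trigpoly_add s t)
  then show ?case using averaged_add by (simp add: distrib_left)
 qed
qed (rule averaged_add)

section \<open>Uniform approximation of correctors\<close>

text \<open>Finite sums of scalar polynomials times fixed vectors of \<open>S\<close>. A list is
  used so that repeated vectors are harmless and sums are concatenations.\<close>

definition comb :: "nat => 'h::real_vector set => ((nat => real^'n) => 'h) => bool" where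
 "comb k S q \<longleftrightarrow> (EX L. (ALL p : set L. pt k (fst p) & snd p : S) & q = (%y. SUM p<-L. fst p y *R snd p))"

lemma comb_zero: "comb k S (%y. 0)"
 unfolding comb_def by (intro exI[of _ "[]"]) auto

lemma comb_add: assumes "comb k S q" "comb k S r" shows "comb k S (%y. q y + r y)"
proof -
 obtain L L' where "ALL p : set L. pt k (fst p) & snd p : S" "q = (%y. SUM p<-L. fst p y *R snd p)"
  "ALL p : set L'. pt k (fst p) & snd p : S" "r = (%y. SUM p<-L'. fst p y *R snd p)"
  using assms unfolding comb_def by blast
 then show ?thesis unfolding comb_def by (intro exI[of _ "L @ L'"]) auto
qed

lemma comb_span: assumes "s : span S" "pt k te" shows "comb k S (%y. te y *R s)"
 using assms(1)
proof (induction rule: span_induct_alt)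
 case base
 show ?case by (simp add: comb_zero)
next
 case (step c a s)
 have "comb k S (%y. (c * te y) *R a)" unfolding comb_def
  by (intro exI[of _ "[(%y. c * te y, a)]"]) (simp add: pt_cmult[OF assms(2)] step(1))
 from comb_add[OF this step(2)] show ?case by (simp add: scaleR_add_right mult.commute)
qed

lemma comb_sum: "finite T ==> (!!s. s : T ==> comb k S (q s)) ==> comb k S (%y. SUM s:T. q s y)"
 by (induction T rule: finite_induct) (auto intro: comb_zero comb_add)

text \<open>The image of \<open>p\<close> is compact, so finitely many vectors of the span come
  e/2-close to all its values. A continuous partition of unity combines them, and its weights, which
  inherit level k, are replaced by elements of \<open>pt k\<close>.\<close>

lemma uniform_span_approx:
 fixes K :: "(real^'n) set" and p :: "(nat => real^'n) => 'h::real_normed_vector"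
 assumes K: "compact K" and p: "continuous_on (pcell K) p" "lev K k p" "!!y. y : pcell K ==> p y : closure (span S)" and e: "0 < e"
 shows "EX q. comb k S q & (ALL y. y 0 : K --> norm (p y - q y) <= e)"
proof -
 have 1: "compact (p ` pcell K)" by (rule compact_continuous_image[OF p(1) compact_pcell[OF K]])
 have 2: "p ` pcell K <= (UN s:span S. ball s (e/2))"
 proof
  fix x assume "x : p ` pcell K"
  then have "x : closure (span S)" using p(3) by auto
  then obtain s where "s : span S" "dist s x < e/2" using e closure_approachable[of x "span S"] by (metis half_gt_zero)
  then show "x : (UN s:span S. ball s (e/2))" by auto
 qed
 obtain T where T: "T <= span S" "finite T" "p ` pcell K <= (UN s:T. ball s (e/2))"
  by (rule compactE_image[OF 1 _ 2]) auto
 \<comment> \<open>Positive only where \<open>s\<close> is within e/2 of \<open>p y\<close>, so the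
   normalized combination stays within e/2 of \<open>p y\<close>.\<close>
 define l where "l s y = max 0 (e/2 - norm (p y - s))" for s y
 define w where "w s y = l s y / (SUM s:T. l s y)" for s y
 have l0: "0 <= l s y" for s y by (simp add: l_def)
 have pos: "(SUM s:T. l s y) > 0" if y: "y : pcell K" for y
 proof -
  obtain s where "s : T" "dist s (p y) < e/2" using T(3) y by auto
  then have "l s y > 0" by (simp add: l_def dist_norm norm_minus_commute)
  then show ?thesis using T(2) l0 \<open>s : T\<close> by (intro sum_pos2) auto
 qed
 have w1: "(SUM s:T. w s y) = 1" if "y : pcell K" for y
  unfolding w_def sum_divide_distrib[symmetric] using pos[OF that] by simp
 have lc: "continuous_on (pcell K) (l s)" for s unfolding l_def[abs_def] by (intro continuous_intros p(1))
 have wc: "continuous_on (pcell K) (w s)" for s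
  unfolding w_def[abs_def] using pos by (intro continuous_on_divide lc continuous_on_sum) fastforce
 have wl: "lev K k (w s)" for s using p(2) unfolding lev_def w_def l_def by metis
 define C where "C = 1 + (SUM s:T. norm s)"
 have C: "C > 0" unfolding C_def by (intro add_pos_nonneg sum_nonneg) auto
 have "ALL s. EX h. pt k h & (ALL y. y 0 : K --> \<bar>w s y - h y\<bar> < e / (2 * C))"
  using pt_dense[OF K wc wl] e C by simp
 then obtain h where h: "!!s. pt k (h s)" "!!s y. y 0 : K ==> \<bar>w s y - h s y\<bar> < e / (2 * C)" by metis
 define q where "q y = (SUM s:T. h s y *R s)" for y
 have cq: "comb k S q" unfolding q_def[abs_def] using T(1) h(1) by (intro comb_sum T(2) comb_span) auto
 have le: "norm (p y - q y) <= e" if y: "y : pcell K" for y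
 proof -
  have "p y - (SUM s:T. w s y *R s) = (SUM s:T. w s y *R (p y - s))"
   using w1[OF y] by (simp add: scaleR_diff_right sum_subtractf scaleR_left.sum[symmetric])
  also have "norm ... <= (SUM s:T. w s y * (e/2))"
  proof (rule sum_norm_le)
   fix s assume "s : T"
   have "0 <= w s y" unfolding w_def using l0 by (intro divide_nonneg_nonneg sum_nonneg) auto
   moreover have "w s y = 0 | norm (p y - s) <= e/2" by (auto simp: w_def l_def max_def)
   ultimately show "norm (w s y *R (p y - s)) <= w s y * (e/2)" using mult_left_mono[of "norm (p y - s)" "e/2" "w s y"] by auto
  qed
  also have "... = e/2" unfolding sum_distrib_right[symmetric] w1[OF y] by simp
  finally have 1: "norm (p y - (SUM s:T. w s y *R s)) <= e/2" .
  have "(SUM s:T. w s y *R s) - q y = (SUM s:T. (w s y - h s y) *R s)" by (simp add: q_def scaleR_diff_left sum_subtractf)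
  also have "norm ... <= (SUM s:T. (e / (2 * C)) * norm s)"
  proof (rule sum_norm_le)
   fix s
   have "\<bar>w s y - h s y\<bar> <= e / (2 * C)" using h(2)[of y s] y by (simp add: pcell_def)
   then show "norm ((w s y - h s y) *R s) <= (e / (2 * C)) * norm s" unfolding norm_scaleR real_norm_def by (rule mult_right_mono) simp
  qed
  also have "... <= (e / (2 * C)) * C" unfolding sum_distrib_left[symmetric] using e C by (intro mult_left_mono) (auto simp: C_def)
  also have "... = e/2" using C by simp
  finally show ?thesis using 1 norm_triangle_ineq[of "p y - (SUM s:T. w s y *R s)" "(SUM s:T. w s y *R s) - q y"] by simp
 qed
 have "lev K k q" unfolding lev_def q_def using pt_lev[OF h(1), of K] unfolding lev_def by (auto intro!: sum.cong)
 then have "norm (p y - q y) <= e" if "y 0 : K" for y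
  using le[OF wrap(1)[of y, OF that]] lev_wrap[of K k p y, OF p(2) that] lev_wrap[of K k q y, OF _ that] by simp
 then show ?thesis using cq by blast
qed

section \<open>Approximation of adjoint correctors and their fluxes\<close>

lemma transpose_diff_bound:
 fixes A B :: "real^'n^'n"
 assumes "!!v. norm (A *v v - B *v v) <= de * norm v"
 shows "norm (transpose A *v v - transpose B *v v) <= de * norm v"
proof -
 have "transpose (A - B) = transpose A - transpose B" by (simp add: vec_eq_iff transpose_def)
 then show ?thesis using transpose_bound[of "A - B" de v] assms by (simp add: matrix_vector_mult_diff_rdistrib)
qed

lemma effective_transpose:
 assumes M: "coef cell mu La M" and mu: "0 < mu"
 shows "effective (%z. transpose (M z)) = transpose (effective M)"
proof -
 note Mt = coef_transpose[OF M]
 have "(effective (%z. transpose (M z)) *v xi) \<bullet> ze = (transpose (effective M) *v xi) \<bullet> ze" for xi ze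
 proof -
  obtain P where P: "sq_on cell P" "cst ze + corr M ze = cls cell P" by (rule corrected_cls[OF M mu])
  obtain Q where Q: "sq_on cell Q" "cst xi + corr (%z. transpose (M z)) xi = cls cell Q" by (rule corrected_cls[OF Mt mu])
  have "(effective (%z. transpose (M z)) *v xi) \<bullet> ze = inner (mulop cell (%z. transpose (M z)) (cls cell Q)) (cls cell P)"
   using effective_adjoint[OF Mt mu corr(1)[OF Mt mu], of xi ze xi] unfolding transpose_transpose P(2) Q(2) .
  also have "... = inner (mulop cell M (cls cell P)) (cls cell Q)"
   using mulop_transpose[OF M P(1) Q(1)] by (simp add: inner_commute)
  also have "... = (effective M *v ze) \<bullet> xi"
   using effective_adjoint[OF M mu corr(1)[OF M mu], of ze xi ze] unfolding P(2) Q(2) ..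
  finally show ?thesis by (metis transpose_inner inner_commute)
 qed
 then have "effective (%z. transpose (M z)) *v xi = transpose (effective M) *v xi" for xi by (metis vector_eq_rdot)
 then show ?thesis by (simp add: matrix_eq)
qed

text \<open>The solenoidal modes of mean zero: unlike in \<open>solset\<close>, frequency 0 is
  excluded, so that each mode is the divergence of a periodic skew matrix.\<close>

definition solset0 :: "(real^'n, real^'n) l2 set" where
 "solset0 = {cls cell (%x. t x *R et) | t ka et. int_vec ka & ka ~= 0 & ka \<bullet> et = 0 & (t = tcos ka | t = tsin ka)}"

lemma sq_on_trig_scaleR: "t = tcos ka | t = tsin ka ==> sq_on cell (%x. t x *R (et::real^'n))"
 by (intro sq_on_cell_cont continuous_intros trig_continuous)

text \<open>The orthogonal complement of the mean-zero solenoidal modes is generated by gradients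
  together with the constants.\<close>

lemma helmholtz_sol0:
 fixes F :: "real^'n => real^'n"
 assumes F: "sq_on cell F" and g: "!!g. g : gradset ==> inner (cls cell F) g = 0" and c: "!!ze. inner (cls cell F) (cst ze) = 0"
 shows "cls cell F : closure (span solset0)"
proof (rule in_closure_span_if_orthogonal_complement[where T = "gradset \<union> range cst"])
 fix s z :: "(real^'n, real^'n) l2" assume s: "s : solset0" and z: "z : gradset \<union> range cst"
 obtain t ka et where t: "s = cls cell (%x. t x *R et)" "int_vec ka" "ka ~= 0" "ka \<bullet> et = 0" "t = tcos ka | t = tsin ka"
  using s unfolding solset0_def by blast
 have tf: "t : trigfuns" using t unfolding trigfuns_def by blast
 show "inner s z = 0"
 proof (cases "z : gradset")
  case True
  have "s : solset" unfolding solset_def using t by blast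
  then show ?thesis using gradset_orthogonal_solset[OF True] by (simp add: inner_commute)
 next
  case False
  then obtain ze where ze: "z = cst ze" using z by auto
  have "inner s z = (LINT x:cell|lebesgue. t x * (et \<bullet> ze))"
   unfolding ze t(1) cst_def by (subst inner_cls[OF sq_on_trig_scaleR[OF t(5)] sq_on_cst]) simp
  also have "... = (LINT x:cell|lebesgue. t x) * (et \<bullet> ze)" by simp
  also have "(LINT x:cell|lebesgue. t x) = 0"
   using trigfuns_mean[OF tf] by (simp add: inner_cls[OF sq_on_cell_cont[OF trig_continuous[OF t(5)]] sq_on_cst])
  finally show ?thesis by simp
 qed
next
 fix V :: "(real^'n, real^'n) l2" assume V: "!!s. s : solset0 ==> inner V s = 0" "!!z. z : gradset \<union> range cst ==> inner V z = 0"
 show "inner V (cls cell F) = 0"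
 proof (rule orthogonal_gradset_solset[OF V(2) _ F])
  fix z :: "(real^'n, real^'n) l2" assume "z : solset"
  then obtain t ka et where t: "z = cls cell (%x. t x *R et)" "int_vec ka" "ka \<bullet> et = 0" "t = tcos ka | t = tsin ka"
   unfolding solset_def by blast
  show "inner V z = 0"
  proof (cases "ka = 0")
   case True
   then have "z = cst (t 0 *R et)" using t(4) by (auto simp: t(1) cst_def tcos_def tsin_def)
   then show ?thesis using V(2) by blast
  next
   case False
   then show ?thesis using V(1)[of z] t unfolding solset0_def by blast
  qed
 qed auto
qed (use g c in auto)

text \<open>Testing the difference of the two corrector equations with the difference of the
  correctors bounds it by the perturbation of the flux; this is the L^2 continuity of corrector and
  flux in the slow variables.\<close>

lemma corr_perturb:
 assumes N: "coef cell mu La N" and N0: "coef cell mu La N0" and mu: "0 < mu" and de: "0 <= de"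
  and le: "!!z v. z : cell ==> norm (N z *v v - N0 z *v v) <= de * norm v"
 shows "norm (corr N xi - corr N0 xi) <= de * (norm (cst xi + corr N0 xi) / mu)"
  and "norm (mulop cell N (cst xi + corr N xi) - mulop cell N0 (cst xi + corr N0 xi)) <= de * ((La / mu + 1) * norm (cst xi + corr N0 xi))"
proof -
 interpret n: bounded_linear "mulop cell N" by (rule blin_mulop[OF N])
 define p where "p = cst xi + corr N0 xi"
 define d where "d = corr N xi - corr N0 xi"
 have d: "d : gradspace" unfolding d_def by (intro subspace_diff gradspace corr(1)[OF N mu] corr(1)[OF N0 mu])
 obtain F where F: "sq_on cell F" "d = cls cell F" by (rule gradspace_cls[OF d])
 have pd: "cst xi + corr N xi = p + d" by (simp add: p_def d_def)
 note ml = mulop_diff_le[OF N N0 de le, of p]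
 have "mu * (norm d)^2 <= inner (mulop cell N d) d" using mulop_coercive[OF N F(1)] F(2) by simp
 also have "... = inner (mulop cell N (p + d)) d - inner (mulop cell N p - mulop cell N0 p) d - inner (mulop cell N0 p) d"
  by (simp add: n.add inner_add_left inner_diff_left)
 also have "... = - inner (mulop cell N p - mulop cell N0 p) d"
  using corr(2)[OF N mu d, of xi] corr(2)[OF N0 mu d, of xi] by (simp add: pd p_def[symmetric])
 also have "... <= norm (mulop cell N p - mulop cell N0 p) * norm d" using Cauchy_Schwarz_ineq2 by (metis abs_le_D2)
 also have "... <= (de * norm p) * norm d" by (intro mult_right_mono ml) auto
 finally have "norm d * (mu * norm d) <= norm d * (de * norm p)" by (simp add: power2_eq_square mult_ac)
 then have "mu * norm d <= de * norm p" using de by (cases "d = 0") auto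
 then have nd: "norm d <= de * (norm p / mu)" using mu by (simp add: field_simps)
 then show "norm (corr N xi - corr N0 xi) <= de * (norm (cst xi + corr N0 xi) / mu)" by (simp add: d_def p_def)
 have "norm (mulop cell N d + (mulop cell N p - mulop cell N0 p)) <= La * (de * (norm p / mu)) + de * norm p"
  using order_trans[OF norm_mulop_le[OF N] mult_left_mono[OF nd coefD(3)[OF N]]] ml by (rule norm_triangle_mono)
 moreover have "mulop cell N (cst xi + corr N xi) - mulop cell N0 p = mulop cell N d + (mulop cell N p - mulop cell N0 p)"
  unfolding pd by (simp add: n.add)
 ultimately show "norm (mulop cell N (cst xi + corr N xi) - mulop cell N0 (cst xi + corr N0 xi)) <= de * ((La / mu + 1) * norm (cst xi + corr N0 xi))"
  by (simp add: p_def[symmetric] algebra_simps)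
qed

lemma tendsto_if_linear_bound:
 assumes "!!e. e > 0 ==> \<forall>\<^sub>F y in F. norm (f y - l) <= e * C"
 shows "(f \<longlongrightarrow> l) F"
proof (rule tendstoI)
 fix r :: real assume r: "r > 0"
 define e where "e = r / (2 * (\<bar>C\<bar> + 1))"
 have e: "e > 0" using r by (simp add: e_def add_nonneg_pos)
 have "e * C <= e * (\<bar>C\<bar> + 1)" using e by (intro mult_left_mono) auto
 also have "... = r / 2" by (simp add: e_def field_simps)
 also have "... < r" using r by simp
 finally have lt: "e * C < r" .
 show "\<forall>\<^sub>F y in F. dist (f y) l < r" using assms[OF e] by eventually_elim (use lt in "simp add: dist_norm")
qed

lemma cls_sum_list:
 assumes "!!p. p : set L ==> sq_on D (f p)"
 shows "sq_on D (%x. SUM p<-L. f p x)" "cls D (%x. SUM p<-L. f p x) = (SUM p<-L. cls D (f p))"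
proof -
 have "sq_on D (%x. SUM p<-L. f p x) & cls D (%x. SUM p<-L. f p x) = (SUM p<-L. cls D (f p))"
  using assms by (induction L) (auto simp: sq_on_zero cls_zero cls_add sq_on_add)
 then show "sq_on D (%x. SUM p<-L. f p x)" "cls D (%x. SUM p<-L. f p x) = (SUM p<-L. cls D (f p))" by auto
qed

lemma comb_image:
 assumes "comb k (f ` T) q"
 shows "EX L. (ALL p : set L. pt k (fst p) & snd p : T) & (ALL y. q y = (SUM p<-L. fst p y *R f (snd p)))"
proof -
 obtain L where L: "ALL p : set L. pt k (fst p) & snd p : f ` T" "q = (%y. SUM p<-L. fst p y *R snd p)" using assms unfolding comb_def by blast
 define L' where "L' = map (%p. (fst p, inv_into T f (snd p))) L"
 have "(SUM p<-L'. fst p y *R f (snd p)) = (SUM p<-L. fst p y *R snd p)" for y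
  unfolding L'_def map_map using L(1) by (intro arg_cong[of _ _ sum_list] map_cong) (auto simp: f_inv_into_f)
 then show ?thesis
  using L(1) by (intro exI[of _ L']) (auto simp: L'_def L(2) inv_into_into)
qed

definition soltrig :: "((real^'n => real) \<times> (real^'n)) set" where
 "soltrig = {(t, et). EX ka. int_vec ka & ka ~= 0 & ka \<bullet> et = 0 & (t = tcos ka | t = tsin ka)}"

text \<open>The adjoint corrector is, uniformly over the slow variables, a limit of gradient modes,
  and the fluctuation of its flux a limit of mean-zero solenoidal modes. With approximations q and
  q' of corrector c and fluctuation T, the defect in the cell equation is N (q - c) + (T -
  q').\<close>

lemma cell_approx:
 fixes D :: "(real^'n) set"
 assumes M: "adm D mu be (Suc k) M" and mu: "0 < mu" and be: "0 < be" and K: "compact K" "K <= D" and e: "0 < e"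
 obtains L L' where "!!p. p : set L ==> pt k (fst p) & snd p : trigfuns" "!!p. p : set L' ==> pt k (fst p) & snd p : soltrig"
  "!!y. y 0 : K ==> norm (cls cell (%z. transpose (M (y(Suc k := z))) *v (xi + (SUM p<-L. fst p y *R grad (snd p) z))
    - transpose (effective (%z. M (y(Suc k := z)))) *v xi - (SUM p<-L'. (fst p y * fst (snd p) z) *R snd (snd p)))) <= e"
proof -
 define N where "N y = (%z. transpose (M (y(Suc k := z))))" for y
 define Mh where "Mh y = effective (%z. M (y(Suc k := z)))" for y
 define c where "c y = corr (N y) xi" for y
 \<comment> \<open>The adjoint flux minus its mean, which is the adjoint effective flux: orthogonal
   to gradients and to constants.\<close>
 define T where "T y = mulop cell (N y) (cst xi + c y) - cst (transpose (Mh y) *v xi)" for y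
 note s = adm_slice[OF M _ be]
 have N: "coef cell mu (1 / be) (N y)" if "y 0 : D" for y unfolding N_def by (rule coef_transpose[OF s(4)[of y, OF that]])
 have Ml: "M (y(Suc k := z)) = M (y'(Suc k := z))" if "y 0 : D" "y 0 = y' 0" "ALL i. 1 <= i --> i <= k --> int_vec (y i - y' i)" for y y' z
  by (rule adm_cong[OF M]) (use that in "auto simp: int_vec_zero")
 have lev: "lev K k c" "lev K k T" unfolding lev_def using Ml K(2) by (auto simp: c_def T_def N_def Mh_def subset_eq)
 have cont: "continuous_on {y. y 0 : D} c & continuous_on {y. y 0 : D} (%y. mulop cell (N y) (cst xi + c y))"
 proof (intro conjI; unfold continuous_on_def; intro ballI tendsto_if_linear_bound)
  fix y0 :: "nat => real^'n" and r :: real assume y0: "y0 : {y. y 0 : D}" and r: "r > 0"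
  have d: "\<forall>\<^sub>F y in at y0 within {y. y 0 : D}. y 0 : D" by (simp add: eventually_at_filter)
  have u: "\<forall>\<^sub>F y in at y0 within {y. y 0 : D}. y 0 : D & (ALL z : cell. ALL v. norm (N y z *v v - N y0 z *v v) <= r * norm v)"
   using adm_uniform[of D mu be k M y0, OF M y0[unfolded mem_Collect_eq] r] d
   unfolding N_def by eventually_elim (blast intro: transpose_diff_bound)
  show "\<forall>\<^sub>F y in at y0 within {y. y 0 : D}. norm (c y - c y0) <= r * (norm (cst xi + c y0) / mu)"
   using u unfolding c_def by eventually_elim (intro corr_perturb(1)[OF N N mu], use y0 r in auto)
  show "\<forall>\<^sub>F y in at y0 within {y. y 0 : D}. norm (mulop cell (N y) (cst xi + c y) - mulop cell (N y0) (cst xi + c y0)) <= r * ((1 / be / mu + 1) * norm (cst xi + c y0))"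
   using u unfolding c_def by eventually_elim (intro corr_perturb(2)[OF N N mu], use y0 r in auto)
 qed
 have Mhc: "continuous_on {y. y 0 : D} (%y. cst (transpose (Mh y) *v xi))" unfolding continuous_on_def
 proof (intro ballI tendstoI)
  fix y0 :: "nat => real^'n" and r :: real assume y0: "y0 : {y. y 0 : D}" and r: "r > 0"
  have "continuous_on {y. y 0 : D} (%y. transpose (Mh y) *v xi)"
  proof -
   have "continuous_on {y. y 0 : D} Mh" using adm_effective[OF M mu be] by (simp add: adm_def Mh_def[abs_def])
   then show ?thesis unfolding matrix_vector_mult_def transpose_def by (intro continuous_intros continuous_on_vec_lambda) auto
  qed
  then have "\<forall>\<^sub>F y in at y0 within {y. y 0 : D}. dist (transpose (Mh y) *v xi) (transpose (Mh y0) *v xi) < r"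
   using y0 r by (auto simp: continuous_on_def tendsto_iff)
  then show "\<forall>\<^sub>F y in at y0 within {y. y 0 : D}. dist (cst (transpose (Mh y) *v xi)) (cst (transpose (Mh y0) *v xi)) < r"
  proof eventually_elim
   case (elim y)
   have "cst (transpose (Mh y) *v xi) - cst (transpose (Mh y0) *v xi) = cst (transpose (Mh y) *v xi - transpose (Mh y0) *v xi)"
    using cst_add[of "transpose (Mh y) *v xi - transpose (Mh y0) *v xi" "transpose (Mh y0) *v xi"] by simp
   then show ?case using elim by (simp add: dist_norm norm_cst)
  qed
 qed
 have sub: "pcell K <= {y. y 0 : D}" using K(2) by (auto simp: pcell_def)
 have cc: "continuous_on (pcell K) c" "continuous_on (pcell K) T"
  unfolding T_def[abs_def] using cont Mhc by (auto intro!: continuous_intros intro: continuous_on_subset[OF _ sub])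
 have cg: "c y : closure (span gradset)" if "y : pcell K" for y
  unfolding c_def gradspace_def[symmetric] using that sub by (intro corr(1)[OF N mu]) auto
 have Tg: "T y : closure (span solset0)" if "y : pcell K" for y
 proof -
  have y: "y 0 : D" using that sub by auto
  note Ny = N[of y, OF y]
  obtain P where P: "sq_on cell P" "cst xi + corr (N y) xi = cls cell P" by (rule corrected_cls[OF Ny mu])
  have F: "sq_on cell (%z. N y z *v P z - transpose (Mh y) *v xi)" by (intro sq_on_diff coefD(6)[OF Ny] P(1) sq_on_cst)
  have Ty: "T y = cls cell (%z. N y z *v P z - transpose (Mh y) *v xi)"
   unfolding T_def c_def P(2) mulop_cls[OF Ny P(1)] unfolding cst_def by (rule cls_diff[symmetric, OF coefD(6)[OF Ny P(1)] sq_on_cst])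
  have "transpose (Mh y) = effective (N y)" unfolding Mh_def N_def by (rule effective_transpose[OF s(4)[of y, OF y] mu, symmetric])
  then have "inner (T y) (cst ze) = 0" for ze
   unfolding T_def c_def inner_diff_left effective_inner[OF Ny mu, symmetric] by (simp add: inner_cst)
  moreover have "inner (T y) g = 0" if "g : gradset" for g
   unfolding T_def c_def inner_diff_left using corr(2)[OF Ny mu gradset_gradspace[OF that]] gradset_orthogonal_cst[OF that] by (simp add: inner_commute)
  ultimately show ?thesis unfolding Ty by (intro helmholtz_sol0[OF F])
 qed
 \<comment> \<open>Splits \<open>e\<close> so that both errors fit: the corrector error is amplified
   by the operator bound 1 / be, the flux error is not.\<close>
 define r where "r = e / (1 / be + 1)"
 have b: "1 / be + 1 > 0" using be by (intro add_pos_pos) auto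
 have "1 / be * r + r = (1 / be + 1) * r" by (simp add: distrib_right)
 then have r: "r > 0" "1 / be * r + r = e" using e b by (auto simp: r_def)
 obtain q where q: "comb k gradset q" "!!y. y 0 : K ==> norm (c y - q y) <= r"
  using uniform_span_approx[OF K(1) cc(1) lev(1) cg r(1)] by blast
 obtain L where L: "!!p. p : set L ==> pt k (fst p) & snd p : trigfuns" "!!y. q y = (SUM p<-L. fst p y *R cls cell (grad (snd p)))"
  using comb_image[OF q(1)[unfolded gradset_def]] by (elim exE conjE, intro that) auto
 obtain q' where q': "comb k solset0 q'" "!!y. y 0 : K ==> norm (T y - q' y) <= r"
  using uniform_span_approx[OF K(1) cc(2) lev(2) Tg r(1)] by blast
 have "solset0 = (%p. cls cell (%x. fst p x *R snd p :: real^'n)) ` soltrig" unfolding solset0_def soltrig_def by force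
 note q'' = q'(1)[unfolded this]
 obtain L' where L': "!!p. p : set L' ==> pt k (fst p) & snd p : soltrig" "!!y. q' y = (SUM p<-L'. fst p y *R cls cell (%x. fst (snd p) x *R snd (snd p)))"
  using comb_image[OF q''] by (elim exE conjE, intro that) auto
 show ?thesis
 proof (rule that[OF L(1) L'(1)])
  fix y :: "nat => real^'n" assume y: "y 0 : K"
  then have yD: "y 0 : D" using K(2) by auto
  interpret n: bounded_linear "mulop cell (N y)" by (rule blin_mulop[OF N[of y, OF yD]])
  let ?G = "%z. SUM p<-L. fst p y *R grad (snd p) z" and ?S = "%z. SUM p<-L'. (fst p y * fst (snd p) z) *R snd (snd p)"
  have sg: "sq_on cell (grad (snd p))" if "p : set L" for p
   using L(1)[OF that] by (intro sq_on_cell_cont smooth_cont_grad trigfuns_smooth) auto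
  have ss: "sq_on cell (%x. fst (snd p) x *R snd (snd p))" if "p : set L'" for p
   using L'(1)[OF that] by (auto simp: soltrig_def intro: sq_on_trig_scaleR)
  have G: "sq_on cell ?G" "cls cell ?G = q y"
   using cls_sum_list[of L cell "%p z. fst p y *R grad (snd p) z"] sg
   by (auto simp: L(2) sq_on_scaleR cls_scaleR intro!: arg_cong[of _ _ sum_list] map_cong)
  let ?S' = "%p z. fst p y *R (fst (snd p) z *R snd (snd p))"
  have ss': "sq_on cell (?S' p)" if "p : set L'" for p by (rule sq_on_scaleR[OF ss[OF that]])
  have "sq_on cell (%z. SUM p<-L'. ?S' p z)" by (rule cls_sum_list(1)[where f = ?S']) (rule ss')
  then have S: "sq_on cell ?S" by simp
  have "cls cell (%z. SUM p<-L'. ?S' p z) = (SUM p<-L'. cls cell (?S' p))"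
   by (rule cls_sum_list(2)[where f = ?S']) (rule ss')
  also have "... = q' y" unfolding L'(2) by (intro arg_cong[of _ _ sum_list] map_cong refl cls_scaleR ss)
  finally have S': "cls cell ?S = q' y" by simp
  have P: "sq_on cell (%z. xi + ?G z)" "cls cell (%z. xi + ?G z) = cst xi + q y"
   by (auto simp: cst_def G(2) cls_add[OF sq_on_cst G(1)] intro: sq_on_add[OF sq_on_cst G(1)])
  note NP = coefD(6)[OF N[of y, OF yD] P(1)]
  have "cls cell (%z. N y z *v (xi + ?G z) - transpose (Mh y) *v xi - ?S z) = mulop cell (N y) (cst xi + q y) - cst (transpose (Mh y) *v xi) - q' y"
   by (simp add: cls_diff sq_on_diff NP sq_on_cst S S' cst_def mulop_cls[OF N[of y, OF yD] P(1), symmetric] P(2)[unfolded cst_def])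
  also have "... = mulop cell (N y) (q y - c y) + (T y - q' y)" by (simp add: T_def n.add n.diff)
  also have "norm ... <= 1 / be * r + r"
   using q(2)[of y, OF y] be by (intro norm_triangle_mono q'(2) y order_trans[OF norm_mulop_le[OF N[of y, OF yD]]] mult_left_mono) (auto simp: norm_minus_commute)
  finally show "norm (cls cell (%z. transpose (M (y(Suc k := z))) *v (xi + ?G z) - transpose (effective (%z. M (y(Suc k := z)))) *v xi - ?S z)) <= e"
   using r(2) by (simp add: N_def Mh_def)
 qed
qed

section \<open>Oscillating test functions\<close>

lemma continuous_on_extend_zero:
 fixes h :: "real^'n => 'b::real_normed_vector"
 assumes "open D" "compact K" "K <= D" "continuous_on D h" "!!x. x ~: K ==> h x = 0"
 shows "continuous_on UNIV h"
proof -
 have "continuous_on (- K) h" using assms(5) by (subst continuous_on_cong[where g = "%_. 0"]) auto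
 then have "continuous_on (D \<union> - K) h"
  using assms(1,2,4) by (intro continuous_on_open_Un) (auto intro: compact_imp_closed)
 moreover have "D \<union> - K = UNIV" using assms(3) by auto
 ultimately show ?thesis by simp
qed

lemma sq_on_test_cont:
 fixes h :: "real^'n => 'b::euclidean_space"
 assumes D: "open D" and ph: "test_fun D ph" and h: "continuous_on D h"
 shows "sq_on D (%x. ph x *R h x)"
proof -
 obtain K where K: "compact K" "K <= D" "!!x. x ~: K ==> ph x = 0" "smooth ph" by (rule test_funD[OF ph]) blast
 have "continuous_on D (%x. ph x *R h x)"
  by (intro continuous_on_scaleR h continuous_on_subset[OF smooth_cont[OF K(4)]]) auto
 then have "continuous_on UNIV (%x. ph x *R h x)" by (rule continuous_on_extend_zero[OF D K(1,2)]) (simp add: K(3))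
 then show ?thesis by (rule sq_on_cont_support[OF _ K(1,2)]) (simp add: K(3))
qed

definition testset :: "(real^'n) set => (real^'n, real^'n) l2 set" where
 "testset D = {cls D (%x. ph x *R axis i 1) | ph i. test_fun D ph}"

text \<open>The fundamental lemma in dual form: a field orthogonal to all coordinate test fields
  vanishes on \<open>D\<close>.\<close>

lemma testset_dense:
 fixes D :: "(real^'n) set"
 assumes D: "open D" and H: "sq_on D H" shows "cls D H : closure (span (testset D))"
proof (rule in_closure_if_orthogonal[OF subspace_span])
 fix z :: "(real^'n, real^'n) l2" assume z: "!!s. s : span (testset D) ==> inner z s = 0"
 have Dl: "D : sets lebesgue" using D by auto
 have Z: "sq_on D (repr z)" by (rule sq_on_repr[OF Dl])
 have "AE x in lebesgue. x : D --> repr z x = 0"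
 proof (rule AE_eq_if_weak_integrals_eq[OF D])
  fix ph :: "real^'n => real" and i assume ph: "test_fun D ph"
  have "cls D (%x. ph x *R axis i 1) : span (testset D)" using ph unfolding testset_def by (intro span_base) blast
  then have "inner z (cls D (%x. ph x *R axis i 1)) = 0" by (rule z)
  then have "inner (cls D (repr z)) (cls D (%x. ph x *R axis i 1)) = 0"
   by (subst (asm) inner_cls_repr[OF Dl sq_on_test_scaleR[OF ph]])
  then show "(LINT x:D|lebesgue. (repr z x $ i - 0 $ i) * ph x) = 0"
   by (simp add: inner_cls[OF Z sq_on_test_scaleR[OF ph]] inner_axis mult.commute)
 qed (auto intro: sq_on_subset[OF Z] sq_on_zero)
 then have "cls D (repr z) = 0" using cls_eq_iff[OF Z sq_on_zero] by (simp add: cls_zero)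
 then show "inner z (cls D H) = 0" by (subst inner_cls_repr[OF Dl H]) simp
qed

text \<open>The difference of the two fields is the divergence of the skew matrix field w (b a^T - a
  b^T). Gradients are orthogonal to it because second derivatives of \<open>w\<close>
  commute.\<close>

lemma skew_test_fun:
 fixes D :: "(real^'n) set"
 assumes D: "open D" and v: "v : H1 D" and w: "test_fun D w"
 shows "inner (cls D (wgrad D v)) (cls D (%x. (a \<bullet> grad w x) *R b)) = inner (cls D (wgrad D v)) (cls D (%x. (b \<bullet> grad w x) *R a))"
proof -
 let ?G = "cls D (wgrad D v)"
 define c where "c i j = inner ?G (cls D (%x. pd j w x *R axis i 1))" for i j
 have weak: "inner (cls D v) (cls D (pd i (pd j w))) + c i j = 0" for i j
  unfolding c_def using H1D(3)[OF v] test_fun_pd[OF w, of j] unfolding is_weak_grad_iff[OF H1D(1,2)[OF v]] by blast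
 have sym: "c i j = c j i" for i j
 proof -
  have "pd i (pd j w) = pd j (pd i w)" using pd_commute[OF test_fun_smooth[OF w]] by (simp add: fun_eq_iff)
  then show ?thesis using weak[of i j] weak[of j i] by simp
 qed
 have ex: "inner ?G (cls D (%x. (a \<bullet> grad w x) *R b)) = (SUM i:UNIV. SUM j:UNIV. (b $ i * a $ j) * c i j)" for a b
 proof -
  have s: "sq_on D (%x. pd j w x *R (axis i 1 :: real^'n))" for i j by (rule sq_on_test_scaleR[OF test_fun_pd[OF w]])
  have "(a \<bullet> grad w x) *R b = (SUM i:UNIV. SUM j:UNIV. (b $ i * a $ j) *R (pd j w x *R axis i 1))" for x
  proof -
   have "(SUM i:UNIV. SUM j:UNIV. (b $ i * a $ j) *R (pd j w x *R axis i 1)) = (SUM i:UNIV. (a \<bullet> grad w x) *R (b $ i *R (axis i 1 :: real^'n)))"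
    by (intro sum.cong refl) (simp add: inner_vec_def grad_nth scaleR_left.sum[symmetric] sum_distrib_left sum_distrib_right mult_ac)
   then show ?thesis by (simp add: scaleR_sum_right[symmetric] axis_expansion del: scaleR_scaleR)
  qed
  then have "cls D (%x. (a \<bullet> grad w x) *R b) = (SUM i:UNIV. SUM j:UNIV. (b $ i * a $ j) *R cls D (%x. pd j w x *R axis i 1))"
   by (simp add: cls_sum sq_on_sum sq_on_scaleR cls_scaleR s del: scaleR_scaleR)
  then show ?thesis by (simp add: inner_sum_right c_def)
 qed
 show ?thesis unfolding ex by (subst sum.swap) (simp add: sym mult_ac)
qed

text \<open>With w = Th s, where grad s = 2 pi t ka, the field 2 pi |ka|^2 Th t et is the divergence
  of a skew matrix, invisible to gradients, plus terms in which the derivative falls on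
  \<open>Th\<close>. Dividing by |ka|^2 leaves a gain of |ka|.\<close>

lemma solenoidal_bound:
 fixes D :: "(real^'n) set"
 assumes D: "open D" "D : lmeasurable" and v: "v : H1 D" and Th: "test_fun D Th" "!!x. norm (grad Th x) <= C"
  and t: "t = tcos ka | t = tsin ka" and ka: "ka ~= 0" "ka \<bullet> et = 0"
 shows "\<bar>inner (cls D (wgrad D v)) (cls D (%x. (Th x * t x) *R et))\<bar> <= norm (cls D (wgrad D v)) * (C * norm et / norm ka * sqrt (measure lebesgue D))"
proof -
 let ?G = "cls D (wgrad D v)" and ?q = "sqrt (measure lebesgue D)"
 have C: "0 <= C" using Th(2)[of 0] norm_ge_zero order_trans by blast
 obtain s where s: "smooth s" "!!x. \<bar>s x\<bar> <= 1" "!!x. grad s x = (2 * pi * t x) *R ka" using trig_primitive[OF t] by blast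
 define w where "w x = Th x * s x" for x
 have w: "test_fun D w" unfolding w_def[abs_def] by (rule test_fun_mult[OF Th(1) s(1)])
 have gw: "grad w x = Th x *R grad s x + s x *R grad Th x" for x
  unfolding w_def[abs_def] by (rule grad_mult[OF smooth_diffble[OF test_fun_smooth[OF Th(1)]] smooth_diffble[OF s(1)]])
 \<comment> \<open>The lower order terms of the decomposition; the leading terms use ka . et =
   0.\<close>
 define r where "r x = (s x * (et \<bullet> grad Th x)) *R ka - (s x * (ka \<bullet> grad Th x)) *R et" for x
 have cg: "continuous_on UNIV (grad w)" "continuous_on UNIV (grad Th)" "continuous_on UNIV s"
  using smooth_cont_grad[OF test_fun_smooth[OF w]] smooth_cont_grad[OF test_fun_smooth[OF Th(1)]] smooth_cont[OF s(1)] by auto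
 obtain K where K: "compact K" "K <= D" "!!x. x ~: K ==> Th x = 0" "smooth Th" by (rule test_funD[OF Th(1)]) blast
 have z: "grad Th x = 0" "grad w x = 0" if "x ~: K" for x
  using that by (auto intro!: grad_zero_outside[OF compact_imp_closed[OF K(1)]] simp: K(3) w_def)
 have sqw: "sq_on D (%x. (a \<bullet> grad w x) *R b)" for a b :: "real^'n"
  by (rule sq_on_cont_support[OF _ K(1,2)]) (auto intro!: continuous_intros cg simp: z)
 have sqr: "sq_on D r" unfolding r_def[abs_def]
  by (rule sq_on_cont_support[OF _ K(1,2)]) (auto intro!: continuous_intros cg simp: z)
 have sqt: "sq_on D (%x. (Th x * t x) *R et)" by (intro sq_on_test_scaleR test_fun_mult[OF Th(1)] trig_bounds(1)[OF t])
 have "(2 * pi * (norm ka)^2) *R ((Th x * t x) *R et) = (ka \<bullet> grad w x) *R et - (et \<bullet> grad w x) *R ka + r x" for x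
  using ka(2) by (simp add: gw r_def s(3) inner_add_right inner_commute[of et ka] dot_square_norm scaleR_add_left mult_ac)
 then have "(2 * pi * (norm ka)^2) *R cls D (%x. (Th x * t x) *R et) = cls D (%x. (ka \<bullet> grad w x) *R et) - cls D (%x. (et \<bullet> grad w x) *R ka) + cls D r"
  using cls_scaleR[OF sqt, of "2 * pi * (norm ka)^2"] by (simp add: cls_add cls_diff sq_on_diff sqw sqr del: scaleR_scaleR)
 then have "2 * pi * (norm ka)^2 * inner ?G (cls D (%x. (Th x * t x) *R et)) = inner ?G (cls D r)"
  using skew_test_fun[OF D(1) v w, of ka et] by (auto dest!: arg_cong[where f = "inner ?G"] simp: inner_add_right inner_diff_right)
 from arg_cong[OF this, of abs] have "2 * pi * (norm ka)^2 * \<bar>inner ?G (cls D (%x. (Th x * t x) *R et))\<bar> = \<bar>inner ?G (cls D r)\<bar>"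
  by (simp add: abs_mult)
 also have "... <= norm ?G * norm (cls D r)" by (rule Cauchy_Schwarz_ineq2)
 also have "... <= norm ?G * ((2 * C * norm ka * norm et) * ?q)"
 proof (intro mult_left_mono norm_cls_bounded[OF D(2) sqr])
  fix x
  have "\<bar>s x * (a \<bullet> grad Th x)\<bar> <= 1 * (norm a * C)" for a
   unfolding abs_mult by (intro mult_mono s(2) order_trans[OF Cauchy_Schwarz_ineq2 mult_left_mono[OF Th(2) norm_ge_zero]] zero_le_one abs_ge_zero)
  then have "norm ((s x * (et \<bullet> grad Th x)) *R ka) <= (1 * (norm et * C)) * norm ka" "norm ((s x * (ka \<bullet> grad Th x)) *R et) <= (1 * (norm ka * C)) * norm et"
   unfolding norm_scaleR real_norm_def by (intro mult_right_mono; simp)+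
  then show "norm (r x) <= 2 * C * norm ka * norm et" unfolding r_def
   using norm_triangle_ineq4[of "(s x * (et \<bullet> grad Th x)) *R ka" "(s x * (ka \<bullet> grad Th x)) *R et"] by (simp add: mult_ac)
 qed (use C in auto)
 finally have "2 * pi * (norm ka)^2 * \<bar>inner ?G (cls D (%x. (Th x * t x) *R et))\<bar> <= norm ?G * ((2 * C * norm ka * norm et) * ?q)" .
 moreover have "1 * (2 * (norm ka)^2 * \<bar>inner ?G (cls D (%x. (Th x * t x) *R et))\<bar>) <= pi * (2 * (norm ka)^2 * \<bar>inner ?G (cls D (%x. (Th x * t x) *R et))\<bar>)"
  by (rule mult_right_mono) (use pi_ge_two in auto)
 ultimately have "norm ka * (norm ka * \<bar>inner ?G (cls D (%x. (Th x * t x) *R et))\<bar>) <= norm ka * (norm ?G * (C * norm et) * ?q)"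
  by (simp add: power2_eq_square mult_ac)
 then have "norm ka * \<bar>inner ?G (cls D (%x. (Th x * t x) *R et))\<bar> <= norm ?G * (C * norm et) * ?q"
  using ka(1) by (simp add: mult_le_cancel_left_pos)
 then show ?thesis using ka(1) by (simp add: field_simps)
qed

lemma continuous_scl: "continuous_on S (scl ep)"
 unfolding scl_def[abs_def] by (intro continuous_on_coordinatewise_then_product continuous_intros)

lemma adm_coef:
 fixes D :: "(real^'n) set"
 assumes M: "adm D mu be k M" and D: "open D" and be: "0 < be" and ep: "scale_vec ep"
 shows "coef D mu (1 / be) (%x. M (scl ep x))"
proof -
 have e: "ell mu be (M (scl ep x))" if "x : D" for x using M that by (simp add: adm_def scl_0[OF ep])
 have "continuous_on D (%x. M (scl ep x))"
  by (rule continuous_on_compose2[OF _ continuous_scl]) (use M in "auto simp: adm_def scl_0[OF ep]")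
 then have "set_borel_measurable lebesgue D (%x. M (scl ep x))" unfolding set_borel_measurable_def using D
  by (intro measurable_completion) (auto intro!: borel_measurable_continuous_on_indicator)
 then show ?thesis using e D be ell_norm[OF e be] by (auto simp: coef_def ell_def)
qed

text \<open>|R|^2 is only continuous, so it is first approximated by some h in
  \<open>pt (Suc k)\<close>; averaging h over the fast variable then bounds the oscillating L^2 norm
  by the norms on the cell.\<close>

lemma mean_square_bound:
 fixes D :: "(real^'n) set" and R :: "(nat => real^'n) => real^'n"
 assumes D: "open D" "D : lmeasurable" and R: "continuous_on {y. y 0 : D} R" "lev D (Suc k) R" and K: "compact K" "K <= D"
  and ph: "test_fun D ph" "!!x. x ~: K ==> ph x = 0" and e: "0 < e"
  and le: "!!y. y 0 : K ==> norm (cls cell (%z. R (y(Suc k := z)))) <= e" and E: "sep_scales E"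
 shows "\<forall>\<^sub>F m in sequentially. norm (cls D (%x. ph x *R R (scl (E m) x))) <= e * sqrt (1 + 3 * (norm (cls D ph))^2)"
proof -
 note s = sep_scalesD(1)[OF E]
 have sub: "pcell K <= {y. y 0 : D}" using K(2) by (auto simp: pcell_def)
 obtain h where h: "pt (Suc k) h" "!!y. y 0 : K ==> \<bar>R y \<bullet> R y - h y\<bar> < e^2"
 proof -
  have "lev K (Suc k) (%y. R y \<bullet> R y)" using R(2) K(2) unfolding lev_def by (metis subsetD)
  moreover have "continuous_on (pcell K) (%y. R y \<bullet> R y)" by (intro continuous_intros continuous_on_subset[OF R(1) sub])
  ultimately show ?thesis using pt_dense[OF K(1), of "%y. R y \<bullet> R y" "Suc k" "e^2"] e that by auto
 qed
 obtain hb where hb: "pt k hb" "!!y. hb y = (LINT z:cell|lebesgue. h (y(Suc k := z)))"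
  "!!ph E. test_fun D ph ==> sep_scales E ==> (%m. LINT x:D|lebesgue. ph x * (h (scl (E m) x) - hb (scl (E m) x))) ---> 0"
  using averaged[OF D(2) h(1)] by (auto simp: averaged_def)
 have hb2: "hb y <= 2 * e^2" if y: "y 0 : K" for y
 proof -
  have "continuous_on UNIV (R \<circ> (%p. (fst p)(Suc k := snd p)) \<circ> (%z. (y, z)))"
   by (intro continuous_on_compose continuous_on_Pair continuous_on_const continuous_on_id continuous_on_fun_upd continuous_on_subset[OF R(1)]) (use y K(2) in auto)
  then have sq: "sq_on cell (%z. R (y(Suc k := z)))" by (intro sq_on_cell_cont) (simp add: o_def)
  have i: "set_integrable lebesgue cell (%z. R (y(Suc k := z)) \<bullet> R (y(Suc k := z)))" "set_integrable lebesgue cell (%z::real^'n. e^2)"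
   using set_integrable_inner[OF sq sq] set_integrable_inner[OF sq_on_cst[of "e^2"] sq_on_cst[of 1]] by auto
  have "hb y <= (LINT z:cell|lebesgue. R (y(Suc k := z)) \<bullet> R (y(Suc k := z)) + e^2)" unfolding hb(2)
  proof (rule set_integral_mono)
   show "set_integrable lebesgue cell (%z. h (y(Suc k := z)))"
    using set_integrable_inner[OF pt_slice[OF h(1)] sq_on_cst[of 1]] by simp
   show "h (y(Suc k := z)) <= R (y(Suc k := z)) \<bullet> R (y(Suc k := z)) + e^2" for z using h(2)[of "y(Suc k := z)"] y by simp
  qed (rule set_integral_add(1)[OF i])
  also have "... = (norm (cls cell (%z. R (y(Suc k := z)))))^2 + e^2"
   by (simp add: set_integral_add(2)[OF i] cell_const_integral power2_norm_eq_inner inner_cls[OF sq sq])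
  also have "... <= e^2 + e^2" using le[of y, OF y] by (simp add: power_mono)
  finally show ?thesis by simp
 qed
 define ph2 where "ph2 x = ph x * ph x" for x
 have ph2: "test_fun D ph2" unfolding ph2_def[abs_def] by (rule test_fun_mult[OF ph(1) test_fun_smooth[OF ph(1)]])
 have "\<forall>\<^sub>F m in sequentially. (LINT x:D|lebesgue. ph2 x * (h (scl (E m) x) - hb (scl (E m) x))) < e^2"
  using order_tendstoD(2)[OF hb(3)[OF ph2 E], of "e^2"] e by simp
 then show ?thesis
 proof eventually_elim
  case (elim m)
  let ?R = "%x. R (scl (E m) x)"
  have "continuous_on D ?R" by (rule continuous_on_compose2[OF R(1) continuous_scl]) (auto simp: scl_0[OF s])
  then have sq: "sq_on D (%x. ph x *R ?R x)" by (rule sq_on_test_cont[OF D(1) ph(1)])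
  have T: "test_fun D (%x. ph2 x * (h (scl (E m) x) - hb (scl (E m) x)))"
   using osc_bounds[OF ph2 pt_diff[OF h(1) pt_mono[OF hb(1)]]] s by auto
  have "(norm (cls D (%x. ph x *R ?R x)))^2 = (LINT x:D|lebesgue. (ph x *R ?R x) \<bullet> (ph x *R ?R x))" unfolding power2_norm_eq_inner by (rule inner_cls[OF sq sq])
  also have "... <= (LINT x:D|lebesgue. ph2 x * (h (scl (E m) x) - hb (scl (E m) x)) + (3 * e^2) * ph2 x)"
  proof (rule set_integral_mono[OF set_integrable_inner[OF sq sq]])
   show "set_integrable lebesgue D (%x. ph2 x * (h (scl (E m) x) - hb (scl (E m) x)) + (3 * e^2) * ph2 x)"
    by (intro set_integral_add set_integrable_test_fun T test_fun_cmult ph2)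
   fix x
   show "(ph x *R ?R x) \<bullet> (ph x *R ?R x) <= ph2 x * (h (scl (E m) x) - hb (scl (E m) x)) + (3 * e^2) * ph2 x"
   proof (cases "x : K")
    case True
    \<comment> \<open>One e^2 is the error of h, and two bound the average hb: the cell norm squared
      and again the error of h. The 1 under the final root pays for the averaging term.\<close>
    have "?R x \<bullet> ?R x <= (h (scl (E m) x) - hb (scl (E m) x)) + 3 * e^2"
     using h(2)[of "scl (E m) x"] hb2[of "scl (E m) x"] True by (simp add: scl_0[OF s])
    then have "ph2 x * (?R x \<bullet> ?R x) <= ph2 x * ((h (scl (E m) x) - hb (scl (E m) x)) + 3 * e^2)" by (intro mult_left_mono) (auto simp: ph2_def)
    then show ?thesis by (simp add: ph2_def algebra_simps)
   qed (simp add: ph(2) ph2_def)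
  qed
  also have "... = (LINT x:D|lebesgue. ph2 x * (h (scl (E m) x) - hb (scl (E m) x))) + (3 * e^2) * (LINT x:D|lebesgue. ph2 x)"
   by (simp add: set_integral_add(2)[OF set_integrable_test_fun[OF T] set_integrable_test_fun[OF test_fun_cmult[OF ph2]]])
  also have "(LINT x:D|lebesgue. ph2 x) = (norm (cls D ph))^2"
   unfolding power2_norm_eq_inner by (simp add: inner_cls[OF sq_on_test_fun[OF ph(1)] sq_on_test_fun[OF ph(1)]] ph2_def)
  also have "(LINT x:D|lebesgue. ph2 x * (h (scl (E m) x) - hb (scl (E m) x))) + (3 * e^2) * (norm (cls D ph))^2 <= (e * sqrt (1 + 3 * (norm (cls D ph))^2))^2"
   using elim by (simp add: power_mult_distrib algebra_simps)
  finally show ?case by (rule power2_le_imp_le) (use e in simp)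
 qed
qed

lemma tendsto_sum_list_zero:
 "(!!p. p : set L ==> ((%m. f p m) \<longlongrightarrow> (0::real)) F) ==> ((%m. SUM p<-L. f p m) \<longlongrightarrow> 0) F"
 by (induction L) (auto intro!: tendsto_add_zero)

lemma null_sum_list:
 assumes sq: "!!p m. p : set L ==> sq_on D (f p m)"
  and z: "!!p. p : set L ==> (%m. inner (Z m) (cls D (f p m))) ---> 0"
 shows "(%m. inner (Z m) (cls D (%x. SUM p<-L. f p m x))) ---> 0"
proof -
 have "inner (Z m) (cls D (%x. SUM p<-L. f p m x)) = (SUM p<-L. inner (Z m) (cls D (f p m)))" for m
 proof -
  have "inner (Z m) (SUM p<-L. cls D (f p m)) = (SUM p<-L. inner (Z m) (cls D (f p m)))"
   by (induction L) (auto simp: inner_add_right)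
  then show ?thesis by (simp add: cls_sum_list(2)[of L D "%p. f p m", OF sq])
 qed
 then show ?thesis using tendsto_sum_list_zero[of L "%p m. inner (Z m) (cls D (f p m))", OF z] by simp
qed

lemma trigfuns_cases:
 assumes "t : trigfuns"
 obtains ka where "int_vec ka" "ka ~= 0" "t = tcos ka | t = tsin ka"
 using assms unfolding trigfuns_def by blast

lemma grad_trig_scale:
 assumes "t = tcos ka | t = tsin ka"
 shows "(%x. t (c *R x)) = tcos (c *R ka) | (%x. t (c *R x)) = tsin (c *R ka)" "grad (%x. t (c *R x)) x = c *R grad t (c *R x)"
proof -
 have e: "(%x. tcos ka (c *R x)) = tcos (c *R ka)" "(%x. tsin ka (c *R x)) = tsin (c *R ka)" by (auto simp: trig_scl fun_eq_iff)
 show "(%x. t (c *R x)) = tcos (c *R ka) | (%x. t (c *R x)) = tsin (c *R ka)" using assms e by auto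
 show "grad (%x. t (c *R x)) x = c *R grad t (c *R x)" using assms by (auto simp: e grad_tcos grad_tsin trig_scl mult_ac)
qed

lemma scaleR_sum_list: "c *R (SUM p<-L. f p) = (SUM p<-L. c *R f p :: 'b::real_vector)"
 by (induction L) (auto simp: scaleR_add_right)

text \<open>The truncation \<open>n\<close> and the solutions \<open>v m\<close> of the truncated
  problems are fixed. \<open>snd F\<close> is required to be approximable by test fields, so that
  weakly null gradients can be tested with it.\<close>

locale multiscale =
 fixes D :: "(real^'n) set" and mu :: real and B :: "nat => (nat => real^'n) => real^'n^'n" and E :: "nat => nat => real"
  and n :: nat and F g :: "(real^'n, real) l2 \<times> (real^'n, real^'n) l2" and v :: "nat => real^'n => real" and C :: real
 assumes D: "open D" "D : lmeasurable" and st: "standing_assms D mu B" and E: "sep_scales E"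
  and v: "!!m. v m : H1 D" and vb: "!!m. norm (cls D (wgrad D (v m))) <= C"
  and sol: "!!m. sol D (%x. Asum B n (scl (E m) x)) F g (emb D (v m))"
  and F: "snd F : closure (span (testset D))"
begin

definition \<Gamma> where "\<Gamma> m = cls D (wgrad D (v m))"
text \<open>A_n^k in the usual numbering: \<open>hom_level\<close> counts the variables already
  averaged out, \<open>k\<close> those that remain besides y_0.\<close>

definition H where "H k = hom_level B n (n - k)"
definition op where "op k m = mulop D (%x. H k (scl (E m) x)) (\<Gamma> m)"

abbreviation "vol \<equiv> sqrt (measure lebesgue D)"

lemma mu: "0 < mu" "0 < mu ^ 3" using st by (auto simp: standing_assms_def)

lemma sv: "scale_vec (E m)" by (rule sep_scalesD(1)[OF E])

lemma E_pos: "0 < E m k" by (rule scale_vecD(1)[OF sv])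

lemma Eratio: "(%m. c * (E m (Suc k) / E m k)) ---> 0" by (rule tendsto_mult_right_zero[OF sep_scalesD(2)[OF E]])

lemma ratio_le_1: "E m (Suc k) / E m k <= 1" using scale_vecD(3)[OF sv, of k "Suc k" m] E_pos by (simp add: divide_le_eq)

lemma adm_H: "k <= n ==> adm D mu (mu ^ 3) k (H k)"
 using adm_hom_level[OF st, of "n - k" n] by (simp add: H_def)

lemma H_step: "Suc k <= n ==> H k y = effective (%z. H (Suc k) (y(Suc k := z)))"
 by (simp add: H_def Suc_diff_Suc[symmetric] less_eq_Suc_le)

lemma coef_H: "k <= n ==> coef D mu (1 / mu ^ 3) (%x. H k (scl (E m) x))"
 by (rule adm_coef[OF adm_H D(1) mu(2) sv])

lemma C0: "0 <= C" using vb[of 0] norm_ge_zero order_trans by blast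

lemma op_bound: "k <= n ==> norm (op k m) <= 1 / mu ^ 3 * C"
 unfolding op_def \<Gamma>_def using mu by (intro order_trans[OF norm_mulop_le[OF coef_H]] mult_left_mono vb) auto

lemma op_n: "X : H10space D ==> inner (op n m) (snd X) = inner F X"
 using sol[of m] unfolding sol_def op_def H_def \<Gamma>_def by (simp add: emb_def)

lemma osc:
 assumes "test_fun D ph" "pt k te"
 obtains c where "c > 0" "!!m. test_fun D (%x. ph x * te (scl (E m) x))" "!!m x. \<bar>ph x * te (scl (E m) x)\<bar> <= c"
  "!!m x. norm (grad (%x. ph x * te (scl (E m) x)) x) <= c / E m k"
 using osc_bounds[OF assms] sv by (elim exE conjE, rule_tac that) auto

text \<open>Up to a remainder of order eps_{k+1} / eps_k the field is the gradient of a test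
  function \<open>ps\<close> that tends to zero in L^2 with bounded gradient. The equation turns its
  pairing with the flux into the action of \<open>F\<close> on \<open>ps\<close>.\<close>

lemma gradient_null:
 assumes ph: "test_fun D ph" and te: "pt k te" and t: "t : trigfuns"
 shows "(%m. inner (op n m) (cls D (%x. (ph x * te (scl (E m) x)) *R grad t (scl (E m) x (Suc k))))) ---> 0"
proof -
 obtain ka where ka: "t = tcos ka | t = tsin ka" by (rule trigfuns_cases[OF t]) blast
 obtain c where c: "c > 0" "!!m. test_fun D (%x. ph x * te (scl (E m) x))" "!!m x. \<bar>ph x * te (scl (E m) x)\<bar> <= c"
  "!!m x. norm (grad (%x. ph x * te (scl (E m) x)) x) <= c / E m k"
  by (rule osc[OF ph te]) blast
 define Th where "Th m x = ph x * te (scl (E m) x)" for m x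
 define s where "s m = (%x. t ((1 / E m (Suc k)) *R x))" for m
 have ss: "smooth (s m)" "\<bar>s m x\<bar> <= 1" for m x unfolding s_def by (rule trig_bounds(1,2)[OF grad_trig_scale(1)[OF ka]])+
 \<comment> \<open>The factor eps_{k+1} cancels the 1 / eps_{k+1} produced by differentiating the
   fast mode.\<close>
 define ps where "ps m x = E m (Suc k) * (Th m x * s m x)" for m x
 have Th: "test_fun D (Th m)" for m using c(2) by (simp add: Th_def[abs_def])
 have ps: "test_fun D (ps m)" for m unfolding ps_def[abs_def] by (intro test_fun_cmult test_fun_mult[OF Th] ss(1))
 define r where "r m x = (E m (Suc k) * s m x) *R grad (Th m) x" for m x
 define q where "q m x = Th m x *R grad t (scl (E m) x (Suc k))" for m x
 have g: "grad (ps m) x = q m x + r m x" for m x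
 proof -
  have "grad (ps m) x = E m (Suc k) *R (Th m x *R grad (s m) x + s m x *R grad (Th m) x)"
   unfolding ps_def[abs_def] grad_cmult[OF smooth_mult[OF test_fun_smooth[OF Th] ss(1)]]
    grad_mult[OF smooth_diffble[OF test_fun_smooth[OF Th]] smooth_diffble[OF ss(1)]] ..
  also have "grad (s m) x = (1 / E m (Suc k)) *R grad t (scl (E m) x (Suc k))" unfolding s_def grad_trig_scale(2)[OF ka] scl_def ..
  finally show ?thesis using E_pos[of m "Suc k"] by (simp add: q_def r_def scaleR_add_right)
 qed
 have sr: "sq_on D (r m)" for m
 proof -
  obtain K where K: "compact K" "K <= D" "!!x. x ~: K ==> Th m x = 0" by (rule test_funD[OF Th[of m]]) blast
  show ?thesis unfolding r_def[abs_def]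
   by (rule sq_on_cont_support[OF _ K(1,2)])
    (auto intro!: continuous_intros smooth_cont[OF ss(1)] smooth_cont_grad[OF test_fun_smooth[OF Th]] grad_zero_outside[OF compact_imp_closed[OF K(1)]] simp: K(3))
 qed
 have sg: "sq_on D (grad (ps m))" for m by (rule sq_on_test_fun_grad[OF ps])
 have rb: "norm (r m x) <= c * (E m (Suc k) / E m k)" for m x
 proof -
  have "\<bar>E m (Suc k) * s m x\<bar> <= E m (Suc k) * 1" unfolding abs_mult using ss(2)[of m x] E_pos[of m "Suc k"] by (intro mult_mono) auto
  then have "norm (r m x) <= (E m (Suc k) * 1) * (c / E m k)"
   unfolding r_def norm_scaleR Th_def[abs_def] using c(4)[of m x] E_pos[of m "Suc k"] by (intro mult_mono) auto
  then show ?thesis by (simp add: field_simps)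
 qed
 have qr: "cls D (q m) = cls D (grad (ps m)) - cls D (r m)" for m
  using cls_diff[OF sg[of m] sr[of m]] by (simp add: g)
 have ratio0: "0 <= E m (Suc k) / E m k" for m using E_pos[of m k] E_pos[of m "Suc k"] by simp
 have nr: "norm (cls D (r m)) <= (c * vol) * (E m (Suc k) / E m k)" for m
  using norm_cls_bounded[OF D(2) sr[of m] rb] mult_nonneg_nonneg[OF less_imp_le[OF c(1)] ratio0] by (simp add: mult_ac)
 have gb: "norm (cls D (grad (ps m))) <= (c * (2 * pi * norm ka) + c) * vol" for m
 proof (rule norm_cls_bounded[OF D(2) sg])
  fix x
  have "norm (q m x) <= c * (2 * pi * norm ka)"
   unfolding q_def norm_scaleR real_norm_def using c(1,3) trig_bounds(3)[OF ka] by (intro mult_mono) (auto simp: Th_def)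
  moreover have "norm (r m x) <= c" using rb[of m x] mult_left_mono[OF ratio_le_1[of m k], of c] c(1) by linarith
  ultimately show "norm (grad (ps m) x) <= c * (2 * pi * norm ka) + c" unfolding g by (rule norm_triangle_mono)
 qed (use c(1) in auto)
 have psb: "norm (cls D (ps m)) <= (c * vol) * (E m (Suc k) / E m k)" for m
 proof -
  have Ek: "E m k <= 1" using scale_vecD(3)[OF sv, of 0 k m] scale_vecD(2)[OF sv] by simp
  have "norm (ps m x) <= c * (E m (Suc k) / E m k)" for x
  proof -
   have "\<bar>Th m x * s m x\<bar> <= c * 1" unfolding abs_mult using ss(2)[of m x] c(3)[of x m] c(1) by (intro mult_mono) (auto simp: Th_def)
   then have "norm (ps m x) <= E m (Suc k) * c" using E_pos[of m "Suc k"] by (simp add: ps_def abs_mult)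
   also have "... <= c * (E m (Suc k) / E m k)" using E_pos[of m k] E_pos[of m "Suc k"] Ek c(1) by (simp add: divide_simps mult_left_le)
   finally show ?thesis .
  qed
  from norm_cls_bounded[OF D(2) sq_on_test_fun[OF ps[of m]] this] show ?thesis
   using mult_nonneg_nonneg[OF less_imp_le[OF c(1)] ratio0] by (simp add: mult_ac)
 qed
 have ps0: "(%m. inner X (cls D (ps m))) ---> 0" for X
 proof (rule Lim_null_comparison[OF always_eventually Eratio[of "norm X * (c * vol)" k]], rule allI)
  fix m
  have "norm (inner X (cls D (ps m))) <= norm X * ((c * vol) * (E m (Suc k) / E m k))"
   unfolding real_norm_def by (rule order_trans[OF Cauchy_Schwarz_ineq2 mult_left_mono[OF psb norm_ge_zero]])
  then show "norm (inner X (cls D (ps m))) <= norm X * (c * vol) * (E m (Suc k) / E m k)" by (simp only: mult.assoc)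
 qed
 \<comment> \<open>Against a test field the derivative moves off \<open>ps m\<close>, which tends to
   zero; boundedness extends this to \<open>snd F\<close>.\<close>
 have "(%m. inner (cls D (grad (ps m))) (snd F)) ---> 0"
 proof (rule weak_null_on_closure_span[OF gb _ F])
  fix Ps assume "Ps : testset D"
  then obtain om i where om: "test_fun D om" "Ps = cls D (%x. om x *R axis i 1)" unfolding testset_def by blast
  have "inner (cls D (ps m)) (cls D (pd i om)) + inner (cls D (grad (ps m))) Ps = 0" for m
   using smooth_is_weak_grad[OF test_fun_smooth[OF ps[of m]], of D] om(1) unfolding is_weak_grad_iff[OF sq_on_test_fun[OF ps] sg] om(2) by blast
  then have "inner (cls D (grad (ps m))) Ps = - inner (cls D (pd i om)) (cls D (ps m))" for m by (metis add_eq_0_iff inner_commute)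
  then show "(%m. inner (cls D (grad (ps m))) Ps) ---> 0" using tendsto_minus[OF ps0[of "cls D (pd i om)"]] by simp
 qed
 then have "(%m. inner (fst F) (cls D (ps m)) + inner (snd F) (cls D (grad (ps m)))) ---> 0 + 0"
  by (intro tendsto_add ps0) (simp add: inner_commute)
 moreover have "inner (fst F) (cls D (ps m)) + inner (snd F) (cls D (grad (ps m))) = inner (op n m) (cls D (grad (ps m)))" for m
 proof -
  have "emb D (ps m) : H10space D" unfolding H10space_def using ps by (intro subsetD[OF closure_subset] imageI) simp
  from op_n[OF this, of m] show ?thesis by (simp add: test_fun_H1[OF D(1) ps] inner_prod_def)
 qed
 moreover have "(%m. inner (op n m) (cls D (r m))) ---> 0"
 proof (rule Lim_null_comparison[OF always_eventually Eratio[of "(1 / mu ^ 3 * C) * (c * vol)" k]], rule allI)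
  fix m
  have "norm (inner (op n m) (cls D (r m))) <= (1 / mu ^ 3 * C) * ((c * vol) * (E m (Suc k) / E m k))"
   unfolding real_norm_def using op_bound[of n m] nr[of m] C0 mu by (intro order_trans[OF Cauchy_Schwarz_ineq2] mult_mono) auto
  then show "norm (inner (op n m) (cls D (r m))) <= (1 / mu ^ 3 * C) * (c * vol) * (E m (Suc k) / E m k)" by (simp only: mult.assoc)
 qed
 ultimately have "(%m. inner (op n m) (cls D (q m))) ---> 0 - 0"
  unfolding qr inner_diff_right by (intro tendsto_diff) auto
 then show ?thesis by (simp add: q_def[abs_def] Th_def)
qed

text \<open>\<open>solenoidal_bound\<close> at the frequency ka / eps_{k+1}, with an amplitude whose
  gradient is at most c / eps_k.\<close>

lemma solenoidal_null:
 assumes ph: "test_fun D ph" and te: "pt k te" and p: "p : soltrig"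
 shows "(%m. inner (\<Gamma> m) (cls D (%x. (ph x * te (scl (E m) x) * fst p (scl (E m) x (Suc k))) *R snd p))) ---> 0"
proof -
 obtain t et ka where p': "p = (t, et)" "ka ~= 0" "ka \<bullet> et = 0" and t: "t = tcos ka | t = tsin ka" using p unfolding soltrig_def by blast
 obtain c where c: "c > 0" "!!m. test_fun D (%x. ph x * te (scl (E m) x))" "!!m x. norm (grad (%x. ph x * te (scl (E m) x)) x) <= c / E m k"
  by (rule osc[OF ph te]) blast
 show ?thesis
 proof (rule Lim_null_comparison[OF always_eventually Eratio[of "C * (c * norm et / norm ka * vol)" k]], rule allI)
  fix m
  define s where "s = (%x. t ((1 / E m (Suc k)) *R x))"
  note E_pos[of m "Suc k"]
  then have ka: "(1 / E m (Suc k)) *R ka ~= 0" "((1 / E m (Suc k)) *R ka) \<bullet> et = 0" using p' by auto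
  note b = solenoidal_bound[OF D v[of m] c(2,3)[of m] grad_trig_scale(1)[OF t] ka]
  also have "norm (cls D (wgrad D (v m))) * (c / E m k * norm et / norm ((1 / E m (Suc k)) *R ka) * vol) <= C * (c / E m k * norm et / norm ((1 / E m (Suc k)) *R ka) * vol)"
   using c(1) E_pos[of m k] by (intro mult_right_mono vb) auto
  also have "... = C * (c * norm et / norm ka * vol) * (E m (Suc k) / E m k)" using E_pos[of m "Suc k"] by (simp add: field_simps)
  finally show "norm (inner (\<Gamma> m) (cls D (%x. (ph x * te (scl (E m) x) * fst p (scl (E m) x (Suc k))) *R snd p))) <= C * (c * norm et / norm ka * vol) * (E m (Suc k) / E m k)"
   by (simp add: p'(1) \<Gamma>_def scl_def)
 qed
qed

text \<open>The full truncated flux and the flux of A_n^k, on the same gradients, agree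
  asymptotically when tested with fields oscillating on the scales up to k. Allowing those
  oscillations makes the descent from k + 1 to k possible.\<close>

definition levelwise where
 "levelwise k \<longleftrightarrow> (ALL ph f i. test_fun D ph --> pt k f -->
   (%m. inner (op n m - op k m) (cls D (%x. (ph x * f (scl (E m) x)) *R axis i 1))) ---> 0)"

lemma osc_test_fun: "test_fun D ph ==> pt k f ==> test_fun D (%x. ph x * f (scl (E m) x))"
 using osc_bounds sv by blast

lemma levelwise_gradient:
 assumes k: "levelwise (Suc k)" and ph: "test_fun D ph" and f: "pt k f" and t: "t : trigfuns"
 shows "(%m. inner (op n m - op (Suc k) m) (cls D (%x. (ph x * f (scl (E m) x)) *R grad t (scl (E m) x (Suc k))))) ---> 0"
proof -
 obtain ka where ka: "int_vec ka" "t = tcos ka | t = tsin ka" by (rule trigfuns_cases[OF t]) blast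
 obtain s a where s: "s = tcos ka | s = tsin ka" "!!x. grad t x = (a * s x) *R ka"
 proof (cases "t = tcos ka")
  case True
  then show ?thesis using that[of "tsin ka" "- 2 * pi"] by (simp add: grad_tcos)
 next
  case False
  then have "t = tsin ka" using ka by simp
  then show ?thesis using that[of "tcos ka" "2 * pi"] by (simp add: grad_tsin)
 qed
 have p: "pt (Suc k) (%y. f y * (a * ka $ i * s (y (Suc k))))" for i
  by (intro pt_mult pt_mono[OF f] pt_const pt_trig[OF _ _ ka(1) s(1)]) auto
 obtain L where L: "set L = (UNIV :: 'n set)" "distinct L" using finite_distinct_list[OF finite, of "UNIV :: 'n set"] by blast
 have e: "(ph x * f y) *R grad t (y (Suc k)) = (SUM i<-L. (ph x * (f y * (a * ka $ i * s (y (Suc k))))) *R axis i 1)" for x y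
 proof -
  have "(SUM i<-L. (ph x * (f y * (a * ka $ i * s (y (Suc k))))) *R (axis i 1 :: real^'n)) = (SUM i:UNIV. (ph x * f y * a * s (y (Suc k))) *R (ka $ i *R axis i 1))"
   by (simp add: sum_list_distinct_conv_sum_set[OF L(2)] L(1) mult_ac)
  also have "... = (ph x * f y * a * s (y (Suc k))) *R ka" by (simp only: scaleR_sum_right[symmetric] axis_expansion)
  finally show ?thesis by (simp add: s(2) mult_ac)
 qed
 show ?thesis unfolding e
 proof (rule null_sum_list)
  show "sq_on D (%x. (ph x * (f (scl (E m) x) * (a * ka $ i * s (scl (E m) x (Suc k))))) *R axis i 1)" for i m
   by (rule sq_on_test_scaleR) (rule osc_test_fun[OF ph p])
  show "(%m. inner (op n m - op (Suc k) m) (cls D (%x. (ph x * (f (scl (E m) x) * (a * ka $ i * s (scl (E m) x (Suc k))))) *R axis i 1))) ---> 0" for i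
   using k ph p unfolding levelwise_def by blast
 qed
qed

text \<open>Add to the test field X its approximate adjoint corrector Gs. Transposition moves both
  matrices to the test side, where the cell equation says that A_n^{k+1} on X + Gs and A_n^k on X
  differ by the solenoidal field Ss and a residual small in mean square. Against the full flux Gs is
  null by the equation; the level k + 1 statement covers X and Gs.\<close>

lemma levelwise_step:
 assumes k: "Suc k <= n" and lw: "levelwise (Suc k)" shows "levelwise k"
 unfolding levelwise_def
proof (intro allI impI)
 fix ph :: "real^'n => real" and f :: "(nat => real^'n) => real" and i :: 'n assume ph: "test_fun D ph" and f: "pt k f"
 define xi :: "real^'n" where "xi = axis i 1"
 obtain K where K: "compact K" "K <= D" "!!x. x ~: K ==> ph x = 0" "smooth ph" by (rule test_funD[OF ph]) blast
 obtain c where c: "c >= 0" "!!m x. x : K ==> \<bar>f (scl (E m) x)\<bar> <= c" using pt_scl[OF f K(1)] sv by (elim exE conjE, rule_tac that) auto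
 note aH = adm_H[OF k] and aHk = adm_H[of k]
 have kn: "k <= n" using k by simp
 define X where "X m x = (ph x * f (scl (E m) x)) *R xi" for m x
 show "(%m. inner (op n m - op k m) (cls D (%x. (ph x * f (scl (E m) x)) *R axis i 1))) ---> 0"
  unfolding X_def[symmetric, unfolded xi_def]
 \<comment> \<open>The 1 stands for the terms that tend to zero; the rest bounds the residual:
   \<open>C\<close> for the gradients of the solutions, \<open>c\<close> for the oscillating factor,
   the root from \<open>mean_square_bound\<close>.\<close>
 proof (rule tendsto_if_linear_bound[where C = "1 + C * (c * sqrt (1 + 3 * (norm (cls D ph))^2))"])
  fix e :: real assume e: "e > 0"
  obtain L L' where L: "!!p. p : set L ==> pt k (fst p) & snd p : trigfuns" and L': "!!p. p : set L' ==> pt k (fst p) & snd p : soltrig"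
   and le: "!!y. y 0 : K ==> norm (cls cell (%z. transpose (H (Suc k) (y(Suc k := z))) *v (xi + (SUM p<-L. fst p y *R grad (snd p) z))
    - transpose (effective (%z. H (Suc k) (y(Suc k := z)))) *v xi - (SUM p<-L'. (fst p y * fst (snd p) z) *R snd (snd p)))) <= e"
   by (rule cell_approx[OF aH mu K(1,2) e, of xi]) blast
  define Gp where "Gp p m x = (ph x * (f (scl (E m) x) * fst p (scl (E m) x))) *R grad (snd p) (scl (E m) x (Suc k))" for p :: "((nat => real^'n) => real) \<times> (real^'n => real)" and m x
  define Sp where "Sp p m x = (ph x * (f (scl (E m) x) * fst p (scl (E m) x)) * fst (snd p) (scl (E m) x (Suc k))) *R snd (snd p)" for p :: "((nat => real^'n) => real) \<times> ((real^'n => real) \<times> (real^'n))" and m x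
  define Gs where "Gs m x = (SUM p<-L. Gp p m x)" for m x
  define Ss where "Ss m x = (SUM p<-L'. Sp p m x)" for m x
  define w where "w y = xi + (SUM p<-L. fst p y *R grad (snd p) (y (Suc k)))" for y
  \<comment> \<open>The defect of the approximate cell problem; its norm on the cell is at most
    \<open>e\<close> for each slow argument over \<open>K\<close>.\<close>
  define R where "R y = transpose (H (Suc k) y) *v w y - transpose (H k y) *v xi - (SUM p<-L'. (fst p y * fst (snd p) (y (Suc k))) *R snd (snd p))" for y
  have pf: "pt k (%y. f y * fst p y)" if "p : set L" for p using L[OF that] f by (auto intro: pt_mult)
  have pf': "pt k (%y. f y * fst p y)" if "p : set L'" for p using L'[OF that] f by (auto intro: pt_mult)
  have cc: "continuous_on S (%x. x (Suc k))" for S :: "(nat => real^'n) set"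
   by (rule continuous_on_subset[OF continuous_on_product_coordinates]) auto
  have cs: "continuous_on S (%x. scl (E m) x (Suc k))" for S :: "(real^'n) set" and m unfolding scl_def by (intro continuous_intros)
  have cg: "continuous_on UNIV (grad (snd p))" if "p : set L" for p
   using L[OF that] by (intro smooth_cont_grad trigfuns_smooth) auto
  have ct: "continuous_on UNIV (fst (snd p))" if "p : set L'" for p
   using L'[OF that] unfolding soltrig_def by (auto intro: trig_continuous)
  have sX: "sq_on D (X m)" for m unfolding X_def[abs_def] by (intro sq_on_test_scaleR osc_test_fun[OF ph f])
  have sG: "sq_on D (Gp p m)" if "p : set L" for p m unfolding Gp_def[abs_def]
   by (rule sq_on_test_cont[OF D(1) osc_test_fun[OF ph pf[OF that]] continuous_on_compose2[OF cg[OF that] cs]]) auto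
  have sS: "sq_on D (Sp p m)" if "p : set L'" for p m
  proof -
   have "sq_on D (%x. (ph x * (f (scl (E m) x) * fst p (scl (E m) x))) *R (fst (snd p) (scl (E m) x (Suc k)) *R snd (snd p)))"
    by (intro sq_on_test_cont[OF D(1) osc_test_fun[OF ph pf'[OF that]]] continuous_on_scaleR continuous_on_const continuous_on_compose2[OF ct[OF that] cs]) auto
   then show ?thesis by (simp add: Sp_def[abs_def])
  qed
  have sGs: "sq_on D (Gs m)" for m unfolding Gs_def[abs_def] by (rule cls_sum_list(1)) (rule sG)
  have sSs: "sq_on D (Ss m)" for m unfolding Ss_def[abs_def] by (rule cls_sum_list(1)) (rule sS)
  have csum: "continuous_on S (%y. SUM p<-l. h p y)" if "!!p. p : set l ==> continuous_on S (h p)" for S :: "(nat => real^'n) set" and l :: "'z list" and h :: "'z => (nat => real^'n) => real^'n"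
   using that by (induction l) (auto intro!: continuous_intros)
  have wc: "continuous_on {y. y 0 : D} w" unfolding w_def[abs_def] using L
   by (intro continuous_on_add continuous_on_const csum continuous_on_scaleR continuous_on_compose2[OF cg cc]) (auto intro: continuous_on_subset[OF pt_continuous])
  have Mc: "continuous_on {y. y 0 : D} (%y. transpose (M y) *v h y)" if "continuous_on {y. y 0 : D} M" "continuous_on {y. y 0 : D} h" for M :: "(nat => real^'n) => real^'n^'n" and h
   unfolding matrix_vector_mult_def transpose_def using that by (intro continuous_intros continuous_on_vec_lambda) auto
  have Rc: "continuous_on {y. y 0 : D} R" unfolding R_def[abs_def] using aH aHk[OF kn] L'
   by (intro continuous_on_diff Mc wc continuous_on_const csum continuous_on_scaleR continuous_on_mult continuous_on_compose2[OF ct cc])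
    (auto simp: adm_def intro: continuous_on_subset[OF pt_continuous])
  have Rl: "lev D (Suc k) R" unfolding lev_def
  proof (intro allI impI)
   fix y y' :: "nat => real^'n" assume y: "y 0 : D" "y 0 = y' 0" "ALL i. 1 <= i --> i <= Suc k --> int_vec (y i - y' i)"
   have 1: "H (Suc k) y = H (Suc k) y'" by (rule adm_cong[OF aH]) (use y in auto)
   have 2: "H k y = H k y'" by (rule adm_cong[OF aHk[OF kn]]) (use y in auto)
   have 3: "h y = h y'" if "pt k h" for h by (rule pt_lev[OF that, of D, unfolded lev_def, rule_format]) (use y in auto)
   have s: "int_vec (y (Suc k) - y' (Suc k))" using y(3) by simp
   have 4: "grad t (y (Suc k)) = grad t (y' (Suc k))" if t: "t : trigfuns" for t
   proof -
    obtain ka where ka: "int_vec ka" "t = tcos ka | t = tsin ka" by (rule trigfuns_cases[OF t]) blast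
    then show ?thesis using trig_periodic[OF _ ka(1) s] by (auto simp: grad_tcos grad_tsin)
   qed
   have 5: "t (y (Suc k)) = t (y' (Suc k))" if "(t, et) : soltrig" for t et
    using that trig_periodic[OF _ _ s] unfolding soltrig_def by auto
   have "w y = w y'" unfolding w_def using L by (intro arg_cong2[of _ _ _ _ "(+)"] refl arg_cong[of _ _ sum_list] map_cong) (auto simp: 3 4)
   moreover have "(SUM p<-L'. (fst p y * fst (snd p) (y (Suc k))) *R snd (snd p)) = (SUM p<-L'. (fst p y' * fst (snd p) (y' (Suc k))) *R snd (snd p))"
    using L' by (intro arg_cong[of _ _ sum_list] map_cong refl) (metis 3 5 prod.collapse)
   ultimately show "R y = R y'" unfolding R_def by (simp only: 1 2)
  qed
  have Re: "norm (cls cell (%z. R (y(Suc k := z)))) <= e" if y: "y 0 : K" for y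
  proof -
   have yD: "y 0 : D" using y K(2) by auto
   have 3: "h (y(Suc k := z)) = h y" if "pt k h" for h z by (rule pt_lev[OF that, of UNIV, unfolded lev_def, rule_format]) (auto simp: int_vec_zero)
   have "R (y(Suc k := z)) = transpose (H (Suc k) (y(Suc k := z))) *v (xi + (SUM p<-L. fst p y *R grad (snd p) z))
    - transpose (effective (%z. H (Suc k) (y(Suc k := z)))) *v xi - (SUM p<-L'. (fst p y * fst (snd p) z) *R snd (snd p))" for z
   proof -
    have "(SUM p<-L. fst p (y(Suc k := z)) *R grad (snd p) ((y(Suc k := z)) (Suc k))) = (SUM p<-L. fst p y *R grad (snd p) z)"
     "(SUM p<-L'. (fst p (y(Suc k := z)) * fst (snd p) ((y(Suc k := z)) (Suc k))) *R snd (snd p)) = (SUM p<-L'. (fst p y * fst (snd p) z) *R snd (snd p))"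
     using L L' by (intro arg_cong[of _ _ sum_list] map_cong refl; simp add: 3)+
    then show ?thesis unfolding R_def w_def by (simp only: H_step[OF k] fun_upd_upd)
   qed
   then show ?thesis using le[of y, OF y] by simp
  qed
  have sR: "sq_on D (%x. ph x *R R (scl (E m) x))" for m
   by (rule sq_on_test_cont[OF D(1) ph continuous_on_compose2[OF Rc continuous_scl]]) (auto simp: scl_0[OF sv])
  have sfR: "sq_on D (%x. (ph x * f (scl (E m) x)) *R R (scl (E m) x))" for m
   by (rule sq_on_test_cont[OF D(1) osc_test_fun[OF ph f] continuous_on_compose2[OF Rc continuous_scl]]) (auto simp: scl_0[OF sv])
  \<comment> \<open>Exact for every m: the first four terms tend to zero, and the last is the
    residual, kept as an error.\<close>
  have split: "inner (op n m - op k m) (cls D (X m)) = - inner (op n m) (cls D (Gs m)) + (inner (op n m - op (Suc k) m) (cls D (X m)) + inner (op n m - op (Suc k) m) (cls D (Gs m)))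
    + inner (\<Gamma> m) (cls D (Ss m)) + inner (\<Gamma> m) (cls D (%x. (ph x * f (scl (E m) x)) *R R (scl (E m) x)))" for m
  proof -
   have adj: "inner (op j m) (cls D h) = inner (\<Gamma> m) (cls D (%x. transpose (H j (scl (E m) x)) *v h x))" if "j <= n" "sq_on D h" for j h
    unfolding op_def \<Gamma>_def mulop_transpose[OF coef_H[OF that(1)] H1D(2)[OF v] that(2)] mulop_cls[OF coef_transpose[OF coef_H[OF that(1)]] that(2)] ..
   note sA = coefD(6)[OF coef_transpose[OF coef_H]]
   have "transpose (H (Suc k) y) *v (X m x + Gs m x) - transpose (H k y) *v X m x = Ss m x + (ph x * f y) *R R y" if "y = scl (E m) x" for x y
   proof -
    have "X m x + Gs m x = (ph x * f y) *R w y"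
     by (simp add: X_def Gs_def Gp_def w_def that scaleR_add_right scaleR_sum_list mult_ac)
    moreover have "Ss m x = (ph x * f y) *R (SUM p<-L'. (fst p y * fst (snd p) (y (Suc k))) *R snd (snd p))"
     by (simp add: Ss_def Sp_def that scaleR_sum_list mult_ac)
    ultimately show ?thesis by (simp add: R_def X_def that scaleR_diff_right matrix_vector_mult_scaleR del: transpose_matrix_vector)
   qed
   then have eq: "(%x. transpose (H (Suc k) (scl (E m) x)) *v (X m x + Gs m x) - transpose (H k (scl (E m) x)) *v X m x) = (%x. Ss m x + (ph x * f (scl (E m) x)) *R R (scl (E m) x))" by blast
   have "inner (op (Suc k) m) (cls D (%x. X m x + Gs m x)) - inner (op k m) (cls D (X m)) = inner (\<Gamma> m) (cls D (Ss m) + cls D (%x. (ph x * f (scl (E m) x)) *R R (scl (E m) x)))"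
    unfolding adj[OF k sq_on_add[OF sX sGs]] adj[OF kn sX] inner_diff_right[symmetric] cls_diff[OF sA[OF k sq_on_add[OF sX sGs]] sA[OF kn sX], symmetric] eq cls_add[OF sSs sfR] ..
   then show ?thesis by (simp add: cls_add[OF sX sGs] inner_add_right inner_diff_left)
  qed
  have l1: "(%m. inner (op n m) (cls D (Gs m))) ---> 0" unfolding Gs_def[abs_def]
   by (rule null_sum_list[OF sG]) (use L in "auto simp: Gp_def[abs_def] intro!: gradient_null[OF ph pf]")
  have l2: "(%m. inner (op n m - op (Suc k) m) (cls D (Gs m))) ---> 0" unfolding Gs_def[abs_def]
   by (rule null_sum_list[OF sG]) (use L in "auto simp: Gp_def[abs_def] intro!: levelwise_gradient[OF lw ph pf]")
  have l3: "(%m. inner (op n m - op (Suc k) m) (cls D (X m))) ---> 0"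
   using lw ph pt_mono[OF f, of "Suc k"] unfolding levelwise_def X_def[abs_def] xi_def by auto
  have l4: "(%m. inner (\<Gamma> m) (cls D (Ss m))) ---> 0" unfolding Ss_def[abs_def]
   by (rule null_sum_list[OF sS]) (use L' in "auto simp: Sp_def[abs_def] intro!: solenoidal_null[OF ph pf']")
  have "(%m. - inner (op n m) (cls D (Gs m)) + (inner (op n m - op (Suc k) m) (cls D (X m)) + inner (op n m - op (Suc k) m) (cls D (Gs m))) + inner (\<Gamma> m) (cls D (Ss m))) ---> - 0 + (0 + 0) + 0"
   by (intro tendsto_intros l1 l2 l3 l4)
  then have "\<forall>\<^sub>F m in sequentially. \<bar>- inner (op n m) (cls D (Gs m)) + (inner (op n m - op (Suc k) m) (cls D (X m)) + inner (op n m - op (Suc k) m) (cls D (Gs m))) + inner (\<Gamma> m) (cls D (Ss m))\<bar> < e"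
   using e by (auto simp: tendsto_iff dist_real_def)
  moreover have "\<forall>\<^sub>F m in sequentially. norm (cls D (%x. ph x *R R (scl (E m) x))) <= e * sqrt (1 + 3 * (norm (cls D ph))^2)"
   by (rule mean_square_bound[OF D Rc Rl K(1,2) ph _ e _ E]) (use K(3) Re in auto)
  ultimately show "\<forall>\<^sub>F m in sequentially. norm (inner (op n m - op k m) (cls D (X m)) - 0) <= e * (1 + C * (c * sqrt (1 + 3 * (norm (cls D ph))^2)))"
  proof eventually_elim
   case (elim m)
   have "norm (cls D (%x. (ph x * f (scl (E m) x)) *R R (scl (E m) x))) <= c * norm (cls D (%x. ph x *R R (scl (E m) x)))"
   proof (rule norm_cls_le[OF sR sfR _ c(1)], intro always_eventually allI impI)
    fix x
    have "\<bar>f (scl (E m) x)\<bar> * norm (ph x *R R (scl (E m) x)) <= c * norm (ph x *R R (scl (E m) x))"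
     using c(2)[of x m] K(3)[of x] by (cases "x : K") (auto intro!: mult_right_mono)
    then show "norm ((ph x * f (scl (E m) x)) *R R (scl (E m) x)) <= c * norm (ph x *R R (scl (E m) x))" by (simp add: abs_mult mult_ac)
   qed
   also have "... <= c * (e * sqrt (1 + 3 * (norm (cls D ph))^2))" by (rule mult_left_mono[OF elim(2) c(1)])
   finally have "\<bar>inner (\<Gamma> m) (cls D (%x. (ph x * f (scl (E m) x)) *R R (scl (E m) x)))\<bar> <= C * (c * (e * sqrt (1 + 3 * (norm (cls D ph))^2)))"
    using vb[of m] C0 by (intro order_trans[OF Cauchy_Schwarz_ineq2] mult_mono) (auto simp: \<Gamma>_def)
   then show ?case unfolding split using elim(1) by (simp add: algebra_simps)
  qed
 qed
qed

text \<open>Descending induction from the trivial level n, at which both fluxes coincide.\<close>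

lemma levelwise_0: "levelwise 0"
proof (rule inc_induct[of 0 n levelwise])
 show "levelwise n" by (simp add: levelwise_def)
qed (auto intro: levelwise_step)

end

section \<open>Convergence\<close>

lemma matrix_uniform_limit:
 fixes N :: "nat => real^'n^'n"
 assumes le: "!!n p xi. norm (N (n + p) *v xi - N n *v xi) <= ta n * norm xi" and ta: "ta ---> 0"
 shows "N ---> lim N" "norm (lim N *v xi - N n *v xi) <= ta n * norm xi"
proof -
 define c where "c = real CARD('n) * real CARD('n)"
 have c: "c > 0" by (simp add: c_def)
 have d: "norm (N (n + p) - N n) <= c * ta n" for n p
  unfolding c_def by (rule matrix_norm_le(2)) (simp add: matrix_vector_mult_diff_rdistrib le)
 have "Cauchy N" unfolding Cauchy_altdef2
 proof (intro allI impI)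
  fix e :: real assume "e > 0"
  then have "\<forall>\<^sub>F n in sequentially. ta n < e / c" using order_tendstoD(2)[OF ta] c by simp
  then obtain n where n: "ta n < e / c" by (auto simp: eventually_sequentially)
  have "dist (N m) (N n) < e" if "m >= n" for m
  proof -
   have "dist (N m) (N n) <= c * ta n" using d[of n "m - n"] that by (simp add: dist_norm)
   also have "... < e" using n c by (simp add: field_simps)
   finally show ?thesis .
  qed
  then show "EX n. ALL m>=n. dist (N m) (N n) < e" by blast
 qed
 then show l: "N ---> lim N" using Cauchy_convergent convergent_LIMSEQ_iff by blast
 have "(%p. N (n + p) *v xi - N n *v xi) ---> lim N *v xi - N n *v xi"
  using LIMSEQ_ignore_initial_segment[OF l, of n] unfolding matrix_vector_mult_def
  by (intro tendsto_diff tendsto_const tendsto_vec_lambda tendsto_sum tendsto_mult tendsto_vec_nth) (simp_all add: add.commute)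
 then show "norm (lim N *v xi - N n *v xi) <= ta n * norm xi"
  by (rule Lim_norm_ubound[OF trivial_limit_sequentially]) (simp add: le)
qed

lemma matrix_vector_tendsto:
 fixes N :: "nat => real^'n^'n"
 assumes "N ---> A" shows "(%n. N n *v xi) ---> A *v xi"
 unfolding matrix_vector_mult_def
 by (intro tendsto_vec_lambda tendsto_sum tendsto_mult tendsto_vec_nth tendsto_const assms)

lemma ell_limit:
 fixes N :: "nat => real^'n^'n"
 assumes "N ---> A" "!!n. ell mu be (N n)" shows "ell mu be A"
 unfolding ell_def
proof (intro allI conjI)
 fix xi :: "real^'n"
 have l: "(%n. (N n *v xi) \<bullet> xi) ---> (A *v xi) \<bullet> xi" by (intro tendsto_intros matrix_vector_tendsto assms)
 show "mu * (norm xi)^2 <= (A *v xi) \<bullet> xi" by (rule LIMSEQ_le_const[OF l]) (use assms(2) in "auto simp: ell_def")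
 have "(%n. be * (norm (N n *v xi))^2) ---> be * (norm (A *v xi))^2" by (intro tendsto_intros matrix_vector_tendsto assms)
 then show "be * (norm (A *v xi))^2 <= (A *v xi) \<bullet> xi" by (rule LIMSEQ_le[OF _ l]) (use assms(2) in "auto simp: ell_def")
qed

lemma coef_limit:
 fixes A :: "real^'n => real^'n^'n"
 assumes An: "!!n. coef D mu La (An n)" and l: "!!x. x : D ==> (%n. An n x) ---> A x"
  and e: "!!x. x : D ==> ell mu be (A x)" and be: "0 < be" "La = 1 / be"
 shows "coef D mu La A"
proof -
 have "(%x. ind D x *R A x) : borel_measurable lebesgue"
 proof (rule borel_measurable_LIMSEQ_metric)
  show "(%x. ind D x *R An n x) : borel_measurable lebesgue" for n
   using coefD(2)[OF An[of n]] by (simp add: set_borel_measurable_def)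
  show "(%n. ind D x *R An n x) ---> ind D x *R A x" for x
   using l[of x] by (cases "x : D") auto
 qed
 then show ?thesis using coefD(1)[OF An] e ell_norm[OF e be(1)] be by (auto simp: coef_def set_borel_measurable_def ell_def)
qed

text \<open>Coercivity makes the matrix injective, hence invertible; the second inequality of
  \<open>ell\<close>, taken at the inverse image of \<open>xi\<close>, is the bound required of the
  inverse.\<close>

lemma Mclass_ell:
 fixes A :: "real^'n => real^'n^'n"
 assumes A: "coef D mu La A" and e: "!!x. x : D ==> ell mu (1 / be) (A x)" and mu: "0 < mu"
 shows "Mclass mu be D A"
 unfolding Mclass_def
proof (intro conjI exI always_eventually allI impI)
 show "set_borel_measurable lebesgue D A" by (rule coefD(2)[OF A])
 show "norm (A x) <= real CARD('n) * real CARD('n) * La" if "x : D" for x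
  by (rule matrix_norm_le(2)) (rule coefD(5)[OF A that])
 fix x and xi :: "real^'n" assume x: "x : D"
 show "mu * (norm xi)^2 <= (A x *v xi) \<bullet> xi" using e[OF x] by (simp add: ell_def)
 have "et = 0" if "A x *v et = 0" for et
 proof -
  have "mu * (norm et)^2 <= (A x *v et) \<bullet> et" using e[OF x] by (simp add: ell_def)
  then show ?thesis using that mu by (simp add: mult_le_0_iff)
 qed
 then have "invertible (A x)" using matrix_left_invertible_ker[of "A x"] by (auto simp: invertible_left_inverse)
 then have "A x ** matrix_inv (A x) = mat 1" unfolding invertible_def matrix_inv_def by (rule someI2_ex) blast
 then have i: "A x *v (matrix_inv (A x) *v xi) = xi" by (simp add: matrix_vector_mul_assoc)
 have "1 / be * (norm (A x *v (matrix_inv (A x) *v xi)))^2 <= (A x *v (matrix_inv (A x) *v xi)) \<bullet> (matrix_inv (A x) *v xi)"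
  using e[OF x] unfolding ell_def by blast
 then show "1 / be * (norm xi)^2 <= (matrix_inv (A x) *v xi) \<bullet> xi" unfolding i by (simp only: inner_commute)
qed

lemma adm_ell: "adm D mu be k M ==> y 0 : D ==> ell mu be (M y)"
 by (simp add: adm_def)

lemma mulop_cong: "(!!x. x : D ==> A x = A' x) ==> mulop D A V = mulop D A' V"
 unfolding mulop_def cls_def by (intro arg_cong[of _ _ abs_l2] ext) (auto simp: indicator_def)

text \<open>The tail of the series of bounds controls the truncation error of the coefficients and, since
 homogenization is stable, also that of the homogenized coefficients.\<close>

lemma standing_tail:
 fixes D :: "(real^'n) set"
 assumes st: "standing_assms D mu B" and ne: "D ~= {}"
 obtains ta where "!!n. 0 <= ta n" "ta ---> 0"
  "!!n p y xi. y 0 : D ==> norm (Asum B (n + p) y *v xi - Asum B n y *v xi) <= ta n * norm xi"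
  "!!n p x xi. x : D ==> norm (hatA_n B (n + p) x *v xi - hatA_n B n x *v xi) <= ta n * norm xi"
proof -
 have mu: "0 < mu" "0 < mu ^ 3" using st by (auto simp: standing_assms_def)
 obtain c where c: "!!l y xi. y 0 : D ==> norm (B l y *v xi) <= c l * norm xi" "summable c"
  using st unfolding standing_assms_def by (elim conjE exE, intro that) auto
 obtain x0 where x0: "x0 : D" using ne by blast
 have c0: "0 <= c l" for l
  using order_trans[OF norm_ge_zero c(1)[of "%_. x0" l "axis undefined 1"]] x0 by simp
 define ta0 where "ta0 n = suminf c - (\<Sum>l\<le>n. c l)" for n
 have ta0: "0 <= ta0 n" for n unfolding ta0_def using sum_le_suminf[OF c(2), of "{..n}"] c0 by auto
 have tal: "ta0 ---> 0" unfolding ta0_def[abs_def] using tendsto_diff[OF tendsto_const summable_LIMSEQ'[OF c(2)], of "suminf c"] by simp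
 have A: "norm (Asum B (n + p) y *v xi - Asum B n y *v xi) <= ta0 n * norm xi" if y: "y 0 : D" for n p y xi
 proof -
  have "norm (Asum B (n + p) y *v xi - Asum B n y *v xi) <= ((\<Sum>l\<le>n + p. c l) - (\<Sum>l\<le>n. c l)) * norm xi"
  proof (induction p)
   case (Suc p)
   have "Asum B (n + Suc p) y *v xi - Asum B n y *v xi = (Asum B (n + p) y *v xi - Asum B n y *v xi) + B (n + Suc p) y *v xi"
    by (simp add: Asum_def matrix_vector_mult_add_rdistrib)
   then show ?case using norm_triangle_mono[OF Suc c(1)[of y "n + Suc p" xi, OF y]] by (simp add: algebra_simps)
  qed simp
  also have "... <= ta0 n * norm xi" unfolding ta0_def
   using sum_le_suminf[OF c(2), of "{..n + p}"] c0 by (intro mult_right_mono) auto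
  finally show ?thesis .
 qed
 have hat: "norm (hatA_n B (n + p) x *v xi - hatA_n B n x *v xi) <= ta0 n / (mu * mu ^ 3) * norm xi" if x: "x : D" for n p x xi
 proof -
  \<comment> \<open>Makes 2 * de * mu equal to the tail, as \<open>nearI\<close> requires.\<close>
  define de where "de = ta0 n / (2 * mu)"
  have de: "0 <= de" using ta0[of n] mu by (simp add: de_def)
  have "near de (Asum B (n + p) y) (Asum B n y)" if y: "y 0 : D" for y
   by (rule nearI[where mu = mu and be = "mu ^ 3"])
    (use standing_adm[OF st] y de mu A[of y n p, OF y] in "auto simp: adm_def de_def")
  then have "near de (hom_level B (n + p) (p + n) (%_. x)) (hom_level B n n (%_. x))"
   by (intro hom_level_near[OF st]) (use x in auto)
  then have "near de (hatA_n B (n + p) x) (hatA_n B n x)" unfolding hatA_n_def by (simp add: add.commute)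
  moreover have "ell mu (mu ^ 3) (hatA_n B m x)" for m
   unfolding hatA_n_def by (rule adm_ell[OF adm_hom_level[OF st order_refl] x])
  ultimately have "norm (hatA_n B (n + p) x *v xi - hatA_n B n x *v xi) <= 2 * de / mu ^ 3 * norm xi"
   using nearD de mu(2) by blast
  also have "2 * de / mu ^ 3 = ta0 n / (mu * mu ^ 3)" by (simp add: de_def)
  finally show ?thesis .
 qed
 \<comment> \<open>The loss in going to energies and back is one fixed factor, whatever the number
   of levels; the sum of both bounds serves as a common sequence.\<close>
 have p: "0 <= ta0 n / (mu * mu ^ 3)" for n using ta0[of n] mu by simp
 show ?thesis
 proof (rule that[of "%n. ta0 n + ta0 n / (mu * mu ^ 3)"])
  show "(%n. ta0 n + ta0 n / (mu * mu ^ 3)) ---> 0" using tendsto_add[OF tal tendsto_divide[OF tal tendsto_const[of "mu * mu ^ 3"]]] mu by simp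
  show "norm (Asum B (n + p) y *v xi - Asum B n y *v xi) <= (ta0 n + ta0 n / (mu * mu ^ 3)) * norm xi" if "y 0 : D" for n p' p y xi
   by (rule order_trans[OF A[of y, OF that]]) (intro mult_right_mono, use p in auto)
  show "norm (hatA_n B (n + p) x *v xi - hatA_n B n x *v xi) <= (ta0 n + ta0 n / (mu * mu ^ 3)) * norm xi" if "x : D" for n p x xi
   by (rule order_trans[OF hat[OF that]]) (intro mult_right_mono, use ta0 in auto)
 qed (use ta0 p in auto)
qed

lemma H1_realize:
 assumes D: "open D" and G: "G : H1 D" and W: "W - emb D G : H10space D"
 shows "EX v : H1 D. emb D v = W"
proof -
 obtain w where w: "w : H10 D" "emb D w = W - emb D G" using H10space_realize[OF D W] by blast
 have "w : H1 D" using w(1) by (simp add: H10_def)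
 from H1_lincomb[OF D G this, of 1 1] show ?thesis using w(2) by (intro bexI[of _ "%x. 1 * G x + 1 * w x"]) auto
qed

text \<open>The truncated problems satisfy the flux hypothesis of the duality argument by the
  descent to level 0, and the tail estimate gives uniform control of the truncation. An arbitrary
  boundary datum is kept, so both claims of the theorem are special cases.\<close>

lemma homogenization_limits:
 fixes D :: "(real^'n) set"
 assumes D: "open D" "bounded D" "D ~= {}" and st: "standing_assms D mu B" and E: "sep_scales E"
 shows "coef D mu (1 / mu ^ 3) (Aeps B (E m))" "x : D ==> ell mu (mu ^ 3) (Aeps B (E m) x)"
  "coef D mu (1 / mu ^ 3) (hatA B)" "x : D ==> ell mu (mu ^ 3) (hatA B x)"
  "!!f G u u0. Hminus1 D f ==> G : H1 D ==> (!!m. weak_sol D (Aeps B (E m)) f G (u m)) ==> weak_sol D (hatA B) f G u0 ==>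
   weak_conv (H1 D) D u u0 & weak_conv_L2v D (%m x. Aeps B (E m) x *v wgrad D (u m) x) (%x. hatA B x *v wgrad D u0 x)"
proof -
 have mu: "0 < mu" "0 < mu ^ 3" using st by (auto simp: standing_assms_def)
 note sv = sep_scalesD(1)[OF E]
 obtain ta where ta: "!!n. 0 <= ta n" "ta ---> 0"
  and taA: "!!n p y xi. y 0 : D ==> norm (Asum B (n + p) y *v xi - Asum B n y *v xi) <= ta n * norm xi"
  and tah: "!!n p x xi. x : D ==> norm (hatA_n B (n + p) x *v xi - hatA_n B n x *v xi) <= ta n * norm xi"
  by (rule standing_tail[OF st D(3)]) blast
 have Aeps: "Aeps B (E m) x = lim (%n. Asum B n (scl (E m) x))" for m x by (simp add: Aeps_def scl_def[abs_def])
 have s0: "scl (E m) x 0 : D" if "x : D" for m x using that by (simp add: scl_0[OF sv])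
 have lA: "(%n. Asum B n (scl (E m) x)) ---> Aeps B (E m) x" "norm (Aeps B (E m) x *v xi - Asum B n (scl (E m) x) *v xi) <= ta n * norm xi"
  if "x : D" for m x n xi
  unfolding Aeps by (rule matrix_uniform_limit[OF taA[of "scl (E m) x", OF s0[OF that]] ta(2)])+
 have lh: "(%n. hatA_n B n x) ---> hatA B x" "norm (hatA B x *v xi - hatA_n B n x *v xi) <= ta n * norm xi" if "x : D" for x n xi
  unfolding hatA_def by (rule matrix_uniform_limit[OF tah[OF that] ta(2)])+
 \<comment> \<open>At level 0 only y_0 matters, so the constant argument in \<open>hatA_n\<close>
   may be replaced by the scaled point.\<close>
 have hl: "hatA_n B n x = hom_level B n n (scl (E m) x)" if "x : D" for n m x
  unfolding hatA_n_def by (rule adm_cong[OF adm_hom_level[OF st order_refl]]) (use that in "auto simp: scl_0[OF sv]")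
 have cA: "coef D mu (1 / mu ^ 3) (%x. Asum B n (scl (E m) x))" for n m
  by (rule adm_coef[OF standing_adm[OF st] D(1) mu(2) sv])
 have ch: "coef D mu (1 / mu ^ 3) (hatA_n B n)" for n
 proof -
  have "coef D mu (1 / mu ^ 3) (%x. hom_level B n n (scl (E 0) x))"
   by (rule adm_coef[OF adm_hom_level[OF st order_refl] D(1) mu(2) sv])
  moreover have "(%x. ind D x *R hatA_n B n x) = (%x. ind D x *R hom_level B n n (scl (E 0) x))"
   by (intro ext) (metis hl indicator_simps(2) scaleR_zero_left)
  ultimately show ?thesis using hl[of _ n 0] by (simp add: coef_def set_borel_measurable_def)
 qed
 show eA: "ell mu (mu ^ 3) (Aeps B (E m) x)" if "x : D" for m x
  by (rule ell_limit[OF lA(1)[OF that]]) (use standing_adm[OF st] s0[OF that] in "auto simp: adm_def")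
 show eh: "ell mu (mu ^ 3) (hatA B x)" if "x : D" for x
  by (rule ell_limit[OF lh(1)[OF that]]) (simp add: hatA_n_def adm_ell[OF adm_hom_level[OF st order_refl]] that)
 show kA: "coef D mu (1 / mu ^ 3) (Aeps B (E m))" for m by (rule coef_limit[OF cA lA(1) eA mu(2) refl])
 show kh: "coef D mu (1 / mu ^ 3) (hatA B)" by (rule coef_limit[OF ch lh(1) eh mu(2) refl])
 obtain R where R: "0 <= R" "D <= cball 0 R" using bounded_subset_cball D(2)
  by (metis bounded_pos dual_order.order_iff_strict mem_cball_0 subsetI)
 have Dl: "D : lmeasurable" using D(1,2) by (simp add: lmeasurable_open)
 fix f G u u0 assume f: "Hminus1 D f" and G: "G : H1 D" and u: "!!m. weak_sol D (Aeps B (E m)) f G (u m)" and u0: "weak_sol D (hatA B) f G u0"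
 obtain F where F: "F : H10space D" "!!u. u : H10 D ==> f u = inner F (emb D u)" using Hminus1_representation[OF D(1) f] by blast
 have Ft: "snd F : closure (span (testset D))"
  by (rule H10space_cls[OF D(1) F(1)]) (use testset_dense[OF D(1)] in auto)
 have su: "u m : H1 D" "sol D (Aeps B (E m)) F (emb D G) (emb D (u m))" for m
  by (rule weak_sol_imp_sol[OF D(1) kA F(2) G u]; assumption)+
 have su0: "u0 : H1 D" "sol D (hatA B) F (emb D G) (emb D u0)"
  by (rule weak_sol_imp_sol[OF D(1) kh F(2) G u0]; assumption)+
 have K: "(%m. inner (mulop D (%x. Asum B n (scl (E m) x)) (snd (W m)) - mulop D (hatA_n B n) (snd (W m))) Ps) ---> 0"
  if W: "!!m. sol D (%x. Asum B n (scl (E m) x)) F (emb D G) (W m)" and Ps: "Ps : testset D" for n W Ps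
 proof -
  \<comment> \<open>The duality argument produces solutions as classes; the multiscale argument
    works with functions having weak gradients, so the classes are realized.\<close>
  have "ALL m. EX v : H1 D. emb D v = W m" using H1_realize[OF D(1) G] W unfolding sol_def by blast
  then obtain v where v: "!!m. v m : H1 D" "!!m. emb D (v m) = W m" by metis
  have sw: "snd (W m) = cls D (wgrad D (v m))" for m unfolding v(2)[symmetric] by (simp add: emb_def)
  define C where "C = (1 + 2 * R) * ((1 + 2 * R) * norm F + 1 / mu ^ 3 * norm (emb D G)) / mu + norm (emb D G)"
  interpret ms: multiscale D mu B E n F "emb D G" v C
  proof
   show "norm (cls D (wgrad D (v m))) <= C" for m
    unfolding sw[symmetric] C_def by (rule order_trans[OF _ sol_bound[OF D(1) R(2,1) cA mu(1) W[of m]]]) (metis norm_snd_le prod.collapse)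
   show "sol D (%x. Asum B n (scl (E m) x)) F (emb D G) (emb D (v m))" for m unfolding v(2) by (rule W)
  qed (use D Dl st E v Ft in auto)
  obtain ph i where ph: "test_fun D ph" "Ps = cls D (%x. ph x *R axis i 1)" using Ps unfolding testset_def by blast
  have "(%m. inner (ms.op n m - ms.op 0 m) Ps) ---> 0"
   using ms.levelwise_0 ph(1) pt_const[of 0 1] unfolding ms.levelwise_def ph(2) by fastforce
  moreover have "ms.op n m - ms.op 0 m = mulop D (%x. Asum B n (scl (E m) x)) (snd (W m)) - mulop D (hatA_n B n) (snd (W m))" for m
   unfolding ms.op_def ms.H_def ms.\<Gamma>_def sw using mulop_cong[OF hl[of _ n m], of D] by simp
  ultimately show ?thesis by simp
 qed
 have con: "(%m. inner (emb D (u m)) V) ---> inner (emb D u0) V"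
  "sq_on D w ==> (%m. inner (mulop D (Aeps B (E m)) (snd (emb D (u m)))) (cls D w)) ---> inner (mulop D (hatA B) (snd (emb D u0))) (cls D w)" for V w
  by (rule sol_weak_convergence_approx[where S = "testset D" and An = "%n m x. Asum B n (scl (E m) x)" and Ahn = "hatA_n B",
   OF D(1) R(2,1) mu(1) kA kh cA ch ta lA(2) lh(2) su(2) su0(2) K testset_dense[OF D(1)]]; assumption)+
 have "weak_conv (H1 D) D u u0" unfolding weak_conv_def
  by (intro ballI) (simp add: h1_inner_emb[OF su(1)] h1_inner_emb[OF su0(1)] con(1))
 moreover have "weak_conv_L2v D (%m x. Aeps B (E m) x *v wgrad D (u m) x) (%x. hatA B x *v wgrad D u0 x)" unfolding weak_conv_L2v_def
 proof (intro allI impI)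
  fix w assume "L2v D w"
  then have w: "sq_on D w" by (simp add: L2v_iff_sq_on)
  have fl: "inner (mulop D A (snd (emb D v))) (cls D w) = (LINT x:D|lebesgue. (A x *v wgrad D v x) \<bullet> w x)"
   if "coef D mu (1 / mu ^ 3) A" "v : H1 D" for A v
   by (simp add: emb_def mulop_cls[OF that(1) H1D(2)[OF that(2)]] inner_cls[OF coefD(6)[OF that(1) H1D(2)[OF that(2)]] w])
  show "(%m. LINT x:D|lebesgue. (Aeps B (E m) x *v wgrad D (u m) x) \<bullet> w x) ---> (LINT x:D|lebesgue. (hatA B x *v wgrad D u0 x) \<bullet> w x)"
   using con(2)[OF w] by (simp only: fl[OF kA su(1)] fl[OF kh su0(1)])
 qed
 ultimately show "weak_conv (H1 D) D u u0 & weak_conv_L2v D (%m x. Aeps B (E m) x *v wgrad D (u m) x) (%x. hatA B x *v wgrad D u0 x)" ..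
qed

theorem theorem1p1:
  fixes \<Omega> :: "(real^'n) set"
    and \<mu> :: real
    and B :: "nat \<Rightarrow> (nat \<Rightarrow> real^'n) \<Rightarrow> real^'n^'n"
    and f :: "(real^'n \<Rightarrow> real) \<Rightarrow> real"
    and G :: "real^'n \<Rightarrow> real"
  assumes "bounded \<Omega>" and "lipschitz_domain \<Omega>"
    and "standing_assms \<Omega> \<mu> B"
    and "Hminus1 \<Omega> f"
    and "G \<in> H1 \<Omega>"
  shows "(\<forall>E u u0. sep_scales E \<longrightarrow>
            (\<forall>m. weak_sol \<Omega> (Aeps B (E m)) f G (u m)) \<longrightarrow>
            weak_sol \<Omega> (hatA B) f G u0 \<longrightarrow>
            weak_conv (H1 \<Omega>) \<Omega> u u0)
       \<and> (\<forall>E. sep_scales E \<longrightarrow>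
            (\<forall>m. Mclass \<mu> (\<mu> powr (-3)) \<Omega> (Aeps B (E m))) \<and>
            Mclass \<mu> (\<mu> powr (-3)) \<Omega> (hatA B) \<and>
            H_conv \<Omega> (\<lambda>m. Aeps B (E m)) (hatA B))"
proof -
 have \<Omega>: "open \<Omega>" "\<Omega> ~= {}" using assms(2) by (auto simp: lipschitz_domain_def)
 have \<mu>: "0 < \<mu>" using assms(3) by (simp add: standing_assms_def)
 have p: "1 / \<mu> powr (-3) = \<mu> ^ 3" using \<mu> by (simp add: powr_minus powr_numeral divide_inverse)
 note lim = homogenization_limits[OF \<Omega>(1) assms(1) \<Omega>(2) assms(3)]
 have H10: "weak_conv (H1 \<Omega>) \<Omega> us ub ==> weak_conv (H10 \<Omega>) \<Omega> us ub" for us ub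
  by (auto simp: weak_conv_def H10_def)
 show ?thesis
 proof (intro conjI allI impI)
  fix E assume E: "sep_scales E"
  show "Mclass \<mu> (\<mu> powr (-3)) \<Omega> (Aeps B (E m))" for m by (rule Mclass_ell[OF lim(1)[OF E]]) (simp_all only: p lim(2)[OF E] \<mu>)
  show "Mclass \<mu> (\<mu> powr (-3)) \<Omega> (hatA B)" by (rule Mclass_ell[OF lim(3)[OF E]]) (simp_all only: p lim(4)[OF E] \<mu>)
  \<comment> \<open>The case of zero boundary datum; testing with \<open>H1\<close> includes testing
    with \<open>H10\<close>.\<close>
  show "H_conv \<Omega> (%m. Aeps B (E m)) (hatA B)" unfolding H_conv_def
   using lim(5)[OF E _ test_fun_H1(1)[OF \<Omega>(1) test_fun_zero]] H10 by blast
 qed (use lim(5)[OF _ assms(4,5)] in blast)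
qed

end
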